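(* Let $K$ be a field of characteristic zero, let $\mathbb G=\operatorname{Spec}\mathcal A^*$ be an infinitesimal formal monoid, $e:\mathcal A^*\to\mathcal K$ the unit of $\mathbb G$ and $\mathcal I^*=\operatorname{Ker}e$. Then, for every $n$, the natural morphism $$\overline{S^n(\mathcal I^*/\mathcal I^{*2})}\xrightarrow{\ m\ }\mathcal I^{*n}/\mathcal I^{*n+1}$$ is an isomorphism.
   Context: All functors are covariant functors on the category of commutative $K$-algebras, $\mathcal K(S)=S$. For a $K$-vector space $M$, $\mathcal M(S)=M\otimes_KS$ and $\mathcal M^*(S)=\operatorname{Hom}_K(M,S)$; functors of $\mathcal K$-modules of the form $\mathcal M^*$ are called module schemes; $M\mapsto\mathcal M^*$ is an anti-equivalence from vector spaces to module schemes. For a functor of $\mathcal K$-modules $\mathbb M$, $\mathbb M^*(S)=\operatorname{Hom}_{\mathcal S}(\mathbb M_{|S},\mathcal K_{|S})$ ($|S$ denoting restriction to commutative $S$-algebras), and its module scheme closure is $\overline{\mathbb M}:=\mathcal N^*$ with $N=\mathbb M^*(K)$; it has a canonical morphism $\mathbb M\to\overline{\mathbb M}$ universal for morphisms into module schemes. A commutative bialgebra scheme $\mathcal A^*$ is the dual of a cocommutative $K$-bialgebra $A$; $(\operatorname{Spec}\mathcal A^* )(S)=\operatorname{Hom}_{\mathcal K\text{-alg}}(\mathcal A^*,\mathcal S)$, with $\mathcal S(S')=S\otimes_KS'$, is then a functor of monoids whose unit is the counit $e:\mathcal A^*\to\mathcal K$ of $\mathcal A^*$ (evaluation at $1\in A$).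 For ideal schemes $\mathcal I_1^*,\dots,\mathcal I_n^*\subset\mathcal A^*$, the product $\mathcal I_1^*\cdots\mathcal I_n^*$ is the module scheme closure in $\mathcal A^*$ of the image of the multiplication $\mathcal I_1^*\otimes\cdots\otimes\mathcal I_n^*\to\mathcal A^*$, i.e. the smallest module subscheme containing it; $\mathcal I^{*n}$ denotes the $n$-fold product in this sense, and quotients are of module schemes. $\mathbb G=\operatorname{Spec}\mathcal A^*$ is an infinitesimal formal monoid if $\mathcal A^*=\varprojlim_i\mathcal A^*/\mathcal I^{*i}$ where $\mathcal I^*=\operatorname{Ker}e$. $S^n\mathbb M$ is the functor $S\mapsto S^n(\mathbb M(S))$, the $n$-th symmetric power of the $S$-module $\mathbb M(S)$. The composite $\mathcal I^*\otimes\overset{n}{\cdots}\otimes\mathcal I^*\to\mathcal I^{*n}\to\mathcal I^{*n}/\mathcal I^{*n+1}$ factors through $S^n(\mathcal I^*/\mathcal I^{*2})$ and induces $m$ on its module scheme closure. *)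

theory Defs
  imports "HOL-Algebra.Module" "HOL-Algebra.AbelCoset"
begin

section \<open>Modules over a commutative ring\<close>

definition linear_map ::
  "('r,'x) ring_scheme \<Rightarrow> ('r,'m,'y) module_scheme \<Rightarrow> ('r,'n,'z) module_scheme \<Rightarrow> ('m \<Rightarrow> 'n) \<Rightarrow> bool"
where
  "linear_map R M N f \<longleftrightarrow>
     f \<in> carrier M \<rightarrow> carrier N \<and>
     (\<forall>x\<in>carrier M. \<forall>y\<in>carrier M. f (x \<oplus>\<^bsub>M\<^esub> y) = f x \<oplus>\<^bsub>N\<^esub> f y) \<and>
     (\<forall>r\<in>carrier R. \<forall>x\<in>carrier M. f (r \<odot>\<^bsub>M\<^esub> x) = r \<odot>\<^bsub>N\<^esub> f x)"

definition module_span ::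
  "('r,'x) ring_scheme \<Rightarrow> ('r,'m,'y) module_scheme \<Rightarrow> 'm set \<Rightarrow> 'm set"
where
  "module_span R M X = \<Inter>{H. submodule H R M \<and> X \<subseteq> H}"

text \<open>In quotient, free and \<open>Hom\<close> modules only the module structure is meaningful; the
  fields \<open>mult\<close> and \<open>one\<close> of these records are left undefined.\<close>

definition quot_module ::
  "('r,'m,'y) module_scheme \<Rightarrow> 'm set \<Rightarrow> ('r, 'm set) module"
where
  "quot_module M N =
     \<lparr>carrier = a_rcosets\<^bsub>M\<^esub> N, mult = undefined, one = undefined,
      zero = N, add = (\<lambda>X Y. X <+>\<^bsub>M\<^esub> Y),
      smult = (\<lambda>r X. \<Union>x\<in>X. N +>\<^bsub>M\<^esub> (r \<odot>\<^bsub>M\<^esub> x))\<rparr>"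

definition free_module ::
  "('r,'x) ring_scheme \<Rightarrow> 'i set \<Rightarrow> ('r, 'i \<Rightarrow> 'r) module"
where
  "free_module R X =
     \<lparr>carrier = {f. f \<in> X \<rightarrow> carrier R \<and> (\<forall>i. i \<notin> X \<longrightarrow> f i = \<zero>\<^bsub>R\<^esub>) \<and> finite {i. f i \<noteq> \<zero>\<^bsub>R\<^esub>}},
      mult = undefined, one = undefined,
      zero = (\<lambda>_. \<zero>\<^bsub>R\<^esub>), add = (\<lambda>f g i. f i \<oplus>\<^bsub>R\<^esub> g i),
      smult = (\<lambda>r f i. r \<otimes>\<^bsub>R\<^esub> f i)\<rparr>"

definition free_gen :: "('r,'x) ring_scheme \<Rightarrow> 'i \<Rightarrow> 'i \<Rightarrow> 'r" where
  "free_gen R i = (\<lambda>j. if j = i then \<one>\<^bsub>R\<^esub> else \<zero>\<^bsub>R\<^esub>)"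

definition hom_module ::
  "('r,'x) ring_scheme \<Rightarrow> ('r,'m,'y) module_scheme \<Rightarrow> ('r,'s) module \<Rightarrow> ('s, 'm \<Rightarrow> 's) module"
  \<comment> \<open>\<open>Hom\<^sub>R(M,S)\<close> for an \<open>R\<close>-algebra \<open>S\<close>, regarded as an \<open>S\<close>-module\<close>
where
  "hom_module R M S =
     \<lparr>carrier = {f \<in> extensional (carrier M). linear_map R M S f},
      mult = undefined, one = undefined,
      zero = (\<lambda>x\<in>carrier M. \<zero>\<^bsub>S\<^esub>),
      add = (\<lambda>f g. \<lambda>x\<in>carrier M. f x \<oplus>\<^bsub>S\<^esub> g x),
      smult = (\<lambda>s f. \<lambda>x\<in>carrier M. s \<otimes>\<^bsub>S\<^esub> f x)\<rparr>"

definition regular_module :: "('k,'s) module \<Rightarrow> ('s,'s) module" where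
  "regular_module S =
     \<lparr>carrier = carrier S, mult = mult S, one = one S, zero = zero S, add = add S,
      smult = mult S\<rparr>"


subsection \<open>Tensor products\<close>

definition tensor_relations ::
  "('r,'x) ring_scheme \<Rightarrow> ('r,'m,'y) module_scheme \<Rightarrow> ('r,'n,'z) module_scheme \<Rightarrow> ('m \<times> 'n \<Rightarrow> 'r) set"
where
  "tensor_relations R M N =
     (let F = free_module R (carrier M \<times> carrier N); g = free_gen R in
      {g (x \<oplus>\<^bsub>M\<^esub> x', y) \<ominus>\<^bsub>F\<^esub> (g (x, y) \<oplus>\<^bsub>F\<^esub> g (x', y)) | x x' y.
         x \<in> carrier M \<and> x' \<in> carrier M \<and> y \<in> carrier N} \<union>
      {g (x, y \<oplus>\<^bsub>N\<^esub> y') \<ominus>\<^bsub>F\<^esub> (g (x, y) \<oplus>\<^bsub>F\<^esub> g (x, y')) | x y y'.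
         x \<in> carrier M \<and> y \<in> carrier N \<and> y' \<in> carrier N} \<union>
      {g (r \<odot>\<^bsub>M\<^esub> x, y) \<ominus>\<^bsub>F\<^esub> (r \<odot>\<^bsub>F\<^esub> g (x, y)) | r x y.
         r \<in> carrier R \<and> x \<in> carrier M \<and> y \<in> carrier N} \<union>
      {g (x, r \<odot>\<^bsub>N\<^esub> y) \<ominus>\<^bsub>F\<^esub> (r \<odot>\<^bsub>F\<^esub> g (x, y)) | r x y.
         r \<in> carrier R \<and> x \<in> carrier M \<and> y \<in> carrier N})"

definition tensor_kernel ::
  "('r,'x) ring_scheme \<Rightarrow> ('r,'m,'y) module_scheme \<Rightarrow> ('r,'n,'z) module_scheme \<Rightarrow> ('m \<times> 'n \<Rightarrow> 'r) set"
where
  "tensor_kernel R M N =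
     module_span R (free_module R (carrier M \<times> carrier N)) (tensor_relations R M N)"

definition tensor ::
  "('r,'x) ring_scheme \<Rightarrow> ('r,'m,'y) module_scheme \<Rightarrow> ('r,'n,'z) module_scheme
     \<Rightarrow> ('r, ('m \<times> 'n \<Rightarrow> 'r) set) module"
where
  "tensor R M N =
     quot_module (free_module R (carrier M \<times> carrier N)) (tensor_kernel R M N)"

definition pure_tensor ::
  "('r,'x) ring_scheme \<Rightarrow> ('r,'m,'y) module_scheme \<Rightarrow> ('r,'n,'z) module_scheme
     \<Rightarrow> 'm \<Rightarrow> 'n \<Rightarrow> ('m \<times> 'n \<Rightarrow> 'r) set"
where
  "pure_tensor R M N x y =
     tensor_kernel R M N +>\<^bsub>free_module R (carrier M \<times> carrier N)\<^esub> free_gen R (x, y)"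

text \<open>The linear map \<open>M \<otimes> N \<rightarrow> P\<close> induced by a bilinear map \<open>b\<close>, computed on an arbitrary
  representative (only meaningful when \<open>b\<close> is bilinear).\<close>

definition tensor_lift ::
  "('r,'x) ring_scheme \<Rightarrow> ('r,'p,'z) module_scheme \<Rightarrow> ('m \<Rightarrow> 'n \<Rightarrow> 'p)
     \<Rightarrow> ('m \<times> 'n \<Rightarrow> 'r) set \<Rightarrow> 'p"
where
  "tensor_lift R P b X =
     (let f = (SOME f. f \<in> X) in
      finsum P (\<lambda>i. f i \<odot>\<^bsub>P\<^esub> b (fst i) (snd i)) {i. f i \<noteq> \<zero>\<^bsub>R\<^esub>})"


subsection \<open>Symmetric powers\<close>

definition tuples :: "nat \<Rightarrow> ('r,'m,'y) module_scheme \<Rightarrow> 'm list set" where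
  "tuples n M = {xs. length xs = n \<and> set xs \<subseteq> carrier M}"

definition sym_relations ::
  "('r,'x) ring_scheme \<Rightarrow> nat \<Rightarrow> ('r,'m,'y) module_scheme \<Rightarrow> ('m list \<Rightarrow> 'r) set"
where
  "sym_relations R n M =
     (let F = free_module R (tuples n M); g = free_gen R in
      {g (xs @ (x \<oplus>\<^bsub>M\<^esub> y) # ys) \<ominus>\<^bsub>F\<^esub> (g (xs @ x # ys) \<oplus>\<^bsub>F\<^esub> g (xs @ y # ys)) | xs x y ys.
         xs @ x # ys \<in> tuples n M \<and> y \<in> carrier M} \<union>
      {g (xs @ (r \<odot>\<^bsub>M\<^esub> x) # ys) \<ominus>\<^bsub>F\<^esub> (r \<odot>\<^bsub>F\<^esub> g (xs @ x # ys)) | r xs x ys.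
         xs @ x # ys \<in> tuples n M \<and> r \<in> carrier R} \<union>
      {g (xs @ x # y # ys) \<ominus>\<^bsub>F\<^esub> g (xs @ y # x # ys) | xs x y ys.
         xs @ x # y # ys \<in> tuples n M})"

definition sym_kernel ::
  "('r,'x) ring_scheme \<Rightarrow> nat \<Rightarrow> ('r,'m,'y) module_scheme \<Rightarrow> ('m list \<Rightarrow> 'r) set"
where
  "sym_kernel R n M = module_span R (free_module R (tuples n M)) (sym_relations R n M)"

definition sym_power ::
  "('r,'x) ring_scheme \<Rightarrow> nat \<Rightarrow> ('r,'m,'y) module_scheme \<Rightarrow> ('r, ('m list \<Rightarrow> 'r) set) module"
where
  "sym_power R n M = quot_module (free_module R (tuples n M)) (sym_kernel R n M)"

definition sym_product ::
  "('r,'x) ring_scheme \<Rightarrow> nat \<Rightarrow> ('r,'m,'y) module_scheme \<Rightarrow> 'm list \<Rightarrow> ('m list \<Rightarrow> 'r) set"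
where
  "sym_product R n M xs = sym_kernel R n M +>\<^bsub>free_module R (tuples n M)\<^esub> free_gen R xs"


section \<open>Functors of modules on commutative algebras\<close>

text \<open>The commutative \<open>K\<close>-algebras are the records \<open>S :: ('k,'s) module\<close> with
  \<open>algebra K S\<close>; the type \<open>'s\<close> plays the role of the universe
  in which their underlying sets live.  Families indexed by algebras are only
  relevant at those \<open>S\<close>.\<close>

definition alg_hom ::
  "('k,'x) ring_scheme \<Rightarrow> ('k,'s) module \<Rightarrow> ('k,'s) module \<Rightarrow> ('s \<Rightarrow> 's) set"
where
  "alg_hom K S T = {\<phi> \<in> ring_hom S T. linear_map K S T \<phi>}"

record ('k,'s,'m) kfunctor =
  ob :: "('k,'s) module \<Rightarrow> ('s,'m) module"
  ar :: "('k,'s) module \<Rightarrow> ('k,'s) module \<Rightarrow> ('s \<Rightarrow> 's) \<Rightarrow> 'm \<Rightarrow> 'm"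

definition functor_hom ::
  "('k,'x) ring_scheme \<Rightarrow> ('k,'s,'m) kfunctor \<Rightarrow> ('k,'s,'n) kfunctor
     \<Rightarrow> (('k,'s) module \<Rightarrow> 'm \<Rightarrow> 'n) set"
where
  "functor_hom K F G =
     {\<eta>. (\<forall>S. algebra K S \<longrightarrow>
             \<eta> S \<in> extensional (carrier (ob F S)) \<and> linear_map S (ob F S) (ob G S) (\<eta> S)) \<and>
          (\<forall>S. \<not> algebra K S \<longrightarrow> \<eta> S = undefined) \<and>
          (\<forall>S T \<phi>. algebra K S \<longrightarrow> algebra K T \<longrightarrow> \<phi> \<in> alg_hom K S T \<longrightarrow>
             (\<forall>x\<in>carrier (ob F S). \<eta> T (ar F S T \<phi> x) = ar G S T \<phi> (\<eta> S x)))}"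

definition functor_iso ::
  "('k,'x) ring_scheme \<Rightarrow> ('k,'s,'m) kfunctor \<Rightarrow> ('k,'s,'n) kfunctor
     \<Rightarrow> (('k,'s) module \<Rightarrow> 'm \<Rightarrow> 'n) \<Rightarrow> bool"
where
  "functor_iso K F G \<eta> \<longleftrightarrow>
     \<eta> \<in> functor_hom K F G \<and>
     (\<exists>\<theta>\<in>functor_hom K G F. \<forall>S. algebra K S \<longrightarrow>
        (\<forall>x\<in>carrier (ob F S). \<theta> S (\<eta> S x) = x) \<and>
        (\<forall>y\<in>carrier (ob G S). \<eta> S (\<theta> S y) = y))"

definition base_functor :: "('k,'s,'s) kfunctor" where
  "base_functor = \<lparr>ob = regular_module, ar = (\<lambda>S T \<phi>. \<phi>)\<rparr>"

definition dual_functor ::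
  "('k,'x) ring_scheme \<Rightarrow> ('k,'m,'y) module_scheme \<Rightarrow> ('k,'s,'m \<Rightarrow> 's) kfunctor"
  \<comment> \<open>the module scheme \<open>\<M>\<^sup>*\<close>, \<open>S \<mapsto> Hom\<^sub>K(M,S)\<close>\<close>
where
  "dual_functor K M =
     \<lparr>ob = hom_module K M, ar = (\<lambda>S T \<phi> f. restrict (\<phi> \<circ> f) (carrier M))\<rparr>"

definition subfunctor ::
  "('k,'x) ring_scheme \<Rightarrow> ('k,'s,'m) kfunctor \<Rightarrow> (('k,'s) module \<Rightarrow> 'm set) \<Rightarrow> bool"
where
  "subfunctor K F B \<longleftrightarrow>
     (\<forall>S. algebra K S \<longrightarrow> submodule (B S) S (ob F S)) \<and>
     (\<forall>S T \<phi>. algebra K S \<longrightarrow> algebra K T \<longrightarrow> \<phi> \<in> alg_hom K S T \<longrightarrow> ar F S T \<phi> ` B S \<subseteq> B T)"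

definition sub :: "('k,'s,'m) kfunctor \<Rightarrow> (('k,'s) module \<Rightarrow> 'm set) \<Rightarrow> ('k,'s,'m) kfunctor" where
  "sub F B = \<lparr>ob = (\<lambda>S. (ob F S)\<lparr>carrier := B S\<rparr>), ar = ar F\<rparr>"

text \<open>Over a field the restriction \<open>Hom\<^sub>K(M,S) \<rightarrow> Hom\<^sub>K(V,S)\<close> to a subspace \<open>V\<close> is onto,
  hence the quotient of a module scheme by a module subscheme, formed pointwise, is
  again a module scheme and is the quotient in the category of module schemes.\<close>

definition quot :: "('k,'s,'m) kfunctor \<Rightarrow> (('k,'s) module \<Rightarrow> 'm set) \<Rightarrow> ('k,'s,'m set) kfunctor" where
  "quot F B =
     \<lparr>ob = (\<lambda>S. quot_module (ob F S) (B S)),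
      ar = (\<lambda>S T \<phi> X. \<Union>x\<in>X. B T +>\<^bsub>ob F T\<^esub> ar F S T \<phi> x)\<rparr>"

text \<open>The transition maps of \<open>S\<^sup>n F\<close> send \<open>\<Sum> c\<^sub>i x\<^sub>i\<^sub>1\<cdots>x\<^sub>i\<^sub>n\<close> to
  \<open>\<Sum> \<phi>(c\<^sub>i) F(\<phi>)(x\<^sub>i\<^sub>1)\<cdots>F(\<phi>)(x\<^sub>i\<^sub>n)\<close>.\<close>

definition sym_functor ::
  "nat \<Rightarrow> ('k,'s,'m) kfunctor \<Rightarrow> ('k,'s,('m list \<Rightarrow> 's) set) kfunctor"
where
  "sym_functor n F =
     \<lparr>ob = (\<lambda>S. sym_power S n (ob F S)),
      ar = (\<lambda>S T \<phi> X.
        let f = (SOME f. f \<in> X); P = sym_power T n (ob F T) in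
        finsum P (\<lambda>xs. \<phi> (f xs) \<odot>\<^bsub>P\<^esub> sym_product T n (ob F T) (map (ar F S T \<phi>) xs))
          {xs. f xs \<noteq> \<zero>\<^bsub>S\<^esub>})\<rparr>"


subsection \<open>Module scheme closure\<close>

definition dual_space ::
  "('k,'x) ring_scheme \<Rightarrow> ('k,'s,'m) kfunctor \<Rightarrow> ('k, ('k,'s) module \<Rightarrow> 'm \<Rightarrow> 's) module"
  \<comment> \<open>\<open>F\<^sup>*(K)\<close>, the \<open>K\<close>-vector space of morphisms \<open>F \<rightarrow> \<K>\<close>\<close>
where
  "dual_space K F =
     \<lparr>carrier = functor_hom K F base_functor, mult = undefined, one = undefined,
      zero = (\<lambda>S. if algebra K S then \<lambda>x\<in>carrier (ob F S). \<zero>\<^bsub>S\<^esub> else undefined),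
      add = (\<lambda>\<eta> \<theta> S. if algebra K S then \<lambda>x\<in>carrier (ob F S). \<eta> S x \<oplus>\<^bsub>S\<^esub> \<theta> S x else undefined),
      smult = (\<lambda>c \<eta> S. if algebra K S then \<lambda>x\<in>carrier (ob F S). c \<odot>\<^bsub>S\<^esub> \<eta> S x else undefined)\<rparr>"

definition closure_scheme ::
  "('k,'x) ring_scheme \<Rightarrow> ('k,'s,'m) kfunctor
     \<Rightarrow> ('k, 's, (('k,'s) module \<Rightarrow> 'm \<Rightarrow> 's) \<Rightarrow> 's) kfunctor"
where
  "closure_scheme K F = dual_functor K (dual_space K F)"

definition closure_map ::
  "('k,'x) ring_scheme \<Rightarrow> ('k,'s,'m) kfunctor
     \<Rightarrow> ('k,'s) module \<Rightarrow> 'm \<Rightarrow> (('k,'s) module \<Rightarrow> 'm \<Rightarrow> 's) \<Rightarrow> 's"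
  \<comment> \<open>the canonical morphism from \<open>F\<close> to its closure\<close>
where
  "closure_map K F S x = (\<lambda>\<eta>\<in>carrier (dual_space K F). \<eta> S x)"

text \<open>In the next definition a monomorphism of module schemes is dual to a surjection of
  vector spaces, so every candidate \<open>N\<close> is isomorphic to a quotient of \<open>M\<close>, hence to a
  complement in \<open>M\<close>; restricting \<open>N\<close> to the element type of \<open>M\<close> loses nothing.\<close>

definition module_subscheme ::
  "('k,'x) ring_scheme \<Rightarrow> ('k,'m,'y) module_scheme \<Rightarrow> (('k,'s) module \<Rightarrow> ('m \<Rightarrow> 's) set) \<Rightarrow> bool"
where
  "module_subscheme K M B \<longleftrightarrow>
     subfunctor K (dual_functor K M) B \<and>
     (\<exists>(N :: ('k,'m) module) \<eta>. module K N \<and>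
        functor_iso K (dual_functor K N) (sub (dual_functor K M) B) \<eta>)"


section \<open>Commutative bialgebra schemes\<close>

record ('k,'a) bialgebra = "('k,'a) module" +
  comult :: "'a \<Rightarrow> ('a \<times> 'a \<Rightarrow> 'k) set"
  counit :: "'a \<Rightarrow> 'k"

definition cocommutative_bialgebra :: "('k,'x) ring_scheme \<Rightarrow> ('k,'a) bialgebra \<Rightarrow> bool" where
  "cocommutative_bialgebra K A \<longleftrightarrow>
     (let AA = tensor K A A; \<Delta> = comult A; \<epsilon> = counit A; t = pure_tensor K A A in
      \<comment> \<open>associative unital algebra\<close>
      module K A \<and> ring A \<and>
      (\<forall>c\<in>carrier K. \<forall>x\<in>carrier A. \<forall>y\<in>carrier A.
         (c \<odot>\<^bsub>A\<^esub> x) \<otimes>\<^bsub>A\<^esub> y = c \<odot>\<^bsub>A\<^esub> (x \<otimes>\<^bsub>A\<^esub> y) \<and>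
         x \<otimes>\<^bsub>A\<^esub> (c \<odot>\<^bsub>A\<^esub> y) = c \<odot>\<^bsub>A\<^esub> (x \<otimes>\<^bsub>A\<^esub> y)) \<and>
      \<comment> \<open>coassociative, counital, cocommutative coalgebra; both sides of
          coassociativity are compared in \<open>(A \<otimes> A) \<otimes> A\<close>\<close>
      linear_map K A AA \<Delta> \<and>
      (\<forall>c\<in>carrier K. \<forall>x\<in>carrier A. \<epsilon> (c \<odot>\<^bsub>A\<^esub> x) = c \<otimes>\<^bsub>K\<^esub> \<epsilon> x) \<and>
      (\<forall>x\<in>carrier A. \<forall>y\<in>carrier A. \<epsilon> (x \<oplus>\<^bsub>A\<^esub> y) = \<epsilon> x \<oplus>\<^bsub>K\<^esub> \<epsilon> y) \<and>
      \<epsilon> \<in> carrier A \<rightarrow> carrier K \<and>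
      (\<forall>a\<in>carrier A.
         tensor_lift K (tensor K AA A) (\<lambda>x y. pure_tensor K AA A (\<Delta> x) y) (\<Delta> a) =
         tensor_lift K (tensor K AA A)
           (\<lambda>x y. tensor_lift K (tensor K AA A) (\<lambda>u v. pure_tensor K AA A (t x u) v) (\<Delta> y)) (\<Delta> a)) \<and>
      (\<forall>a\<in>carrier A. tensor_lift K A (\<lambda>x y. \<epsilon> x \<odot>\<^bsub>A\<^esub> y) (\<Delta> a) = a) \<and>
      (\<forall>a\<in>carrier A. tensor_lift K A (\<lambda>x y. \<epsilon> y \<odot>\<^bsub>A\<^esub> x) (\<Delta> a) = a) \<and>
      (\<forall>a\<in>carrier A. tensor_lift K AA (\<lambda>x y. t y x) (\<Delta> a) = \<Delta> a) \<and>
      \<comment> \<open>\<open>\<Delta>\<close> and \<open>\<epsilon>\<close> are morphisms of algebras\<close>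
      (\<forall>a\<in>carrier A. \<forall>b\<in>carrier A.
         \<Delta> (a \<otimes>\<^bsub>A\<^esub> b) =
         tensor_lift K AA
           (\<lambda>x y. tensor_lift K AA (\<lambda>u v. t (x \<otimes>\<^bsub>A\<^esub> u) (y \<otimes>\<^bsub>A\<^esub> v)) (\<Delta> b)) (\<Delta> a)) \<and>
      \<Delta> \<one>\<^bsub>A\<^esub> = t \<one>\<^bsub>A\<^esub> \<one>\<^bsub>A\<^esub> \<and>
      (\<forall>a\<in>carrier A. \<forall>b\<in>carrier A. \<epsilon> (a \<otimes>\<^bsub>A\<^esub> b) = \<epsilon> a \<otimes>\<^bsub>K\<^esub> \<epsilon> b) \<and>
      \<epsilon> \<one>\<^bsub>A\<^esub> = \<one>\<^bsub>K\<^esub>)"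

text \<open>The algebra structure of \<open>\<A>\<^sup>*(S) = Hom\<^sub>K(A,S)\<close>, dual to the coalgebra structure of \<open>A\<close>.\<close>

definition conv ::
  "('k,'x) ring_scheme \<Rightarrow> ('k,'a) bialgebra \<Rightarrow> ('k,'s) module \<Rightarrow> ('a \<Rightarrow> 's) \<Rightarrow> ('a \<Rightarrow> 's) \<Rightarrow> 'a \<Rightarrow> 's"
where
  "conv K A S v w =
     (\<lambda>a\<in>carrier A. tensor_lift K S (\<lambda>x y. v x \<otimes>\<^bsub>S\<^esub> w y) (comult A a))"

definition conv_unit :: "('k,'a) bialgebra \<Rightarrow> ('k,'s) module \<Rightarrow> 'a \<Rightarrow> 's" where
  "conv_unit A S = (\<lambda>a\<in>carrier A. counit A a \<odot>\<^bsub>S\<^esub> \<one>\<^bsub>S\<^esub>)"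

definition conv_prod ::
  "('k,'x) ring_scheme \<Rightarrow> ('k,'a) bialgebra \<Rightarrow> ('k,'s) module \<Rightarrow> ('a \<Rightarrow> 's) list \<Rightarrow> 'a \<Rightarrow> 's"
where
  "conv_prod K A S ws = foldr (conv K A S) ws (conv_unit A S)"

definition unit_morphism ::
  "('k,'x) ring_scheme \<Rightarrow> ('k,'a) bialgebra \<Rightarrow> ('k,'s) module \<Rightarrow> ('a \<Rightarrow> 's) \<Rightarrow> 's"
  \<comment> \<open>\<open>e : \<A>\<^sup>* \<rightarrow> \<K>\<close>, evaluation at \<open>1 \<in> A\<close>, the unit of the functor of monoids \<open>Spec \<A>\<^sup>*\<close>\<close>
where
  "unit_morphism K A S =
     (if algebra K S then \<lambda>w\<in>carrier (hom_module K A S). w \<one>\<^bsub>A\<^esub> else undefined)"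

definition aug_ideal ::
  "('k,'x) ring_scheme \<Rightarrow> ('k,'a) bialgebra \<Rightarrow> ('k,'s) module \<Rightarrow> ('a \<Rightarrow> 's) set"
where
  "aug_ideal K A S = {w \<in> carrier (hom_module K A S). unit_morphism K A S w = \<zero>\<^bsub>S\<^esub>}"

definition mult_image ::
  "('k,'x) ring_scheme \<Rightarrow> ('k,'a) bialgebra \<Rightarrow> (('k,'s) module \<Rightarrow> ('a \<Rightarrow> 's) set) list
     \<Rightarrow> ('k,'s) module \<Rightarrow> ('a \<Rightarrow> 's) set"
  \<comment> \<open>the image of the multiplication \<open>J\<^sub>1 \<otimes> \<cdots> \<otimes> J\<^sub>n \<rightarrow> \<A>\<^sup>*\<close> at \<open>S\<close>\<close>
where
  "mult_image K A Js S =
     module_span S (hom_module K A S)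
       {conv_prod K A S ws | ws. list_all2 (\<lambda>w J. w \<in> J S) ws Js}"

text \<open>The smallest module subscheme containing the image; it exists because the
  module subschemes of \<open>\<A>\<^sup>*\<close> are stable under intersection.\<close>

definition ideal_product ::
  "('k,'x) ring_scheme \<Rightarrow> ('k,'a) bialgebra \<Rightarrow> (('k,'s) module \<Rightarrow> ('a \<Rightarrow> 's) set) list
     \<Rightarrow> ('k,'s) module \<Rightarrow> ('a \<Rightarrow> 's) set"
where
  "ideal_product K A Js S =
     \<Inter>{B S | B. module_subscheme K A B \<and>
                (\<forall>T. algebra K T \<longrightarrow> mult_image K A Js T \<subseteq> B T)}"

text \<open>As for ideals of a ring, the zeroth power is the whole of \<open>\<A>\<^sup>*\<close>.\<close>

definition aug_power ::
  "('k,'x) ring_scheme \<Rightarrow> ('k,'a) bialgebra \<Rightarrow> nat \<Rightarrow> ('k,'s) module \<Rightarrow> ('a \<Rightarrow> 's) set"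
where
  "aug_power K A n S =
     (if n = 0 then carrier (hom_module K A S)
      else ideal_product K A (replicate n (aug_ideal K A)) S)"

text \<open>\<open>Spec \<A>\<^sup>*\<close> is an infinitesimal formal monoid: the canonical morphism from \<open>\<A>\<^sup>*\<close> to the
  inverse limit of the \<open>\<A>\<^sup>*/\<I>\<^sup>*\<^sup>i\<close> is an isomorphism.  The transition map from level \<open>i + 1\<close>
  to level \<open>i\<close> sends a coset of \<open>\<I>\<^sup>*\<^sup>i\<^sup>+\<^sup>1\<close> to the coset of \<open>\<I>\<^sup>*\<^sup>i\<close> containing it.\<close>

definition infinitesimal_formal_monoid ::
  "'s itself \<Rightarrow> ('k,'x) ring_scheme \<Rightarrow> ('k,'a) bialgebra \<Rightarrow> bool"
where
  "infinitesimal_formal_monoid TYPE('s) K A \<longleftrightarrow>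
     (\<forall>S :: ('k,'s) module. algebra K S \<longrightarrow>
        bij_betw (\<lambda>w i. aug_power K A i S +>\<^bsub>hom_module K A S\<^esub> w)
          (carrier (hom_module K A S))
          {X. \<forall>i. X i \<in> carrier (quot_module (hom_module K A S) (aug_power K A i S)) \<and>
                  X (Suc i) \<subseteq> X i})"


section \<open>The natural morphism\<close>

definition graded_piece ::
  "('k,'x) ring_scheme \<Rightarrow> ('k,'a) bialgebra \<Rightarrow> nat \<Rightarrow> ('k,'s,('a \<Rightarrow> 's) set) kfunctor"
  \<comment> \<open>\<open>\<I>\<^sup>*\<^sup>n / \<I>\<^sup>*\<^sup>n\<^sup>+\<^sup>1\<close>\<close>
where
  "graded_piece K A n =
     quot (sub (dual_functor K A) (aug_power K A n)) (aug_power K A (Suc n))"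

definition cotangent ::
  "('k,'x) ring_scheme \<Rightarrow> ('k,'a) bialgebra \<Rightarrow> ('k,'s,('a \<Rightarrow> 's) set) kfunctor"
  \<comment> \<open>\<open>\<I>\<^sup>* / \<I>\<^sup>*\<^sup>2\<close>\<close>
where
  "cotangent K A = quot (sub (dual_functor K A) (aug_ideal K A)) (aug_power K A 2)"

text \<open>\<open>m\<close> is the morphism from the module scheme closure of \<open>S\<^sup>n(\<I>\<^sup>*/\<I>\<^sup>*\<^sup>2)\<close> to
  \<open>\<I>\<^sup>*\<^sup>n/\<I>\<^sup>*\<^sup>n\<^sup>+\<^sup>1\<close> whose composite with the canonical morphism into the closure sends the
  symmetric product of the classes of \<open>w\<^sub>1, \<dots>, w\<^sub>n \<in> \<I>\<^sup>*(S)\<close> to the class of \<open>w\<^sub>1 \<cdots> w\<^sub>n\<close>.\<close>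

definition natural_morphism ::
  "('k,'x) ring_scheme \<Rightarrow> ('k,'a) bialgebra \<Rightarrow> nat
     \<Rightarrow> (('k,'s) module \<Rightarrow> ((('k,'s) module \<Rightarrow> (('a \<Rightarrow> 's) set list \<Rightarrow> 's) set \<Rightarrow> 's) \<Rightarrow> 's)
            \<Rightarrow> ('a \<Rightarrow> 's) set) \<Rightarrow> bool"
where
  "natural_morphism K A n m \<longleftrightarrow>
     m \<in> functor_hom K (closure_scheme K (sym_functor n (cotangent K A))) (graded_piece K A n) \<and>
     (\<forall>S ws. algebra K S \<longrightarrow> length ws = n \<longrightarrow> set ws \<subseteq> aug_ideal K A S \<longrightarrow>
        m S (closure_map K (sym_functor n (cotangent K A)) S
               (sym_product S n (ob (cotangent K A) S)
                  (map (\<lambda>w. aug_power K A 2 S +>\<^bsub>hom_module K A S\<^esub> w) ws)))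
        = aug_power K A (Suc n) S +>\<^bsub>hom_module K A S\<^esub> conv_prod K A S ws)"

end

theory Submission
  imports Defs "HOL-Library.Multiset"
begin

text \<open>
  Let \<open>G n \<subseteq> A\<close> be the common annihilator of all \<open>n\<close>-fold convolution products of elements of the
  augmentation ideal. Then \<open>\<I>\<^sup>*\<^sup>n\<close> is the annihilator of \<open>G n\<close>, so \<open>\<I>\<^sup>*\<^sup>n/\<I>\<^sup>*\<^sup>n\<^sup>+\<^sup>1\<close>
  is the module scheme dual to \<open>G (n+1)/G n\<close>, and it suffices to identify this space with
  the space of linear forms on \<open>S\<^sup>n(\<I>\<^sup>*/\<I>\<^sup>*\<^sup>2)\<close>. An element of \<open>G (n+1)\<close> gives such a form by evaluation.
  Conversely, by Yoneda, evaluating a form at generic points shows that it is given by a finite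
  symmetric tensor \<open>\<Sum> p\<^sub>1 \<otimes> \<cdots> \<otimes> p\<^sub>n\<close> in the space of primitive elements. Primitive elements act on the
  convolution algebra as derivations, so the value of \<open>w\<^sub>1 \<cdots> w\<^sub>n\<close> at the product \<open>p\<^sub>1 \<cdots> p\<^sub>n\<close> in \<open>A\<close> is a
  permanent, and in characteristic zero the form is induced by \<open>1/n! \<Sum> p\<^sub>1 \<cdots> p\<^sub>n\<close>.
\<close>

text \<open>The Yoneda argument needs the generic point to be an algebra of the universe
  \<open>'s\<close>, whereas polynomials form a type of functions. Room for them comes from the
  injection of \<open>'a\<close> into \<open>'s\<close>: it carries the scalars along,
  characteristic zero makes them infinite, so \<open>'s\<close> is infinite, contains codes of its
  own pairs and lists, and hence a copy of the polynomial algebra over \<open>K\<close> with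
  variables in \<open>nat \<times> 's\<close>. Characteristic zero enters twice more: the powers of
  2 are distinct in \<open>K\<close>, which isolates multilinear polynomials, and n! is invertible.
  The second obstacle is that module scheme closures can contain more than finite sums of products,
  so that checking on generators is not enough. Statements on closures are translated into vanishing
  on a subspace of \<open>A\<close>, and naturality in the algebra turns functions of points into
  evaluation at one element. Uniqueness of the natural morphism, which is prescribed only on points
  coming from the symmetric power, is obtained in the same way.\<close>

hide_const (open) Multiset.mult

section \<open>Linear maps, free modules and quotients\<close>

lemma linear_mapI:
  assumes "\<And>x. x \<in> carrier M \<Longrightarrow> f x \<in> carrier N"
    and "\<And>x y. x \<in> carrier M \<Longrightarrow> y \<in> carrier M \<Longrightarrow> f (x \<oplus>\<^bsub>M\<^esub> y) = f x \<oplus>\<^bsub>N\<^esub> f y"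
    and "\<And>r x. r \<in> carrier R \<Longrightarrow> x \<in> carrier M \<Longrightarrow> f (r \<odot>\<^bsub>M\<^esub> x) = r \<odot>\<^bsub>N\<^esub> f x"
  shows "linear_map R M N f"
  using assms by (auto simp: linear_map_def)

lemma linear_mapD:
  assumes "linear_map R M N f"
  shows "x \<in> carrier M \<Longrightarrow> f x \<in> carrier N"
    and "x \<in> carrier M \<Longrightarrow> y \<in> carrier M \<Longrightarrow> f (x \<oplus>\<^bsub>M\<^esub> y) = f x \<oplus>\<^bsub>N\<^esub> f y"
    and "r \<in> carrier R \<Longrightarrow> x \<in> carrier M \<Longrightarrow> f (r \<odot>\<^bsub>M\<^esub> x) = r \<odot>\<^bsub>N\<^esub> f x"
  using assms by (auto simp: linear_map_def)

lemma linear_map_comp: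
  assumes "linear_map R M N f" "linear_map R N P g"
  shows "linear_map R M P (\<lambda>x. g (f x))"
  using linear_mapD[OF assms(1)] linear_mapD[OF assms(2)] by (intro linear_mapI) auto

lemma linear_map_cong:
  assumes "linear_map R M N f" "module R M" "\<And>x. x \<in> carrier M \<Longrightarrow> g x = f x"
  shows "linear_map R M N g"
proof -
  interpret M: module R M by fact
  show ?thesis using linear_mapD[OF assms(1)] by (intro linear_mapI) (auto simp: assms(3))
qed

lemma linear_map_ident: "linear_map R M M (\<lambda>x. x)"
  by (intro linear_mapI) auto

context
  fixes R :: "('r,'x) ring_scheme" and M :: "('r,'m,'y) module_scheme"
    and N :: "('r,'n,'z) module_scheme" and f
  assumes M: "module R M" and N: "module R N" and f: "linear_map R M N f"
begin

interpretation M: module R M by (fact M)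
interpretation N: module R N by (fact N)

lemma linear_map_zero: "f \<zero>\<^bsub>M\<^esub> = \<zero>\<^bsub>N\<^esub>"
  using linear_mapD(3)[OF f, of "\<zero>\<^bsub>R\<^esub>" "\<zero>\<^bsub>M\<^esub>"] linear_mapD(1)[OF f, of "\<zero>\<^bsub>M\<^esub>"] by simp

lemma linear_map_neg:
  assumes "x \<in> carrier M" shows "f (\<ominus>\<^bsub>M\<^esub> x) = \<ominus>\<^bsub>N\<^esub> f x"
proof -
  have "f (\<ominus>\<^bsub>M\<^esub> x) \<oplus>\<^bsub>N\<^esub> f x = \<zero>\<^bsub>N\<^esub>"
    using linear_mapD(2)[OF f, of "\<ominus>\<^bsub>M\<^esub> x" x] assms by (simp add: linear_map_zero M.M.l_neg)
  then show ?thesis using assms linear_mapD(1)[OF f]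
    by (metis M.M.a_inv_closed N.M.minus_equality)
qed

lemma linear_map_minus:
  assumes "x \<in> carrier M" "y \<in> carrier M" shows "f (x \<ominus>\<^bsub>M\<^esub> y) = f x \<ominus>\<^bsub>N\<^esub> f y"
  using assms linear_mapD(2)[OF f] by (simp add: a_minus_def linear_map_neg)

lemma linear_map_finsum:
  assumes "g \<in> I \<rightarrow> carrier M" shows "f (finsum M g I) = finsum N (\<lambda>i. f (g i)) I"
  using assms
proof (induction I rule: infinite_finite_induct)
  case (insert i I)
  then show ?case using linear_mapD[OF f] by (auto simp: Pi_def)
qed (auto simp: linear_map_zero)

lemma kernel_submodule: "submodule {x \<in> carrier M. f x = \<zero>\<^bsub>N\<^esub>} R M"
  using linear_mapD[OF f] by (intro M.submoduleI) (auto simp: linear_map_zero linear_map_neg)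

lemma linear_map_inj_on:
  assumes "\<And>x. x \<in> carrier M \<Longrightarrow> f x = \<zero>\<^bsub>N\<^esub> \<Longrightarrow> x = \<zero>\<^bsub>M\<^esub>"
  shows "inj_on f (carrier M)"
proof (rule inj_onI)
  fix x y assume xy: "x \<in> carrier M" "y \<in> carrier M" "f x = f y"
  then have "f (x \<ominus>\<^bsub>M\<^esub> y) = \<zero>\<^bsub>N\<^esub>"
    using linear_mapD(1)[OF f] by (simp add: linear_map_minus) (simp add: N.M.r_neg a_minus_def)
  then have "x \<ominus>\<^bsub>M\<^esub> y = \<zero>\<^bsub>M\<^esub>" using assms xy by blast
  then show "x = y" using xy M.M.minus_equality[of x "\<ominus>\<^bsub>M\<^esub> y"] by (simp add: a_minus_def)
qed

end

section \<open>Restriction of scalars and finite sums in submodules\<close>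

lemma finsum_smult_update:
  "finsum (M\<lparr>smult := s\<rparr>) g I = finsum M g I"
  by (simp add: finsum_def)

text \<open>Restriction of scalars along \<open>\<phi>\<close>. Transition maps of functors are
  semilinear over an algebra homomorphism; with the action on the target precomposed with it they
  become linear over a single ring, so that one notion \<open>linear_map\<close> suffices.\<close>

lemma module_smult_update:
  assumes "cring R" "module S P" "\<phi> \<in> ring_hom R S"
  shows "module R (P\<lparr>smult := (\<lambda>r. smult P (\<phi> r))\<rparr>)"
proof -
  interpret P: module S P by fact
  interpret R: cring R by fact
  interpret \<phi>: ring_hom_cring R S \<phi>
    by unfold_locales (rule assms(3))
  have ab: "abelian_group (P\<lparr>smult := (\<lambda>r. smult P (\<phi> r))\<rparr>)"
    using P.M.a_comm_group P.M.abelian_monoid_axioms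
    by (simp add: abelian_group_def abelian_group_axioms_def abelian_monoid_def)
  show ?thesis
    by (intro moduleI assms(1) ab)
      (auto simp: P.smult_l_distr P.smult_r_distr P.smult_assoc1)
qed

lemma submodule_finsum:
  assumes "module R M" "submodule H R M" "g \<in> I \<rightarrow> H"
  shows "finsum M g I \<in> H"
proof -
  interpret M: module R M by fact
  note H = M.submoduleE[OF assms(2)]
  have z: "\<zero>\<^bsub>M\<^esub> \<in> H"
    using subgroup.one_closed[OF submodule.axioms(1)[OF assms(2)]] by simp
  show ?thesis using assms(3)
  proof (induction I rule: infinite_finite_induct)
    case (insert i I)
    then have "g \<in> I \<rightarrow> carrier M" "g i \<in> carrier M" using H(1) by auto
    then show ?case using insert H(5) by auto
  qed (auto simp: z)
qed

lemma submodule_zero: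
  assumes "submodule H R M" shows "\<zero>\<^bsub>M\<^esub> \<in> H"
  using subgroup.one_closed[OF submodule.axioms(1)[OF assms]] by simp

lemma finsum_mono_neutral:
  assumes "abelian_monoid M" "finite J" "I \<subseteq> J" "\<And>i. i \<in> J - I \<Longrightarrow> g i = \<zero>\<^bsub>M\<^esub>"
    "g \<in> J \<rightarrow> carrier M"
  shows "finsum M g I = finsum M g J"
proof -
  interpret abelian_monoid M by fact
  show ?thesis
    using assms(2-) by (intro add.finprod_mono_neutral_cong_left) auto
qed

subsection \<open>Free modules\<close>

lemma free_module_simps [simp]:
  "x \<oplus>\<^bsub>free_module R X\<^esub> y = (\<lambda>i. x i \<oplus>\<^bsub>R\<^esub> y i)"
  "\<zero>\<^bsub>free_module R X\<^esub> = (\<lambda>_. \<zero>\<^bsub>R\<^esub>)"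
  "r \<odot>\<^bsub>free_module R X\<^esub> x = (\<lambda>i. r \<otimes>\<^bsub>R\<^esub> x i)"
  by (simp_all add: free_module_def)

lemma free_module_carrier:
  "f \<in> carrier (free_module R X) \<longleftrightarrow>
    f \<in> X \<rightarrow> carrier R \<and> (\<forall>i. i \<notin> X \<longrightarrow> f i = \<zero>\<^bsub>R\<^esub>) \<and> finite {i. f i \<noteq> \<zero>\<^bsub>R\<^esub>}"
  by (simp add: free_module_def)

lemma (in cring) free_module_apply:
  "f \<in> carrier (free_module R X) \<Longrightarrow> f i \<in> carrier R"
  unfolding free_module_carrier by (cases "i \<in> X") auto

lemma (in cring) free_gen_closed: "i \<in> X \<Longrightarrow> free_gen R i \<in> carrier (free_module R X)"
  unfolding free_module_carrier free_gen_def
  by (auto intro: finite_subset[of _ "{i}"])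

lemma (in cring) module_free_module: "module R (free_module R X)"
proof (rule moduleI)
  note app = free_module_apply
  let ?F = "free_module R X"
  have add: "(\<lambda>i. f i \<oplus> g i) \<in> carrier ?F"
    if "f \<in> carrier ?F" "g \<in> carrier ?F" for f g
    using that unfolding free_module_carrier
    by (auto intro: finite_subset[of _ "{i. f i \<noteq> \<zero>} \<union> {i. g i \<noteq> \<zero>}"])
  have sm: "(\<lambda>i. r \<otimes> f i) \<in> carrier ?F"
    if "f \<in> carrier ?F" "r \<in> carrier R" for f r
    using that unfolding free_module_carrier
    by (auto intro: finite_subset[of _ "{i. f i \<noteq> \<zero>}"])
  show "abelian_group ?F"
  proof (rule abelian_groupI)
    fix f assume f: "f \<in> carrier ?F"
    show "\<exists>g\<in>carrier ?F. g \<oplus>\<^bsub>?F\<^esub> f = \<zero>\<^bsub>?F\<^esub>"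
      using sm[OF f, of "\<ominus> \<one>"] app[OF f]
      by (intro bexI[of _ "\<lambda>i. \<ominus> \<one> \<otimes> f i"]) (auto simp: l_minus l_neg)
  qed (auto simp: add app a_ac free_module_carrier[of "\<lambda>_. \<zero>"])
  show "r \<odot>\<^bsub>?F\<^esub> f \<in> carrier ?F" if "r \<in> carrier R" "f \<in> carrier ?F" for r f
    using that sm by simp
qed (auto simp: is_cring l_distr r_distr m_assoc free_module_apply)

text \<open>The linear extension of \<open>b\<close> from the free generators. For \<open>b\<close>
  the identity it forms linear combinations, for monomial values it evaluates polynomials, and, up
  to a chosen representative, \<open>tensor_lift\<close> and the transition maps of
  \<open>sym_functor\<close> have this form.\<close>

definition lin_ext ::
  "('r,'x) ring_scheme \<Rightarrow> ('r,'p,'z) module_scheme \<Rightarrow> ('i \<Rightarrow> 'p) \<Rightarrow> ('i \<Rightarrow> 'r) \<Rightarrow> 'p" where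
  "lin_ext R P b f = finsum P (\<lambda>i. f i \<odot>\<^bsub>P\<^esub> b i) {i. f i \<noteq> \<zero>\<^bsub>R\<^esub>}"

context module
begin

text \<open>\<open>lin_ext\<close> sums over the support, which varies with \<open>f\<close>; a
  common finite superset is needed before two such sums can be added term by term.\<close>

lemma lin_ext_superset:
  assumes "f \<in> carrier (free_module R X)" "b \<in> X \<rightarrow> carrier M" "{i. f i \<noteq> \<zero>} \<subseteq> J" "finite J" "J \<subseteq> X"
  shows "lin_ext R M b f = finsum M (\<lambda>i. f i \<odot>\<^bsub>M\<^esub> b i) J"
proof -
  have bJ: "b i \<in> carrier M" if "i \<in> J" for i using assms that by auto
  show ?thesis unfolding lin_ext_def
    using assms bJ R.free_module_apply[OF assms(1)] M.abelian_monoid_axioms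
    by (intro finsum_mono_neutral) (auto simp del: Pi_iff)
qed

lemma free_support_subset: "f \<in> carrier (free_module R X) \<Longrightarrow> {i. f i \<noteq> \<zero>} \<subseteq> X"
  by (auto simp: free_module_carrier)

lemma free_support_finite: "f \<in> carrier (free_module R X) \<Longrightarrow> finite {i. f i \<noteq> \<zero>}"
  by (auto simp: free_module_carrier)

lemma lin_ext_linear:
  assumes b: "b \<in> X \<rightarrow> carrier M"
  shows "linear_map R (free_module R X) M (lin_ext R M b)"
proof (rule linear_mapI)
  let ?F = "free_module R X"
  interpret F: module R ?F by (rule R.module_free_module)
  note app = R.free_module_apply
  fix f assume f: "f \<in> carrier ?F"
  show "lin_ext R M b f \<in> carrier M"
    unfolding lin_ext_def using b free_support_subset[OF f] app[OF f] by (intro finsum_closed) auto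
  {
    fix g assume g: "g \<in> carrier ?F"
    let ?J = "{i. f i \<noteq> \<zero>} \<union> {i. g i \<noteq> \<zero>}"
    have J: "finite ?J" "?J \<subseteq> X" using f g by (auto simp: free_module_carrier)
    have bJ: "b i \<in> carrier M" if "i \<in> ?J" for i using b J that by auto
    have fg: "f \<oplus>\<^bsub>?F\<^esub> g \<in> carrier ?F" using f g by (rule F.M.a_closed)
    have "{i. (f \<oplus>\<^bsub>?F\<^esub> g) i \<noteq> \<zero>} \<subseteq> ?J" by auto
    from lin_ext_superset[OF fg b this J]
    have "lin_ext R M b (f \<oplus>\<^bsub>?F\<^esub> g) = finsum M (\<lambda>i. (f i \<odot>\<^bsub>M\<^esub> b i) \<oplus>\<^bsub>M\<^esub> (g i \<odot>\<^bsub>M\<^esub> b i)) ?J"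
      using bJ app[OF f] app[OF g] by (simp add: smult_l_distr cong: finsum_cong)
    also have "\<dots> = finsum M (\<lambda>i. f i \<odot>\<^bsub>M\<^esub> b i) ?J \<oplus>\<^bsub>M\<^esub> finsum M (\<lambda>i. g i \<odot>\<^bsub>M\<^esub> b i) ?J"
      using bJ app[OF f] app[OF g] by (intro finsum_addf) auto
    also have "\<dots> = lin_ext R M b f \<oplus>\<^bsub>M\<^esub> lin_ext R M b g"
      using lin_ext_superset[OF f b _ J] lin_ext_superset[OF g b _ J] by simp
    finally show "lin_ext R M b (f \<oplus>\<^bsub>?F\<^esub> g) = lin_ext R M b f \<oplus>\<^bsub>M\<^esub> lin_ext R M b g" .
  }
  {
    fix r assume r: "r \<in> carrier R"
    let ?J = "{i. f i \<noteq> \<zero>}"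
    have J: "finite ?J" "?J \<subseteq> X" using f by (auto simp: free_module_carrier)
    have bJ: "b i \<in> carrier M" if "i \<in> ?J" for i using b J that by auto
    have fg: "r \<odot>\<^bsub>?F\<^esub> f \<in> carrier ?F" using f r by (intro F.smult_closed)
    have "{i. (r \<odot>\<^bsub>?F\<^esub> f) i \<noteq> \<zero>} \<subseteq> ?J" using r by auto
    from lin_ext_superset[OF fg b this J]
    have "lin_ext R M b (r \<odot>\<^bsub>?F\<^esub> f) = finsum M (\<lambda>i. r \<odot>\<^bsub>M\<^esub> (f i \<odot>\<^bsub>M\<^esub> b i)) ?J"
      using bJ app[OF f] r by (simp add: smult_assoc1 cong: finsum_cong)
    also have "\<dots> = r \<odot>\<^bsub>M\<^esub> lin_ext R M b f"
      unfolding lin_ext_def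
      using bJ app[OF f] r J by (intro finsum_smult_ldistr[symmetric]) auto
    finally show "lin_ext R M b (r \<odot>\<^bsub>?F\<^esub> f) = r \<odot>\<^bsub>M\<^esub> lin_ext R M b f" .
  }
qed

lemma lin_ext_gen:
  assumes "b i \<in> carrier M"
  shows "lin_ext R M b (free_gen R i) = b i"
proof (cases "\<one> = \<zero>")
  \<comment> \<open>In the zero ring \<open>free_gen R i\<close> has empty support, so
    \<open>b i\<close> must vanish; it does since \<open>\<one>\<close> acts as the
    identity.\<close>
  case True
  then have "b i = \<zero>\<^bsub>M\<^esub>" using smult_one[OF assms] smult_l_null[OF assms] by simp
  then show ?thesis using True by (simp add: lin_ext_def free_gen_def)
next
  case False
  then have "{j. free_gen R i j \<noteq> \<zero>} = {i}" by (auto simp: free_gen_def)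
  then show ?thesis using assms by (simp add: lin_ext_def free_gen_def)
qed

end

lemma (in cring) finsum_free_apply:
  assumes "g \<in> I \<rightarrow> carrier (free_module R X)"
  shows "finsum (free_module R X) g I j = finsum R (\<lambda>i. g i j) I"
  using assms
proof (induction I rule: infinite_finite_induct)
  interpret F: module R "free_module R X" by (rule module_free_module)
  case (insert i I)
  have "g i j' \<in> carrier R" "k \<in> I \<Longrightarrow> g k j' \<in> carrier R" for j' k
    using insert.prems free_module_apply[of _ X] by auto
  then show ?case using insert by (simp add: Pi_def)
next
  interpret F: module R "free_module R X" by (rule module_free_module)
  case empty then show ?case by (simp del: )
next
  interpret F: module R "free_module R X" by (rule module_free_module)
  case infinite then show ?case by simp
qed

lemma (in cring) free_expand:
  assumes f: "f \<in> carrier (free_module R X)"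
  shows "lin_ext R (free_module R X) (free_gen R) f = f"
proof
  fix j
  interpret F: module R "free_module R X" by (rule module_free_module)
  let ?I = "{i. f i \<noteq> \<zero>}"
  have "lin_ext R (free_module R X) (free_gen R) f j
      = finsum R (\<lambda>i. (f i \<odot>\<^bsub>free_module R X\<^esub> free_gen R i) j) ?I"
    unfolding lin_ext_def
    using free_gen_closed[of _ X] F.free_support_subset[OF f] free_module_apply[OF f]
    by (intro finsum_free_apply funcsetI F.smult_closed) auto
  also have "\<dots> = finsum R (\<lambda>i. if i = j then f i else \<zero>) ?I"
    using free_module_apply[OF f] by (intro finsum_cong') (auto simp: free_gen_def)
  also have "\<dots> = f j"
  proof (cases "j \<in> ?I")
    case True
    then show ?thesis using add.finprod_singleton_swap[of j ?I f] F.free_support_finite[OF f]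
        free_module_apply[OF f] by simp
  next
    case False
    then have "finsum R (\<lambda>i. if i = j then f i else \<zero>) ?I = finsum R (\<lambda>i. \<zero>) ?I"
      by (intro finsum_cong') auto
    then show ?thesis using False by simp
  qed
  finally show "lin_ext R (free_module R X) (free_gen R) f j = f j" .
qed

lemma free_linear_expand:
  assumes M: "module R M" and g: "linear_map R (free_module R X) M g"
    and f: "f \<in> carrier (free_module R X)"
  shows "g f = lin_ext R M (\<lambda>i. g (free_gen R i)) f"
proof -
  interpret M: module R M by fact
  interpret F: module R "free_module R X" by (rule M.R.module_free_module)
  have I: "i \<in> X" if "f i \<noteq> \<zero>\<^bsub>R\<^esub>" for i using F.free_support_subset[OF f] that by auto
  have cl: "f i \<odot>\<^bsub>free_module R X\<^esub> free_gen R i \<in> carrier (free_module R X)" if "f i \<noteq> \<zero>\<^bsub>R\<^esub>" for i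
    using I that M.R.free_module_apply[OF f] M.R.free_gen_closed[of _ X] by (intro F.smult_closed) auto
  have "g f = g (lin_ext R (free_module R X) (free_gen R) f)"
    by (simp add: M.R.free_expand[OF f])
  also have "\<dots> = finsum M (\<lambda>i. g (f i \<odot>\<^bsub>free_module R X\<^esub> free_gen R i)) {i. f i \<noteq> \<zero>\<^bsub>R\<^esub>}"
    unfolding lin_ext_def using cl
    by (intro linear_map_finsum[OF F.module_axioms M g]) auto
  also have "\<dots> = lin_ext R M (\<lambda>i. g (free_gen R i)) f"
    unfolding lin_ext_def
    using I M.R.free_module_apply[OF f] M.R.free_gen_closed[of _ X] linear_mapD(1,3)[OF g]
    by (intro M.finsum_cong') (auto simp del: free_module_simps)
  finally show ?thesis .
qed

lemma free_linear_unique: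
  assumes M: "module R M" and "linear_map R (free_module R X) M g" "linear_map R (free_module R X) M h"
    and f: "f \<in> carrier (free_module R X)"
    and eq: "\<And>i. i \<in> X \<Longrightarrow> g (free_gen R i) = h (free_gen R i)"
  shows "g f = h f"
proof -
  interpret M: module R M by fact
  interpret F: module R "free_module R X" by (rule M.R.module_free_module)
  have I: "i \<in> X" if "f i \<noteq> \<zero>\<^bsub>R\<^esub>" for i using F.free_support_subset[OF f] that by auto
  have "lin_ext R M (\<lambda>i. g (free_gen R i)) f = lin_ext R M (\<lambda>i. h (free_gen R i)) f"
    unfolding lin_ext_def
    using I M.R.free_module_apply[OF f] M.R.free_gen_closed[of _ X] linear_mapD(1)[OF assms(3)]
    by (intro M.finsum_cong') (auto simp: eq)
  then show ?thesis
    by (simp add: free_linear_expand[OF M assms(2) f] free_linear_expand[OF M assms(3) f])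
qed

subsection \<open>Spans and quotients\<close>

context module
begin

lemma module_span_submodule:
  assumes "X \<subseteq> carrier M" shows "submodule (module_span R M X) R M"
proof -
  have "carrier M \<in> {H. submodule H R M \<and> X \<subseteq> H}"
    using assms carrier_is_submodule by auto
  then show ?thesis unfolding module_span_def
    by (intro submoduleI) (auto simp: submoduleE submodule_zero)
qed

lemma module_span_subset: "X \<subseteq> module_span R M X"
  by (auto simp: module_span_def)

lemma module_span_least: "submodule H R M \<Longrightarrow> X \<subseteq> H \<Longrightarrow> module_span R M X \<subseteq> H"
  by (auto simp: module_span_def)

lemma submodule_abelian_subgroup:
  assumes "submodule N R M" shows "abelian_subgroup N M"
  using assms by (intro abelian_subgroupI3 additive_subgroupI submodule.axioms(1) M.abelian_group_axioms)

lemma coset_eq_iff: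
  assumes N: "submodule N R M" and "x \<in> carrier M" "y \<in> carrier M"
  shows "N +>\<^bsub>M\<^esub> x = N +>\<^bsub>M\<^esub> y \<longleftrightarrow> x \<ominus>\<^bsub>M\<^esub> y \<in> N"
proof -
  interpret N: abelian_subgroup N M by (rule submodule_abelian_subgroup[OF N])
  show ?thesis
    using assms N.a_rcos_module[of y x] N.a_rcos_self[of x] N.a_repr_independence'[of x y]
    by (auto simp: a_minus_def)
qed

end

text \<open>Evaluation at an arbitrary representative, in the same form as the \<open>SOME\<close>
  inside \<open>tensor_lift\<close> and \<open>sym_functor\<close>. These become instances, and one
  proof of independence from the representative serves all of them.\<close>

definition quot_lift :: "('m \<Rightarrow> 'p) \<Rightarrow> 'm set \<Rightarrow> 'p" where
  "quot_lift g X = g (SOME x. x \<in> X)"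

lemma quot_module_simps:
  "carrier (quot_module M N) = a_rcosets\<^bsub>M\<^esub> N"
  "\<zero>\<^bsub>quot_module M N\<^esub> = N"
  "X \<oplus>\<^bsub>quot_module M N\<^esub> Y = X <+>\<^bsub>M\<^esub> Y"
  "r \<odot>\<^bsub>quot_module M N\<^esub> X = (\<Union>x\<in>X. N +>\<^bsub>M\<^esub> (r \<odot>\<^bsub>M\<^esub> x))"
  by (simp_all add: quot_module_def)

lemma quot_carrier_iff: "X \<in> carrier (quot_module M N) \<longleftrightarrow> (\<exists>x\<in>carrier M. X = N +>\<^bsub>M\<^esub> x)"
  by (auto simp: quot_module_simps A_RCOSETS_def')

context
  fixes R :: "('r,'x) ring_scheme" and M :: "('r,'m,'y) module_scheme" and N :: "'m set"
  assumes M: "module R M" and N: "submodule N R M"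
begin

interpretation M: module R M by (fact M)
interpretation N: abelian_subgroup N M by (rule M.submodule_abelian_subgroup[OF N])

lemma quot_add:
  "x \<in> carrier M \<Longrightarrow> y \<in> carrier M \<Longrightarrow>
    (N +>\<^bsub>M\<^esub> x) \<oplus>\<^bsub>quot_module M N\<^esub> (N +>\<^bsub>M\<^esub> y) = N +>\<^bsub>M\<^esub> (x \<oplus>\<^bsub>M\<^esub> y)"
  by (simp add: quot_module_simps N.a_rcos_sum)

lemma coset_some:
  assumes "x \<in> carrier M"
  shows "(SOME y. y \<in> N +>\<^bsub>M\<^esub> x) \<in> carrier M"
    and "N +>\<^bsub>M\<^esub> (SOME y. y \<in> N +>\<^bsub>M\<^esub> x) = N +>\<^bsub>M\<^esub> x"
proof -
  have *: "(SOME y. y \<in> N +>\<^bsub>M\<^esub> x) \<in> N +>\<^bsub>M\<^esub> x"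
    using N.a_rcos_self[OF assms] by (rule someI)
  show "(SOME y. y \<in> N +>\<^bsub>M\<^esub> x) \<in> carrier M"
    using N.a_elemrcos_carrier[OF assms *] .
  show "N +>\<^bsub>M\<^esub> (SOME y. y \<in> N +>\<^bsub>M\<^esub> x) = N +>\<^bsub>M\<^esub> x"
    using N.a_repr_independence'[OF * assms] by simp
qed

lemma coset_eqD:
  assumes "y \<in> N +>\<^bsub>M\<^esub> x" "x \<in> carrier M"
  shows "y \<in> carrier M" "N +>\<^bsub>M\<^esub> y = N +>\<^bsub>M\<^esub> x"
  using N.a_elemrcos_carrier[OF assms(2,1)] N.a_repr_independence'[OF assms] by auto

lemma coset_self: "x \<in> carrier M \<Longrightarrow> x \<in> N +>\<^bsub>M\<^esub> x"
  by (rule N.a_rcos_self)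

text \<open>\<open>quot_module\<close> defines the multiple of a coset as a union over its elements,
  so that no representative is chosen. The union collapses: if \<open>y\<close> and \<open>x\<close>
  differ by an element of \<open>N\<close>, so do their multiples by \<open>r\<close>, hence all
  members of the union are the same coset.\<close>

lemma quot_smult:
  assumes "r \<in> carrier R" "x \<in> carrier M"
  shows "r \<odot>\<^bsub>quot_module M N\<^esub> (N +>\<^bsub>M\<^esub> x) = N +>\<^bsub>M\<^esub> (r \<odot>\<^bsub>M\<^esub> x)"
proof -
  have "N +>\<^bsub>M\<^esub> (r \<odot>\<^bsub>M\<^esub> y) = N +>\<^bsub>M\<^esub> (r \<odot>\<^bsub>M\<^esub> x)" if "y \<in> N +>\<^bsub>M\<^esub> x" for y
  proof -
    have y: "y \<in> carrier M" "y \<ominus>\<^bsub>M\<^esub> x \<in> N"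
      using coset_eqD[OF that assms(2)] M.coset_eq_iff[OF N _ assms(2), of y] by blast+
    have "r \<odot>\<^bsub>M\<^esub> (y \<ominus>\<^bsub>M\<^esub> x) \<in> N" using y assms M.submoduleE(4)[OF N] by blast
    moreover have "r \<odot>\<^bsub>M\<^esub> (y \<ominus>\<^bsub>M\<^esub> x) = (r \<odot>\<^bsub>M\<^esub> y) \<ominus>\<^bsub>M\<^esub> (r \<odot>\<^bsub>M\<^esub> x)"
      using y assms by (simp add: a_minus_def M.smult_r_distr M.smult_r_minus)
    ultimately have "(r \<odot>\<^bsub>M\<^esub> y) \<ominus>\<^bsub>M\<^esub> (r \<odot>\<^bsub>M\<^esub> x) \<in> N" by simp
    then show ?thesis by (subst M.coset_eq_iff[OF N]) (use y assms in auto)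
  qed
  then have "(\<Union>y\<in>N +>\<^bsub>M\<^esub> x. N +>\<^bsub>M\<^esub> (r \<odot>\<^bsub>M\<^esub> y)) = N +>\<^bsub>M\<^esub> (r \<odot>\<^bsub>M\<^esub> x)"
    using coset_self[OF assms(2)] by blast
  then show ?thesis by (simp only: quot_module_simps)
qed

lemma coset_zero: "N +>\<^bsub>M\<^esub> \<zero>\<^bsub>M\<^esub> = N"
  using M.submoduleE(1)[OF N] by (rule M.M.a_coset_add_zero)

lemma coset_closed: "x \<in> carrier M \<Longrightarrow> N +>\<^bsub>M\<^esub> x \<in> carrier (quot_module M N)"
  by (auto simp: quot_carrier_iff)

lemma module_quot: "module R (quot_module M N)"
proof -
  let ?Q = "quot_module M N"
  have z: "\<zero>\<^bsub>?Q\<^esub> = N +>\<^bsub>M\<^esub> \<zero>\<^bsub>M\<^esub>" by (simp add: quot_module_simps coset_zero)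
  have ex: "\<exists>x\<in>carrier M. X = N +>\<^bsub>M\<^esub> x" if "X \<in> carrier ?Q" for X
    using that by (simp add: quot_carrier_iff)
  have ab: "abelian_group ?Q"
  proof (rule abelian_groupI)
    fix X Y assume XY: "X \<in> carrier ?Q" "Y \<in> carrier ?Q"
    show "X \<oplus>\<^bsub>?Q\<^esub> Y \<in> carrier ?Q"
      using ex[OF XY(1)] ex[OF XY(2)] by (elim bexE) (simp only: quot_add coset_closed M.M.a_closed)
    show "X \<oplus>\<^bsub>?Q\<^esub> Y = Y \<oplus>\<^bsub>?Q\<^esub> X"
      using ex[OF XY(1)] ex[OF XY(2)] by (elim bexE) (simp only: quot_add M.M.a_comm)
    fix Z assume Z: "Z \<in> carrier ?Q"
    show "X \<oplus>\<^bsub>?Q\<^esub> Y \<oplus>\<^bsub>?Q\<^esub> Z = X \<oplus>\<^bsub>?Q\<^esub> (Y \<oplus>\<^bsub>?Q\<^esub> Z)"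
      using ex[OF XY(1)] ex[OF XY(2)] ex[OF Z]
      by (elim bexE) (simp only: quot_add M.M.a_assoc M.M.a_closed)
  next
    show "\<zero>\<^bsub>?Q\<^esub> \<in> carrier ?Q" by (simp only: z coset_closed M.M.zero_closed)
  next
    fix X assume X: "X \<in> carrier ?Q"
    show "\<zero>\<^bsub>?Q\<^esub> \<oplus>\<^bsub>?Q\<^esub> X = X"
      using ex[OF X] by (elim bexE) (simp only: z quot_add M.M.zero_closed M.M.l_zero)
    obtain x where x: "x \<in> carrier M" "X = N +>\<^bsub>M\<^esub> x" using ex[OF X] by blast
    then have "(N +>\<^bsub>M\<^esub> (\<ominus>\<^bsub>M\<^esub> x)) \<oplus>\<^bsub>?Q\<^esub> X = \<zero>\<^bsub>?Q\<^esub>"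
      by (simp only: z quot_add M.M.l_neg M.M.a_inv_closed)
    then show "\<exists>Y\<in>carrier ?Q. Y \<oplus>\<^bsub>?Q\<^esub> X = \<zero>\<^bsub>?Q\<^esub>"
      using coset_closed[OF M.M.a_inv_closed[OF x(1)]] by blast
  qed
  have 1: "\<one>\<^bsub>R\<^esub> \<odot>\<^bsub>?Q\<^esub> X = X" if "X \<in> carrier ?Q" for X
    using ex[OF that] by (elim bexE) (simp only: quot_smult M.R.one_closed M.smult_one)
  have 2: "r \<odot>\<^bsub>?Q\<^esub> X \<in> carrier ?Q" if "r \<in> carrier R" "X \<in> carrier ?Q" for r X
    using ex[OF that(2)] that(1) by (elim bexE) (simp only: quot_smult coset_closed M.smult_closed)
  have 3: "(r \<oplus>\<^bsub>R\<^esub> s) \<odot>\<^bsub>?Q\<^esub> X = r \<odot>\<^bsub>?Q\<^esub> X \<oplus>\<^bsub>?Q\<^esub> s \<odot>\<^bsub>?Q\<^esub> X"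
    if "r \<in> carrier R" "s \<in> carrier R" "X \<in> carrier ?Q" for r s X
    using ex[OF that(3)] that(1,2)
    by (elim bexE) (simp only: quot_smult quot_add M.smult_closed M.R.a_closed M.smult_l_distr)
  have 4: "(r \<otimes>\<^bsub>R\<^esub> s) \<odot>\<^bsub>?Q\<^esub> X = r \<odot>\<^bsub>?Q\<^esub> (s \<odot>\<^bsub>?Q\<^esub> X)"
    if "r \<in> carrier R" "s \<in> carrier R" "X \<in> carrier ?Q" for r s X
    using ex[OF that(3)] that(1,2)
    by (elim bexE) (simp only: quot_smult M.smult_closed M.R.m_closed M.smult_assoc1)
  have 5: "r \<odot>\<^bsub>?Q\<^esub> (X \<oplus>\<^bsub>?Q\<^esub> Y) = r \<odot>\<^bsub>?Q\<^esub> X \<oplus>\<^bsub>?Q\<^esub> r \<odot>\<^bsub>?Q\<^esub> Y"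
    if "r \<in> carrier R" "X \<in> carrier ?Q" "Y \<in> carrier ?Q" for r X Y
    using ex[OF that(2)] ex[OF that(3)] that(1)
    by (elim bexE) (simp only: quot_smult quot_add M.smult_closed M.M.a_closed M.smult_r_distr)
  show ?thesis by (rule moduleI[OF M.R.is_cring ab 2 3 5 4 1])
qed

lemma coset_linear: "linear_map R M (quot_module M N) (\<lambda>x. N +>\<^bsub>M\<^esub> x)"
  by (intro linear_mapI) (simp_all only: coset_closed quot_add quot_smult)

context
  fixes P :: "('r,'p,'z) module_scheme" and g
  assumes P: "module R P" and g: "linear_map R M P g" and g0: "\<And>x. x \<in> N \<Longrightarrow> g x = \<zero>\<^bsub>P\<^esub>"
begin

lemma quot_lift_coset:
  assumes x: "x \<in> carrier M" shows "quot_lift g (N +>\<^bsub>M\<^esub> x) = g x"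
proof -
  interpret P: module R P by (fact P)
  let ?y = "SOME y. y \<in> N +>\<^bsub>M\<^esub> x"
  have "?y \<ominus>\<^bsub>M\<^esub> x \<in> N" using coset_some[OF x] x M.coset_eq_iff[OF N] by blast
  then have "g ?y \<ominus>\<^bsub>P\<^esub> g x = \<zero>\<^bsub>P\<^esub>"
    using g0 linear_map_minus[OF M P g coset_some(1)[OF x] x] by simp
  moreover have "g ?y \<in> carrier P" "g x \<in> carrier P"
    using linear_mapD(1)[OF g] coset_some(1)[OF x] x by auto
  ultimately have "\<ominus>\<^bsub>P\<^esub> (\<ominus>\<^bsub>P\<^esub> g x) = g ?y"
    by (intro P.M.minus_equality) (auto simp: a_minus_def)
  then show ?thesis unfolding quot_lift_def using \<open>g x \<in> carrier P\<close> by simp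
qed

lemma quot_lift_linear: "linear_map R (quot_module M N) P (quot_lift g)"
  by (intro linear_mapI; unfold quot_carrier_iff; elim bexE)
    (simp_all only: linear_mapD[OF g] quot_lift_coset quot_add quot_smult M.M.a_closed M.smult_closed)

end

end

subsection \<open>Tensor products\<close>

definition bilinear ::
  "('r,'x) ring_scheme \<Rightarrow> ('r,'m,'y) module_scheme \<Rightarrow> ('r,'n,'z) module_scheme
    \<Rightarrow> ('r,'p,'w) module_scheme \<Rightarrow> ('m \<Rightarrow> 'n \<Rightarrow> 'p) \<Rightarrow> bool" where
  "bilinear R M N P b \<longleftrightarrow>
    (\<forall>y\<in>carrier N. linear_map R M P (\<lambda>x. b x y)) \<and> (\<forall>x\<in>carrier M. linear_map R N P (b x))"

lemma bilinearD:
  assumes "bilinear R M N P b"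
  shows "y \<in> carrier N \<Longrightarrow> linear_map R M P (\<lambda>x. b x y)"
    and "x \<in> carrier M \<Longrightarrow> linear_map R N P (b x)"
    and "x \<in> carrier M \<Longrightarrow> y \<in> carrier N \<Longrightarrow> b x y \<in> carrier P"
  using assms linear_mapD(1) unfolding bilinear_def by metis+

text \<open>Reduces the universal property of the tensor product to those of free modules and
  quotients.\<close>

lemma tensor_lift_alt:
  "tensor_lift R P b = quot_lift (lin_ext R P (\<lambda>i. b (fst i) (snd i)))"
  by (simp add: fun_eq_iff tensor_lift_def quot_lift_def lin_ext_def Let_def)

context
  fixes R :: "('r,'x) ring_scheme" and M :: "('r,'m,'y) module_scheme" and N :: "('r,'n,'z) module_scheme"
  assumes M: "module R M" and N: "module R N"
begin

interpretation M: module R M by (fact M)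
interpretation N: module R N by (fact N)

abbreviation (input) "FMN \<equiv> free_module R (carrier M \<times> carrier N)"

interpretation F: module R FMN by (rule M.R.module_free_module)

lemma tensor_relationsE:
  assumes "z \<in> tensor_relations R M N"
  obtains (add_left) x x' y where
      "z = free_gen R (x \<oplus>\<^bsub>M\<^esub> x', y) \<ominus>\<^bsub>FMN\<^esub> (free_gen R (x, y) \<oplus>\<^bsub>FMN\<^esub> free_gen R (x', y))"
      "x \<in> carrier M" "x' \<in> carrier M" "y \<in> carrier N"
    | (add_right) x y y' where
      "z = free_gen R (x, y \<oplus>\<^bsub>N\<^esub> y') \<ominus>\<^bsub>FMN\<^esub> (free_gen R (x, y) \<oplus>\<^bsub>FMN\<^esub> free_gen R (x, y'))"
      "x \<in> carrier M" "y \<in> carrier N" "y' \<in> carrier N"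
    | (smult_left) r x y where
      "z = free_gen R (r \<odot>\<^bsub>M\<^esub> x, y) \<ominus>\<^bsub>FMN\<^esub> (r \<odot>\<^bsub>FMN\<^esub> free_gen R (x, y))"
      "r \<in> carrier R" "x \<in> carrier M" "y \<in> carrier N"
    | (smult_right) r x y where
      "z = free_gen R (x, r \<odot>\<^bsub>N\<^esub> y) \<ominus>\<^bsub>FMN\<^esub> (r \<odot>\<^bsub>FMN\<^esub> free_gen R (x, y))"
      "r \<in> carrier R" "x \<in> carrier M" "y \<in> carrier N"
  using assms unfolding tensor_relations_def Let_def by blast

lemma tensor_gen_closed:
  "x \<in> carrier M \<Longrightarrow> y \<in> carrier N \<Longrightarrow> free_gen R (x, y) \<in> carrier FMN"
  by (intro M.R.free_gen_closed) blast

lemma tensor_relations_subset: "tensor_relations R M N \<subseteq> carrier FMN"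
proof
  fix z assume "z \<in> tensor_relations R M N"
  then show "z \<in> carrier FMN"
    by (cases rule: tensor_relationsE)
      (simp_all only: F.M.minus_closed F.M.a_closed F.smult_closed tensor_gen_closed
        M.M.a_closed N.M.a_closed M.smult_closed N.smult_closed)
qed

lemma tensor_kernel_submodule: "submodule (tensor_kernel R M N) R FMN"
  unfolding tensor_kernel_def by (rule F.module_span_submodule[OF tensor_relations_subset])

lemma module_tensor: "module R (tensor R M N)"
  unfolding tensor_def by (rule module_quot[OF F.module_axioms tensor_kernel_submodule])

lemma tensor_carrierE:
  assumes "X \<in> carrier (tensor R M N)"
  obtains f where "f \<in> carrier FMN" "X = tensor_kernel R M N +>\<^bsub>FMN\<^esub> f"
  using assms by (auto simp: tensor_def quot_carrier_iff)

lemma pure_tensor_bilinear: "bilinear R M N (tensor R M N) (pure_tensor R M N)"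
proof -
  let ?N = "tensor_kernel R M N"
  let ?g = "free_gen R"
  note g = tensor_gen_closed
  have rel: "?N +>\<^bsub>FMN\<^esub> u = ?N +>\<^bsub>FMN\<^esub> v"
    if "u \<in> carrier FMN" "v \<in> carrier FMN" "u \<ominus>\<^bsub>FMN\<^esub> v \<in> tensor_relations R M N" for u v
    using that F.module_span_subset[of "tensor_relations R M N"] F.coset_eq_iff[OF tensor_kernel_submodule]
    unfolding tensor_kernel_def by blast
  note q = quot_add[OF F.module_axioms tensor_kernel_submodule]
    quot_smult[OF F.module_axioms tensor_kernel_submodule]
    coset_closed[OF F.module_axioms tensor_kernel_submodule]
  show ?thesis
    unfolding bilinear_def tensor_def pure_tensor_def
  proof (intro conjI ballI linear_mapI)
    fix x y assume "x \<in> carrier M" "y \<in> carrier N"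
    then show "?N +>\<^bsub>FMN\<^esub> ?g (x, y) \<in> carrier (quot_module FMN ?N)" by (intro q g)
    then show "?N +>\<^bsub>FMN\<^esub> ?g (x, y) \<in> carrier (quot_module FMN ?N)" .
  next
    fix y x x' assume a: "y \<in> carrier N" "x \<in> carrier M" "x' \<in> carrier M"
    have "?g (x \<oplus>\<^bsub>M\<^esub> x', y) \<ominus>\<^bsub>FMN\<^esub> (?g (x, y) \<oplus>\<^bsub>FMN\<^esub> ?g (x', y)) \<in> tensor_relations R M N"
      unfolding tensor_relations_def Let_def using a by blast
    then show "?N +>\<^bsub>FMN\<^esub> ?g (x \<oplus>\<^bsub>M\<^esub> x', y) =
      (?N +>\<^bsub>FMN\<^esub> ?g (x, y)) \<oplus>\<^bsub>quot_module FMN ?N\<^esub> (?N +>\<^bsub>FMN\<^esub> ?g (x', y))"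
      unfolding q(1)[OF g[OF a(2,1)] g[OF a(3,1)]]
      using a by (intro rel) (simp_all only: g F.M.a_closed M.M.a_closed)
  next
    fix y y' x assume a: "x \<in> carrier M" "y \<in> carrier N" "y' \<in> carrier N"
    have "?g (x, y \<oplus>\<^bsub>N\<^esub> y') \<ominus>\<^bsub>FMN\<^esub> (?g (x, y) \<oplus>\<^bsub>FMN\<^esub> ?g (x, y')) \<in> tensor_relations R M N"
      unfolding tensor_relations_def Let_def using a by blast
    then show "?N +>\<^bsub>FMN\<^esub> ?g (x, y \<oplus>\<^bsub>N\<^esub> y') =
      (?N +>\<^bsub>FMN\<^esub> ?g (x, y)) \<oplus>\<^bsub>quot_module FMN ?N\<^esub> (?N +>\<^bsub>FMN\<^esub> ?g (x, y'))"
      unfolding q(1)[OF g[OF a(1,2)] g[OF a(1,3)]]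
      using a by (intro rel) (simp_all only: g F.M.a_closed N.M.a_closed)
  next
    fix r x y assume a: "y \<in> carrier N" "r \<in> carrier R" "x \<in> carrier M"
    have "?g (r \<odot>\<^bsub>M\<^esub> x, y) \<ominus>\<^bsub>FMN\<^esub> (r \<odot>\<^bsub>FMN\<^esub> ?g (x, y)) \<in> tensor_relations R M N"
      unfolding tensor_relations_def Let_def using a by blast
    then show "?N +>\<^bsub>FMN\<^esub> ?g (r \<odot>\<^bsub>M\<^esub> x, y) = r \<odot>\<^bsub>quot_module FMN ?N\<^esub> (?N +>\<^bsub>FMN\<^esub> ?g (x, y))"
      unfolding q(2)[OF a(2) g[OF a(3,1)]]
      using a by (intro rel) (simp_all only: g F.smult_closed M.smult_closed)
  next
    fix r x y assume a: "x \<in> carrier M" "r \<in> carrier R" "y \<in> carrier N"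
    have "?g (x, r \<odot>\<^bsub>N\<^esub> y) \<ominus>\<^bsub>FMN\<^esub> (r \<odot>\<^bsub>FMN\<^esub> ?g (x, y)) \<in> tensor_relations R M N"
      unfolding tensor_relations_def Let_def using a by blast
    then show "?N +>\<^bsub>FMN\<^esub> ?g (x, r \<odot>\<^bsub>N\<^esub> y) = r \<odot>\<^bsub>quot_module FMN ?N\<^esub> (?N +>\<^bsub>FMN\<^esub> ?g (x, y))"
      unfolding q(2)[OF a(2) g[OF a(1,3)]]
      using a by (intro rel) (simp_all only: g F.smult_closed N.smult_closed)
  qed
qed

context
  fixes P :: "('r,'p,'w) module_scheme" and b
  assumes P: "module R P" and b: "bilinear R M N P b"
begin

interpretation P: module R P by (fact P)

abbreviation (input) "ext_b \<equiv> lin_ext R P (\<lambda>i. b (fst i) (snd i))"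

lemma tensor_ext_linear: "linear_map R FMN P ext_b"
  using bilinearD[OF b] by (intro P.lin_ext_linear) auto

lemma tensor_ext_kernel: "x \<in> tensor_kernel R M N \<Longrightarrow> ext_b x = \<zero>\<^bsub>P\<^esub>"
proof -
  note L = tensor_ext_linear
  note g = tensor_gen_closed
  have e: "ext_b (free_gen R (x, y)) = b x y" if "x \<in> carrier M" "y \<in> carrier N" for x y
    using that bilinearD[OF b] by (subst P.lin_ext_gen) auto
  have m: "ext_b (u \<ominus>\<^bsub>FMN\<^esub> v) = \<zero>\<^bsub>P\<^esub>" if "u \<in> carrier FMN" "v \<in> carrier FMN" "ext_b u = ext_b v" for u v
    using linear_map_minus[OF F.module_axioms P L that(1,2)] that(3) linear_mapD(1)[OF L that(2)]
    by (simp add: a_minus_def P.M.r_neg)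
  have "tensor_relations R M N \<subseteq> {x \<in> carrier FMN. ext_b x = \<zero>\<^bsub>P\<^esub>}"
  proof
    fix z assume z: "z \<in> tensor_relations R M N"
    from z have "ext_b z = \<zero>\<^bsub>P\<^esub>"
    proof (cases rule: tensor_relationsE)
      case (add_left x x' y)
      show ?thesis unfolding add_left(1)
        by (rule m) (simp_all only: add_left g F.M.a_closed M.M.a_closed linear_mapD(2)[OF L] e
            linear_mapD(2)[OF bilinearD(1)[OF b]])
    next
      case (add_right x y y')
      show ?thesis unfolding add_right(1)
        by (rule m) (simp_all only: add_right g F.M.a_closed N.M.a_closed linear_mapD(2)[OF L] e
            linear_mapD(2)[OF bilinearD(2)[OF b]])
    next
      case (smult_left r x y)
      show ?thesis unfolding smult_left(1)
        by (rule m) (simp_all only: smult_left g F.smult_closed M.smult_closed linear_mapD(3)[OF L] e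
            linear_mapD(3)[OF bilinearD(1)[OF b]])
    next
      case (smult_right r x y)
      show ?thesis unfolding smult_right(1)
        by (rule m) (simp_all only: smult_right g F.smult_closed N.smult_closed linear_mapD(3)[OF L] e
            linear_mapD(3)[OF bilinearD(2)[OF b]])
    qed
    then show "z \<in> {x \<in> carrier FMN. ext_b x = \<zero>\<^bsub>P\<^esub>}" using z tensor_relations_subset by auto
  qed
  then have "tensor_kernel R M N \<subseteq> {x \<in> carrier FMN. ext_b x = \<zero>\<^bsub>P\<^esub>}"
    unfolding tensor_kernel_def
    by (intro F.module_span_least kernel_submodule[OF F.module_axioms P L])
  then show "x \<in> tensor_kernel R M N \<Longrightarrow> ext_b x = \<zero>\<^bsub>P\<^esub>" by auto
qed

lemma tensor_lift_coset:
  "f \<in> carrier FMN \<Longrightarrow> tensor_lift R P b (tensor_kernel R M N +>\<^bsub>FMN\<^esub> f) = ext_b f"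
  unfolding tensor_lift_alt
  by (rule quot_lift_coset[OF F.module_axioms tensor_kernel_submodule P tensor_ext_linear tensor_ext_kernel])

lemma tensor_lift_linear: "linear_map R (tensor R M N) P (tensor_lift R P b)"
  unfolding tensor_lift_alt tensor_def
  by (rule quot_lift_linear[OF F.module_axioms tensor_kernel_submodule P tensor_ext_linear tensor_ext_kernel])

lemma tensor_lift_pure:
  assumes "x \<in> carrier M" "y \<in> carrier N"
  shows "tensor_lift R P b (pure_tensor R M N x y) = b x y"
  unfolding pure_tensor_def using assms bilinearD(3)[OF b]
  by (subst tensor_lift_coset) (auto intro!: M.R.free_gen_closed simp: P.lin_ext_gen)

end

lemma tensor_linear_unique:
  assumes P: "module R P" and g: "linear_map R (tensor R M N) P g" and h: "linear_map R (tensor R M N) P h"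
    and X: "X \<in> carrier (tensor R M N)"
    and eq: "\<And>x y. x \<in> carrier M \<Longrightarrow> y \<in> carrier N \<Longrightarrow> g (pure_tensor R M N x y) = h (pure_tensor R M N x y)"
  shows "g X = h X"
proof -
  obtain f where f: "f \<in> carrier FMN" "X = tensor_kernel R M N +>\<^bsub>FMN\<^esub> f"
    using X by (rule tensor_carrierE)
  note q = coset_linear[OF F.module_axioms tensor_kernel_submodule, folded tensor_def]
  show ?thesis unfolding f(2)
    by (rule free_linear_unique[OF P linear_map_comp[OF q g] linear_map_comp[OF q h] f(1)])
      (auto simp: eq[unfolded pure_tensor_def])
qed

text \<open>A linear map may be moved inside a lift, since both sides are linear and agree on pure
  tensors. Calculations with the coproduct use this instead of explicit sums of pure
  tensors.\<close>

lemma linear_tensor_lift: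
  assumes P: "module R P" and Q: "module R Q" and b: "bilinear R M N P b" and L: "linear_map R P Q L"
    and X: "X \<in> carrier (tensor R M N)"
  shows "L (tensor_lift R P b X) = tensor_lift R Q (\<lambda>x y. L (b x y)) X"
proof -
  have b': "bilinear R M N Q (\<lambda>x y. L (b x y))"
    unfolding bilinear_def
    using linear_map_comp[OF bilinearD(1)[OF b] L] linear_map_comp[OF bilinearD(2)[OF b] L] by simp
  show ?thesis
    by (rule tensor_linear_unique[OF Q linear_map_comp[OF tensor_lift_linear[OF P b] L]
          tensor_lift_linear[OF Q b'] X])
      (simp add: tensor_lift_pure[OF P b] tensor_lift_pure[OF Q b'])
qed

text \<open>\<open>c\<close> agrees with \<open>b\<close> on the carriers and is thereby bilinear
  too, so a bilinearity proof for one of the two integrands is enough.\<close>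

lemma tensor_lift_cong:
  assumes P: "module R P" and b: "bilinear R M N P b"
    and eq: "\<And>x y. x \<in> carrier M \<Longrightarrow> y \<in> carrier N \<Longrightarrow> c x y = b x y"
    and X: "X \<in> carrier (tensor R M N)"
  shows "tensor_lift R P c X = tensor_lift R P b X"
proof -
  have c: "bilinear R M N P c"
    unfolding bilinear_def
    using linear_map_cong[OF bilinearD(1)[OF b] M] linear_map_cong[OF bilinearD(2)[OF b] N] eq by simp
  show ?thesis
    by (rule tensor_linear_unique[OF P tensor_lift_linear[OF P c] tensor_lift_linear[OF P b] X])
      (simp add: tensor_lift_pure[OF P b] tensor_lift_pure[OF P c] eq)
qed

end

subsection \<open>Symmetric powers\<close>

text \<open>Mirrors \<open>sym_relations\<close> clause by clause, with symmetry only for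
  neighbouring entries; invariance under all permutations is
  \<open>sym_multilinear_mset\<close>.\<close>

definition sym_multilinear ::
  "('r,'x) ring_scheme \<Rightarrow> nat \<Rightarrow> ('r,'m,'y) module_scheme \<Rightarrow> ('r,'p,'z) module_scheme \<Rightarrow> ('m list \<Rightarrow> 'p) \<Rightarrow> bool"
where
  "sym_multilinear R n M P b \<longleftrightarrow>
    (\<forall>xs\<in>tuples n M. b xs \<in> carrier P) \<and>
    (\<forall>xs x y ys. xs @ x # ys \<in> tuples n M \<longrightarrow> y \<in> carrier M \<longrightarrow>
       b (xs @ (x \<oplus>\<^bsub>M\<^esub> y) # ys) = b (xs @ x # ys) \<oplus>\<^bsub>P\<^esub> b (xs @ y # ys)) \<and>
    (\<forall>xs x ys r. xs @ x # ys \<in> tuples n M \<longrightarrow> r \<in> carrier R \<longrightarrow>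
       b (xs @ (r \<odot>\<^bsub>M\<^esub> x) # ys) = r \<odot>\<^bsub>P\<^esub> b (xs @ x # ys)) \<and>
    (\<forall>xs x y ys. xs @ x # y # ys \<in> tuples n M \<longrightarrow> b (xs @ x # y # ys) = b (xs @ y # x # ys))"

lemma sym_multilinearD:
  assumes "sym_multilinear R n M P b"
  shows "xs \<in> tuples n M \<Longrightarrow> b xs \<in> carrier P"
    "ys @ x # zs \<in> tuples n M \<Longrightarrow> y \<in> carrier M \<Longrightarrow>
       b (ys @ (x \<oplus>\<^bsub>M\<^esub> y) # zs) = b (ys @ x # zs) \<oplus>\<^bsub>P\<^esub> b (ys @ y # zs)"
    "ys @ x # zs \<in> tuples n M \<Longrightarrow> r \<in> carrier R \<Longrightarrow>
       b (ys @ (r \<odot>\<^bsub>M\<^esub> x) # zs) = r \<odot>\<^bsub>P\<^esub> b (ys @ x # zs)"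
    "ys @ x # y # zs \<in> tuples n M \<Longrightarrow> b (ys @ x # y # zs) = b (ys @ y # x # zs)"
  using assms unfolding sym_multilinear_def by blast+

context
  fixes R :: "('r,'x) ring_scheme" and M :: "('r,'m,'y) module_scheme" and n :: nat
  assumes M: "module R M"
begin

interpretation M: module R M by (fact M)

abbreviation (input) "Fn \<equiv> free_module R (tuples n M)"

interpretation F: module R Fn by (rule M.R.module_free_module)

lemma sym_relationsE:
  assumes "z \<in> sym_relations R n M"
  obtains (add) xs x y ys where
      "z = free_gen R (xs @ (x \<oplus>\<^bsub>M\<^esub> y) # ys) \<ominus>\<^bsub>Fn\<^esub> (free_gen R (xs @ x # ys) \<oplus>\<^bsub>Fn\<^esub> free_gen R (xs @ y # ys))"
      "xs @ x # ys \<in> tuples n M" "y \<in> carrier M" "xs @ y # ys \<in> tuples n M" "xs @ (x \<oplus>\<^bsub>M\<^esub> y) # ys \<in> tuples n M"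
    | (smult) r xs x ys where
      "z = free_gen R (xs @ (r \<odot>\<^bsub>M\<^esub> x) # ys) \<ominus>\<^bsub>Fn\<^esub> (r \<odot>\<^bsub>Fn\<^esub> free_gen R (xs @ x # ys))"
      "xs @ x # ys \<in> tuples n M" "r \<in> carrier R" "xs @ (r \<odot>\<^bsub>M\<^esub> x) # ys \<in> tuples n M"
    | (swap) xs x y ys where
      "z = free_gen R (xs @ x # y # ys) \<ominus>\<^bsub>Fn\<^esub> free_gen R (xs @ y # x # ys)"
      "xs @ x # y # ys \<in> tuples n M" "xs @ y # x # ys \<in> tuples n M"
proof -
  from assms consider
      (1) xs x y ys where "z = free_gen R (xs @ (x \<oplus>\<^bsub>M\<^esub> y) # ys) \<ominus>\<^bsub>Fn\<^esub> (free_gen R (xs @ x # ys) \<oplus>\<^bsub>Fn\<^esub> free_gen R (xs @ y # ys))"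
         "xs @ x # ys \<in> tuples n M" "y \<in> carrier M"
    | (2) r xs x ys where "z = free_gen R (xs @ (r \<odot>\<^bsub>M\<^esub> x) # ys) \<ominus>\<^bsub>Fn\<^esub> (r \<odot>\<^bsub>Fn\<^esub> free_gen R (xs @ x # ys))"
         "xs @ x # ys \<in> tuples n M" "r \<in> carrier R"
    | (3) xs x y ys where "z = free_gen R (xs @ x # y # ys) \<ominus>\<^bsub>Fn\<^esub> free_gen R (xs @ y # x # ys)"
         "xs @ x # y # ys \<in> tuples n M"
    unfolding sym_relations_def Let_def by blast
  then show ?thesis
  proof cases
    case 1
    then have "xs @ y # ys \<in> tuples n M" "xs @ (x \<oplus>\<^bsub>M\<^esub> y) # ys \<in> tuples n M"
      by (auto simp: tuples_def)
    then show ?thesis by (rule add[OF 1])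
  next
    case 2
    then have "xs @ (r \<odot>\<^bsub>M\<^esub> x) # ys \<in> tuples n M" by (auto simp: tuples_def)
    then show ?thesis by (rule smult[OF 2])
  next
    case 3
    then have "xs @ y # x # ys \<in> tuples n M" by (auto simp: tuples_def)
    then show ?thesis by (rule swap[OF 3])
  qed
qed

lemma sym_gen_closed: "xs \<in> tuples n M \<Longrightarrow> free_gen R xs \<in> carrier Fn"
  by (intro M.R.free_gen_closed)

lemma sym_relations_subset: "sym_relations R n M \<subseteq> carrier Fn"
proof
  fix z assume "z \<in> sym_relations R n M"
  then show "z \<in> carrier Fn"
    by (cases rule: sym_relationsE)
      (simp_all only: F.M.minus_closed F.M.a_closed F.smult_closed sym_gen_closed)
qed

lemma sym_kernel_submodule: "submodule (sym_kernel R n M) R Fn"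
  unfolding sym_kernel_def by (rule F.module_span_submodule[OF sym_relations_subset])

lemma module_sym_power: "module R (sym_power R n M)"
  unfolding sym_power_def by (rule module_quot[OF F.module_axioms sym_kernel_submodule])

lemma sym_power_carrierE:
  assumes "X \<in> carrier (sym_power R n M)"
  obtains f where "f \<in> carrier Fn" "X = sym_kernel R n M +>\<^bsub>Fn\<^esub> f"
  using assms by (auto simp: sym_power_def quot_carrier_iff)

lemma sym_product_multilinear: "sym_multilinear R n M (sym_power R n M) (sym_product R n M)"
proof -
  let ?N = "sym_kernel R n M"
  let ?g = "free_gen R"
  note g = sym_gen_closed
  have rel: "?N +>\<^bsub>Fn\<^esub> u = ?N +>\<^bsub>Fn\<^esub> v"
    if "u \<in> carrier Fn" "v \<in> carrier Fn" "u \<ominus>\<^bsub>Fn\<^esub> v \<in> sym_relations R n M" for u v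
    using that F.module_span_subset[of "sym_relations R n M"] F.coset_eq_iff[OF sym_kernel_submodule]
    unfolding sym_kernel_def by blast
  note q = quot_add[OF F.module_axioms sym_kernel_submodule]
    quot_smult[OF F.module_axioms sym_kernel_submodule]
    coset_closed[OF F.module_axioms sym_kernel_submodule]
  show ?thesis
    unfolding sym_multilinear_def sym_power_def sym_product_def
  proof (intro conjI ballI allI impI)
    fix xs assume "xs \<in> tuples n M"
    then show "?N +>\<^bsub>Fn\<^esub> ?g xs \<in> carrier (quot_module Fn ?N)" by (intro q g)
  next
    fix xs x y ys assume a: "xs @ x # ys \<in> tuples n M" "y \<in> carrier M"
    then have a': "xs @ y # ys \<in> tuples n M" "xs @ (x \<oplus>\<^bsub>M\<^esub> y) # ys \<in> tuples n M" by (auto simp: tuples_def)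
    show "?N +>\<^bsub>Fn\<^esub> ?g (xs @ (x \<oplus>\<^bsub>M\<^esub> y) # ys) =
      (?N +>\<^bsub>Fn\<^esub> ?g (xs @ x # ys)) \<oplus>\<^bsub>quot_module Fn ?N\<^esub> (?N +>\<^bsub>Fn\<^esub> ?g (xs @ y # ys))"
      unfolding q(1)[OF g[OF a(1)] g[OF a'(1)]] unfolding sym_relations_def Let_def
      apply (rule rel[OF g[OF a'(2)] F.M.a_closed[OF g[OF a(1)] g[OF a'(1)]]])
      unfolding sym_relations_def Let_def using a by blast
  next
    fix xs x ys r assume a: "xs @ x # ys \<in> tuples n M" "r \<in> carrier R"
    then have a': "xs @ (r \<odot>\<^bsub>M\<^esub> x) # ys \<in> tuples n M" by (auto simp: tuples_def)
    show "?N +>\<^bsub>Fn\<^esub> ?g (xs @ (r \<odot>\<^bsub>M\<^esub> x) # ys) =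
      r \<odot>\<^bsub>quot_module Fn ?N\<^esub> (?N +>\<^bsub>Fn\<^esub> ?g (xs @ x # ys))"
      unfolding q(2)[OF a(2) g[OF a(1)]]
      apply (rule rel[OF g[OF a'] F.smult_closed[OF a(2) g[OF a(1)]]])
      unfolding sym_relations_def Let_def using a by blast
  next
    fix xs x y ys assume a: "xs @ x # y # ys \<in> tuples n M"
    then have a': "xs @ y # x # ys \<in> tuples n M" by (auto simp: tuples_def)
    show "?N +>\<^bsub>Fn\<^esub> ?g (xs @ x # y # ys) = ?N +>\<^bsub>Fn\<^esub> ?g (xs @ y # x # ys)"
      apply (rule rel[OF g[OF a] g[OF a']])
      unfolding sym_relations_def Let_def using a by blast
  qed
qed

context
  fixes P :: "('r,'p,'w) module_scheme" and b
  assumes P: "module R P" and b: "sym_multilinear R n M P b"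
begin

interpretation P: module R P by (fact P)

lemma sym_ext_linear: "linear_map R Fn P (lin_ext R P b)"
  using sym_multilinearD(1)[OF b] by (intro P.lin_ext_linear) auto

lemma sym_ext_kernel: "x \<in> sym_kernel R n M \<Longrightarrow> lin_ext R P b x = \<zero>\<^bsub>P\<^esub>"
proof -
  note L = sym_ext_linear
  let ?e = "lin_ext R P b"
  note g = sym_gen_closed
  have e: "?e (free_gen R xs) = b xs" if "xs \<in> tuples n M" for xs
    using that sym_multilinearD(1)[OF b] by (subst P.lin_ext_gen) auto
  have m: "?e (u \<ominus>\<^bsub>Fn\<^esub> v) = \<zero>\<^bsub>P\<^esub>" if "u \<in> carrier Fn" "v \<in> carrier Fn" "?e u = ?e v" for u v
    using linear_map_minus[OF F.module_axioms P L that(1,2)] that(3) linear_mapD(1)[OF L that(2)]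
    by (simp add: a_minus_def P.M.r_neg)
  have "sym_relations R n M \<subseteq> {x \<in> carrier Fn. ?e x = \<zero>\<^bsub>P\<^esub>}"
  proof
    fix z assume z: "z \<in> sym_relations R n M"
    from z have "?e z = \<zero>\<^bsub>P\<^esub>"
    proof (cases rule: sym_relationsE)
      case (add xs x y ys)
      show ?thesis unfolding add(1)
        by (rule m) (simp_all only: add g F.M.a_closed linear_mapD(2)[OF L] e sym_multilinearD(2)[OF b])
    next
      case (smult r xs x ys)
      show ?thesis unfolding smult(1)
        by (rule m) (simp_all only: smult g F.smult_closed linear_mapD(3)[OF L] e sym_multilinearD(3)[OF b])
    next
      case (swap xs x y ys)
      show ?thesis unfolding swap(1)
        by (rule m) (simp_all only: swap g e sym_multilinearD(4)[OF b swap(2)])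
    qed
    then show "z \<in> {x \<in> carrier Fn. ?e x = \<zero>\<^bsub>P\<^esub>}" using z sym_relations_subset by auto
  qed
  then have "sym_kernel R n M \<subseteq> {x \<in> carrier Fn. ?e x = \<zero>\<^bsub>P\<^esub>}"
    unfolding sym_kernel_def
    by (intro F.module_span_least kernel_submodule[OF F.module_axioms P L])
  then show "x \<in> sym_kernel R n M \<Longrightarrow> ?e x = \<zero>\<^bsub>P\<^esub>" by auto
qed

lemma sym_lift_coset:
  "f \<in> carrier Fn \<Longrightarrow> quot_lift (lin_ext R P b) (sym_kernel R n M +>\<^bsub>Fn\<^esub> f) = lin_ext R P b f"
  by (rule quot_lift_coset[OF F.module_axioms sym_kernel_submodule P sym_ext_linear sym_ext_kernel])

lemma sym_lift_linear: "linear_map R (sym_power R n M) P (quot_lift (lin_ext R P b))"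
  unfolding sym_power_def
  by (rule quot_lift_linear[OF F.module_axioms sym_kernel_submodule P sym_ext_linear sym_ext_kernel])

lemma sym_lift_product:
  assumes "xs \<in> tuples n M"
  shows "quot_lift (lin_ext R P b) (sym_product R n M xs) = b xs"
  unfolding sym_product_def using assms sym_multilinearD(1)[OF b]
  by (subst sym_lift_coset) (auto intro!: M.R.free_gen_closed simp: P.lin_ext_gen)

end

lemma sym_linear_unique:
  assumes P: "module R P" and g: "linear_map R (sym_power R n M) P g" and h: "linear_map R (sym_power R n M) P h"
    and X: "X \<in> carrier (sym_power R n M)"
    and eq: "\<And>xs. xs \<in> tuples n M \<Longrightarrow> g (sym_product R n M xs) = h (sym_product R n M xs)"
  shows "g X = h X"
proof -
  obtain f where f: "f \<in> carrier Fn" "X = sym_kernel R n M +>\<^bsub>Fn\<^esub> f"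
    using X by (rule sym_power_carrierE)
  note q = coset_linear[OF F.module_axioms sym_kernel_submodule, folded sym_power_def]
  show ?thesis unfolding f(2)
    by (rule free_linear_unique[OF P linear_map_comp[OF q g] linear_map_comp[OF q h] f(1)])
      (auto simp: eq[unfolded sym_product_def])
qed

end

section \<open>The convolution algebra\<close>

lemma algebraD:
  assumes "algebra K S" shows "module K S" "cring S" "cring K"
  using assms algebra.module algebra.M_cring algebra.R_cring by blast+

lemma linear_map_mult_left:
  assumes "algebra K S" "linear_map K M S v" "c \<in> carrier S"
  shows "linear_map K M S (\<lambda>x. c \<otimes>\<^bsub>S\<^esub> v x)"
proof -
  interpret S: algebra K S by fact
  show ?thesis
    using linear_mapD[OF assms(2)] assms(3)
    by (intro linear_mapI) (auto simp: S.r_distr S.smult_assoc2 S.m_comm[of c])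
qed

lemma linear_map_mult_right:
  assumes "algebra K S" "linear_map K M S v" "c \<in> carrier S"
  shows "linear_map K M S (\<lambda>x. v x \<otimes>\<^bsub>S\<^esub> c)"
proof -
  interpret S: algebra K S by fact
  show ?thesis
    using linear_mapD[OF assms(2)] assms(3)
    by (intro linear_mapI) (auto simp: S.l_distr S.smult_assoc2)
qed

lemma linear_map_add:
  assumes "module K P" "linear_map K M P f" "linear_map K M P g"
  shows "linear_map K M P (\<lambda>x. f x \<oplus>\<^bsub>P\<^esub> g x)"
proof -
  interpret P: module K P by fact
  show ?thesis
    using linear_mapD[OF assms(2)] linear_mapD[OF assms(3)]
    by (intro linear_mapI) (auto simp: P.M.a_ac P.smult_r_distr)
qed

lemma linear_map_smult:
  assumes "module K P" "linear_map K M P f" "r \<in> carrier K"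
  shows "linear_map K M P (\<lambda>x. r \<odot>\<^bsub>P\<^esub> f x)"
proof -
  interpret P: module K P by fact
  show ?thesis
    using linear_mapD[OF assms(2)] assms(3)
    by (intro linear_mapI) (auto simp: P.smult_r_distr P.smult_assoc1[symmetric] P.R.m_comm)
qed

lemma bilinearI:
  assumes "\<And>y. y \<in> carrier N \<Longrightarrow> linear_map R M P (\<lambda>x. b x y)"
    and "\<And>x. x \<in> carrier M \<Longrightarrow> linear_map R N P (\<lambda>y. b x y)"
  shows "bilinear R M N P b"
  using assms by (auto simp: bilinear_def)

lemma bilinear_mult:
  assumes "algebra K S" "linear_map K M S v" "linear_map K N S w"
  shows "bilinear K M N S (\<lambda>x y. v x \<otimes>\<^bsub>S\<^esub> w y)"
  using linear_mapD(1)[OF assms(2)] linear_mapD(1)[OF assms(3)]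
  by (intro bilinearI linear_map_mult_left linear_map_mult_right assms) auto

lemma bilinear_add:
  assumes "module K P" "bilinear K M N P b" "bilinear K M N P c"
  shows "bilinear K M N P (\<lambda>x y. b x y \<oplus>\<^bsub>P\<^esub> c x y)"
  by (intro bilinearI linear_map_add assms(1) bilinearD(1)[OF assms(2)] bilinearD(1)[OF assms(3)]
      bilinearD(2)[OF assms(2)] bilinearD(2)[OF assms(3)])

lemma bilinear_smult:
  assumes "module K P" "bilinear K M N P b" "r \<in> carrier K"
  shows "bilinear K M N P (\<lambda>x y. r \<odot>\<^bsub>P\<^esub> b x y)"
  by (intro bilinearI linear_map_smult assms(1,3) bilinearD(1)[OF assms(2)] bilinearD(2)[OF assms(2)])

lemma tensor_lift_add:
  assumes M: "module K M" and N: "module K N" and P: "module K P"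
    and b: "bilinear K M N P b" and c: "bilinear K M N P c" and X: "X \<in> carrier (tensor K M N)"
  shows "tensor_lift K P (\<lambda>x y. b x y \<oplus>\<^bsub>P\<^esub> c x y) X = tensor_lift K P b X \<oplus>\<^bsub>P\<^esub> tensor_lift K P c X"
  by (rule tensor_linear_unique[OF M N P tensor_lift_linear[OF M N P bilinear_add[OF P b c]]
        linear_map_add[OF P tensor_lift_linear[OF M N P b] tensor_lift_linear[OF M N P c]] X])
    (simp add: tensor_lift_pure[OF M N P] b c bilinear_add[OF P b c])

lemma tensor_lift_smult:
  assumes M: "module K M" and N: "module K N" and P: "module K P"
    and b: "bilinear K M N P b" and r: "r \<in> carrier K" and X: "X \<in> carrier (tensor K M N)"
  shows "tensor_lift K P (\<lambda>x y. r \<odot>\<^bsub>P\<^esub> b x y) X = r \<odot>\<^bsub>P\<^esub> tensor_lift K P b X"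
  by (rule tensor_linear_unique[OF M N P tensor_lift_linear[OF M N P bilinear_smult[OF P b r]]
        linear_map_smult[OF P tensor_lift_linear[OF M N P b] r] X])
    (simp add: tensor_lift_pure[OF M N P] b bilinear_smult[OF P b r])

text \<open>The bialgebra axioms nest one \<open>tensor_lift\<close> in another, and the inner one
  has to be bilinear in the outer variables before the outer lift means anything. With one outer
  variable fixed, this gives linearity in the other.\<close>

lemma tensor_lift_param_linear:
  assumes M: "module K M" and N: "module K N" and P: "module K P" and Q: "module K Q"
    and b: "\<And>z. z \<in> carrier Q \<Longrightarrow> bilinear K M N P (b z)"
    and l: "\<And>x y. x \<in> carrier M \<Longrightarrow> y \<in> carrier N \<Longrightarrow> linear_map K Q P (\<lambda>z. b z x y)"
    and X: "X \<in> carrier (tensor K M N)"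
  shows "linear_map K Q P (\<lambda>z. tensor_lift K P (b z) X)"
proof (rule linear_mapI)
  interpret Q: module K Q by fact
  fix z assume z: "z \<in> carrier Q"
  show "tensor_lift K P (b z) X \<in> carrier P"
    using linear_mapD(1)[OF tensor_lift_linear[OF M N P b[OF z]]] X .
  show "tensor_lift K P (b (z \<oplus>\<^bsub>Q\<^esub> z')) X = tensor_lift K P (b z) X \<oplus>\<^bsub>P\<^esub> tensor_lift K P (b z') X"
    if z': "z' \<in> carrier Q" for z'
    unfolding tensor_lift_add[OF M N P b[OF z] b[OF z'] X, symmetric]
    by (rule tensor_lift_cong[OF M N P bilinear_add[OF P b[OF z] b[OF z']] _ X])
      (simp add: linear_mapD(2)[OF l z z'])
  show "tensor_lift K P (b (r \<odot>\<^bsub>Q\<^esub> z)) X = r \<odot>\<^bsub>P\<^esub> tensor_lift K P (b z) X"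
    if r: "r \<in> carrier K" for r
    unfolding tensor_lift_smult[OF M N P b[OF z] r X, symmetric]
    by (rule tensor_lift_cong[OF M N P bilinear_smult[OF P b[OF z] r] _ X])
      (simp add: linear_mapD(3)[OF l r z])
qed

text \<open>A Fubini rule. Both sides are linear in \<open>X\<close>, so \<open>X\<close> may be
  taken to be a pure tensor; then both reduce to the same single lift over \<open>Y\<close>.\<close>

lemma tensor_lift_swap:
  assumes M: "module K M" and N: "module K N" and M': "module K M'" and N': "module K N'" and P: "module K P"
    and b: "\<And>u v. u \<in> carrier M' \<Longrightarrow> v \<in> carrier N' \<Longrightarrow> bilinear K M N P (\<lambda>x y. q x y u v)"
    and c: "\<And>x y. x \<in> carrier M \<Longrightarrow> y \<in> carrier N \<Longrightarrow> bilinear K M' N' P (\<lambda>u v. q x y u v)"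
    and Y: "Y \<in> carrier (tensor K M N)" and X: "X \<in> carrier (tensor K M' N')"
  shows "tensor_lift K P (\<lambda>x y. tensor_lift K P (\<lambda>u v. q x y u v) X) Y
    = tensor_lift K P (\<lambda>u v. tensor_lift K P (\<lambda>x y. q x y u v) Y) X"
proof -
  have T: "module K (tensor K M' N')" by (rule module_tensor[OF M' N'])
  have bl: "bilinear K M N P (\<lambda>x y. tensor_lift K P (\<lambda>u v. q x y u v) Z)"
    if Z: "Z \<in> carrier (tensor K M' N')" for Z
    by (intro bilinearI tensor_lift_param_linear[OF M' N' P _ _ _ Z] M N c)
      (auto intro: bilinearD(1)[OF b] bilinearD(2)[OF b])
  have bl': "bilinear K M' N' P (\<lambda>u v. tensor_lift K P (\<lambda>x y. q x y u v) Y)"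
    by (intro bilinearI tensor_lift_param_linear[OF M N P _ _ _ Y] M' N' b)
      (auto intro: bilinearD(1)[OF c] bilinearD(2)[OF c])
  have L: "linear_map K (tensor K M' N') P (\<lambda>Z. tensor_lift K P (\<lambda>x y. tensor_lift K P (\<lambda>u v. q x y u v) Z) Y)"
    by (rule tensor_lift_param_linear[OF M N P T bl tensor_lift_linear[OF M' N' P c] Y])
  show ?thesis
  proof (rule tensor_linear_unique[OF M' N' P L tensor_lift_linear[OF M' N' P bl'] X])
    fix u v assume uv: "u \<in> carrier M'" "v \<in> carrier N'"
    have "tensor_lift K P (\<lambda>x y. tensor_lift K P (q x y) (pure_tensor K M' N' u v)) Y
      = tensor_lift K P (\<lambda>x y. q x y u v) Y"
      by (rule tensor_lift_cong[OF M N P b[OF uv] _ Y]) (simp add: tensor_lift_pure[OF M' N' P c] uv)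
    then show "tensor_lift K P (\<lambda>x y. tensor_lift K P (q x y) (pure_tensor K M' N' u v)) Y
      = tensor_lift K P (\<lambda>u v. tensor_lift K P (\<lambda>x y. q x y u v) Y) (pure_tensor K M' N' u v)"
      by (simp add: tensor_lift_pure[OF M' N' P bl'] uv)
  qed
qed

subsection \<open>Modules of linear maps\<close>

lemma hom_module_simps:
  "v \<in> carrier (hom_module K M S) \<longleftrightarrow> v \<in> extensional (carrier M) \<and> linear_map K M S v"
  "\<zero>\<^bsub>hom_module K M S\<^esub> = (\<lambda>x\<in>carrier M. \<zero>\<^bsub>S\<^esub>)"
  "v \<oplus>\<^bsub>hom_module K M S\<^esub> w = (\<lambda>x\<in>carrier M. v x \<oplus>\<^bsub>S\<^esub> w x)"
  "s \<odot>\<^bsub>hom_module K M S\<^esub> v = (\<lambda>x\<in>carrier M. s \<otimes>\<^bsub>S\<^esub> v x)"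
  by (simp_all add: hom_module_def)

lemma hom_module_linear: "v \<in> carrier (hom_module K M S) \<Longrightarrow> linear_map K M S v"
  by (simp add: hom_module_simps)

lemma hom_module_app:
  "x \<in> carrier M \<Longrightarrow> (v \<oplus>\<^bsub>hom_module K M S\<^esub> w) x = v x \<oplus>\<^bsub>S\<^esub> w x"
  "x \<in> carrier M \<Longrightarrow> (s \<odot>\<^bsub>hom_module K M S\<^esub> v) x = s \<otimes>\<^bsub>S\<^esub> v x"
  "x \<in> carrier M \<Longrightarrow> \<zero>\<^bsub>hom_module K M S\<^esub> x = \<zero>\<^bsub>S\<^esub>"
  by (simp_all add: hom_module_simps)

lemma hom_module_eqI:
  assumes "v \<in> carrier (hom_module K M S)" "w \<in> carrier (hom_module K M S)"
    "\<And>x. x \<in> carrier M \<Longrightarrow> v x = w x"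
  shows "v = w"
  using assms by (auto simp: hom_module_simps intro: extensionalityI)

lemma hom_module_restrict:
  assumes "module K M" "linear_map K M S v" shows "(\<lambda>x\<in>carrier M. v x) \<in> carrier (hom_module K M S)"
proof -
  interpret M: module K M by fact
  show ?thesis using linear_mapD[OF assms(2)]
    by (auto simp: hom_module_simps intro!: linear_mapI)
qed

lemma module_hom_module:
  fixes S :: "('k,'s) module"
  assumes M: "module K M" and S: "algebra K S"
  shows "module S (hom_module K M S)"
proof -
  interpret M: module K M by fact
  interpret S: algebra K S by fact
  let ?H = "hom_module K M S"
  note eqI = hom_module_eqI[of _ K M S]
  note app = hom_module_app
  have cl: "v x \<in> carrier S" if "v \<in> carrier ?H" "x \<in> carrier M" for v x
    by (rule linear_mapD(1)[OF hom_module_linear[OF that(1)] that(2)])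
  have add: "v \<oplus>\<^bsub>?H\<^esub> w \<in> carrier ?H" if "v \<in> carrier ?H" "w \<in> carrier ?H" for v w
    unfolding hom_module_simps(3)
    by (rule hom_module_restrict[OF M linear_map_add[OF S.module that[THEN hom_module_linear]]])
  have sm: "s \<odot>\<^bsub>?H\<^esub> v \<in> carrier ?H" if "s \<in> carrier S" "v \<in> carrier ?H" for v s
    unfolding hom_module_simps(4)
    by (rule hom_module_restrict[OF M linear_map_mult_left[OF S hom_module_linear[OF that(2)] that(1)]])
  have z: "\<zero>\<^bsub>?H\<^esub> \<in> carrier ?H"
    unfolding hom_module_simps(2) by (intro hom_module_restrict[OF M] linear_mapI) auto
  show ?thesis
  proof (rule moduleI)
    show "abelian_group ?H"
    proof (rule abelian_groupI)
      fix v assume v: "v \<in> carrier ?H"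
      have c: "(\<ominus>\<^bsub>S\<^esub> \<one>\<^bsub>S\<^esub>) \<odot>\<^bsub>?H\<^esub> v \<in> carrier ?H" by (rule sm[OF _ v]) simp
      have "((\<ominus>\<^bsub>S\<^esub> \<one>\<^bsub>S\<^esub>) \<odot>\<^bsub>?H\<^esub> v) \<oplus>\<^bsub>?H\<^esub> v = \<zero>\<^bsub>?H\<^esub>"
        by (rule eqI[OF add[OF c v] z]) (simp add: app cl[OF v] S.l_minus S.l_neg)
      then show "\<exists>w\<in>carrier ?H. w \<oplus>\<^bsub>?H\<^esub> v = \<zero>\<^bsub>?H\<^esub>" using c by blast
    next
      fix u v w assume uvw: "u \<in> carrier ?H" "v \<in> carrier ?H" "w \<in> carrier ?H"
      show "u \<oplus>\<^bsub>?H\<^esub> v \<oplus>\<^bsub>?H\<^esub> w = u \<oplus>\<^bsub>?H\<^esub> (v \<oplus>\<^bsub>?H\<^esub> w)"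
        by (rule eqI) (use uvw in \<open>simp_all add: add app cl S.a_assoc\<close>)
    next
      fix v w assume vw: "v \<in> carrier ?H" "w \<in> carrier ?H"
      show "v \<oplus>\<^bsub>?H\<^esub> w = w \<oplus>\<^bsub>?H\<^esub> v"
        by (rule eqI) (use vw in \<open>simp_all add: add app cl S.a_comm\<close>)
    next
      fix v assume v: "v \<in> carrier ?H"
      show "\<zero>\<^bsub>?H\<^esub> \<oplus>\<^bsub>?H\<^esub> v = v"
        by (rule eqI) (use v in \<open>simp_all add: add app cl z\<close>)
    qed (auto simp: add z)
  next
    fix r s v assume a: "r \<in> carrier S" "s \<in> carrier S" "v \<in> carrier ?H"
    show "(r \<oplus>\<^bsub>S\<^esub> s) \<odot>\<^bsub>?H\<^esub> v = (r \<odot>\<^bsub>?H\<^esub> v) \<oplus>\<^bsub>?H\<^esub> (s \<odot>\<^bsub>?H\<^esub> v)"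
      by (rule eqI) (use a in \<open>simp_all add: add sm app cl S.l_distr\<close>)
    show "(r \<otimes>\<^bsub>S\<^esub> s) \<odot>\<^bsub>?H\<^esub> v = r \<odot>\<^bsub>?H\<^esub> (s \<odot>\<^bsub>?H\<^esub> v)"
      by (rule eqI) (use a in \<open>simp_all add: sm app cl S.m_assoc\<close>)
  next
    fix r v w assume a: "r \<in> carrier S" "v \<in> carrier ?H" "w \<in> carrier ?H"
    show "r \<odot>\<^bsub>?H\<^esub> (v \<oplus>\<^bsub>?H\<^esub> w) = (r \<odot>\<^bsub>?H\<^esub> v) \<oplus>\<^bsub>?H\<^esub> (r \<odot>\<^bsub>?H\<^esub> w)"
      by (rule eqI) (use a in \<open>simp_all add: add sm app cl S.r_distr\<close>)
  next
    fix v assume v: "v \<in> carrier ?H"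
    show "\<one>\<^bsub>S\<^esub> \<odot>\<^bsub>?H\<^esub> v = v"
      by (rule eqI) (use v in \<open>simp_all add: sm app cl\<close>)
  qed (auto simp: sm S.M_cring)
qed

lemma alg_homD:
  assumes "\<phi> \<in> alg_hom K S T"
  shows "\<phi> \<in> ring_hom S T" "linear_map K S T \<phi>"
    "\<And>x y. x \<in> carrier S \<Longrightarrow> y \<in> carrier S \<Longrightarrow> \<phi> (x \<otimes>\<^bsub>S\<^esub> y) = \<phi> x \<otimes>\<^bsub>T\<^esub> \<phi> y"
    "\<phi> \<one>\<^bsub>S\<^esub> = \<one>\<^bsub>T\<^esub>"
    "\<And>x. x \<in> carrier S \<Longrightarrow> \<phi> x \<in> carrier T"
    "\<And>x y. x \<in> carrier S \<Longrightarrow> y \<in> carrier S \<Longrightarrow> \<phi> (x \<oplus>\<^bsub>S\<^esub> y) = \<phi> x \<oplus>\<^bsub>T\<^esub> \<phi> y"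
  using assms by (auto simp: alg_hom_def ring_hom_def linear_map_def)

abbreviation push :: "('k,'m,'y) module_scheme \<Rightarrow> ('s \<Rightarrow> 's) \<Rightarrow> ('m \<Rightarrow> 's) \<Rightarrow> 'm \<Rightarrow> 's" where
  "push M \<phi> w \<equiv> restrict (\<phi> \<circ> w) (carrier M)"

lemma push_closed:
  assumes "module K M" "\<phi> \<in> alg_hom K S T" "w \<in> carrier (hom_module K M S)"
  shows "push M \<phi> w \<in> carrier (hom_module K M T)"
  using hom_module_restrict[OF assms(1) linear_map_comp[OF hom_module_linear[OF assms(3)] alg_homD(2)[OF assms(2)]]]
  by (simp add: o_def)

subsection \<open>The dual of a cocommutative bialgebra\<close>

locale cocomm_bialgebra =
  fixes K :: "'k ring" and A :: "('k,'a) bialgebra"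
  assumes field: "field K" and bialgebra: "cocommutative_bialgebra K A"
begin

abbreviation "AA \<equiv> tensor K A A"
abbreviation "\<Delta> \<equiv> comult A"
abbreviation "\<epsilon> \<equiv> counit A"
abbreviation "t \<equiv> pure_tensor K A A"
abbreviation "H S \<equiv> hom_module K A S"

lemma A_module: "module K A"
  and A_ring: "ring A"
  and smult_mult: "\<And>c x y. c \<in> carrier K \<Longrightarrow> x \<in> carrier A \<Longrightarrow> y \<in> carrier A \<Longrightarrow>
      (c \<odot>\<^bsub>A\<^esub> x) \<otimes>\<^bsub>A\<^esub> y = c \<odot>\<^bsub>A\<^esub> (x \<otimes>\<^bsub>A\<^esub> y)"
    "\<And>c x y. c \<in> carrier K \<Longrightarrow> x \<in> carrier A \<Longrightarrow> y \<in> carrier A \<Longrightarrow>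
      x \<otimes>\<^bsub>A\<^esub> (c \<odot>\<^bsub>A\<^esub> y) = c \<odot>\<^bsub>A\<^esub> (x \<otimes>\<^bsub>A\<^esub> y)"
  and comult_linear: "linear_map K A AA \<Delta>"
  and counit_smult: "\<And>c x. c \<in> carrier K \<Longrightarrow> x \<in> carrier A \<Longrightarrow> \<epsilon> (c \<odot>\<^bsub>A\<^esub> x) = c \<otimes>\<^bsub>K\<^esub> \<epsilon> x"
  and counit_add: "\<And>x y. x \<in> carrier A \<Longrightarrow> y \<in> carrier A \<Longrightarrow> \<epsilon> (x \<oplus>\<^bsub>A\<^esub> y) = \<epsilon> x \<oplus>\<^bsub>K\<^esub> \<epsilon> y"
  and counit_closed: "\<And>x. x \<in> carrier A \<Longrightarrow> \<epsilon> x \<in> carrier K"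
  and coassoc: "\<And>a. a \<in> carrier A \<Longrightarrow>
         tensor_lift K (tensor K AA A) (\<lambda>x y. pure_tensor K AA A (\<Delta> x) y) (\<Delta> a) =
         tensor_lift K (tensor K AA A)
           (\<lambda>x y. tensor_lift K (tensor K AA A) (\<lambda>u v. pure_tensor K AA A (t x u) v) (\<Delta> y)) (\<Delta> a)"
  and counit_left: "\<And>a. a \<in> carrier A \<Longrightarrow> tensor_lift K A (\<lambda>x y. \<epsilon> x \<odot>\<^bsub>A\<^esub> y) (\<Delta> a) = a"
  and cocomm: "\<And>a. a \<in> carrier A \<Longrightarrow> tensor_lift K AA (\<lambda>x y. t y x) (\<Delta> a) = \<Delta> a"
  and comult_mult: "\<And>a b. a \<in> carrier A \<Longrightarrow> b \<in> carrier A \<Longrightarrow>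
         \<Delta> (a \<otimes>\<^bsub>A\<^esub> b) =
         tensor_lift K AA
           (\<lambda>x y. tensor_lift K AA (\<lambda>u v. t (x \<otimes>\<^bsub>A\<^esub> u) (y \<otimes>\<^bsub>A\<^esub> v)) (\<Delta> b)) (\<Delta> a)"
  and comult_one: "\<Delta> \<one>\<^bsub>A\<^esub> = t \<one>\<^bsub>A\<^esub> \<one>\<^bsub>A\<^esub>"
  and counit_one: "\<epsilon> \<one>\<^bsub>A\<^esub> = \<one>\<^bsub>K\<^esub>"
  using bialgebra unfolding cocommutative_bialgebra_def Let_def by (elim conjE; blast)+

sublocale A: module K A by (rule A_module)
sublocale Ar: ring A by (rule A_ring)
sublocale K: field K by (rule field)

lemma AA_module: "module K AA" by (rule module_tensor[OF A_module A_module])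

lemma comult_closed: "a \<in> carrier A \<Longrightarrow> \<Delta> a \<in> carrier AA"
  by (rule linear_mapD(1)[OF comult_linear])

lemma linear_mult_A:
  assumes "linear_map K A P w" "p \<in> carrier A"
  shows "linear_map K A P (\<lambda>a. w (p \<otimes>\<^bsub>A\<^esub> a))" "linear_map K A P (\<lambda>a. w (a \<otimes>\<^bsub>A\<^esub> p))"
  using linear_mapD[OF assms(1)] assms(2)
  by (intro linear_mapI; simp add: Ar.r_distr Ar.l_distr smult_mult)+

context
  fixes S :: "('k,'s) module"
  assumes S: "algebra K S"
begin

interpretation S: algebra K S by (rule S)
interpretation HS: module S "H S" by (rule module_hom_module[OF A_module S])

lemma H_app_closed: "v \<in> carrier (H S) \<Longrightarrow> a \<in> carrier A \<Longrightarrow> v a \<in> carrier S"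
  by (rule linear_mapD(1)[OF hom_module_linear])

lemma conv_bilinear:
  "v \<in> carrier (H S) \<Longrightarrow> w \<in> carrier (H S) \<Longrightarrow> bilinear K A A S (\<lambda>x y. v x \<otimes>\<^bsub>S\<^esub> w y)"
  by (intro bilinear_mult[OF S] hom_module_linear)

lemma conv_closed:
  assumes "v \<in> carrier (H S)" "w \<in> carrier (H S)" shows "conv K A S v w \<in> carrier (H S)"
  unfolding conv_def
  by (rule hom_module_restrict[OF A_module linear_map_comp[OF comult_linear
        tensor_lift_linear[OF A_module A_module S.module conv_bilinear[OF assms]]]])

lemma conv_app: "a \<in> carrier A \<Longrightarrow> conv K A S v w a = tensor_lift K S (\<lambda>x y. v x \<otimes>\<^bsub>S\<^esub> w y) (\<Delta> a)"
  by (simp add: conv_def)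

lemma conv_unit_closed: "conv_unit A S \<in> carrier (H S)"
  unfolding conv_unit_def
  by (intro hom_module_restrict[OF A_module] linear_mapI)
    (auto simp: counit_closed counit_add counit_smult S.smult_l_distr S.smult_assoc1)

lemma conv_unit_app: "a \<in> carrier A \<Longrightarrow> conv_unit A S a = \<epsilon> a \<odot>\<^bsub>S\<^esub> \<one>\<^bsub>S\<^esub>"
  by (simp add: conv_unit_def)

lemma conv_comm:
  assumes v: "v \<in> carrier (H S)" and w: "w \<in> carrier (H S)"
  shows "conv K A S v w = conv K A S w v"
proof (rule hom_module_eqI[OF conv_closed[OF v w] conv_closed[OF w v]])
  fix a assume a: "a \<in> carrier A"
  let ?L = "tensor_lift K S (\<lambda>x y. v x \<otimes>\<^bsub>S\<^esub> w y)"
  note L = tensor_lift_linear[OF A_module A_module S.module conv_bilinear[OF v w]]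
  note bl = pure_tensor_bilinear[OF A_module A_module]
  have bl': "bilinear K A A AA (\<lambda>x y. t y x)"
    by (intro bilinearI bilinearD(1)[OF bl] bilinearD(2)[OF bl])
  have "conv K A S v w a = ?L (tensor_lift K AA (\<lambda>x y. t y x) (\<Delta> a))"
    using a by (simp add: conv_app cocomm)
  also have "\<dots> = tensor_lift K S (\<lambda>x y. ?L (t y x)) (\<Delta> a)"
    by (rule linear_tensor_lift[OF A_module A_module AA_module S.module bl' L comult_closed[OF a]])
  also have "\<dots> = tensor_lift K S (\<lambda>x y. w x \<otimes>\<^bsub>S\<^esub> v y) (\<Delta> a)"
    by (rule tensor_lift_cong[OF A_module A_module S.module conv_bilinear[OF w v] _ comult_closed[OF a]])
      (use v w in \<open>simp add: tensor_lift_pure[OF A_module A_module S.module conv_bilinear[OF v w]] H_app_closed S.m_comm\<close>)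
  finally show "conv K A S v w a = conv K A S w v a" using a by (simp add: conv_app)
qed

lemma conv_unit_left:
  assumes w: "w \<in> carrier (H S)" shows "conv K A S (conv_unit A S) w = w"
proof (rule hom_module_eqI[OF conv_closed[OF conv_unit_closed w] w])
  fix a assume a: "a \<in> carrier A"
  have bl: "bilinear K A A A (\<lambda>x y. \<epsilon> x \<odot>\<^bsub>A\<^esub> y)"
    by (intro bilinearI linear_mapI)
      (auto simp: counit_closed counit_add counit_smult A.smult_l_distr A.smult_r_distr
        A.smult_assoc1[symmetric] A.R.m_comm)
  have "w a = w (tensor_lift K A (\<lambda>x y. \<epsilon> x \<odot>\<^bsub>A\<^esub> y) (\<Delta> a))" using a by (simp add: counit_left)
  also have "\<dots> = tensor_lift K S (\<lambda>x y. w (\<epsilon> x \<odot>\<^bsub>A\<^esub> y)) (\<Delta> a)"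
    by (rule linear_tensor_lift[OF A_module A_module A_module S.module bl hom_module_linear[OF w] comult_closed[OF a]])
  also have "\<dots> = tensor_lift K S (\<lambda>x y. conv_unit A S x \<otimes>\<^bsub>S\<^esub> w y) (\<Delta> a)"
    by (rule tensor_lift_cong[OF A_module A_module S.module conv_bilinear[OF conv_unit_closed w] _ comult_closed[OF a]])
      (use w in \<open>simp add: conv_unit_app H_app_closed counit_closed S.smult_assoc2 linear_mapD(3)[OF hom_module_linear[OF w]]\<close>)
  finally show "conv K A S (conv_unit A S) w a = w a" using a by (simp add: conv_app)
qed

text \<open>The two sides of coassociativity are elements of
  \<open>(A \<otimes> A) \<otimes> A\<close>. The three functionals induce a linear form on this
  space, and its values on the two elements are the two bracketings.\<close>

lemma conv_assoc:
  assumes f: "f \<in> carrier (H S)" and g: "g \<in> carrier (H S)" and h: "h \<in> carrier (H S)"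
  shows "conv K A S (conv K A S f g) h = conv K A S f (conv K A S g h)"
proof (rule hom_module_eqI[OF conv_closed[OF conv_closed[OF f g] h] conv_closed[OF f conv_closed[OF g h]]])
  fix a assume a: "a \<in> carrier A"
  let ?T = "tensor K AA A"
  note T = module_tensor[OF AA_module A_module]
  note bT = pure_tensor_bilinear[OF AA_module A_module]
  note bA = pure_tensor_bilinear[OF A_module A_module]
  let ?L = "tensor_lift K S (\<lambda>x y. f x \<otimes>\<^bsub>S\<^esub> g y)"
  note L = tensor_lift_linear[OF A_module A_module S.module conv_bilinear[OF f g]]
  \<comment> \<open>The form sending \<open>(x \<otimes> y) \<otimes> z\<close> to the product of
    \<open>f x\<close>, \<open>g y\<close> and \<open>h z\<close>.\<close>
  let ?G = "tensor_lift K S (\<lambda>X z. ?L X \<otimes>\<^bsub>S\<^esub> h z)"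
  have bG: "bilinear K AA A S (\<lambda>X z. ?L X \<otimes>\<^bsub>S\<^esub> h z)"
    by (intro bilinear_mult[OF S] L hom_module_linear[OF h])
  note G = tensor_lift_linear[OF AA_module A_module S.module bG]
  note Gp = tensor_lift_pure[OF AA_module A_module S.module bG]
  have b1: "bilinear K A A ?T (\<lambda>x y. pure_tensor K AA A (\<Delta> x) y)"
    by (intro bilinearI linear_map_comp[OF comult_linear bilinearD(1)[OF bT]] bilinearD(2)[OF bT] comult_closed)
  have b2: "bilinear K A A ?T (\<lambda>u v. pure_tensor K AA A (t x u) v)" if "x \<in> carrier A" for x
    by (intro bilinearI linear_map_comp[OF bilinearD(2)[OF bA that] bilinearD(1)[OF bT]] bilinearD(2)[OF bT]
        bilinearD(3)[OF bA] that)
  have b3: "bilinear K A A ?T (\<lambda>x y. tensor_lift K ?T (\<lambda>u v. pure_tensor K AA A (t x u) v) (\<Delta> y))"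
    apply (intro bilinearI)
    subgoal for y
      by (rule tensor_lift_param_linear[OF A_module A_module T A_module b2 _ comult_closed])
        (auto intro: linear_map_comp[OF bilinearD(1)[OF bA] bilinearD(1)[OF bT]])
    subgoal for x
      by (rule linear_map_comp[OF comult_linear tensor_lift_linear[OF A_module A_module T b2]])
    done
  have "conv K A S (conv K A S f g) h a = tensor_lift K S (\<lambda>x y. ?G (pure_tensor K AA A (\<Delta> x) y)) (\<Delta> a)"
    unfolding conv_app[OF a]
    by (rule tensor_lift_cong[OF A_module A_module S.module _ _ comult_closed[OF a], symmetric])
      (use f g h in \<open>simp_all add: Gp comult_closed conv_app conv_bilinear conv_closed\<close>)
  also have "\<dots> = ?G (tensor_lift K ?T (\<lambda>x y. pure_tensor K AA A (\<Delta> x) y) (\<Delta> a))"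
    by (rule linear_tensor_lift[OF A_module A_module T S.module b1 G comult_closed[OF a], symmetric])
  also have "\<dots> = ?G (tensor_lift K ?T
           (\<lambda>x y. tensor_lift K ?T (\<lambda>u v. pure_tensor K AA A (t x u) v) (\<Delta> y)) (\<Delta> a))"
    by (simp add: coassoc[OF a])
  also have "\<dots> = tensor_lift K S (\<lambda>x y. ?G (tensor_lift K ?T (\<lambda>u v. pure_tensor K AA A (t x u) v) (\<Delta> y))) (\<Delta> a)"
    by (rule linear_tensor_lift[OF A_module A_module T S.module b3 G comult_closed[OF a]])
  also have "\<dots> = tensor_lift K S (\<lambda>x y. f x \<otimes>\<^bsub>S\<^esub> conv K A S g h y) (\<Delta> a)"
  proof (rule tensor_lift_cong[OF A_module A_module S.module conv_bilinear[OF f conv_closed[OF g h]] _ comult_closed[OF a]])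
    fix x y assume xy: "x \<in> carrier A" "y \<in> carrier A"
    have fx: "f x \<in> carrier S" by (rule H_app_closed[OF f xy(1)])
    have "?G (tensor_lift K ?T (\<lambda>u v. pure_tensor K AA A (t x u) v) (\<Delta> y))
      = tensor_lift K S (\<lambda>u v. ?G (pure_tensor K AA A (t x u) v)) (\<Delta> y)"
      by (rule linear_tensor_lift[OF A_module A_module T S.module b2[OF xy(1)] G comult_closed[OF xy(2)]])
    also have "\<dots> = tensor_lift K S (\<lambda>u v. f x \<otimes>\<^bsub>S\<^esub> (g u \<otimes>\<^bsub>S\<^esub> h v)) (\<Delta> y)"
      apply (rule tensor_lift_cong[OF A_module A_module S.module _ _ comult_closed[OF xy(2)]])
      subgoal by (intro bilinearI linear_map_mult_left[OF S _ fx] bilinearD(1)[OF conv_bilinear[OF g h]]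
            bilinearD(2)[OF conv_bilinear[OF g h]])
      subgoal for u v
        using xy f g h
        by (simp add: Gp bilinearD(3)[OF bA] tensor_lift_pure[OF A_module A_module S.module conv_bilinear[OF f g]]
            H_app_closed S.m_assoc)
      done
    also have "\<dots> = f x \<otimes>\<^bsub>S\<^esub> tensor_lift K S (\<lambda>u v. g u \<otimes>\<^bsub>S\<^esub> h v) (\<Delta> y)"
      by (rule linear_tensor_lift[OF A_module A_module S.module S.module conv_bilinear[OF g h] _ comult_closed[OF xy(2)], symmetric])
        (rule linear_map_mult_left[OF S linear_map_ident fx])
    finally show "?G (tensor_lift K ?T (\<lambda>u v. pure_tensor K AA A (t x u) v) (\<Delta> y)) = f x \<otimes>\<^bsub>S\<^esub> conv K A S g h y"
      using xy by (simp add: conv_app)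
  qed
  finally show "conv K A S (conv K A S f g) h a = conv K A S f (conv K A S g h) a"
    using a by (simp add: conv_app)
qed

lemma conv_lcomm:
  assumes "u \<in> carrier (H S)" "v \<in> carrier (H S)" "w \<in> carrier (H S)"
  shows "conv K A S u (conv K A S v w) = conv K A S v (conv K A S u w)"
  using assms conv_assoc[of u v w] conv_assoc[of v u w] conv_comm[of u v] by simp

lemma conv_add_left:
  assumes u: "u \<in> carrier (H S)" and v: "v \<in> carrier (H S)" and w: "w \<in> carrier (H S)"
  shows "conv K A S (u \<oplus>\<^bsub>H S\<^esub> v) w = conv K A S u w \<oplus>\<^bsub>H S\<^esub> conv K A S v w"
proof (rule hom_module_eqI[of _ K A S])
  fix a assume a: "a \<in> carrier A"
  show "conv K A S (u \<oplus>\<^bsub>H S\<^esub> v) w a = (conv K A S u w \<oplus>\<^bsub>H S\<^esub> conv K A S v w) a"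
    unfolding hom_module_app(1)[OF a] conv_app[OF a]
      tensor_lift_add[OF A_module A_module S.module conv_bilinear[OF u w] conv_bilinear[OF v w] comult_closed[OF a], symmetric]
    by (rule tensor_lift_cong[OF A_module A_module S.module bilinear_add[OF S.module conv_bilinear[OF u w] conv_bilinear[OF v w]] _ comult_closed[OF a]])
      (use u v w in \<open>simp add: hom_module_app H_app_closed S.l_distr\<close>)
qed (intro conv_closed HS.M.a_closed u v w)+

lemma conv_smult_left:
  assumes s: "s \<in> carrier S" and v: "v \<in> carrier (H S)" and w: "w \<in> carrier (H S)"
  shows "conv K A S (s \<odot>\<^bsub>H S\<^esub> v) w = s \<odot>\<^bsub>H S\<^esub> conv K A S v w"
proof (rule hom_module_eqI[of _ K A S])
  fix a assume a: "a \<in> carrier A"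
  have "(s \<odot>\<^bsub>H S\<^esub> conv K A S v w) a = s \<otimes>\<^bsub>S\<^esub> tensor_lift K S (\<lambda>x y. v x \<otimes>\<^bsub>S\<^esub> w y) (\<Delta> a)"
    using a by (simp add: hom_module_app conv_app)
  also have "\<dots> = tensor_lift K S (\<lambda>x y. s \<otimes>\<^bsub>S\<^esub> (v x \<otimes>\<^bsub>S\<^esub> w y)) (\<Delta> a)"
    by (rule linear_tensor_lift[OF A_module A_module S.module S.module conv_bilinear[OF v w] _ comult_closed[OF a]])
      (rule linear_map_mult_left[OF S linear_map_ident s])
  also have "\<dots> = conv K A S (s \<odot>\<^bsub>H S\<^esub> v) w a"
    unfolding conv_app[OF a]
    by (rule tensor_lift_cong[OF A_module A_module S.module conv_bilinear[OF HS.smult_closed[OF s v] w] _ comult_closed[OF a]])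
      (use s v w in \<open>simp add: hom_module_app H_app_closed S.m_assoc\<close>)
  finally show "conv K A S (s \<odot>\<^bsub>H S\<^esub> v) w a = (s \<odot>\<^bsub>H S\<^esub> conv K A S v w) a" by simp
qed (intro conv_closed HS.smult_closed s v w)+

lemma conv_add_right:
  assumes "u \<in> carrier (H S)" "v \<in> carrier (H S)" "w \<in> carrier (H S)"
  shows "conv K A S w (u \<oplus>\<^bsub>H S\<^esub> v) = conv K A S w u \<oplus>\<^bsub>H S\<^esub> conv K A S w v"
  using assms by (simp add: conv_comm[of w] conv_add_left)

lemma conv_smult_right:
  assumes "s \<in> carrier S" "v \<in> carrier (H S)" "w \<in> carrier (H S)"
  shows "conv K A S w (s \<odot>\<^bsub>H S\<^esub> v) = s \<odot>\<^bsub>H S\<^esub> conv K A S w v"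
  using assms by (simp add: conv_comm[of w] conv_smult_left)

lemma conv_at_one:
  assumes "v \<in> carrier (H S)" "w \<in> carrier (H S)"
  shows "conv K A S v w \<one>\<^bsub>A\<^esub> = v \<one>\<^bsub>A\<^esub> \<otimes>\<^bsub>S\<^esub> w \<one>\<^bsub>A\<^esub>"
  using assms by (simp add: conv_app comult_one tensor_lift_pure[OF A_module A_module S.module conv_bilinear])

lemma conv_unit_at_one: "conv_unit A S \<one>\<^bsub>A\<^esub> = \<one>\<^bsub>S\<^esub>"
  by (simp add: conv_unit_app counit_one)

lemma conv_prod_Cons: "conv_prod K A S (w # ws) = conv K A S w (conv_prod K A S ws)"
  by (simp add: conv_prod_def)

lemma conv_prod_Nil: "conv_prod K A S [] = conv_unit A S"
  by (simp add: conv_prod_def)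

lemma conv_prod_closed: "set ws \<subseteq> carrier (H S) \<Longrightarrow> conv_prod K A S ws \<in> carrier (H S)"
  by (induction ws) (auto simp: conv_prod_Cons conv_prod_Nil conv_unit_closed conv_closed)

text \<open>Commutativity lets any factor be brought to the front, where linearity of
  \<open>conv\<close> in its first argument applies.\<close>

lemma conv_prod_insert:
  assumes "set us \<subseteq> carrier (H S)" "set vs \<subseteq> carrier (H S)" "w \<in> carrier (H S)"
  shows "conv_prod K A S (us @ w # vs) = conv K A S w (conv_prod K A S (us @ vs))"
  using assms by (induction us) (auto simp: conv_prod_Cons conv_lcomm conv_prod_closed)

end

lemma conv_push:
  assumes S: "algebra K S" and T: "algebra K T" and \<phi>: "\<phi> \<in> alg_hom K S T"
    and v: "v \<in> carrier (H S)" and w: "w \<in> carrier (H S)"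
  shows "push A \<phi> (conv K A S v w) = conv K A T (push A \<phi> v) (push A \<phi> w)"
proof (rule hom_module_eqI[OF push_closed[OF A_module \<phi> conv_closed[OF S v w]]
      conv_closed[OF T push_closed[OF A_module \<phi> v] push_closed[OF A_module \<phi> w]]])
  fix a assume a: "a \<in> carrier A"
  note ST = algebraD(1)[OF S] algebraD(1)[OF T]
  have "push A \<phi> (conv K A S v w) a = \<phi> (tensor_lift K S (\<lambda>x y. v x \<otimes>\<^bsub>S\<^esub> w y) (\<Delta> a))"
    using a by (simp add: conv_app[OF S])
  also have "\<dots> = tensor_lift K T (\<lambda>x y. \<phi> (v x \<otimes>\<^bsub>S\<^esub> w y)) (\<Delta> a)"
    by (rule linear_tensor_lift[OF A_module A_module ST conv_bilinear[OF S v w] alg_homD(2)[OF \<phi>] comult_closed[OF a]])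
  also have "\<dots> = tensor_lift K T (\<lambda>x y. push A \<phi> v x \<otimes>\<^bsub>T\<^esub> push A \<phi> w y) (\<Delta> a)"
    by (rule tensor_lift_cong[OF A_module A_module ST(2) conv_bilinear[OF T push_closed[OF A_module \<phi> v] push_closed[OF A_module \<phi> w]] _ comult_closed[OF a]])
      (use v w in \<open>simp add: alg_homD[OF \<phi>] H_app_closed[OF S]\<close>)
  finally show "push A \<phi> (conv K A S v w) a = conv K A T (push A \<phi> v) (push A \<phi> w) a"
    using a by (simp add: conv_app[OF T])
qed

lemma conv_unit_push:
  assumes S: "algebra K S" and T: "algebra K T" and \<phi>: "\<phi> \<in> alg_hom K S T"
  shows "push A \<phi> (conv_unit A S) = conv_unit A T"
proof -
  interpret S: algebra K S by fact
  show ?thesis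
    using alg_homD(4)[OF \<phi>] linear_mapD(3)[OF alg_homD(2)[OF \<phi>]]
    by (auto simp: conv_unit_def counit_closed fun_eq_iff restrict_def)
qed

lemma conv_prod_push:
  assumes S: "algebra K S" and T: "algebra K T" and \<phi>: "\<phi> \<in> alg_hom K S T"
    and "set ws \<subseteq> carrier (H S)"
  shows "push A \<phi> (conv_prod K A S ws) = conv_prod K A T (map (push A \<phi>) ws)"
  using assms(4)
proof (induction ws)
  case Nil
  then show ?case by (simp only: conv_prod_Nil[OF S] conv_prod_Nil[OF T] conv_unit_push[OF S T \<phi>] list.map)
next
  case (Cons w ws)
  then show ?case
    by (simp only: conv_prod_Cons[OF S] conv_prod_Cons[OF T] conv_push[OF S T \<phi>] list.map
        conv_prod_closed[OF S] list.set insert_subset)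
qed

end

subsection \<open>Primitive elements act as derivations\<close>

text \<open>Lists keep multiplicities. The terms of a Leibniz expansion and the permutations of a
  list are indexed by positions, and equal entries must be counted repeatedly for the total to be
  n!.\<close>

definition lsum :: "('m,'x) ring_scheme \<Rightarrow> 'm list \<Rightarrow> 'm" where
  "lsum M xs = foldr (add M) xs \<zero>\<^bsub>M\<^esub>"

lemma lsum_simps: "lsum M [] = \<zero>\<^bsub>M\<^esub>" "lsum M (x # xs) = x \<oplus>\<^bsub>M\<^esub> lsum M xs"
  by (simp_all add: lsum_def)

lemma (in abelian_monoid) lsum_closed: "set xs \<subseteq> carrier G \<Longrightarrow> lsum G xs \<in> carrier G"
  by (induction xs) (auto simp: lsum_simps)

lemma (in abelian_monoid) lsum_append:
  "set xs \<subseteq> carrier G \<Longrightarrow> set ys \<subseteq> carrier G \<Longrightarrow> lsum G (xs @ ys) = lsum G xs \<oplus> lsum G ys"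
  by (induction xs) (auto simp: lsum_simps lsum_closed a_assoc)

lemma linear_map_lsum:
  assumes M: "module K M" and N: "module K N" and f: "linear_map K M N f" and "set xs \<subseteq> carrier M"
  shows "f (lsum M xs) = lsum N (map f xs)"
proof -
  interpret M: module K M by fact
  show ?thesis using assms(4)
    by (induction xs)
      (auto simp: lsum_simps linear_map_zero[OF M N f] linear_mapD(2)[OF f] M.M.lsum_closed)
qed

section \<open>Permutations of a list, with multiplicity\<close>

fun selections :: "'b list \<Rightarrow> ('b \<times> 'b list) list" where
  "selections [] = []"
| "selections (x # xs) = (x, xs) # map (\<lambda>(y, ys). (y, x # ys)) (selections xs)"

text \<open>Permutations are generated by choosing the first entry, because a primitive element
  consumes one factor of a product at a time. The number \<open>n\<close> is meant to be the length
  of the list; it carries the recursion.\<close>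

fun arrangements :: "nat \<Rightarrow> 'b list \<Rightarrow> 'b list list" where
  "arrangements 0 xs = [[]]"
| "arrangements (Suc n) xs = concat (map (\<lambda>(y, ys). map ((#) y) (arrangements n ys)) (selections xs))"

lemma selections_mset: "(y, ys) \<in> set (selections xs) \<Longrightarrow> mset xs = add_mset y (mset ys)"
  by (induction xs arbitrary: ys) auto

lemma length_selections: "length (selections xs) = length xs"
  by (induction xs) auto

lemma selections_length: "(y, ys) \<in> set (selections xs) \<Longrightarrow> length xs = Suc (length ys)"
  using selections_mset[of y ys xs] by (metis size_add_mset size_mset)

lemma selections_set: "(y, ys) \<in> set (selections xs) \<Longrightarrow> set xs = insert y (set ys)"
  using selections_mset[of y ys xs] by (metis set_mset_add_mset_insert set_mset_mset)

lemma arrangements_mset: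
  "length xs = n \<Longrightarrow> ys \<in> set (arrangements n xs) \<Longrightarrow> mset ys = mset xs"
proof (induction n arbitrary: xs ys)
  case (Suc n)
  then obtain z zs us where *: "(z, zs) \<in> set (selections xs)" "ys = z # us" "us \<in> set (arrangements n zs)"
    by auto
  then show ?case using Suc.IH[of zs us] selections_mset[OF *(1)] selections_length[OF *(1)] Suc.prems by simp
qed auto

lemma length_arrangements: "length xs = n \<Longrightarrow> length (arrangements n xs) = fact n"
proof (induction n arbitrary: xs)
  case (Suc n)
  have "length (arrangements n ys) = fact n" if "(y, ys) \<in> set (selections xs)" for y ys
    using Suc.IH[of ys] selections_length[OF that] Suc.prems by simp
  then have "sum_list (map (length \<circ> (\<lambda>(y, ys). map ((#) y) (arrangements n ys))) (selections xs))
     = sum_list (map (\<lambda>_. fact n) (selections xs))"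
    by (intro arg_cong[where f = sum_list] map_cong refl) auto
  then show ?case using Suc.prems
    by (simp add: length_concat length_selections sum_list_triv)
qed auto

text \<open>One term of the permanent of the matrix with entries \<open>w p\<close>, for lists of
  equal length.\<close>

definition eval_prod :: "('s,'x) monoid_scheme \<Rightarrow> ('p \<Rightarrow> 's) list \<Rightarrow> 'p list \<Rightarrow> 's" where
  "eval_prod S ws ps = foldr (\<otimes>\<^bsub>S\<^esub>) (map2 (\<lambda>w p. w p) ws ps) \<one>\<^bsub>S\<^esub>"

lemma eval_prod_simps:
  "eval_prod S [] ps = \<one>\<^bsub>S\<^esub>"
  "eval_prod S (w # ws) (p # ps) = w p \<otimes>\<^bsub>S\<^esub> eval_prod S ws ps"
  by (simp_all add: eval_prod_def)

context cocomm_bialgebra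
begin

lemma counit_mult: "a \<in> carrier A \<Longrightarrow> b \<in> carrier A \<Longrightarrow> \<epsilon> (a \<otimes>\<^bsub>A\<^esub> b) = \<epsilon> a \<otimes>\<^bsub>K\<^esub> \<epsilon> b"
  using bialgebra unfolding cocommutative_bialgebra_def Let_def by (elim conjE) blast

definition A_prod :: "'a list \<Rightarrow> 'a" where
  "A_prod ps = foldr (\<otimes>\<^bsub>A\<^esub>) ps \<one>\<^bsub>A\<^esub>"

lemma A_prod_simps: "A_prod [] = \<one>\<^bsub>A\<^esub>" "A_prod (p # ps) = p \<otimes>\<^bsub>A\<^esub> A_prod ps"
  by (simp_all add: A_prod_def)

lemma A_prod_closed: "set ps \<subseteq> carrier A \<Longrightarrow> A_prod ps \<in> carrier A"
  by (induction ps) (auto simp: A_prod_simps)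

text \<open>Primitivity of \<open>p\<close> tested through \<open>S\<close>-valued functionals
  instead of a formula for \<open>\<Delta> p\<close>; \<open>prim_conv\<close> recovers the effect
  of \<open>p \<otimes> 1 + 1 \<otimes> p\<close>. The condition on the counit excludes the nonzero
  multiples of the unit.\<close>

definition prim :: "('k,'s) module \<Rightarrow> 'a \<Rightarrow> bool" where
  "prim S p \<longleftrightarrow> p \<in> carrier A \<and> \<epsilon> p = \<zero>\<^bsub>K\<^esub> \<and>
     (\<forall>v\<in>aug_ideal K A S. \<forall>w\<in>aug_ideal K A S. conv K A S v w p = \<zero>\<^bsub>S\<^esub>)"

context
  fixes S :: "('k,'s) module"
  assumes S: "algebra K S"
begin

interpretation S: algebra K S by (rule S)
interpretation HS: module S "H S" by (rule module_hom_module[OF A_module S])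

lemma aug_ideal_iff: "w \<in> aug_ideal K A S \<longleftrightarrow> w \<in> carrier (H S) \<and> w \<one>\<^bsub>A\<^esub> = \<zero>\<^bsub>S\<^esub>"
  using S by (auto simp: aug_ideal_def unit_morphism_def)

lemma aug_ideal_subset: "aug_ideal K A S \<subseteq> carrier (H S)"
  by (auto simp: aug_ideal_iff)

lemma aug_ideal_conv:
  assumes "w \<in> aug_ideal K A S" "v \<in> carrier (H S)"
  shows "conv K A S w v \<in> aug_ideal K A S"
  using assms by (simp add: aug_ideal_iff conv_closed[OF S] conv_at_one[OF S] H_app_closed[OF S])

lemma evaluation_linear:
  assumes "a \<in> carrier A" shows "linear_map S (H S) (regular_module S) (\<lambda>w. w a)"
  by (rule linear_mapI)
    (simp_all add: regular_module_def hom_module_app assms H_app_closed[OF S])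

lemma module_regular: "module S (regular_module S)"
proof -
  have "abelian_group (regular_module S)"
    by (rule abelian_groupI)
      (auto simp: regular_module_def S.a_ac intro!: bexI[of _ "\<ominus>\<^bsub>S\<^esub> _"] S.l_neg)
  then show ?thesis
    by (intro moduleI S.M_cring) (auto simp: regular_module_def S.l_distr S.r_distr S.m_assoc)
qed

text \<open>The projection of the convolution algebra onto the augmentation ideal along the
  multiples of its unit.\<close>

definition aug_part :: "('a \<Rightarrow> 's) \<Rightarrow> 'a \<Rightarrow> 's" where
  "aug_part w = w \<ominus>\<^bsub>H S\<^esub> (w \<one>\<^bsub>A\<^esub> \<odot>\<^bsub>H S\<^esub> conv_unit A S)"

lemma H_minus_app:
  assumes "v \<in> carrier (H S)" "w \<in> carrier (H S)" "a \<in> carrier A"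
  shows "(v \<ominus>\<^bsub>H S\<^esub> w) a = v a \<ominus>\<^bsub>S\<^esub> w a"
  using linear_map_minus[OF HS.module_axioms module_regular evaluation_linear[OF assms(3)] assms(1,2)]
  by (simp add: a_minus_def a_inv_def regular_module_def m_inv_def)

lemma aug_part_closed: "w \<in> carrier (H S) \<Longrightarrow> aug_part w \<in> carrier (H S)"
  unfolding aug_part_def
  by (intro HS.M.minus_closed HS.smult_closed conv_unit_closed[OF S] H_app_closed[OF S]) auto

lemma aug_part_app:
  assumes "w \<in> carrier (H S)" "a \<in> carrier A"
  shows "aug_part w a = w a \<ominus>\<^bsub>S\<^esub> (w \<one>\<^bsub>A\<^esub> \<otimes>\<^bsub>S\<^esub> conv_unit A S a)"
proof -
  have "w \<one>\<^bsub>A\<^esub> \<odot>\<^bsub>H S\<^esub> conv_unit A S \<in> carrier (H S)"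
    by (intro HS.smult_closed conv_unit_closed[OF S] H_app_closed[OF S] assms) auto
  then show ?thesis unfolding aug_part_def
    using assms by (simp add: H_minus_app hom_module_app)
qed

lemma aug_part_aug_ideal:
  assumes "w \<in> carrier (H S)" shows "aug_part w \<in> aug_ideal K A S"
proof -
  have "w \<one>\<^bsub>A\<^esub> \<in> carrier S" by (rule H_app_closed[OF S assms]) simp
  then have "aug_part w \<one>\<^bsub>A\<^esub> = \<zero>\<^bsub>S\<^esub>"
    using assms by (simp add: aug_part_app conv_unit_at_one[OF S]) (simp add: a_minus_def S.r_neg)
  then show ?thesis by (simp add: aug_ideal_iff aug_part_closed[OF assms])
qed

lemma aug_decomp:
  assumes "w \<in> carrier (H S)"
  shows "w = (w \<one>\<^bsub>A\<^esub> \<odot>\<^bsub>H S\<^esub> conv_unit A S) \<oplus>\<^bsub>H S\<^esub> aug_part w"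
proof -
  have "w \<one>\<^bsub>A\<^esub> \<odot>\<^bsub>H S\<^esub> conv_unit A S \<in> carrier (H S)"
    by (intro HS.smult_closed conv_unit_closed[OF S] H_app_closed[OF S] assms) auto
  then show ?thesis unfolding aug_part_def
    using assms by (simp add: a_minus_def HS.M.a_lcomm[of _ w] HS.M.r_neg)
qed

text \<open>Both factors split into a multiple of the unit and an augmentation part. The product of
  the constants vanishes at \<open>p\<close> because the counit does, the product of the
  augmentation parts because \<open>p\<close> is primitive, and the mixed terms give the
  formula.\<close>

lemma prim_conv:
  assumes p: "prim S p" and v: "v \<in> carrier (H S)" and w: "w \<in> carrier (H S)"
  shows "conv K A S v w p = (v p \<otimes>\<^bsub>S\<^esub> w \<one>\<^bsub>A\<^esub>) \<oplus>\<^bsub>S\<^esub> (v \<one>\<^bsub>A\<^esub> \<otimes>\<^bsub>S\<^esub> w p)"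
proof -
  let ?u = "conv_unit A S"
  have pA: "p \<in> carrier A" and up: "?u p = \<zero>\<^bsub>S\<^esub>"
    using p by (auto simp: prim_def conv_unit_app[OF S])
  let ?v = "aug_part v" and ?w = "aug_part w"
  have cl: "?u \<in> carrier (H S)" "?v \<in> carrier (H S)" "?w \<in> carrier (H S)"
      "v \<one>\<^bsub>A\<^esub> \<in> carrier S" "w \<one>\<^bsub>A\<^esub> \<in> carrier S" "v p \<in> carrier S" "w p \<in> carrier S"
    using v w pA H_app_closed[OF S v] H_app_closed[OF S w]
    by (auto simp: conv_unit_closed[OF S] aug_part_closed)
  note cc = cl conv_closed[OF S] HS.smult_closed HS.M.a_closed
  have vp: "?v p = v p" "?w p = w p"
    using cl pA v w by (simp_all add: aug_part_app up) (simp_all add: a_minus_def)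
  have "conv K A S v w p =
    conv K A S ((v \<one>\<^bsub>A\<^esub> \<odot>\<^bsub>H S\<^esub> ?u) \<oplus>\<^bsub>H S\<^esub> ?v) ((w \<one>\<^bsub>A\<^esub> \<odot>\<^bsub>H S\<^esub> ?u) \<oplus>\<^bsub>H S\<^esub> ?w) p"
    using aug_decomp[OF v] aug_decomp[OF w] by simp
  also have "\<dots> = (conv K A S (v \<one>\<^bsub>A\<^esub> \<odot>\<^bsub>H S\<^esub> ?u) (w \<one>\<^bsub>A\<^esub> \<odot>\<^bsub>H S\<^esub> ?u) p
     \<oplus>\<^bsub>S\<^esub> conv K A S ?v (w \<one>\<^bsub>A\<^esub> \<odot>\<^bsub>H S\<^esub> ?u) p)
     \<oplus>\<^bsub>S\<^esub> (conv K A S (v \<one>\<^bsub>A\<^esub> \<odot>\<^bsub>H S\<^esub> ?u) ?w p \<oplus>\<^bsub>S\<^esub> conv K A S ?v ?w p)"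
    using cc by (simp add: conv_add_left[OF S] conv_add_right[OF S] hom_module_app pA)
  also have "conv K A S (v \<one>\<^bsub>A\<^esub> \<odot>\<^bsub>H S\<^esub> ?u) (w \<one>\<^bsub>A\<^esub> \<odot>\<^bsub>H S\<^esub> ?u) p = \<zero>\<^bsub>S\<^esub>"
    using cc by (simp add: conv_smult_left[OF S] conv_smult_right[OF S] conv_unit_left[OF S] hom_module_app pA up)
  also have "conv K A S (v \<one>\<^bsub>A\<^esub> \<odot>\<^bsub>H S\<^esub> ?u) ?w p = v \<one>\<^bsub>A\<^esub> \<otimes>\<^bsub>S\<^esub> w p"
    using cc by (simp add: conv_smult_left[OF S] conv_unit_left[OF S] hom_module_app pA vp)
  also have "conv K A S ?v (w \<one>\<^bsub>A\<^esub> \<odot>\<^bsub>H S\<^esub> ?u) p = w \<one>\<^bsub>A\<^esub> \<otimes>\<^bsub>S\<^esub> v p"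
    using cc by (simp add: conv_comm[OF S, of ?v] conv_smult_left[OF S] conv_unit_left[OF S] hom_module_app pA vp)
  also have "conv K A S ?v ?w p = \<zero>\<^bsub>S\<^esub>"
    using p aug_part_aug_ideal[OF v] aug_part_aug_ideal[OF w] by (auto simp: prim_def)
  finally show ?thesis using cl by (simp add: S.m_comm S.a_comm)
qed

definition lmul :: "'a \<Rightarrow> ('a \<Rightarrow> 's) \<Rightarrow> 'a \<Rightarrow> 's" where
  "lmul p w = (\<lambda>a\<in>carrier A. w (p \<otimes>\<^bsub>A\<^esub> a))"

lemma lmul_closed: "p \<in> carrier A \<Longrightarrow> w \<in> carrier (H S) \<Longrightarrow> lmul p w \<in> carrier (H S)"
  unfolding lmul_def
  by (intro hom_module_restrict[OF A_module] linear_mult_A(1) hom_module_linear)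

text \<open>The Leibniz rule. Since \<open>\<Delta>\<close> is multiplicative, the value of a
  convolution at the product of \<open>p\<close> and \<open>a\<close> is a double lift over
  \<open>\<Delta> p\<close> and \<open>\<Delta> a\<close>. With the lift over
  \<open>\<Delta> p\<close> inside, it is a convolution of right translates of \<open>v\<close> and
  \<open>w\<close> at \<open>p\<close>, which \<open>prim_conv\<close> evaluates.\<close>

lemma lmul_conv:
  assumes p: "prim S p" and v: "v \<in> carrier (H S)" and w: "w \<in> carrier (H S)"
  shows "lmul p (conv K A S v w) = conv K A S (lmul p v) w \<oplus>\<^bsub>H S\<^esub> conv K A S v (lmul p w)"
proof -
  have pA: "p \<in> carrier A" using p by (auto simp: prim_def)
  note lv = lmul_closed[OF pA v] and lw = lmul_closed[OF pA w]
  note MA = A_module A_module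
  have sh: "(\<lambda>x\<in>carrier A. v (x \<otimes>\<^bsub>A\<^esub> u)) \<in> carrier (H S)" if "u \<in> carrier A" "v \<in> carrier (H S)" for u v
    using that by (intro hom_module_restrict[OF A_module] linear_mult_A(2) hom_module_linear)
  have vl: "linear_map K A S v" "linear_map K A S w" using v w by (auto intro: hom_module_linear)
  show ?thesis
  proof (rule hom_module_eqI[OF lmul_closed[OF pA conv_closed[OF S v w]]
        HS.M.a_closed[OF conv_closed[OF S lv w] conv_closed[OF S v lw]]])
    fix a assume a: "a \<in> carrier A"
    let ?L = "tensor_lift K S (\<lambda>x y. v x \<otimes>\<^bsub>S\<^esub> w y)"
    note L = tensor_lift_linear[OF MA S.module conv_bilinear[OF S v w]]
    note bA = pure_tensor_bilinear[OF MA]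
    have lmA: "linear_map K A AA (\<lambda>x. f (x \<otimes>\<^bsub>A\<^esub> u))" "linear_map K A AA (\<lambda>x. f (u \<otimes>\<^bsub>A\<^esub> x))"
      if "linear_map K A AA f" "u \<in> carrier A" for f u
      using linear_mult_A[OF that] by auto
    have b1: "bilinear K A A AA (\<lambda>u v. t (x \<otimes>\<^bsub>A\<^esub> u) (y \<otimes>\<^bsub>A\<^esub> v))" if "x \<in> carrier A" "y \<in> carrier A" for x y
      apply (rule bilinearI)
      subgoal using that by (intro linear_mult_A(1)[of AA "\<lambda>x. t x _"] bilinearD(1)[OF bA] Ar.m_closed)
      subgoal using that by (intro linear_mult_A(1)[of AA "\<lambda>y. t _ y"] bilinearD(2)[OF bA] Ar.m_closed)
      done
    have b2: "bilinear K A A AA (\<lambda>x y. t (x \<otimes>\<^bsub>A\<^esub> u) (y \<otimes>\<^bsub>A\<^esub> v))" if "u \<in> carrier A" "v \<in> carrier A" for u v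
      apply (rule bilinearI)
      subgoal using that by (intro linear_mult_A(2)[of AA "\<lambda>x. t x _"] bilinearD(1)[OF bA] Ar.m_closed)
      subgoal using that by (intro linear_mult_A(2)[of AA "\<lambda>y. t _ y"] bilinearD(2)[OF bA] Ar.m_closed)
      done
    have b3: "bilinear K A A AA (\<lambda>x y. tensor_lift K AA (\<lambda>u v. t (x \<otimes>\<^bsub>A\<^esub> u) (y \<otimes>\<^bsub>A\<^esub> v)) (\<Delta> a))"
      by (intro bilinearI tensor_lift_param_linear[OF MA AA_module A_module _ _ comult_closed[OF a]] b1)
        (auto intro: bilinearD(1)[OF b2] bilinearD(2)[OF b2])
    let ?q = "\<lambda>x y u z. v (x \<otimes>\<^bsub>A\<^esub> u) \<otimes>\<^bsub>S\<^esub> w (y \<otimes>\<^bsub>A\<^esub> z)"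
    have q1: "bilinear K A A S (\<lambda>u z. ?q x y u z)" if "x \<in> carrier A" "y \<in> carrier A" for x y
      using that by (intro bilinear_mult[OF S] linear_mult_A(1) vl)
    have q2: "bilinear K A A S (\<lambda>x y. ?q x y u z)" if "u \<in> carrier A" "z \<in> carrier A" for u z
      using that by (intro bilinear_mult[OF S] linear_mult_A(2) vl)
    have "lmul p (conv K A S v w) a = ?L (\<Delta> (p \<otimes>\<^bsub>A\<^esub> a))"
      using a pA by (simp add: lmul_def conv_app[OF S])
    also have "\<dots> = ?L (tensor_lift K AA
           (\<lambda>x y. tensor_lift K AA (\<lambda>u v. t (x \<otimes>\<^bsub>A\<^esub> u) (y \<otimes>\<^bsub>A\<^esub> v)) (\<Delta> a)) (\<Delta> p))"
      by (simp add: comult_mult[OF pA a])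
    also have "\<dots> = tensor_lift K S (\<lambda>x y. ?L (tensor_lift K AA (\<lambda>u v. t (x \<otimes>\<^bsub>A\<^esub> u) (y \<otimes>\<^bsub>A\<^esub> v)) (\<Delta> a))) (\<Delta> p)"
      by (rule linear_tensor_lift[OF MA AA_module S.module b3 L comult_closed[OF pA]])
    also have "\<dots> = tensor_lift K S (\<lambda>x y. tensor_lift K S (?q x y) (\<Delta> a)) (\<Delta> p)"
    proof (rule tensor_lift_cong[OF MA S.module _ _ comult_closed[OF pA]])
      show "bilinear K A A S (\<lambda>x y. tensor_lift K S (?q x y) (\<Delta> a))"
        by (intro bilinearI tensor_lift_param_linear[OF MA S.module A_module _ _ comult_closed[OF a]] q1)
          (auto intro: bilinearD(1)[OF q2] bilinearD(2)[OF q2])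
      fix x y assume xy: "x \<in> carrier A" "y \<in> carrier A"
      have "?L (tensor_lift K AA (\<lambda>u v. t (x \<otimes>\<^bsub>A\<^esub> u) (y \<otimes>\<^bsub>A\<^esub> v)) (\<Delta> a))
        = tensor_lift K S (\<lambda>u v. ?L (t (x \<otimes>\<^bsub>A\<^esub> u) (y \<otimes>\<^bsub>A\<^esub> v))) (\<Delta> a)"
        by (rule linear_tensor_lift[OF MA AA_module S.module b1[OF xy] L comult_closed[OF a]])
      also have "\<dots> = tensor_lift K S (?q x y) (\<Delta> a)"
        by (rule tensor_lift_cong[OF MA S.module q1[OF xy] _ comult_closed[OF a]])
          (use xy in \<open>simp add: tensor_lift_pure[OF MA S.module conv_bilinear[OF S v w]]\<close>)
      finally show "?L (tensor_lift K AA (\<lambda>u v. t (x \<otimes>\<^bsub>A\<^esub> u) (y \<otimes>\<^bsub>A\<^esub> v)) (\<Delta> a)) = tensor_lift K S (?q x y) (\<Delta> a)" .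
    qed
    also have "\<dots> = tensor_lift K S (\<lambda>u z. tensor_lift K S (\<lambda>x y. ?q x y u z) (\<Delta> p)) (\<Delta> a)"
      by (rule tensor_lift_swap[OF MA MA S.module q2 q1 comult_closed[OF pA] comult_closed[OF a]])
    also have "\<dots> = tensor_lift K S (\<lambda>u z. (lmul p v u \<otimes>\<^bsub>S\<^esub> w z) \<oplus>\<^bsub>S\<^esub> (v u \<otimes>\<^bsub>S\<^esub> lmul p w z)) (\<Delta> a)"
    proof (rule tensor_lift_cong[OF MA S.module bilinear_add[OF S.module conv_bilinear[OF S lv w] conv_bilinear[OF S v lw]] _ comult_closed[OF a]])
      fix u z assume uz: "u \<in> carrier A" "z \<in> carrier A"
      let ?v = "\<lambda>x\<in>carrier A. v (x \<otimes>\<^bsub>A\<^esub> u)" and ?w = "\<lambda>x\<in>carrier A. w (x \<otimes>\<^bsub>A\<^esub> z)"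
      have "tensor_lift K S (\<lambda>x y. ?q x y u z) (\<Delta> p) = conv K A S ?v ?w p"
        unfolding conv_app[OF S pA]
        by (rule tensor_lift_cong[OF MA S.module conv_bilinear[OF S sh[OF uz(1) v] sh[OF uz(2) w]] _ comult_closed[OF pA]])
          simp
      also have "\<dots> = (v (p \<otimes>\<^bsub>A\<^esub> u) \<otimes>\<^bsub>S\<^esub> w z) \<oplus>\<^bsub>S\<^esub> (v u \<otimes>\<^bsub>S\<^esub> w (p \<otimes>\<^bsub>A\<^esub> z))"
        using prim_conv[OF p sh[OF uz(1) v] sh[OF uz(2) w]] pA uz by simp
      finally show "tensor_lift K S (\<lambda>x y. ?q x y u z) (\<Delta> p) = (lmul p v u \<otimes>\<^bsub>S\<^esub> w z) \<oplus>\<^bsub>S\<^esub> (v u \<otimes>\<^bsub>S\<^esub> lmul p w z)"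
        using uz by (simp add: lmul_def)
    qed
    also have "\<dots> = (conv K A S (lmul p v) w \<oplus>\<^bsub>H S\<^esub> conv K A S v (lmul p w)) a"
      unfolding hom_module_app(1)[OF a] conv_app[OF S a]
      by (rule tensor_lift_add[OF MA S.module conv_bilinear[OF S lv w] conv_bilinear[OF S v lw] comult_closed[OF a]])
    finally show "lmul p (conv K A S v w) a = (conv K A S (lmul p v) w \<oplus>\<^bsub>H S\<^esub> conv K A S v (lmul p w)) a" .
  qed
qed

lemma lmul_conv_prod:
  assumes p: "prim S p" and "set ws \<subseteq> carrier (H S)"
  shows "lmul p (conv_prod K A S ws)
    = lsum (H S) (map (\<lambda>(w, us). conv K A S (lmul p w) (conv_prod K A S us)) (selections ws))"
  using assms(2)
proof (induction ws)
  \<comment> \<open>A primitive element kills the convolution unit: the counit is multiplicative and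
    vanishes at \<open>p\<close>.\<close>
  case Nil
  have pA: "p \<in> carrier A" and "\<epsilon> p = \<zero>\<^bsub>K\<^esub>" using p by (auto simp: prim_def)
  then have "lmul p (conv_unit A S) = \<zero>\<^bsub>H S\<^esub>"
    by (auto simp: lmul_def hom_module_simps conv_unit_app[OF S] counit_mult counit_closed fun_eq_iff restrict_def)
  then show ?case by (simp add: conv_prod_Nil[OF S] lsum_simps)
next
  case (Cons x xs)
  have pA: "p \<in> carrier A" using p by (auto simp: prim_def)
  have x: "x \<in> carrier (H S)" and xs: "set xs \<subseteq> carrier (H S)" using Cons.prems by auto
  let ?f = "\<lambda>(w, us). conv K A S (lmul p w) (conv_prod K A S us)"
  have sel: "y \<in> carrier (H S)" "set ys \<subseteq> carrier (H S)" if "(y, ys) \<in> set (selections xs)" for y ys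
    using selections_set[OF that] xs by auto
  have fcl: "set (map ?f (selections xs)) \<subseteq> carrier (H S)"
    by (clarsimp simp del: subset_iff) (intro conv_closed[OF S] lmul_closed[OF pA] conv_prod_closed[OF S]; rule sel; assumption)
  have lin: "linear_map S (H S) (H S) (conv K A S x)"
    by (rule linear_mapI) (simp_all add: conv_closed[OF S] conv_add_right[OF S] conv_smult_right[OF S] x)
  have "lmul p (conv_prod K A S (x # xs)) = conv K A S (lmul p x) (conv_prod K A S xs)
      \<oplus>\<^bsub>H S\<^esub> conv K A S x (lsum (H S) (map ?f (selections xs)))"
    using lmul_conv[OF p x conv_prod_closed[OF S xs]] Cons.IH[OF xs] by (simp add: conv_prod_Cons[OF S])
  also have "conv K A S x (lsum (H S) (map ?f (selections xs)))
     = lsum (H S) (map (\<lambda>z. conv K A S x (?f z)) (selections xs))"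
    using linear_map_lsum[OF HS.module_axioms HS.module_axioms lin fcl] by (simp add: o_def)
  also have "map (\<lambda>z. conv K A S x (?f z)) (selections xs) = map (?f \<circ> (\<lambda>(y, ys). (y, x # ys))) (selections xs)"
    by (intro map_cong refl; clarsimp simp: conv_prod_Cons[OF S] simp del: subset_iff)
      (intro conv_lcomm[OF S] x lmul_closed[OF pA] conv_prod_closed[OF S]; rule sel; assumption)
  finally show ?case by (simp add: lsum_simps)
qed

text \<open>The Leibniz rule replaces one factor \<open>w\<close> by \<open>lmul p w\<close>, whose
  value at the unit of \<open>A\<close> is \<open>w p\<close>. Its constant part gives the stated
  term; its augmentation part gives a product of \<open>length ws\<close> elements of the
  augmentation ideal, which \<open>van\<close> kills at \<open>a\<close>.\<close>

lemma conv_prod_at_prim_step: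
  assumes p: "prim S p" and ws: "set ws \<subseteq> aug_ideal K A S" and a: "a \<in> carrier A"
    and van: "\<And>us. length us = length ws \<Longrightarrow> set us \<subseteq> aug_ideal K A S \<Longrightarrow> conv_prod K A S us a = \<zero>\<^bsub>S\<^esub>"
  shows "conv_prod K A S ws (p \<otimes>\<^bsub>A\<^esub> a)
    = lsum S (map (\<lambda>(w, us). w p \<otimes>\<^bsub>S\<^esub> conv_prod K A S us a) (selections ws))"
proof -
  have pA: "p \<in> carrier A" using p by (auto simp: prim_def)
  have wsH: "set ws \<subseteq> carrier (H S)" using ws by (auto simp: aug_ideal_iff)
  let ?f = "\<lambda>(w, us). conv K A S (lmul p w) (conv_prod K A S us)"
  have sel: "w \<in> carrier (H S)" "set us \<subseteq> carrier (H S)" "set us \<subseteq> aug_ideal K A S" "length ws = Suc (length us)"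
    if "(w, us) \<in> set (selections ws)" for w us
    using selections_set[OF that] ws wsH selections_length[OF that] by auto
  have fcl: "set (map ?f (selections ws)) \<subseteq> carrier (H S)"
    by (clarsimp simp del: subset_iff) (intro conv_closed[OF S] lmul_closed[OF pA] conv_prod_closed[OF S]; rule sel; assumption)
  have "conv_prod K A S ws (p \<otimes>\<^bsub>A\<^esub> a) = lmul p (conv_prod K A S ws) a"
    using a by (simp add: lmul_def)
  also have "\<dots> = lsum (H S) (map ?f (selections ws)) a" by (simp add: lmul_conv_prod[OF p wsH])
  also have "\<dots> = lsum S (map (\<lambda>z. ?f z a) (selections ws))"
    using linear_map_lsum[OF HS.module_axioms module_regular evaluation_linear[OF a] fcl]
    by (simp add: o_def lsum_def regular_module_def)
  also have "map (\<lambda>z. ?f z a) (selections ws) = map (\<lambda>(w, us). w p \<otimes>\<^bsub>S\<^esub> conv_prod K A S us a) (selections ws)"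
  proof (rule map_cong[OF refl], clarify)
    fix w us assume z: "(w, us) \<in> set (selections ws)"
    note s = sel[OF z]
    let ?w = "aug_part (lmul p w)"
    note lw = lmul_closed[OF pA s(1)]
    note C = conv_prod_closed[OF S s(2)]
    have wp: "lmul p w \<one>\<^bsub>A\<^esub> = w p" using pA by (simp add: lmul_def)
    have wpS: "w p \<in> carrier S" by (rule H_app_closed[OF S s(1) pA])
    have "conv K A S (lmul p w) (conv_prod K A S us)
      = conv K A S ((w p \<odot>\<^bsub>H S\<^esub> conv_unit A S) \<oplus>\<^bsub>H S\<^esub> ?w) (conv_prod K A S us)"
      using aug_decomp[OF lw] by (simp add: wp)
    also have "\<dots> = (w p \<odot>\<^bsub>H S\<^esub> conv_prod K A S us) \<oplus>\<^bsub>H S\<^esub> conv_prod K A S (?w # us)"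
      using wpS C by (simp add: conv_add_left[OF S] conv_smult_left[OF S] conv_unit_left[OF S]
          conv_unit_closed[OF S] aug_part_closed[OF lw] conv_prod_Cons[OF S])
    finally have "conv K A S (lmul p w) (conv_prod K A S us) a
      = (w p \<otimes>\<^bsub>S\<^esub> conv_prod K A S us a) \<oplus>\<^bsub>S\<^esub> conv_prod K A S (?w # us) a"
      using a by (simp add: hom_module_app)
    also have "conv_prod K A S (?w # us) a = \<zero>\<^bsub>S\<^esub>"
      by (rule van) (use s aug_part_aug_ideal[OF lw] in auto)
    finally show "conv K A S (lmul p w) (conv_prod K A S us) a = w p \<otimes>\<^bsub>S\<^esub> conv_prod K A S us a"
      using wpS H_app_closed[OF S C a] by simp
  qed
  finally show ?thesis .
qed

lemma lsum_zeros: "set xs \<subseteq> {\<zero>\<^bsub>S\<^esub>} \<Longrightarrow> lsum S xs = \<zero>\<^bsub>S\<^esub>"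
  by (induction xs) (auto simp: lsum_simps)

text \<open>Each primitive element absorbs one factor. With more factors than primitive elements a
  factor is left over, and at the unit of \<open>A\<close>, where evaluation is multiplicative, it
  contributes zero.\<close>

lemma conv_prod_vanish:
  assumes "length ps < length ws" "set ws \<subseteq> aug_ideal K A S" "\<forall>p\<in>set ps. prim S p"
  shows "conv_prod K A S ws (A_prod ps) = \<zero>\<^bsub>S\<^esub>"
  using assms
proof (induction ps arbitrary: ws)
  case Nil
  then obtain w us where "ws = w # us" by (cases ws) auto
  moreover from this have "w \<in> aug_ideal K A S" "set us \<subseteq> carrier (H S)"
    using Nil.prems aug_ideal_subset by auto
  moreover from this have "conv_prod K A S us \<in> carrier (H S)" by (intro conv_prod_closed[OF S])
  ultimately show ?case
    by (simp add: conv_prod_Cons[OF S] A_prod_simps conv_at_one[OF S] aug_ideal_iff H_app_closed[OF S])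
next
  case (Cons p ps)
  have psA: "A_prod ps \<in> carrier A" "p \<in> carrier A"
    using Cons.prems by (auto intro!: A_prod_closed simp: prim_def)
  have "conv_prod K A S ws (p \<otimes>\<^bsub>A\<^esub> A_prod ps)
    = lsum S (map (\<lambda>(w, us). w p \<otimes>\<^bsub>S\<^esub> conv_prod K A S us (A_prod ps)) (selections ws))"
    using Cons.prems psA by (intro conv_prod_at_prim_step Cons.IH) auto
  also have "\<dots> = \<zero>\<^bsub>S\<^esub>"
  proof (rule lsum_zeros, clarsimp simp del: subset_iff)
    fix w us assume z: "(w, us) \<in> set (selections ws)"
    have "conv_prod K A S us (A_prod ps) = \<zero>\<^bsub>S\<^esub>"
      using Cons.prems selections_set[OF z] selections_length[OF z] by (intro Cons.IH) auto
    moreover have "w p \<in> carrier S"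
      using Cons.prems selections_set[OF z] psA by (intro H_app_closed[OF S]) (auto simp: aug_ideal_iff)
    ultimately show "w p \<otimes>\<^bsub>S\<^esub> conv_prod K A S us (A_prod ps) = \<zero>\<^bsub>S\<^esub>" by simp
  qed
  finally show ?case by (simp add: A_prod_simps)
qed

lemma eval_prod_closed:
  "set ws \<subseteq> carrier (H S) \<Longrightarrow> set ps \<subseteq> carrier A \<Longrightarrow> eval_prod S ws ps \<in> carrier S"
proof (induction ws arbitrary: ps)
  case (Cons w ws)
  then show ?case
    by (cases ps) (auto simp: eval_prod_simps eval_prod_def[of S "_ # _" "[]"] H_app_closed[OF S])
qed (auto simp: eval_prod_simps)

lemma lsum_concat:
  assumes "\<And>xs. xs \<in> set xss \<Longrightarrow> set xs \<subseteq> carrier S"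
  shows "lsum S (concat xss) = lsum S (map (lsum S) xss)"
  using assms
proof (induction xss)
  case (Cons xs xss)
  then have "set (concat xss) \<subseteq> carrier S" by auto
  then show ?case using Cons by (simp add: lsum_simps S.lsum_append)
qed (auto simp: lsum_simps)

text \<open>Peeling off the first primitive element is the expansion of a permanent along a row. The
  side condition of \<open>conv_prod_at_prim_step\<close> is supplied by
  \<open>conv_prod_vanish\<close>: the remaining \<open>n\<close> primitive elements meet products
  of \<open>n + 1\<close> factors.\<close>

lemma conv_prod_permanent:
  assumes "length ps = n" "length ws = n" "set ws \<subseteq> aug_ideal K A S" "\<forall>p\<in>set ps. prim S p"
  shows "conv_prod K A S ws (A_prod ps) = lsum S (map (\<lambda>vs. eval_prod S vs ps) (arrangements n ws))"
  using assms
proof (induction n arbitrary: ws ps)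
  case 0
  then show ?case
    by (simp add: conv_prod_Nil[OF S] A_prod_simps conv_unit_at_one[OF S] lsum_simps eval_prod_simps)
next
  case (Suc n)
  then obtain p qs where ps: "ps = p # qs" by (cases ps) auto
  have qsA: "A_prod qs \<in> carrier A" "p \<in> carrier A" "set qs \<subseteq> carrier A"
    using Suc.prems ps by (auto intro!: A_prod_closed simp: prim_def)
  have "conv_prod K A S ws (p \<otimes>\<^bsub>A\<^esub> A_prod qs)
    = lsum S (map (\<lambda>(w, us). w p \<otimes>\<^bsub>S\<^esub> conv_prod K A S us (A_prod qs)) (selections ws))"
    using Suc.prems qsA ps by (intro conv_prod_at_prim_step conv_prod_vanish) auto
  also have "\<dots> = lsum S (map (\<lambda>(w, us). lsum S (map (\<lambda>vs. eval_prod S vs ps) (map ((#) w) (arrangements n us)))) (selections ws))"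
  proof (intro arg_cong[where f = "lsum S"] map_cong[OF refl], clarify)
    fix w us assume z: "(w, us) \<in> set (selections ws)"
    have us: "set us \<subseteq> aug_ideal K A S" "length us = n" "w \<in> carrier (H S)"
      using Suc.prems selections_set[OF z] selections_length[OF z] by (auto simp: aug_ideal_iff)
    have wp: "w p \<in> carrier S" by (rule H_app_closed[OF S us(3) qsA(2)])
    have lin: "linear_map S (regular_module S) (regular_module S) ((\<otimes>\<^bsub>S\<^esub>) (w p))"
      using wp by (intro linear_mapI) (auto simp: regular_module_def S.r_distr S.m_lcomm)
    have arr: "set (map (\<lambda>vs. eval_prod S vs qs) (arrangements n us)) \<subseteq> carrier (regular_module S)"
    proof clarsimp
      fix vs assume "vs \<in> set (arrangements n us)"
      then have "set vs = set us" using arrangements_mset[OF us(2)] by (metis set_mset_mset)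
      then show "eval_prod S vs qs \<in> carrier (regular_module S)"
        using subset_trans[OF us(1) aug_ideal_subset] qsA(3) eval_prod_closed[of vs qs]
        by (simp add: regular_module_def)
    qed
    have "w p \<otimes>\<^bsub>S\<^esub> conv_prod K A S us (A_prod qs)
      = w p \<otimes>\<^bsub>S\<^esub> lsum S (map (\<lambda>vs. eval_prod S vs qs) (arrangements n us))"
      using Suc.IH[of qs us] us Suc.prems ps by simp
    also have "\<dots> = lsum S (map ((\<otimes>\<^bsub>S\<^esub>) (w p)) (map (\<lambda>vs. eval_prod S vs qs) (arrangements n us)))"
      using linear_map_lsum[OF module_regular module_regular lin arr]
      by (simp add: lsum_def regular_module_def)
    finally show "w p \<otimes>\<^bsub>S\<^esub> conv_prod K A S us (A_prod qs)
      = lsum S (map (\<lambda>vs. eval_prod S vs ps) (map ((#) w) (arrangements n us)))"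
      by (simp add: o_def ps eval_prod_simps)
  qed
  also have "\<dots> = lsum S (map (\<lambda>vs. eval_prod S vs ps) (arrangements (Suc n) ws))"
  proof -
    have cl: "eval_prod S (w # vs) ps \<in> carrier S" if z: "(w, us) \<in> set (selections ws)" "vs \<in> set (arrangements n us)" for w us vs
    proof -
      have "set vs = set us" using arrangements_mset[of us n vs] that selections_length[OF z(1)] Suc.prems
        by (metis Suc_inject set_mset_mset)
      then show ?thesis using selections_set[OF z(1)] Suc.prems(3) qsA ps
        by (intro eval_prod_closed) (auto simp: aug_ideal_iff)
    qed
    show ?thesis
      by (simp only: arrangements.simps map_concat map_map o_def)
        (subst lsum_concat; (auto simp: cl case_prod_unfold o_def)?)
  qed
  finally show ?case by (simp add: ps A_prod_simps)
qed

end
end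

section \<open>Bases of vector spaces\<close>

definition independent :: "('r,'x) ring_scheme \<Rightarrow> ('r,'m,'y) module_scheme \<Rightarrow> 'm set \<Rightarrow> bool" where
  "independent R M B \<longleftrightarrow> B \<subseteq> carrier M \<and>
    (\<forall>f\<in>carrier (free_module R B). lin_ext R M (\<lambda>b. b) f = \<zero>\<^bsub>M\<^esub> \<longrightarrow> f = (\<lambda>_. \<zero>\<^bsub>R\<^esub>))"

lemma (in cring) free_module_carrier':
  "f \<in> carrier (free_module R X) \<longleftrightarrow>
    (\<forall>i. f i \<in> carrier R) \<and> {i. f i \<noteq> \<zero>} \<subseteq> X \<and> finite {i. f i \<noteq> \<zero>}"
  unfolding free_module_carrier by (auto simp: Pi_def)

text \<open>Independence involves finitely many vectors at a time, so unions of chains of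
  independent sets are independent. A maximal independent set spans: adding a vector
  \<open>x\<close> outside it creates a relation, which can be solved for \<open>x\<close>.\<close>

lemma (in field) basis_extension:
  assumes M: "module R M" and B0: "independent R M B0"
  shows "\<exists>B. B0 \<subseteq> B \<and> independent R M B \<and> lin_ext R M (\<lambda>b. b) ` carrier (free_module R B) = carrier M"
proof -
  interpret M: module R M by fact
  note fc = free_module_carrier'
  let ?e = "lin_ext R M (\<lambda>b. b)"
  let ?A = "{B. B0 \<subseteq> B \<and> independent R M B}"
  have "\<exists>B\<in>?A. \<forall>X\<in>?A. B \<subseteq> X \<longrightarrow> X = B"
  proof (rule subset_Zorn_nonempty)
    show "?A \<noteq> {}" using B0 by blast
    fix C assume C: "C \<noteq> {}" "subset.chain ?A C"
    have CA: "B0 \<subseteq> B" "independent R M B" if "B \<in> C" for B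
      using C(2) that unfolding subset.chain_def by auto
    have "independent R M (\<Union>C)"
      unfolding independent_def
    proof (intro conjI ballI impI)
      show "\<Union>C \<subseteq> carrier M" using CA(2) unfolding independent_def by blast
      fix f assume f: "f \<in> carrier (free_module R (\<Union>C))" "?e f = \<zero>\<^bsub>M\<^esub>"
      have "\<exists>B\<in>C. {i. f i \<noteq> \<zero>} \<subseteq> B"
        using finite_subset_Union_chain[OF _ _ C(1) C(2)] f(1) by (metis fc)
      then obtain B where B: "B \<in> C" "{i. f i \<noteq> \<zero>} \<subseteq> B" by blast
      then have "f \<in> carrier (free_module R B)" using f(1) by (simp add: fc)
      then show "f = (\<lambda>_. \<zero>)" using CA(2)[OF B(1)] f(2) unfolding independent_def by blast
    qed
    then show "\<Union>C \<in> ?A" using C(1) CA(1) by blast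
  qed
  then obtain B where B': "B \<in> ?A" "\<forall>X\<in>?A. B \<subseteq> X \<longrightarrow> X = B" by (rule bexE)
  have B: "B0 \<subseteq> B" "independent R M B" using B'(1) by simp_all
  have max: "X = B" if "independent R M X" "B \<subseteq> X" for X
    using B'(2) that B(1) by (auto simp del: subset_antisym)
  have BM: "B \<subseteq> carrier M" using B(2) by (simp add: independent_def)
  interpret F: module R "free_module R B" by (rule module_free_module)
  have lin: "linear_map R (free_module R B) M ?e"
    using BM by (intro M.lin_ext_linear) auto
  have "x \<in> ?e ` carrier (free_module R B)" if x: "x \<in> carrier M" for x
  proof (cases "x \<in> B")
    case True
    then show ?thesis
      using M.lin_ext_gen[of "\<lambda>b. b" x] x free_gen_closed[OF True] by (metis imageI)
  next
    case False
    have "\<not> independent R M (insert x B)" using max[of "insert x B"] False by blast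
    then obtain f where f: "f \<in> carrier (free_module R (insert x B))" "?e f = \<zero>\<^bsub>M\<^esub>" "f \<noteq> (\<lambda>_. \<zero>)"
      using BM x unfolding independent_def by auto
    have fR: "f i \<in> carrier R" for i using f(1) by (simp add: fc)
    let ?g = "f(x := \<zero>)"
    have "finite {i. ?g i \<noteq> \<zero>}"
      by (rule finite_subset[of _ "{i. f i \<noteq> \<zero>}"]) (use f(1) in \<open>auto simp: fc\<close>)
    then have g: "?g \<in> carrier (free_module R B)"
      using f(1) by (auto simp: fc)
    have egM: "?e ?g \<in> carrier M" using linear_mapD(1)[OF lin g] .
    have fx: "f x \<noteq> \<zero>"
    proof
      assume "f x = \<zero>"
      then have "?g = f" by auto
      then show False using g f B(2) unfolding independent_def by metis
    qed
    have supp: "{i. f i \<noteq> \<zero>} = insert x {i. ?g i \<noteq> \<zero>}" using fx by auto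
    have bM: "i \<in> carrier M" if "?g i \<noteq> \<zero>" for i using M.free_support_subset[OF g] that BM by auto
    have "finsum M (\<lambda>i. f i \<odot>\<^bsub>M\<^esub> i) {i. ?g i \<noteq> \<zero>} = ?e ?g"
      unfolding lin_ext_def using bM fR by (intro M.finsum_cong') (auto split: if_splits)
    moreover have "?e f = (f x \<odot>\<^bsub>M\<^esub> x) \<oplus>\<^bsub>M\<^esub> finsum M (\<lambda>i. f i \<odot>\<^bsub>M\<^esub> i) {i. ?g i \<noteq> \<zero>}"
      unfolding lin_ext_def supp
      using M.free_support_finite[OF g] bM fR x by (intro M.finsum_insert) auto
    ultimately have "(f x \<odot>\<^bsub>M\<^esub> x) \<oplus>\<^bsub>M\<^esub> ?e ?g = \<zero>\<^bsub>M\<^esub>" using f(2) by simp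
    then have *: "f x \<odot>\<^bsub>M\<^esub> x = \<ominus>\<^bsub>M\<^esub> ?e ?g"
      using M.M.minus_equality[of "f x \<odot>\<^bsub>M\<^esub> x" "?e ?g"] egM fR x by simp
    have c: "inv (f x) \<in> carrier R" "inv (f x) \<otimes> f x = \<one>"
      using fx fR by (auto simp: field_Units)
    have "x = inv (f x) \<odot>\<^bsub>M\<^esub> (f x \<odot>\<^bsub>M\<^esub> x)"
      using c fR x by (simp add: M.smult_assoc1[symmetric])
    also have "\<dots> = (\<ominus> (inv (f x))) \<odot>\<^bsub>M\<^esub> ?e ?g"
      unfolding * using c egM by (simp add: M.smult_r_minus M.smult_l_minus)
    also have "\<dots> = ?e ((\<ominus> (inv (f x))) \<odot>\<^bsub>free_module R B\<^esub> ?g)"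
      using c by (intro linear_mapD(3)[OF lin _ g, symmetric]) simp
    finally show ?thesis
      using F.smult_closed[OF _ g, of "\<ominus> (inv (f x))"] c by (metis a_inv_closed imageI)
  qed
  then show ?thesis using B linear_mapD(1)[OF lin] by blast
qed

lemma linear_map_inv_into:
  assumes M: "module R M" and N: "module R N" and f: "linear_map R M N f"
    and inj: "inj_on f (carrier M)" and sur: "f ` carrier M = carrier N"
  shows "linear_map R N M (inv_into (carrier M) f)"
proof (rule linear_mapI)
  interpret M: module R M by fact
  let ?g = "inv_into (carrier M) f"
  have g: "?g y \<in> carrier M" "f (?g y) = y" if "y \<in> carrier N" for y
    using that sur by (auto intro: inv_into_into f_inv_into_f)
  fix y assume y: "y \<in> carrier N"
  show "?g y \<in> carrier M" by (rule g(1)[OF y])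
  show "?g (y \<oplus>\<^bsub>N\<^esub> z) = ?g y \<oplus>\<^bsub>M\<^esub> ?g z" if z: "z \<in> carrier N" for z
  proof -
    have "y \<oplus>\<^bsub>N\<^esub> z = f (?g y \<oplus>\<^bsub>M\<^esub> ?g z)"
      using linear_mapD(2)[OF f g(1)[OF y] g(1)[OF z]] g(2)[OF y] g(2)[OF z] by simp
    then show ?thesis using inj g(1)[OF y] g(1)[OF z] by (simp add: inv_into_f_f)
  qed
  show "?g (r \<odot>\<^bsub>N\<^esub> y) = r \<odot>\<^bsub>M\<^esub> ?g y" if r: "r \<in> carrier R" for r
  proof -
    have "r \<odot>\<^bsub>N\<^esub> y = f (r \<odot>\<^bsub>M\<^esub> ?g y)"
      using linear_mapD(3)[OF f r g(1)[OF y]] g(2)[OF y] by simp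
    then show ?thesis using inj g(1)[OF y] r by (simp add: inv_into_f_f)
  qed
qed

text \<open>The initial set \<open>B0\<close> lets the basis contain prescribed vectors: a basis of
  a subspace in \<open>linear_retraction\<close>, the unit of \<open>A\<close> in
  \<open>coproduct_slices\<close>.\<close>

lemma (in field) coordinates:
  assumes M: "module R M" and B0: "independent R M B0"
  obtains B c where "B0 \<subseteq> B" "B \<subseteq> carrier M" "linear_map R M (free_module R B) c"
    "\<And>x. x \<in> carrier M \<Longrightarrow> lin_ext R M (\<lambda>b. b) (c x) = x"
    "\<And>f. f \<in> carrier (free_module R B) \<Longrightarrow> c (lin_ext R M (\<lambda>b. b) f) = f"
proof -
  interpret M: module R M by fact
  let ?e = "lin_ext R M (\<lambda>b. b)"
  obtain B where B: "B0 \<subseteq> B" "independent R M B" "?e ` carrier (free_module R B) = carrier M"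
    using basis_extension[OF assms] by blast
  have BM: "B \<subseteq> carrier M" using B(2) by (simp add: independent_def)
  interpret F: module R "free_module R B" by (rule module_free_module)
  have lin: "linear_map R (free_module R B) M ?e"
    using BM by (intro M.lin_ext_linear) auto
  have inj: "inj_on ?e (carrier (free_module R B))"
    by (rule linear_map_inj_on[OF F.module_axioms M lin]) (use B(2) in \<open>auto simp: independent_def\<close>)
  let ?c = "inv_into (carrier (free_module R B)) ?e"
  show ?thesis
  proof (rule that[OF B(1) BM linear_map_inv_into[OF F.module_axioms M lin inj B(3)]])
    show "?e (?c x) = x" if "x \<in> carrier M" for x
      using that B(3) by (simp add: f_inv_into_f)
    show "?c (?e f) = f" if "f \<in> carrier (free_module R B)" for f
      using inj that by simp
  qed
qed

lemma (in module) independent_empty: "independent R M {}"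
  by (auto simp: independent_def free_module_carrier)

text \<open>A basis of \<open>V\<close> is extended to one of \<open>M\<close> and the new basis
  vectors are sent to zero. A retraction stands in for a choice of complement.\<close>

lemma (in field) linear_retraction:
  assumes M: "module R M" and V: "submodule V R M"
  obtains \<pi> where "linear_map R M M \<pi>" "\<And>x. x \<in> carrier M \<Longrightarrow> \<pi> x \<in> V" "\<And>x. x \<in> V \<Longrightarrow> \<pi> x = x"
proof -
  interpret M: module R M by fact
  let ?V = "M\<lparr>carrier := V\<rparr>"
  have V': "module R ?V" by (rule submodule.submodule_is_module[OF V M])
  interpret V: module R ?V by (rule V')
  have VM: "V \<subseteq> carrier M" by (rule M.submoduleE(1)[OF V])
  have incl: "linear_map R ?V M (\<lambda>x. x)" using VM by (auto intro!: linear_mapI)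
  let ?e = "lin_ext R M (\<lambda>b. b)"
  obtain B0 c0 where B0: "B0 \<subseteq> V" "linear_map R ?V (free_module R B0) c0"
    "\<And>x. x \<in> V \<Longrightarrow> lin_ext R ?V (\<lambda>b. b) (c0 x) = x"
    "\<And>f. f \<in> carrier (free_module R B0) \<Longrightarrow> c0 (lin_ext R ?V (\<lambda>b. b) f) = f"
    by (rule coordinates[OF V' V.independent_empty]) auto
  have e0: "lin_ext R ?V (\<lambda>b. b) f = ?e f" if f: "f \<in> carrier (free_module R B0)" for f
  proof -
    have "(\<lambda>i. f i \<odot>\<^bsub>M\<^esub> i) \<in> {i. f i \<noteq> \<zero>} \<rightarrow> V"
      using M.free_support_subset[OF f] B0(1) free_module_apply[OF f] M.submoduleE(4)[OF V] by auto
    then show ?thesis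
      using linear_map_finsum[OF V' M incl, of "\<lambda>i. f i \<odot>\<^bsub>M\<^esub> i" "{i. f i \<noteq> \<zero>}"]
      by (simp add: lin_ext_def)
  qed
  have z: "\<zero>\<^bsub>M\<^esub> \<in> V" by (rule submodule_zero[OF V])
  have ind: "independent R M B0"
    unfolding independent_def
  proof (intro conjI ballI impI)
    show "B0 \<subseteq> carrier M" using B0(1) VM by blast
    fix f assume f: "f \<in> carrier (free_module R B0)" "?e f = \<zero>\<^bsub>M\<^esub>"
    interpret F: module R "free_module R B0" by (rule module_free_module)
    have "c0 \<zero>\<^bsub>?V\<^esub> = \<zero>\<^bsub>free_module R B0\<^esub>" by (rule linear_map_zero[OF V' F.module_axioms B0(2)])
    then show "f = (\<lambda>_. \<zero>)" using B0(4)[OF f(1)] e0[OF f(1)] f(2) by simp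
  qed
  obtain B c where B: "B0 \<subseteq> B" "B \<subseteq> carrier M" "linear_map R M (free_module R B) c"
    "\<And>x. x \<in> carrier M \<Longrightarrow> ?e (c x) = x"
    "\<And>f. f \<in> carrier (free_module R B) \<Longrightarrow> c (?e f) = f"
    using coordinates[OF M ind] by metis
  define b where "b i = (if i \<in> B0 then i else \<zero>\<^bsub>M\<^esub>)" for i
  have bV: "b i \<in> V" "b i \<in> carrier M" for i using B0(1) VM z by (auto simp: b_def)
  have lin: "linear_map R M M (\<lambda>x. lin_ext R M b (c x))"
    by (rule linear_map_comp[OF B(3) M.lin_ext_linear]) (use bV in auto)
  show ?thesis
  proof (rule that[OF lin])
    fix x assume "x \<in> carrier M"
    then have cx: "c x \<in> carrier (free_module R B)" by (rule linear_mapD(1)[OF B(3)])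
    show "lin_ext R M b (c x) \<in> V"
      unfolding lin_ext_def using bV M.submoduleE(4)[OF V] free_module_apply[OF cx]
      by (intro submodule_finsum[OF M V]) auto
  next
    fix x assume x: "x \<in> V"
    let ?f = "c0 x"
    have f: "?f \<in> carrier (free_module R B0)" using linear_mapD(1)[OF B0(2)] x by simp
    have f': "?f \<in> carrier (free_module R B)" using f B(1) by (auto simp: free_module_carrier')
    have xf: "?e ?f = x" using B0(3)[OF x] e0[OF f] by simp
    then have "c x = ?f" using B(5)[OF f'] by simp
    moreover have "lin_ext R M b ?f = ?e ?f"
    proof -
      have "i \<in> B0" "i \<in> carrier M" if "c0 x i \<noteq> \<zero>" for i
        using M.free_support_subset[OF f] that B0(1) VM by auto
      then show ?thesis
        unfolding lin_ext_def using free_module_apply[OF f]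
        by (intro M.finsum_cong') (auto simp: b_def)
    qed
    ultimately show "lin_ext R M b (c x) = x" using xf by simp
  qed
qed

section \<open>Polynomial algebras\<close>

text \<open>Here \<open>f\<close> stays fixed and the images of the generators vary linearly.
  \<open>poly_mult\<close> extends its two arguments one after the other, and this yields linearity
  in the second.\<close>

lemma (in module) lin_ext_param_linear:
  assumes Q: "module R Q" and b: "\<And>a. a \<in> X \<Longrightarrow> linear_map R Q M (\<lambda>g. b g a)"
    and f: "f \<in> carrier (free_module R X)"
  shows "linear_map R Q M (\<lambda>g. lin_ext R M (b g) f)"
proof -
  have fX: "a \<in> X" if "f a \<noteq> \<zero>" for a using free_support_subset[OF f] that by auto
  note fR = R.free_module_apply[OF f] and fin = free_support_finite[OF f]
  have cl: "b g a \<in> carrier M" if "g \<in> carrier Q" "f a \<noteq> \<zero>" for g a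
    by (rule linear_mapD(1)[OF b[OF fX[OF that(2)]] that(1)])
  have cl2: "(\<lambda>a. f a \<odot>\<^bsub>M\<^esub> b g a) \<in> {i. f i \<noteq> \<zero>} \<rightarrow> carrier M" if "g \<in> carrier Q" for g
    using cl[OF that] fR by simp
  show ?thesis
    unfolding lin_ext_def
  proof (rule linear_mapI)
    fix g assume g: "g \<in> carrier Q"
    show "finsum M (\<lambda>i. f i \<odot>\<^bsub>M\<^esub> b g i) {i. f i \<noteq> \<zero>} \<in> carrier M"
      by (rule finsum_closed[OF cl2[OF g]])
    show "finsum M (\<lambda>i. f i \<odot>\<^bsub>M\<^esub> b (g \<oplus>\<^bsub>Q\<^esub> h) i) {i. f i \<noteq> \<zero>}
      = finsum M (\<lambda>i. f i \<odot>\<^bsub>M\<^esub> b g i) {i. f i \<noteq> \<zero>} \<oplus>\<^bsub>M\<^esub> finsum M (\<lambda>i. f i \<odot>\<^bsub>M\<^esub> b h i) {i. f i \<noteq> \<zero>}"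
      if h: "h \<in> carrier Q" for h
      unfolding finsum_addf[OF cl2[OF g] cl2[OF h], symmetric]
      using cl[OF g] cl[OF h] fR
      by (intro finsum_cong' refl) (auto simp: linear_mapD(2)[OF b[OF fX] g h] smult_r_distr)
    show "finsum M (\<lambda>i. f i \<odot>\<^bsub>M\<^esub> b (r \<odot>\<^bsub>Q\<^esub> g) i) {i. f i \<noteq> \<zero>}
      = r \<odot>\<^bsub>M\<^esub> finsum M (\<lambda>i. f i \<odot>\<^bsub>M\<^esub> b g i) {i. f i \<noteq> \<zero>}"
      if r: "r \<in> carrier R" for r
      unfolding finsum_smult_ldistr[OF fin r cl2[OF g]]
      using cl[OF g] fR r
      by (intro finsum_cong' refl)
        (auto simp: linear_mapD(3)[OF b[OF fX] r g] smult_assoc1[symmetric] R.m_comm)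
  qed
qed

lemma free_bilinear_unique:
  assumes P: "module R P"
    and b: "bilinear R (free_module R X) (free_module R Y) P b"
    and c: "bilinear R (free_module R X) (free_module R Y) P c"
    and f: "f \<in> carrier (free_module R X)" and g: "g \<in> carrier (free_module R Y)"
    and eq: "\<And>i j. i \<in> X \<Longrightarrow> j \<in> Y \<Longrightarrow> b (free_gen R i) (free_gen R j) = c (free_gen R i) (free_gen R j)"
  shows "b f g = c f g"
proof -
  interpret P: module R P by fact
  show ?thesis
  proof (rule free_linear_unique[OF P bilinearD(1)[OF b g] bilinearD(1)[OF c g] f])
    fix i assume i: "i \<in> X"
    note gi = P.R.free_gen_closed[OF i]
    show "b (free_gen R i) g = c (free_gen R i) g"
      by (rule free_linear_unique[OF P bilinearD(2)[OF b gi] bilinearD(2)[OF c gi] g eq[OF i]])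
  qed
qed

text \<open>Monomials are finite multisets of variables, multiplied by multiset sum; the polynomial
  algebra is the monoid algebra of the free commutative monoid.\<close>

definition poly_mult :: "('k,'x) ring_scheme \<Rightarrow> ('v multiset \<Rightarrow> 'k) \<Rightarrow> ('v multiset \<Rightarrow> 'k) \<Rightarrow> 'v multiset \<Rightarrow> 'k" where
  "poly_mult K f g = lin_ext K (free_module K UNIV)
     (\<lambda>a. lin_ext K (free_module K UNIV) (\<lambda>b. free_gen K (a + b)) g) f"

definition poly_algebra :: "('k,'x) ring_scheme \<Rightarrow> ('k, 'v multiset \<Rightarrow> 'k) module" where
  "poly_algebra K = (free_module K UNIV)\<lparr>mult := poly_mult K, one := free_gen K {#}\<rparr>"

lemma poly_algebra_simps:
  "carrier (poly_algebra K) = carrier (free_module K UNIV)"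
  "x \<oplus>\<^bsub>poly_algebra K\<^esub> y = x \<oplus>\<^bsub>free_module K UNIV\<^esub> y"
  "\<zero>\<^bsub>poly_algebra K\<^esub> = \<zero>\<^bsub>free_module K UNIV\<^esub>"
  "r \<odot>\<^bsub>poly_algebra K\<^esub> x = r \<odot>\<^bsub>free_module K UNIV\<^esub> x"
  "x \<otimes>\<^bsub>poly_algebra K\<^esub> y = poly_mult K x y"
  "\<one>\<^bsub>poly_algebra K\<^esub> = free_gen K {#}"
  by (simp_all add: poly_algebra_def)

context cring
begin

abbreviation (input) "FU \<equiv> free_module R UNIV"

lemma gen_closed: "free_gen R a \<in> carrier FU"
  by (rule free_gen_closed) simp

lemma poly_mult_bilinear: "bilinear R FU FU FU (poly_mult R)"
proof (rule bilinearI)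
  interpret F: module R FU by (rule module_free_module)
  have 1: "linear_map R FU FU (lin_ext R FU (\<lambda>b. free_gen R (a + b)))" for a :: "'v multiset"
    by (rule F.lin_ext_linear) (simp add: gen_closed)
  show "linear_map R FU FU (\<lambda>f. poly_mult R f g)" if "g \<in> carrier FU" for g :: "'v multiset \<Rightarrow> 'a"
    unfolding poly_mult_def
    by (rule F.lin_ext_linear) (use linear_mapD(1)[OF 1 that] in simp)
  show "linear_map R FU FU (\<lambda>g. poly_mult R f g)" if "f \<in> carrier FU" for f :: "'v multiset \<Rightarrow> 'a"
    unfolding poly_mult_def
    by (rule F.lin_ext_param_linear[OF F.module_axioms 1 that])
qed

lemma poly_mult_gen: "poly_mult R (free_gen R a) (free_gen R b) = free_gen R (a + b)"
proof -
  interpret F: module R FU by (rule module_free_module)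
  show ?thesis unfolding poly_mult_def by (simp add: F.lin_ext_gen gen_closed)
qed

lemma poly_mult_closed: "f \<in> carrier FU \<Longrightarrow> g \<in> carrier FU \<Longrightarrow> poly_mult R f g \<in> carrier FU"
  by (rule bilinearD(3)[OF poly_mult_bilinear])

lemma poly_mult_comm:
  assumes "f \<in> carrier FU" "g \<in> carrier FU" shows "poly_mult R f g = poly_mult R g f"
proof (rule free_bilinear_unique[OF module_free_module poly_mult_bilinear _ assms])
  show "bilinear R FU FU FU (\<lambda>f g. poly_mult R g f)"
    by (rule bilinearI) (rule bilinearD(2)[OF poly_mult_bilinear] bilinearD(1)[OF poly_mult_bilinear]; assumption)+
qed (simp add: poly_mult_gen add.commute)

lemma poly_mult_assoc:
  fixes f g h :: "'v multiset \<Rightarrow> 'a"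
  assumes f: "f \<in> carrier FU" and g: "g \<in> carrier FU" and h: "h \<in> carrier FU"
  shows "poly_mult R (poly_mult R f g) h = poly_mult R f (poly_mult R g h)"
proof -
  note B = poly_mult_bilinear
  note D = bilinearD(1)[OF B] bilinearD(2)[OF B]
  show ?thesis
  proof (rule free_bilinear_unique[where b = "\<lambda>f g. poly_mult R (poly_mult R f g) h"
        and c = "\<lambda>f g. poly_mult R f (poly_mult R g h)", OF module_free_module _ _ f g])
    show "bilinear R FU FU FU (\<lambda>f g. poly_mult R (poly_mult R f g) h)"
      by (rule bilinearI; rule linear_map_comp[OF _ D(1)[OF h]]; rule D; assumption)
    show "bilinear R FU FU FU (\<lambda>f g. poly_mult R f (poly_mult R g h))"
    proof (rule bilinearI)
      show "linear_map R FU FU (\<lambda>f. poly_mult R f (poly_mult R g h))" if "g \<in> carrier FU" for g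
        by (rule D(1)[OF poly_mult_closed[OF that h]])
      show "linear_map R FU FU (\<lambda>g. poly_mult R f (poly_mult R g h))" if "f \<in> carrier FU" for f
        by (rule linear_map_comp[OF D(1)[OF h] D(2)[OF that]])
    qed
    fix i j :: "'v multiset"
    show "poly_mult R (poly_mult R (free_gen R i) (free_gen R j)) h
      = poly_mult R (free_gen R i) (poly_mult R (free_gen R j) h)"
      by (rule free_linear_unique[OF module_free_module D(2)
            linear_map_comp[OF D(2) D(2)] h])
        (simp_all add: gen_closed poly_mult_closed poly_mult_gen add.assoc)
  qed
qed

lemma poly_mult_one:
  assumes "f \<in> carrier FU" shows "poly_mult R (free_gen R {#}) f = f"
  by (rule free_linear_unique[OF module_free_module bilinearD(2)[OF poly_mult_bilinear] linear_map_ident assms])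
    (simp_all add: gen_closed poly_mult_gen)

lemma algebra_poly_algebra: "algebra R (poly_algebra R)"
proof -
  let ?P = "poly_algebra R :: ('a, 'v multiset \<Rightarrow> 'a) module"
  interpret F: module R "free_module R (UNIV :: 'v multiset set)" by (rule module_free_module)
  note B = bilinearD[OF poly_mult_bilinear]
  have ab: "abelian_group ?P"
  proof (rule abelian_groupI)
    fix f assume "f \<in> carrier ?P"
    then have "f \<in> carrier (free_module R UNIV)" by (simp only: poly_algebra_simps)
    then have "\<exists>g\<in>carrier (free_module R UNIV). g \<oplus>\<^bsub>free_module R UNIV\<^esub> f = \<zero>\<^bsub>free_module R UNIV\<^esub>"
      using F.M.l_neg F.M.a_inv_closed by blast
    then show "\<exists>g\<in>carrier ?P. g \<oplus>\<^bsub>?P\<^esub> f = \<zero>\<^bsub>?P\<^esub>" by (simp only: poly_algebra_simps)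
  qed (unfold poly_algebra_simps, (rule F.M.a_closed F.M.zero_closed F.M.a_assoc F.M.a_comm F.M.l_zero; assumption?)+)
  have cm: "Group.comm_monoid ?P"
    by (rule comm_monoidI)
      (unfold poly_algebra_simps, (rule poly_mult_closed gen_closed poly_mult_assoc poly_mult_one poly_mult_comm; assumption?)+)
  have cr: "cring ?P"
    by (rule cringI[OF ab cm]) (simp only: poly_algebra_simps linear_mapD(2)[OF B(1)])
  show ?thesis
    by (rule algebraI[OF is_cring cr])
      (simp_all only: poly_algebra_simps F.smult_closed F.smult_l_distr F.smult_r_distr F.smult_assoc1
        F.smult_one linear_mapD(3)[OF B(1)])
qed

end

section \<open>Evaluation of polynomials at a point of an algebra\<close>

definition monomial_value :: "('s,'x) monoid_scheme \<Rightarrow> ('v \<Rightarrow> 's) \<Rightarrow> 'v multiset \<Rightarrow> 's" where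
  "monomial_value S val m = finprod S (\<lambda>v. val v [^]\<^bsub>S\<^esub> count m v) (set_mset m)"

context Group.comm_monoid
begin

lemma monomial_value_closed: "range val \<subseteq> carrier G \<Longrightarrow> monomial_value G val m \<in> carrier G"
  unfolding monomial_value_def by (intro finprod_closed) auto

lemma monomial_value_superset:
  assumes "range val \<subseteq> carrier G" "finite J" "set_mset m \<subseteq> J"
  shows "monomial_value G val m = finprod G (\<lambda>v. val v [^] count m v) J"
  unfolding monomial_value_def
  using assms by (intro finprod_mono_neutral_cong_left) (auto simp: not_in_iff)

lemma monomial_value_add:
  assumes v: "range val \<subseteq> carrier G"
  shows "monomial_value G val (a + b) = monomial_value G val a \<otimes> monomial_value G val b"
proof -
  let ?J = "set_mset a \<union> set_mset b"
  have vc: "val x \<in> carrier G" for x using v by auto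
  have "monomial_value G val (a + b) = finprod G (\<lambda>v. (val v [^] count a v) \<otimes> (val v [^] count b v)) ?J"
    unfolding monomial_value_superset[OF v, of ?J "a + b", simplified]
    using vc by (intro finprod_cong') (auto simp: nat_pow_mult)
  also have "\<dots> = monomial_value G val a \<otimes> monomial_value G val b"
    unfolding monomial_value_superset[OF v, of ?J a, simplified] monomial_value_superset[OF v, of ?J b, simplified]
    using vc by (intro finprod_multf) auto
  finally show ?thesis .
qed

lemma monomial_value_single: "range val \<subseteq> carrier G \<Longrightarrow> monomial_value G val {#x#} = val x"
  unfolding monomial_value_def by (auto simp: range_subsetD)

lemma monomial_value_empty: "monomial_value G val {#} = \<one>"
  unfolding monomial_value_def by simp

lemma monomial_value_mset:
  "range val \<subseteq> carrier G \<Longrightarrow> monomial_value G val (mset xs) = foldr (\<otimes>) (map val xs) \<one>"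
proof (induction xs)
  case (Cons x xs)
  then show ?case
    using monomial_value_add[of val "{#x#}" "mset xs"] by (simp add: monomial_value_single)
qed (simp add: monomial_value_empty)

end

text \<open>The universal property of polynomials. It is stated with \<open>ring_hom\<close> and
  \<open>linear_map\<close> separately because \<open>alg_hom\<close> relates algebras on one and
  the same carrier type, and the polynomial algebra does not yet live in the universe.\<close>

lemma poly_eval_alg_hom:
  fixes S :: "('k,'s) module" and K :: "'k ring"
  assumes S: "algebra K S" and v: "range val \<subseteq> carrier S"
  shows "lin_ext K S (monomial_value S val) \<in> ring_hom (poly_algebra K) S"
    and "linear_map K (poly_algebra K) S (lin_ext K S (monomial_value S val))"
proof -
  interpret S: algebra K S by fact
  let ?F = "free_module K UNIV :: ('k, 'b multiset \<Rightarrow> 'k) module"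
  let ?e = "lin_ext K S (monomial_value S val)"
  note mc = S.monomial_value_closed[OF v]
  have L: "linear_map K ?F S ?e"
    by (rule S.lin_ext_linear) (simp add: mc)
  have g: "?e (free_gen K a) = monomial_value S val a" for a by (rule S.lin_ext_gen) (rule mc)
  note B = bilinearD[OF S.R.poly_mult_bilinear]
  have mult: "?e (poly_mult K f g) = ?e f \<otimes>\<^bsub>S\<^esub> ?e g" if "f \<in> carrier ?F" "g \<in> carrier ?F" for f g
  proof (rule free_bilinear_unique[OF S.module _ bilinear_mult[OF S L L] that])
    show "bilinear K ?F ?F S (\<lambda>f g. ?e (poly_mult K f g))"
      by (rule bilinearI; rule linear_map_comp[OF _ L]; rule B; assumption)
  qed (simp add: S.R.poly_mult_gen g S.monomial_value_add[OF v])
  show "?e \<in> ring_hom (poly_algebra K) S"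
    unfolding poly_algebra_simps
    by (rule ring_hom_memI; simp only: poly_algebra_simps linear_mapD[OF L] mult g S.monomial_value_empty)
  show "linear_map K (poly_algebra K) S ?e"
    using L unfolding linear_map_def poly_algebra_simps .
qed

section \<open>Degrees in a block of variables and scaling\<close>

definition degree_in :: "'i \<Rightarrow> ('i \<times> 'v) multiset \<Rightarrow> nat" where
  "degree_in i m = size (filter_mset (\<lambda>v. fst v = i) m)"

text \<open>The substitution multiplying every variable with first component \<open>i\<close> by
  \<open>c\<close>. It is diagonal on monomials, hence given directly on coefficients.\<close>

definition scale_var :: "('k,'x) ring_scheme \<Rightarrow> 'k \<Rightarrow> 'i \<Rightarrow> (('i \<times> 'v) multiset \<Rightarrow> 'k) \<Rightarrow> ('i \<times> 'v) multiset \<Rightarrow> 'k" where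
  "scale_var K c i f = (\<lambda>m. c [^]\<^bsub>K\<^esub> degree_in i m \<otimes>\<^bsub>K\<^esub> f m)"

context cring
begin

lemma scale_var_linear:
  fixes i :: 'i
  assumes c: "c \<in> carrier R"
  shows "linear_map R FU FU (scale_var R c i :: (('i \<times> 'v) multiset \<Rightarrow> 'a) \<Rightarrow> _)"
proof (rule linear_mapI)
  fix f :: "('i \<times> 'v) multiset \<Rightarrow> 'a" assume f: "f \<in> carrier FU"
  note fR = free_module_apply[OF f]
  show "scale_var R c i f \<in> carrier FU"
    using f c unfolding free_module_carrier' scale_var_def
    by (auto intro: finite_subset[of _ "{i. f i \<noteq> \<zero>}"])
  show "scale_var R c i (r \<odot>\<^bsub>FU\<^esub> f) = r \<odot>\<^bsub>FU\<^esub> scale_var R c i f" if "r \<in> carrier R" for r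
    using that c fR by (auto simp: scale_var_def m_lcomm)
  show "scale_var R c i (f \<oplus>\<^bsub>FU\<^esub> g) = scale_var R c i f \<oplus>\<^bsub>FU\<^esub> scale_var R c i g"
    if "g \<in> carrier FU" for g
    using free_module_apply[OF that] c fR by (auto simp: scale_var_def r_distr)
qed

lemma scale_var_gen:
  assumes c: "c \<in> carrier R"
  shows "scale_var R c i (free_gen R a) = (c [^] degree_in i a) \<odot>\<^bsub>FU\<^esub> free_gen R a"
  using c by (auto simp: scale_var_def free_gen_def)

lemma scale_var_mult:
  fixes f g :: "('i \<times> 'v) multiset \<Rightarrow> 'a"
  assumes c: "c \<in> carrier R" and "f \<in> carrier FU" "g \<in> carrier FU"
  shows "scale_var R c i (poly_mult R f g) = poly_mult R (scale_var R c i f) (scale_var R c i g)"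
proof -
  note B = bilinearD[OF poly_mult_bilinear]
  note L = scale_var_linear[OF c]
  interpret F: module R FU by (rule module_free_module)
  show ?thesis
  proof (rule free_bilinear_unique[where b = "\<lambda>f g. scale_var R c i (poly_mult R f g)"
        and c = "\<lambda>f g. poly_mult R (scale_var R c i f) (scale_var R c i g)", OF module_free_module _ _ assms(2,3)])
    show "bilinear R FU FU FU (\<lambda>f g. scale_var R c i (poly_mult R f g))"
      by (rule bilinearI; rule linear_map_comp[OF _ L]; rule B; assumption)
    show "bilinear R FU FU FU (\<lambda>f g. poly_mult R (scale_var R c i f) (scale_var R c i g))"
    proof (rule bilinearI)
      show "linear_map R FU FU (\<lambda>f. poly_mult R (scale_var R c i f) (scale_var R c i g))" if "g \<in> carrier FU" for g
        by (rule linear_map_comp[OF L B(1)[OF linear_mapD(1)[OF L that]]])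
      show "linear_map R FU FU (\<lambda>g. poly_mult R (scale_var R c i f) (scale_var R c i g))" if "f \<in> carrier FU" for f
        by (rule linear_map_comp[OF L B(2)[OF linear_mapD(1)[OF L that]]])
    qed
    fix a b :: "('i \<times> 'v) multiset"
    have ca: "c [^] degree_in i a \<in> carrier R" "c [^] degree_in i b \<in> carrier R" using c by auto
    have "poly_mult R (scale_var R c i (free_gen R a)) (scale_var R c i (free_gen R b))
      = (c [^] degree_in i a) \<odot>\<^bsub>FU\<^esub> ((c [^] degree_in i b) \<odot>\<^bsub>FU\<^esub> free_gen R (a + b))"
      unfolding scale_var_gen[OF c] linear_mapD(3)[OF B(1)[OF F.smult_closed[OF ca(2) gen_closed]] ca(1) gen_closed]
        linear_mapD(3)[OF B(2)[OF gen_closed] ca(2) gen_closed] poly_mult_gen ..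
    also have "\<dots> = (c [^] degree_in i a \<otimes> c [^] degree_in i b) \<odot>\<^bsub>FU\<^esub> free_gen R (a + b)"
      by (rule F.smult_assoc1[OF ca gen_closed, symmetric])
    also have "\<dots> = scale_var R c i (free_gen R (a + b))"
      unfolding scale_var_gen[OF c] using c by (simp add: nat_pow_mult degree_in_def)
    finally show "scale_var R c i (poly_mult R (free_gen R a) (free_gen R b))
      = poly_mult R (scale_var R c i (free_gen R a)) (scale_var R c i (free_gen R b))"
      by (simp only: poly_mult_gen)
  qed
qed

end

section \<open>Transport of algebras\<close>

text \<open>Moves an algebra into the universe along an injection of its carrier. The quantification
  over algebras in \<open>functor_hom\<close> ranges over records on the type \<open>'s\<close>, so
  naturality can be applied to the generic algebra only after its elements have been moved
  there.\<close>

definition transport :: "('k,'r) module \<Rightarrow> ('r \<Rightarrow> 's) \<Rightarrow> ('k,'s) module" where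
  "transport P e = (let d = inv_into (carrier P) e in
     \<lparr>carrier = e ` carrier P, mult = (\<lambda>x y. e (d x \<otimes>\<^bsub>P\<^esub> d y)), one = e \<one>\<^bsub>P\<^esub>,
      zero = e \<zero>\<^bsub>P\<^esub>, add = (\<lambda>x y. e (d x \<oplus>\<^bsub>P\<^esub> d y)), smult = (\<lambda>c x. e (c \<odot>\<^bsub>P\<^esub> d x))\<rparr>)"

context
  fixes K :: "'k ring" and P :: "('k,'r) module" and e :: "'r \<Rightarrow> 's"
  assumes P: "algebra K P" and e: "inj_on e (carrier P)"
begin

interpretation P: algebra K P by (rule P)

lemma transport_simps:
  "carrier (transport P e) = e ` carrier P"
  "x \<in> carrier P \<Longrightarrow> y \<in> carrier P \<Longrightarrow> e x \<otimes>\<^bsub>transport P e\<^esub> e y = e (x \<otimes>\<^bsub>P\<^esub> y)"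
  "x \<in> carrier P \<Longrightarrow> y \<in> carrier P \<Longrightarrow> e x \<oplus>\<^bsub>transport P e\<^esub> e y = e (x \<oplus>\<^bsub>P\<^esub> y)"
  "x \<in> carrier P \<Longrightarrow> c \<odot>\<^bsub>transport P e\<^esub> e x = e (c \<odot>\<^bsub>P\<^esub> x)"
  "\<one>\<^bsub>transport P e\<^esub> = e \<one>\<^bsub>P\<^esub>"
  "\<zero>\<^bsub>transport P e\<^esub> = e \<zero>\<^bsub>P\<^esub>"
  by (simp_all add: transport_def Let_def inv_into_f_f[OF e])

lemma transport_algebra: "algebra K (transport P e)"
proof -
  let ?T = "transport P e"
  note ts = transport_simps
  have ab: "abelian_group ?T"
  proof (rule abelian_groupI)
    fix x assume "x \<in> carrier ?T"
    then obtain a where a: "a \<in> carrier P" "x = e a" by (auto simp: ts)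
    then have "e (\<ominus>\<^bsub>P\<^esub> a) \<oplus>\<^bsub>?T\<^esub> x = \<zero>\<^bsub>?T\<^esub>" by (simp add: ts P.M.l_neg)
    then show "\<exists>y\<in>carrier ?T. y \<oplus>\<^bsub>?T\<^esub> x = \<zero>\<^bsub>?T\<^esub>" using a by (auto simp: ts(1))
  qed (auto simp: ts P.M.a_ac)
  have cm: "Group.comm_monoid ?T"
    by (rule comm_monoidI) (auto simp: ts P.m_ac)
  have cr: "cring ?T"
    by (rule cringI[OF ab cm]) (auto simp: ts P.l_distr)
  show ?thesis
    by (rule algebraI[OF P.R.is_cring cr])
      (auto simp: ts P.smult_l_distr P.smult_r_distr P.smult_assoc1 P.smult_assoc2)
qed

lemma transport_linear: "linear_map K P (transport P e) e"
  by (rule linear_mapI) (simp_all add: transport_simps)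

lemma transport_hom:
  assumes "\<phi> \<in> ring_hom P S" "linear_map K P S \<phi>"
  shows "(\<lambda>x. \<phi> (inv_into (carrier P) e x)) \<in> alg_hom K (transport P e) S"
  using assms inv_into_f_f[OF e]
  by (auto simp: alg_hom_def linear_map_def transport_simps ring_hom_def)

end

section \<open>A Yoneda lemma for multilinear forms on module schemes\<close>

lemma infinite_pairing:
  assumes "infinite (UNIV :: 's set)"
  obtains p :: "'s \<times> 's \<Rightarrow> 's" where "inj p"
proof -
  have "infinite (UNIV :: 's set)" by fact
  from card_of_Times_same_infinite[OF this]
  obtain p where "bij_betw p ((UNIV :: 's set) \<times> (UNIV :: 's set)) (UNIV :: 's set)"
    using card_of_ordIso by blast
  then show ?thesis using that[of p] by (simp add: bij_betw_def)
qed

text \<open>The tags \<open>c 0\<close> and \<open>c 1\<close> keep the code of the empty list apart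
  from all others; the rest is iterated pairing.\<close>

primrec list_code :: "(nat \<Rightarrow> 's) \<Rightarrow> ('s \<times> 's \<Rightarrow> 's) \<Rightarrow> 's list \<Rightarrow> 's" where
  "list_code c p [] = p (c 0, c 0)"
| "list_code c p (x # xs) = p (c 1, p (x, list_code c p xs))"

lemma inj_list_code:
  assumes "inj c" "inj p" shows "inj (list_code c p)"
proof (rule injI)
  fix xs ys assume "list_code c p xs = list_code c p ys"
  then show "xs = ys"
  proof (induction xs arbitrary: ys)
    case Nil
    then show ?case by (cases ys) (auto simp: inj_eq[OF assms(1)] inj_eq[OF assms(2)])
  next
    case (Cons x xs)
    then show ?case by (cases ys) (auto simp: inj_eq[OF assms(1)] inj_eq[OF assms(2)])
  qed
qed

text \<open>\<open>kemb\<close> places the scalars in the universe. The coding of coefficients, the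
  infinitude of \<open>'s\<close> and the copy \<open>Kc\<close> of \<open>K\<close> as an algebra
  in the universe all come from it.\<close>

locale char_zero_field = field K for K :: "'k ring" (structure) +
  fixes kemb :: "'k \<Rightarrow> 's"
  assumes kemb: "inj_on kemb (carrier K)"
    and char_zero: "\<And>k::nat. k > 0 \<Longrightarrow> add_pow K k \<one> \<noteq> \<zero>"
begin

lemma of_nat_inj: "inj (\<lambda>n::nat. add_pow K n \<one>)"
proof -
  have "\<not> m < n" if "add_pow K m \<one> = add_pow K n \<one>" for m n :: nat
  proof
    assume mn: "m < n"
    then have "add_pow K m \<one> \<oplus> add_pow K (n - m) \<one> = add_pow K n \<one>"
      by (simp add: add.nat_pow_mult)
    then have "add_pow K (n - m) \<one> = \<zero>" using that by simp
    then show False using char_zero[of "n - m"] mn by simp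
  qed
  then show ?thesis by (intro injI) (metis linorder_neqE_nat)
qed

lemma nat_code: obtains c :: "nat \<Rightarrow> 's" where "inj c"
proof -
  have "inj (\<lambda>n::nat. kemb (add_pow K n \<one>))"
  proof (rule injI)
    fix m n :: nat assume "kemb (add_pow K m \<one>) = kemb (add_pow K n \<one>)"
    then have "add_pow K m \<one> = add_pow K n \<one>" by (rule inj_onD[OF kemb]) (rule add.nat_pow_closed, simp)+
    then show "m = n" by (rule injD[OF of_nat_inj])
  qed
  then show ?thesis by (rule that)
qed

text \<open>An infinite type contains its own pairs and lists. A polynomial is coded by listing its
  support in a chosen order, each monomial, itself coded as a list of variables, together with its
  coefficient.\<close>

lemma poly_code:
  obtains e :: "((nat \<times> 's) multiset \<Rightarrow> 'k) \<Rightarrow> 's" where "inj_on e (carrier (poly_algebra K))"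
proof -
  obtain c :: "nat \<Rightarrow> 's" where c: "inj c" by (rule nat_code)
  have inf: "infinite (UNIV :: 's set)"
    using c by (metis finite_imageD finite_subset infinite_UNIV_nat subset_UNIV)
  obtain p :: "'s \<times> 's \<Rightarrow> 's" where p: "inj p" by (rule infinite_pairing[OF inf])
  let ?l = "list_code c p"
  have l: "inj ?l" by (rule inj_list_code[OF c p])
  have vi: "inj (\<lambda>(n, s). p (c n, s))"
    by (rule injI) (clarsimp simp: inj_eq[OF c] inj_eq[OF p])
  define em where "em m = ?l (map (\<lambda>(n, s). p (c n, s)) (SOME xs. mset xs = m))" for m :: "(nat \<times> 's) multiset"
  have em: "inj em"
  proof (rule injI)
    fix m m' assume "em m = em m'"
    then have "map (\<lambda>(n, s). p (c n, s)) (SOME xs. mset xs = m) = map (\<lambda>(n, s). p (c n, s)) (SOME xs. mset xs = m')"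
      unfolding em_def by (rule injD[OF l])
    then have "(SOME xs. mset xs = m) = (SOME xs. mset xs = m')" by (rule injD[OF inj_mapI[OF vi]])
    moreover have "mset (SOME xs. mset xs = m) = m" for m :: "(nat \<times> 's) multiset"
      by (rule someI_ex[OF ex_mset])
    ultimately show "m = m'" by metis
  qed
  define xs where "xs f = (SOME xs. set xs = {m. f m \<noteq> \<zero>})" for f :: "(nat \<times> 's) multiset \<Rightarrow> 'k"
  have xs: "set (xs f) = {m. f m \<noteq> \<zero>}" if "f \<in> carrier (poly_algebra K)" for f
    unfolding xs_def by (rule someI_ex[OF finite_list])
      (use that in \<open>simp add: poly_algebra_simps free_module_carrier'\<close>)
  have "inj_on (\<lambda>f. ?l (map (\<lambda>m. p (em m, kemb (f m))) (xs f))) (carrier (poly_algebra K))"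
  proof (rule inj_onI)
    fix f g assume f: "f \<in> carrier (poly_algebra K)" and g: "g \<in> carrier (poly_algebra K)"
      and eq: "?l (map (\<lambda>m. p (em m, kemb (f m))) (xs f)) = ?l (map (\<lambda>m. p (em m, kemb (g m))) (xs g))"
    have fg: "f m \<in> carrier K" "g m \<in> carrier K" for m
      using f g by (auto simp: poly_algebra_simps free_module_carrier')
    \<comment> \<open>It is enough to compare the sets of listed pairs: a pair determines its
      monomial and its coefficient, so equal sets force equal supports and equal
      coefficients.\<close>
    have im: "(\<lambda>m. p (em m, kemb (f m))) ` {m. f m \<noteq> \<zero>} = (\<lambda>m. p (em m, kemb (g m))) ` {m. g m \<noteq> \<zero>}"
    proof -
      have "set (map (\<lambda>m. p (em m, kemb (f m))) (xs f)) = set (map (\<lambda>m. p (em m, kemb (g m))) (xs g))"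
        by (simp only: injD[OF l eq])
      then show ?thesis by (simp only: set_map xs[OF f] xs[OF g])
    qed
    have A: "\<exists>m'. g m' \<noteq> \<zero> \<and> p (em m, kemb (f m)) = p (em m', kemb (g m'))" if "f m \<noteq> \<zero>" for m
      using im that by blast
    have B: "\<exists>m'. f m' \<noteq> \<zero> \<and> p (em m, kemb (g m)) = p (em m', kemb (f m'))" if "g m \<noteq> \<zero>" for m
      using im that by blast
    have pe: "x = y" "m = m'" if "p (em m, kemb x) = p (em m', kemb y)" "x \<in> carrier K" "y \<in> carrier K" for m m' x y
      using that(1) inj_onD[OF kemb _ that(2,3)] by (simp_all add: inj_eq[OF p] inj_eq[OF em])
    show "f = g"
    proof
      fix m
      show "f m = g m"
      proof (cases "f m = \<zero>")
        case False
        then obtain m' where m': "p (em m, kemb (f m)) = p (em m', kemb (g m'))" using A by blast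
        from pe(1)[OF m' fg] pe(2)[OF m' fg] show ?thesis by simp
      next
        case True
        show ?thesis
        proof (rule ccontr)
          assume ne: "f m \<noteq> g m"
          then have "g m \<noteq> \<zero>" using True by simp
          then obtain m' where m': "p (em m, kemb (g m)) = p (em m', kemb (f m'))" using B by blast
          from pe(1)[OF m' fg(2,1)] pe(2)[OF m' fg(2,1)] ne show False by simp
        qed
      qed
    qed
  qed
  then show ?thesis by (rule that)
qed

text \<open>Doubling a block of variables multiplies a monomial of degree \<open>d\<close> in it by
  the d-th power of 2. The natural numbers embed in \<open>K\<close>, so the factor 2 occurs only
  for \<open>d = 1\<close>.\<close>

lemma two_power_eq_two:
  assumes "(\<one> \<oplus> \<one>) [^] (d::nat) \<otimes> q = (\<one> \<oplus> \<one>) \<otimes> q" "q \<in> carrier K" "q \<noteq> \<zero>"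
  shows "d = 1"
proof -
  have p: "(\<one> \<oplus> \<one>) [^] d = add_pow K ((2::nat) ^ d) \<one>"
  proof (induction d)
    case (Suc d)
    then show ?case by (simp add: r_distr add.nat_pow_mult mult_2 mult_2_right)
  qed simp
  have "(\<one> \<oplus> \<one>) [^] d = \<one> \<oplus> \<one>" using assms by (simp add: m_rcancel)
  also have "\<dots> = add_pow K (2::nat) \<one>" by (simp add: numeral_2_eq_2)
  finally have "(2::nat) ^ d = 2" using p injD[OF of_nat_inj] by metis
  then show ?thesis by (metis power_one_right power_inject_exp one_less_numeral_iff semiring_norm(76))
qed

lemma two_power_eq_one:
  assumes "(\<one> \<oplus> \<one>) [^] (d::nat) \<otimes> q = q" "q \<in> carrier K" "q \<noteq> \<zero>"
  shows "d = 0"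
proof -
  \<comment> \<open>Multiplication by 2 turns the claim into the previous lemma for
    \<open>Suc d\<close>.\<close>
  have "(\<one> \<oplus> \<one>) [^] Suc d \<otimes> q = (\<one> \<oplus> \<one>) \<otimes> q"
  proof -
    let ?t = "(\<one> \<oplus> \<one>) [^] d"
    have "(?t \<otimes> (\<one> \<oplus> \<one>)) \<otimes> q = (\<one> \<oplus> \<one>) \<otimes> (?t \<otimes> q)"
      using assms(2) by (simp only: m_comm[of ?t "\<one> \<oplus> \<one>"] m_assoc nat_pow_closed a_closed one_closed)
    then show ?thesis by (simp only: nat_pow_Suc assms(1))
  qed
  then show ?thesis using two_power_eq_two[of "Suc d" q] assms by simp
qed

end

text \<open>Each block below \<open>n\<close> contributes exactly one variable; the one of the last
  block is removed and the argument repeats. Through the function \<open>s\<close> a monomial is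
  read as a pure tensor.\<close>

lemma multidegree_one_multiset:
  fixes m :: "(nat \<times> 'v) multiset"
  assumes "\<And>i. i < n \<Longrightarrow> degree_in i m = 1" "\<And>i. i \<ge> n \<Longrightarrow> degree_in i m = 0"
  shows "\<exists>s. m = mset (map (\<lambda>i. (i, s i)) [0..<n])"
  using assms
proof (induction n arbitrary: m)
  case 0
  have "m = {#}"
  proof (rule ccontr)
    assume "m \<noteq> {#}"
    then obtain v where "v \<in># m" by blast
    then have "v \<in># filter_mset (\<lambda>w. fst w = fst v) m" by simp
    then have "degree_in (fst v) m \<noteq> 0" unfolding degree_in_def by (metis size_eq_0_iff_empty empty_iff set_mset_empty)
    then show False using 0 by simp
  qed
  then show ?case by simp
next
  case (Suc n)
  have "size (filter_mset (\<lambda>v. fst v = n) m) = 1" using Suc.prems(1)[of n] by (simp add: degree_in_def)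
  then obtain v where v: "filter_mset (\<lambda>v. fst v = n) m = {#v#}" using size_1_singleton_mset by blast
  have "v \<in># filter_mset (\<lambda>v. fst v = n) m" by (simp add: v)
  then have fv: "fst v = n" "v \<in># m" by simp_all
  let ?m = "m - {#v#}"
  have m: "m = add_mset v ?m" using fv(2) by simp
  have deg: "degree_in i m = (if i = n then 1 else 0) + degree_in i ?m" for i
    by (subst m) (simp add: degree_in_def fv(1))
  have "\<exists>s. ?m = mset (map (\<lambda>i. (i, s i)) [0..<n])"
  proof (rule Suc.IH)
    show "degree_in i ?m = 1" if "i < n" for i using deg[of i] Suc.prems(1)[of i] that by simp
    show "degree_in i ?m = 0" if "i \<ge> n" for i
      using deg[of i] Suc.prems(1)[of i] Suc.prems(2)[of i] that by (cases "i = n") auto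
  qed
  then obtain s where s: "?m = mset (map (\<lambda>i. (i, s i)) [0..<n])" by blast
  have "map (\<lambda>i. (i, (s(n := snd v)) i)) [0..<n] = map (\<lambda>i. (i, s i)) [0..<n]" by auto
  moreover have upt_Suc_append_mset: "mset (map f [0..<Suc n]) = add_mset (f n) (mset (map f [0..<n]))" for f :: "nat \<Rightarrow> nat \<times> 'v"
    by simp
  ultimately have "mset (map (\<lambda>i. (i, (s(n := snd v)) i)) [0..<Suc n]) = add_mset (n, snd v) ?m"
    unfolding s upt_Suc_append_mset by (simp only: fun_upd_same)
  also have "\<dots> = m" using m fv(1) by (cases v) simp
  finally have "m = mset (map (\<lambda>i. (i, (s(n := snd v)) i)) [0..<Suc n])" ..
  then show ?case by blast
qed

context char_zero_field
begin

text \<open>\<open>\<Theta>\<close> is evaluated at the generic point, whose coordinates are the variables of a polynomial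
  algebra. Every other point is a specialisation, so \<open>\<Theta>\<close> is evaluation of one polynomial \<open>Q\<close>, and
  homogeneity under scaling by \<open>2\<close> forces \<open>Q\<close> to be multilinear.\<close>

lemma multi_yoneda:
  fixes M :: "('k,'m,'y) module_scheme" and \<Theta> :: "('k,'s) module \<Rightarrow> ('m \<Rightarrow> 's) list \<Rightarrow> 's"
  assumes M: "module K M" and enc: "inj_on (enc :: 'm \<Rightarrow> 's) (carrier M)"
    and cl: "\<And>S ws. algebra K S \<Longrightarrow> length ws = n \<Longrightarrow> set ws \<subseteq> carrier (hom_module K M S) \<Longrightarrow>
      \<Theta> S ws \<in> carrier S"
    and hom: "\<And>S ws i c. algebra K S \<Longrightarrow> length ws = n \<Longrightarrow> set ws \<subseteq> carrier (hom_module K M S) \<Longrightarrow>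
      i < n \<Longrightarrow> c \<in> carrier K \<Longrightarrow>
      \<Theta> S (ws[i := (\<lambda>x\<in>carrier M. c \<odot>\<^bsub>S\<^esub> (ws ! i) x)]) = c \<odot>\<^bsub>S\<^esub> \<Theta> S ws"
    and nat: "\<And>S T \<phi> ws. algebra K S \<Longrightarrow> algebra K T \<Longrightarrow> \<phi> \<in> alg_hom K S T \<Longrightarrow>
      length ws = n \<Longrightarrow> set ws \<subseteq> carrier (hom_module K M S) \<Longrightarrow>
      \<Theta> T (map (push M \<phi>) ws) = \<phi> (\<Theta> S ws)"
  obtains X :: "(nat \<times> 's) multiset set" and q tt where
    "finite X" "\<And>x. x \<in> X \<Longrightarrow> q x \<in> carrier K" "\<And>x. x \<in> X \<Longrightarrow> tt x \<in> tuples n M"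
    "\<And>S ws. algebra K S \<Longrightarrow> length ws = n \<Longrightarrow> set ws \<subseteq> carrier (hom_module K M S) \<Longrightarrow>
      \<Theta> S ws = finsum S (\<lambda>x. q x \<odot>\<^bsub>S\<^esub> eval_prod S ws (tt x)) X"
proof -
  interpret M: module K M by (rule M)
  \<comment> \<open>The variable \<open>(i, s)\<close> stands for the value of the i-th argument at
    the basis vector coded by \<open>s\<close>. Indexing by \<open>'s\<close> instead of by vectors
    gives one type of polynomials, for which \<open>poly_code\<close> provides a code.\<close>
  let ?P = "poly_algebra K :: ('k, (nat \<times> 's) multiset \<Rightarrow> 'k) module"
  let ?F = "free_module K UNIV :: ('k, (nat \<times> 's) multiset \<Rightarrow> 'k) module"
  interpret F: module K ?F by (rule module_free_module)
  have P: "algebra K ?P" by (rule algebra_poly_algebra)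
  interpret P: algebra K ?P by (rule P)
  obtain e :: "((nat \<times> 's) multiset \<Rightarrow> 'k) \<Rightarrow> 's" where e: "inj_on e (carrier ?P)" by (rule poly_code)
  let ?T = "transport ?P e"
  have T: "algebra K ?T" by (rule transport_algebra[OF P e])
  interpret T: algebra K ?T by (rule T)
  let ?d = "inv_into (carrier ?P) e"
  have carr: "carrier ?P = carrier ?F" by (simp add: poly_algebra_simps)
  have de: "?d (e f) = f" if "f \<in> carrier ?F" for f using that inv_into_f_f[OF e] carr by simp
  obtain B c where B: "B \<subseteq> carrier M" "linear_map K M (free_module K B) c"
    "\<And>x. x \<in> carrier M \<Longrightarrow> lin_ext K M (\<lambda>b. b) (c x) = x"
    "\<And>f. f \<in> carrier (free_module K B) \<Longrightarrow> c (lin_ext K M (\<lambda>b. b) f) = f"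
    by (rule coordinates[OF M M.independent_empty]) blast
  interpret FB: module K "free_module K B" by (rule module_free_module)
  \<comment> \<open>Outside the codes of the basis the value is zero, so that every variable, also
    one that the generic point does not use, has a value under each specialisation.\<close>
  define dec where "dec s = (if s \<in> enc ` B then inv_into B enc s else \<zero>\<^bsub>M\<^esub>)" for s
  have dec_enc: "dec (enc b) = b" if "b \<in> B" for b
    using that enc B(1) by (simp add: dec_def inv_into_f_f inj_on_subset)
  have dec_M: "dec s \<in> carrier M" for s
    using B(1) by (auto simp: dec_def inv_into_into subsetD)
  \<comment> \<open>The i-th generic point: it sends a basis vector \<open>b\<close> to the variable
    \<open>(i, enc b)\<close>.\<close>
  define u where "u i x = lin_ext K ?F (\<lambda>b. free_gen K {#(i, enc b)#}) (c x)" for i :: nat and x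
  have u_lin: "linear_map K M ?F (u i)" for i
    unfolding u_def by (rule linear_map_comp[OF B(2) F.lin_ext_linear]) (simp add: gen_closed)
  have u_lin': "linear_map K M ?P (u i)" for i
    using u_lin[of i] unfolding linear_map_def poly_algebra_simps .
  define u' where "u' i = (\<lambda>x\<in>carrier M. e (u i x))" for i
  have u': "u' i \<in> carrier (hom_module K M ?T)" for i
    unfolding u'_def
    by (rule hom_module_restrict[OF M linear_map_comp[OF u_lin' transport_linear[OF P e]]])
  let ?us = "map u' [0..<n]"
  have us: "length ?us = n" "set ?us \<subseteq> carrier (hom_module K M ?T)" using u' by auto
  define Q where "Q = ?d (\<Theta> ?T ?us)"
  have Q': "\<Theta> ?T ?us \<in> carrier ?T" by (rule cl[OF T us])
  then have Q: "Q \<in> carrier ?F" "e Q = \<Theta> ?T ?us"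
    unfolding Q_def carr[symmetric] transport_simps(1)[OF P e]
    by (auto intro: inv_into_into simp: f_inv_into_f)
  have QK: "Q m \<in> carrier K" for m by (rule free_module_apply[OF Q(1)])
  \<comment> \<open>An arbitrary tuple \<open>ws\<close> is the image of the generic tuple under the
    homomorphism that sends the variable \<open>(i, s)\<close> to \<open>(ws ! i) (dec s)\<close>
    for \<open>i < n\<close>. Naturality then expresses \<open>\<Theta> S ws\<close> by evaluating
    the single polynomial \<open>Q\<close>.\<close>
  have special: "\<Theta> S ws = lin_ext K S (monomial_value S (\<lambda>(i, s). if i < n then (ws ! i) (dec s) else \<zero>\<^bsub>S\<^esub>)) Q"
    and special_val: "range (\<lambda>(i, s). if i < n then (ws ! i) (dec s) else \<zero>\<^bsub>S\<^esub>) \<subseteq> carrier S"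
    if S: "algebra K S" and ws: "length ws = n" "set ws \<subseteq> carrier (hom_module K M S)" for S ws
  proof -
    interpret S: algebra K S by (rule S)
    let ?v = "\<lambda>(i, s). if i < n then (ws ! i) (dec s) else \<zero>\<^bsub>S\<^esub>"
    have wl: "linear_map K M S (ws ! i)" if "i < n" for i
      using ws that by (intro hom_module_linear) (auto simp: subset_iff)
    show v: "range ?v \<subseteq> carrier S"
    proof
      fix z assume "z \<in> range ?v"
      then obtain i s where "z = (if i < n then (ws ! i) (dec s) else \<zero>\<^bsub>S\<^esub>)" by auto
      then show "z \<in> carrier S" using linear_mapD(1)[OF wl dec_M] by (cases "i < n") auto
    qed
    let ?E = "lin_ext K S (monomial_value S ?v)"
    note Eh = poly_eval_alg_hom[OF S v]
    let ?\<phi> = "\<lambda>x. ?E (?d x)"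
    have \<phi>: "?\<phi> \<in> alg_hom K ?T S" by (rule transport_hom[OF P e Eh])
    have E_lin: "linear_map K ?F S ?E" using Eh(2) unfolding linear_map_def poly_algebra_simps .
    have Eg: "?E (free_gen K a) = monomial_value S ?v a" for a
      by (rule S.lin_ext_gen) (rule S.monomial_value_closed[OF v])
    have "push M ?\<phi> (u' i) = ws ! i" if i: "i < n" for i
    proof (rule hom_module_eqI[OF push_closed[OF M \<phi> u']])
      show "ws ! i \<in> carrier (hom_module K M S)" using ws i by (auto simp: subset_iff)
      fix x assume x: "x \<in> carrier M"
      have cx: "c x \<in> carrier (free_module K B)" by (rule linear_mapD(1)[OF B(2) x])
      have "push M ?\<phi> (u' i) x = ?E (u i x)"
        using x by (simp add: u'_def de linear_mapD(1)[OF u_lin])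
      also have "\<dots> = (ws ! i) (lin_ext K M (\<lambda>b. b) (c x))"
        unfolding u_def
      proof (rule free_linear_unique[OF S.module _ _ cx])
        show "linear_map K (free_module K B) S (\<lambda>f. ?E (lin_ext K ?F (\<lambda>b. free_gen K {#(i, enc b)#}) f))"
          by (rule linear_map_comp[OF F.lin_ext_linear E_lin]) (simp add: gen_closed)
        show "linear_map K (free_module K B) S (\<lambda>f. (ws ! i) (lin_ext K M (\<lambda>b. b) f))"
          by (rule linear_map_comp[OF M.lin_ext_linear wl[OF i]]) (use B(1) in auto)
        fix b assume b: "b \<in> B"
        have "?E (lin_ext K ?F (\<lambda>b. free_gen K {#(i, enc b)#}) (free_gen K b)) = (ws ! i) (dec (enc b))"
          using i by (simp add: F.lin_ext_gen gen_closed Eg S.monomial_value_single[OF v])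
        also have "\<dots> = (ws ! i) (lin_ext K M (\<lambda>b. b) (free_gen K b))"
          using b B(1) by (subst M.lin_ext_gen) (auto simp: dec_enc)
        finally show "?E (lin_ext K ?F (\<lambda>b. free_gen K {#(i, enc b)#}) (free_gen K b))
          = (ws ! i) (lin_ext K M (\<lambda>b. b) (free_gen K b))" .
      qed
      also have "\<dots> = (ws ! i) x" by (simp add: B(3)[OF x])
      finally show "push M ?\<phi> (u' i) x = (ws ! i) x" .
    qed
    then have "map (push M ?\<phi>) ?us = ws"
      using ws by (intro nth_equalityI) auto
    then have "\<Theta> S ws = ?\<phi> (\<Theta> ?T ?us)" using nat[OF T S \<phi> us] by simp
    then show "\<Theta> S ws = ?E Q" by (simp add: Q_def)
  qed
  let ?two = "\<one> \<oplus> \<one>"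
  have two: "?two \<in> carrier K" by simp
  \<comment> \<open>Naturality for the endomorphism of the generic algebra that doubles the i-th
    block of variables.\<close>
  have scaled: "\<Theta> ?T (map (push M (\<lambda>x. e (scale_var K ?two i (?d x)))) ?us) = e (scale_var K ?two i Q)" for i
  proof -
    note SL = scale_var_linear[OF two, of i]
    have "(\<lambda>f. e (scale_var K ?two i f)) \<in> ring_hom ?P ?T"
    proof (rule ring_hom_memI)
      show "e (scale_var K ?two i \<one>\<^bsub>?P\<^esub>) = \<one>\<^bsub>?T\<^esub>"
        unfolding transport_simps(5)[OF P e] poly_algebra_simps scale_var_gen[OF two]
        by (simp add: degree_in_def free_gen_def fun_eq_iff del: add.nat_pow_Suc) 
      fix f g assume fg: "f \<in> carrier ?P" "g \<in> carrier ?P"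
      then have sf: "scale_var K ?two i f \<in> carrier ?P" "scale_var K ?two i g \<in> carrier ?P"
        using linear_mapD(1)[OF SL] carr by auto
      then show "e (scale_var K ?two i f) \<in> carrier ?T" by (simp add: transport_simps(1)[OF P e])
      show "e (scale_var K ?two i (f \<otimes>\<^bsub>?P\<^esub> g)) = e (scale_var K ?two i f) \<otimes>\<^bsub>?T\<^esub> e (scale_var K ?two i g)"
        unfolding transport_simps(2)[OF P e sf] using fg carr
        by (simp only: poly_algebra_simps scale_var_mult[OF two])
      show "e (scale_var K ?two i (f \<oplus>\<^bsub>?P\<^esub> g)) = e (scale_var K ?two i f) \<oplus>\<^bsub>?T\<^esub> e (scale_var K ?two i g)"
        unfolding transport_simps(3)[OF P e sf] using fg carr
        by (simp only: poly_algebra_simps linear_mapD(2)[OF SL])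
    qed
    moreover have "linear_map K ?P ?T (\<lambda>f. e (scale_var K ?two i f))"
    proof -
      have "linear_map K ?P ?P (scale_var K ?two i)" using SL unfolding linear_map_def poly_algebra_simps .
      then show ?thesis by (rule linear_map_comp[OF _ transport_linear[OF P e]])
    qed
    ultimately have "(\<lambda>x. e (scale_var K ?two i (?d x))) \<in> alg_hom K ?T ?T"
      by (rule transport_hom[OF P e])
    then show ?thesis using nat[OF T T _ us] by (simp add: Q_def)
  qed
  have scale_u: "scale_var K ?two i (u j x) = (if i = j then ?two \<odot>\<^bsub>?F\<^esub> u j x else u j x)" if x: "x \<in> carrier M" for i j x
  proof -
    note SL = scale_var_linear[OF two, of i]
    let ?r = "if i = j then ?two else \<one>"
    have r: "?r \<in> carrier K" by simp
    have "linear_map K (free_module K B) ?F (lin_ext K ?F (\<lambda>b. free_gen K {#(j, enc b)#}))"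
      by (rule F.lin_ext_linear) (simp add: gen_closed)
    note L = this
    have "scale_var K ?two i (u j x) = ?r \<odot>\<^bsub>?F\<^esub> u j x"
      unfolding u_def
    proof (rule free_linear_unique[OF F.module_axioms linear_map_comp[OF L SL] linear_map_smult[OF F.module_axioms L r]
          linear_mapD(1)[OF B(2) x]])
      fix b assume "b \<in> B"
      show "scale_var K ?two i (lin_ext K ?F (\<lambda>b. free_gen K {#(j, enc b)#}) (free_gen K b))
        = ?r \<odot>\<^bsub>?F\<^esub> lin_ext K ?F (\<lambda>b. free_gen K {#(j, enc b)#}) (free_gen K b)"
      proof -
        have "lin_ext K ?F (\<lambda>b. free_gen K {#(j, enc b)#}) (free_gen K b) = free_gen K {#(j, enc b)#}"
          by (rule F.lin_ext_gen) (rule gen_closed)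
        then show ?thesis
          by (simp add: scale_var_gen[OF two] degree_in_def del: free_module_simps)
      qed
    qed
    moreover have "\<one> \<odot>\<^bsub>?F\<^esub> u j x = u j x" by (rule F.smult_one[OF linear_mapD(1)[OF u_lin x]])
    ultimately show ?thesis by (simp split: if_splits)
  qed
  \<comment> \<open>Doubling the i-th block doubles the i-th generic point and fixes the others.
    Homogeneity and naturality give two expressions for the same value of \<open>\<Theta>\<close>,
    and comparing the coefficients of \<open>m\<close> determines its degree in the block.\<close>
  have deg: "degree_in i m = (if i < n then 1 else 0)" if m: "Q m \<noteq> \<zero>" for i m
  proof -
    let ?p = "push M (\<lambda>x. e (scale_var K ?two i (?d x)))"
    have pu: "?p (u' j) = (if i = j then (\<lambda>x\<in>carrier M. ?two \<odot>\<^bsub>?T\<^esub> u' j x) else u' j)" for j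
    proof (rule ext)
      fix x
      show "?p (u' j) x = (if i = j then (\<lambda>x\<in>carrier M. ?two \<odot>\<^bsub>?T\<^esub> u' j x) else u' j) x"
      proof (cases "x \<in> carrier M")
        case True
        have uF: "u j x \<in> carrier ?F" by (rule linear_mapD(1)[OF u_lin True])
        then have "?two \<odot>\<^bsub>?T\<^esub> e (u j x) = e (?two \<odot>\<^bsub>?F\<^esub> u j x)"
          using transport_simps(4)[OF P e, of "u j x" ?two] by (simp add: poly_algebra_simps)
        then show ?thesis using True scale_u[OF True, of i j]
          by (simp add: u'_def de[OF uF] del: free_module_simps)
      qed (simp add: u'_def)
    qed
    show ?thesis
    proof (cases "i < n")
      case True
      have "map ?p ?us = ?us[i := (\<lambda>x\<in>carrier M. ?two \<odot>\<^bsub>?T\<^esub> (?us ! i) x)]"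
        using True by (intro nth_equalityI) (auto simp: pu nth_list_update)
      then have "e (scale_var K ?two i Q) = \<Theta> ?T (?us[i := (\<lambda>x\<in>carrier M. ?two \<odot>\<^bsub>?T\<^esub> (?us ! i) x)])"
        by (simp only: scaled[of i, symmetric])
      also have "\<dots> = ?two \<odot>\<^bsub>?T\<^esub> \<Theta> ?T ?us" by (rule hom[OF T us True two])
      also have "\<dots> = e (?two \<odot>\<^bsub>?P\<^esub> Q)"
        using transport_simps(4)[OF P e, of Q ?two] Q(1) by (simp only: carr Q(2))
      finally have "scale_var K ?two i Q = ?two \<odot>\<^bsub>?P\<^esub> Q"
        by (rule inj_onD[OF e])
          (simp_all only: carr poly_algebra_simps(4) linear_mapD(1)[OF scale_var_linear[OF two] Q(1)]
            F.smult_closed[OF two Q(1)])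
      then have "scale_var K ?two i Q = ?two \<odot>\<^bsub>?F\<^esub> Q" by (simp only: poly_algebra_simps(4))
      then have "?two [^] degree_in i m \<otimes> Q m = ?two \<otimes> Q m"
        by (simp add: scale_var_def fun_eq_iff)
      then show ?thesis using two_power_eq_two[OF _ QK m] True by simp
    next
      \<comment> \<open>Blocks from \<open>n\<close> on do not occur in the generic tuple but might
        a priori occur in \<open>Q\<close>. Doubling one of them fixes the tuple, hence
        \<open>Q\<close>, which therefore has degree zero in it.\<close>
      case False
      have "map ?p ?us = ?us" using False by (intro nth_equalityI) (auto simp: pu)
      then have "e (scale_var K ?two i Q) = e Q" by (simp only: scaled[of i, symmetric] Q(2))
      then have "scale_var K ?two i Q = Q"
        by (rule inj_onD[OF e])
          (simp_all only: carr linear_mapD(1)[OF scale_var_linear[OF two] Q(1)] Q(1))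
      then have "?two [^] degree_in i m \<otimes> Q m = Q m"
        by (simp add: scale_var_def fun_eq_iff)
      then show ?thesis using two_power_eq_one[OF _ QK m] False by simp
    qed
  qed
  define s where "s m = (SOME s. m = mset (map (\<lambda>i. (i, s i)) [0..<n]))" for m :: "(nat \<times> 's) multiset"
  have s: "m = mset (map (\<lambda>i. (i, s m i)) [0..<n])" if "Q m \<noteq> \<zero>" for m
    unfolding s_def
    by (rule someI_ex[OF multidegree_one_multiset]) (simp_all add: deg[OF that])
  show ?thesis
  proof (rule that[of "{m. Q m \<noteq> \<zero>}" Q "\<lambda>m. map (\<lambda>i. dec (s m i)) [0..<n]"])
    show "finite {m. Q m \<noteq> \<zero>}" by (rule F.free_support_finite[OF Q(1)])
    show "Q x \<in> carrier K" for x by (rule QK)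
    show "map (\<lambda>i. dec (s m i)) [0..<n] \<in> tuples n M" for m using dec_M by (auto simp: tuples_def)
    fix S :: "('k,'s) module" and ws assume S: "algebra K S" and ws: "length ws = n" "set ws \<subseteq> carrier (hom_module K M S)"
    interpret S: algebra K S by (rule S)
    let ?v = "\<lambda>(i, s). if i < n then (ws ! i) (dec s) else \<zero>\<^bsub>S\<^esub>"
    have v: "range ?v \<subseteq> carrier S" by (rule special_val[OF S ws])
    have mv: "monomial_value S ?v m = eval_prod S ws (map (\<lambda>i. dec (s m i)) [0..<n])" if m: "Q m \<noteq> \<zero>" for m
    proof -
      have "monomial_value S ?v m = foldr (\<otimes>\<^bsub>S\<^esub>) (map ?v (map (\<lambda>i. (i, s m i)) [0..<n])) \<one>\<^bsub>S\<^esub>"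
        using S.monomial_value_mset[OF v, of "map (\<lambda>i. (i, s m i)) [0..<n]"] s[OF m] by simp
      also have "map ?v (map (\<lambda>i. (i, s m i)) [0..<n]) = map2 (\<lambda>w p. w p) ws (map (\<lambda>i. dec (s m i)) [0..<n])"
        using ws(1) by (intro nth_equalityI) auto
      finally show ?thesis by (simp add: eval_prod_def)
    qed
    have mvS: "monomial_value S ?v m \<in> carrier S" for m by (rule S.monomial_value_closed[OF v])
    show "\<Theta> S ws = finsum S (\<lambda>m. Q m \<odot>\<^bsub>S\<^esub> eval_prod S ws (map (\<lambda>i. dec (s m i)) [0..<n])) {m. Q m \<noteq> \<zero>}"
      unfolding special[OF S ws] lin_ext_def
    proof (rule S.finsum_cong'[OF refl])
      show "(\<lambda>m. Q m \<odot>\<^bsub>S\<^esub> eval_prod S ws (map (\<lambda>i. dec (s m i)) [0..<n])) \<in> {m. Q m \<noteq> \<zero>} \<rightarrow> carrier S"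
        using mv mvS QK by (auto simp flip: mv)
    qed (simp add: mv)
  qed
qed

end

section \<open>Functors of modules\<close>

lemma smult_update_simps:
  "carrier (M\<lparr>smult := s\<rparr>) = carrier M"
  "x \<oplus>\<^bsub>M\<lparr>smult := s\<rparr>\<^esub> y = x \<oplus>\<^bsub>M\<^esub> y"
  "r \<odot>\<^bsub>M\<lparr>smult := s\<rparr>\<^esub> x = s r x"
  by simp_all

text \<open>Semilinearity of the transition maps over \<open>\<phi>\<close> is expressed as
  linearity into the target with scalars restricted along \<open>\<phi>\<close>.\<close>

definition module_functor :: "('k,'x) ring_scheme \<Rightarrow> ('k,'s,'m) kfunctor \<Rightarrow> bool" where
  "module_functor K F \<longleftrightarrow> (\<forall>S. algebra K S \<longrightarrow> module S (ob F S)) \<and>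
    (\<forall>S T \<phi>. algebra K S \<longrightarrow> algebra K T \<longrightarrow> \<phi> \<in> alg_hom K S T \<longrightarrow>
      linear_map S (ob F S) ((ob F T)\<lparr>smult := (\<lambda>s. smult (ob F T) (\<phi> s))\<rparr>) (ar F S T \<phi>))"

lemma module_functorD:
  assumes "module_functor K F"
  shows "algebra K S \<Longrightarrow> module S (ob F S)"
    and "algebra K S \<Longrightarrow> algebra K T \<Longrightarrow> \<phi> \<in> alg_hom K S T \<Longrightarrow>
      linear_map S (ob F S) ((ob F T)\<lparr>smult := (\<lambda>s. smult (ob F T) (\<phi> s))\<rparr>) (ar F S T \<phi>)"
  using assms unfolding module_functor_def by blast+

lemma module_functor_ar_closed:
  assumes "module_functor K F" "algebra K S" "algebra K T" "\<phi> \<in> alg_hom K S T" "x \<in> carrier (ob F S)"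
  shows "ar F S T \<phi> x \<in> carrier (ob F T)"
  using linear_mapD(1)[OF module_functorD(2)[OF assms(1-4)] assms(5)] by simp

lemma functor_homD:
  assumes "\<eta> \<in> functor_hom K F G"
  shows "algebra K S \<Longrightarrow> \<eta> S \<in> extensional (carrier (ob F S))"
    and "algebra K S \<Longrightarrow> linear_map S (ob F S) (ob G S) (\<eta> S)"
    and "\<not> algebra K S \<Longrightarrow> \<eta> S = undefined"
    and "algebra K S \<Longrightarrow> algebra K T \<Longrightarrow> \<phi> \<in> alg_hom K S T \<Longrightarrow> x \<in> carrier (ob F S) \<Longrightarrow>
      \<eta> T (ar F S T \<phi> x) = ar G S T \<phi> (\<eta> S x)"
  using assms unfolding functor_hom_def by simp_all

lemma functor_hom_eqI:
  fixes F :: "('k,'s,'m) kfunctor" and G :: "('k,'s,'n) kfunctor"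
  assumes "\<eta> \<in> functor_hom K F G" "\<theta> \<in> functor_hom K F G"
    and "\<And>S x. algebra K S \<Longrightarrow> x \<in> carrier (ob F S) \<Longrightarrow> \<eta> S x = \<theta> S x"
  shows "\<eta> = \<theta>"
proof
  fix S
  show "\<eta> S = \<theta> S"
  proof (cases "algebra K S")
    case True
    show ?thesis
      by (rule extensionalityI[OF functor_homD(1)[OF assms(1) True] functor_homD(1)[OF assms(2) True]])
        (rule assms(3)[OF True])
  next
    case False
    then show ?thesis by (simp only: functor_homD(3)[OF assms(1) False] functor_homD(3)[OF assms(2) False])
  qed
qed

text \<open>\<open>functor_hom\<close> fixes the values of a morphism outside the relevant carriers
  and algebras. Cutting a family to this normal form makes equality of morphisms a matter of the
  relevant values, as in \<open>functor_hom_eqI\<close>.\<close>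

definition mk_hom :: "('k,'x) ring_scheme \<Rightarrow> ('k,'s,'m) kfunctor \<Rightarrow> (('k,'s) module \<Rightarrow> 'm \<Rightarrow> 'n)
    \<Rightarrow> ('k,'s) module \<Rightarrow> 'm \<Rightarrow> 'n" where
  "mk_hom K F g S = (if algebra K S then restrict (g S) (carrier (ob F S)) else undefined)"

lemma mk_hom_app: "algebra K S \<Longrightarrow> x \<in> carrier (ob F S) \<Longrightarrow> mk_hom K F g S x = g S x"
  by (simp add: mk_hom_def)

lemma linear_map_restrict:
  assumes "linear_map R M N f" "module R M" shows "linear_map R M N (restrict f (carrier M))"
  by (rule linear_map_cong[OF assms]) simp

lemma mk_hom_functor_hom:
  fixes F :: "('k,'s,'m) kfunctor" and G :: "('k,'s,'n) kfunctor"
  assumes F: "module_functor K F"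
    and lin: "\<And>S. algebra K S \<Longrightarrow> linear_map S (ob F S) (ob G S) (g S)"
    and nat: "\<And>S T \<phi> x. algebra K S \<Longrightarrow> algebra K T \<Longrightarrow> \<phi> \<in> alg_hom K S T \<Longrightarrow> x \<in> carrier (ob F S) \<Longrightarrow>
      g T (ar F S T \<phi> x) = ar G S T \<phi> (g S x)"
  shows "mk_hom K F g \<in> functor_hom K F G"
  unfolding functor_hom_def mem_Collect_eq
proof (intro conjI allI impI ballI)
  fix S :: "('k,'s) module" assume S: "algebra K S"
  show "mk_hom K F g S \<in> extensional (carrier (ob F S))" using S by (simp add: mk_hom_def)
  show "linear_map S (ob F S) (ob G S) (mk_hom K F g S)"
    using linear_map_restrict[OF lin[OF S] module_functorD(1)[OF F S]] S by (simp add: mk_hom_def)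
  fix T \<phi> x assume T: "algebra K T" and \<phi>: "\<phi> \<in> alg_hom K S T" and x: "x \<in> carrier (ob F S)"
  show "mk_hom K F g T (ar F S T \<phi> x) = ar G S T \<phi> (mk_hom K F g S x)"
    by (simp only: mk_hom_app[OF S x] mk_hom_app[OF T module_functor_ar_closed[OF F S T \<phi> x]] nat[OF S T \<phi> x])
qed (simp add: mk_hom_def)

text \<open>The pointwise inverses of a linear and natural family are again linear and natural, so
  isomorphisms can be checked algebra by algebra.\<close>

lemma functor_iso_bij:
  fixes F :: "('k,'s,'m) kfunctor" and G :: "('k,'s,'n) kfunctor"
  assumes F: "module_functor K F" and G: "module_functor K G" and \<eta>: "\<eta> \<in> functor_hom K F G"
    and bij: "\<And>S. algebra K S \<Longrightarrow> bij_betw (\<eta> S) (carrier (ob F S)) (carrier (ob G S))"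
  shows "functor_iso K F G \<eta>"
proof -
  let ?h = "\<lambda>S. inv_into (carrier (ob F S)) (\<eta> S)"
  have inj: "inj_on (\<eta> S) (carrier (ob F S))" and sur: "\<eta> S ` carrier (ob F S) = carrier (ob G S)"
    if "algebra K S" for S using bij[OF that] by (auto simp: bij_betw_def)
  have h1: "?h S (\<eta> S x) = x" if "algebra K S" "x \<in> carrier (ob F S)" for S x
    using inv_into_f_f[OF inj[OF that(1)] that(2)] .
  have h2: "\<eta> S (?h S y) = y" "?h S y \<in> carrier (ob F S)" if "algebra K S" "y \<in> carrier (ob G S)" for S y
    using that(2) unfolding sur[OF that(1), symmetric] by (auto intro: f_inv_into_f inv_into_into)
  have "mk_hom K G ?h \<in> functor_hom K G F"
  proof (rule mk_hom_functor_hom[OF G])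
    fix S :: "('k,'s) module" assume S: "algebra K S"
    show "linear_map S (ob G S) (ob F S) (?h S)"
      by (rule linear_map_inv_into[OF module_functorD(1)[OF F S] module_functorD(1)[OF G S]
            functor_homD(2)[OF \<eta> S] inj[OF S] sur[OF S]])
    fix T \<phi> y assume T: "algebra K T" and \<phi>: "\<phi> \<in> alg_hom K S T" and y: "y \<in> carrier (ob G S)"
    have "ar G S T \<phi> y = \<eta> T (ar F S T \<phi> (?h S y))"
      using functor_homD(4)[OF \<eta> S T \<phi> h2(2)[OF S y]] h2(1)[OF S y] by simp
    then show "?h T (ar G S T \<phi> y) = ar F S T \<phi> (?h S y)"
      using h1[OF T module_functor_ar_closed[OF F S T \<phi> h2(2)[OF S y]]] by simp
  qed
  moreover have "mk_hom K G ?h S (\<eta> S x) = x" if S: "algebra K S" and x: "x \<in> carrier (ob F S)" for S x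
    using mk_hom_app[OF S linear_mapD(1)[OF functor_homD(2)[OF \<eta> S] x], where g = ?h] h1[OF S x] by simp
  moreover have "\<eta> S (mk_hom K G ?h S y) = y" if S: "algebra K S" and y: "y \<in> carrier (ob G S)" for S y
    using mk_hom_app[OF S y, where g = ?h] h2(1)[OF S y] by simp
  ultimately show ?thesis using \<eta> unfolding functor_iso_def by blast
qed

lemma regular_module_simps:
  "carrier (regular_module S) = carrier S"
  "x \<oplus>\<^bsub>regular_module S\<^esub> y = x \<oplus>\<^bsub>S\<^esub> y"
  "\<zero>\<^bsub>regular_module S\<^esub> = \<zero>\<^bsub>S\<^esub>"
  "r \<odot>\<^bsub>regular_module S\<^esub> x = r \<otimes>\<^bsub>S\<^esub> x"
  by (simp_all add: regular_module_def)

lemma module_regular: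
  assumes "algebra K S" shows "module S (regular_module S)"
proof -
  interpret S: algebra K S by fact
  have "abelian_group (regular_module S)"
    by (rule abelian_groupI)
      (auto simp: regular_module_simps S.a_ac intro!: bexI[of _ "\<ominus>\<^bsub>S\<^esub> _"] S.l_neg)
  then show ?thesis
    by (intro moduleI S.M_cring) (auto simp: regular_module_simps S.l_distr S.r_distr S.m_assoc)
qed

lemma base_functor_simps: "ob base_functor S = regular_module S" "ar base_functor S T \<phi> = \<phi>"
  by (simp_all add: base_functor_def)

subsection \<open>The space of linear forms on a functor\<close>

lemma dual_space_simps:
  "carrier (dual_space K F) = functor_hom K F base_functor"
  "\<zero>\<^bsub>dual_space K F\<^esub> = mk_hom K F (\<lambda>S x. \<zero>\<^bsub>S\<^esub>)"
  "\<eta> \<oplus>\<^bsub>dual_space K F\<^esub> \<theta> = mk_hom K F (\<lambda>S x. \<eta> S x \<oplus>\<^bsub>S\<^esub> \<theta> S x)"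
  "c \<odot>\<^bsub>dual_space K F\<^esub> \<eta> = mk_hom K F (\<lambda>S x. c \<odot>\<^bsub>S\<^esub> \<eta> S x)"
  by (simp_all add: dual_space_def mk_hom_def fun_eq_iff)

context
  fixes K :: "('k,'x) ring_scheme" and F :: "('k,'s,'m) kfunctor"
  assumes F: "module_functor K F" and K: "cring K"
begin

abbreviation (input) "DF \<equiv> dual_space K F"

lemma dual_space_app_closed:
  assumes "\<eta> \<in> carrier DF" "algebra K S" "x \<in> carrier (ob F S)" shows "\<eta> S x \<in> carrier S"
  using linear_mapD(1)[OF functor_homD(2)[OF assms(1)[unfolded dual_space_simps] assms(2)] assms(3)]
  by (simp add: base_functor_simps regular_module_simps)

lemma dual_space_linear:
  assumes "\<eta> \<in> carrier DF" "algebra K S"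
  shows "linear_map S (ob F S) (regular_module S) (\<eta> S)"
  using functor_homD(2)[OF assms(1)[unfolded dual_space_simps] assms(2)]
  by (simp add: base_functor_simps)

lemma dual_space_natural:
  assumes "\<eta> \<in> carrier DF" "algebra K S" "algebra K T" "\<phi> \<in> alg_hom K S T" "x \<in> carrier (ob F S)"
  shows "\<eta> T (ar F S T \<phi> x) = \<phi> (\<eta> S x)"
  using functor_homD(4)[OF assms(1)[unfolded dual_space_simps] assms(2-5)] by (simp add: base_functor_simps)

lemma dual_space_zero: "\<zero>\<^bsub>DF\<^esub> \<in> carrier DF"
  unfolding dual_space_simps
proof (rule mk_hom_functor_hom[OF F]; unfold base_functor_simps)
  fix S :: "('k,'s) module" assume S: "algebra K S"
  interpret S: algebra K S by (rule S)
  show "linear_map S (ob F S) (regular_module S) (\<lambda>x. \<zero>\<^bsub>S\<^esub>)"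
    by (rule linear_mapI) (simp_all add: regular_module_simps)
  fix T \<phi> x assume T: "algebra K T" and \<phi>: "\<phi> \<in> alg_hom K S T"
  show "\<zero>\<^bsub>T\<^esub> = \<phi> \<zero>\<^bsub>S\<^esub>"
    by (rule linear_map_zero[OF algebraD(1)[OF S] algebraD(1)[OF T] alg_homD(2)[OF \<phi>], symmetric])
qed

lemma dual_space_add:
  assumes \<eta>: "\<eta> \<in> carrier DF" and \<theta>: "\<theta> \<in> carrier DF" shows "\<eta> \<oplus>\<^bsub>DF\<^esub> \<theta> \<in> carrier DF"
  unfolding dual_space_simps
proof (rule mk_hom_functor_hom[OF F]; unfold base_functor_simps)
  fix S :: "('k,'s) module" assume S: "algebra K S"
  show "linear_map S (ob F S) (regular_module S) (\<lambda>x. \<eta> S x \<oplus>\<^bsub>S\<^esub> \<theta> S x)"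
    using linear_map_add[OF module_regular[OF S] dual_space_linear[OF \<eta> S] dual_space_linear[OF \<theta> S]]
    by (simp add: regular_module_simps)
  fix T \<phi> x assume a: "algebra K T" "\<phi> \<in> alg_hom K S T" "x \<in> carrier (ob F S)"
  show "\<eta> T (ar F S T \<phi> x) \<oplus>\<^bsub>T\<^esub> \<theta> T (ar F S T \<phi> x) = \<phi> (\<eta> S x \<oplus>\<^bsub>S\<^esub> \<theta> S x)"
    by (simp only: dual_space_natural[OF \<eta> S a] dual_space_natural[OF \<theta> S a]
        alg_homD(6)[OF a(2)] dual_space_app_closed[OF \<eta> S a(3)] dual_space_app_closed[OF \<theta> S a(3)])
qed

lemma dual_space_smult:
  assumes c: "c \<in> carrier K" and \<eta>: "\<eta> \<in> carrier DF" shows "c \<odot>\<^bsub>DF\<^esub> \<eta> \<in> carrier DF"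
  unfolding dual_space_simps
proof (rule mk_hom_functor_hom[OF F]; unfold base_functor_simps)
  fix S :: "('k,'s) module" assume S: "algebra K S"
  interpret S: algebra K S by (rule S)
  \<comment> \<open>A scalar of \<open>K\<close> acts on \<open>S\<close> as multiplication by its
    image in \<open>S\<close>, so linearity over \<open>S\<close> covers it.\<close>
  have c1: "c \<odot>\<^bsub>S\<^esub> \<one>\<^bsub>S\<^esub> \<in> carrier (regular_module S)"
    using c by (simp add: regular_module_simps)
  show "linear_map S (ob F S) (regular_module S) (\<lambda>x. c \<odot>\<^bsub>S\<^esub> \<eta> S x)"
  proof (rule linear_map_cong[OF linear_map_smult[OF module_regular[OF S] dual_space_linear[OF \<eta> S] c1[unfolded regular_module_simps]]
        module_functorD(1)[OF F S]])
    fix x assume "x \<in> carrier (ob F S)"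
    then show "c \<odot>\<^bsub>S\<^esub> \<eta> S x = (c \<odot>\<^bsub>S\<^esub> \<one>\<^bsub>S\<^esub>) \<odot>\<^bsub>regular_module S\<^esub> \<eta> S x"
      using c dual_space_app_closed[OF \<eta> S] by (simp add: regular_module_simps S.smult_assoc2)
  qed
  fix T \<phi> x assume a: "algebra K T" "\<phi> \<in> alg_hom K S T" "x \<in> carrier (ob F S)"
  show "c \<odot>\<^bsub>T\<^esub> \<eta> T (ar F S T \<phi> x) = \<phi> (c \<odot>\<^bsub>S\<^esub> \<eta> S x)"
    by (simp only: dual_space_natural[OF \<eta> S a] linear_mapD(3)[OF alg_homD(2)[OF a(2)] c]
        dual_space_app_closed[OF \<eta> S a(3)])
qed

lemma dual_space_app:
  "algebra K S \<Longrightarrow> x \<in> carrier (ob F S) \<Longrightarrow> \<zero>\<^bsub>DF\<^esub> S x = \<zero>\<^bsub>S\<^esub>"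
  "algebra K S \<Longrightarrow> x \<in> carrier (ob F S) \<Longrightarrow> (\<eta> \<oplus>\<^bsub>DF\<^esub> \<theta>) S x = \<eta> S x \<oplus>\<^bsub>S\<^esub> \<theta> S x"
  "algebra K S \<Longrightarrow> x \<in> carrier (ob F S) \<Longrightarrow> (c \<odot>\<^bsub>DF\<^esub> \<eta>) S x = c \<odot>\<^bsub>S\<^esub> \<eta> S x"
  by (simp_all add: dual_space_simps mk_hom_app)

lemma module_dual_space: "module K DF"
proof -
  interpret K: cring K by (rule K)
  note eqI = functor_hom_eqI[of _ K F base_functor, folded dual_space_simps(1)]
  note cl = dual_space_add dual_space_smult dual_space_zero
  note app = dual_space_app dual_space_app_closed
  have ab: "abelian_group DF"
  proof (rule abelian_groupI)
    fix \<eta> assume \<eta>: "\<eta> \<in> carrier DF"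
    have m1: "\<ominus>\<^bsub>K\<^esub> \<one>\<^bsub>K\<^esub> \<in> carrier K" by simp
    note c = dual_space_smult[OF m1 \<eta>]
    have "((\<ominus>\<^bsub>K\<^esub> \<one>\<^bsub>K\<^esub>) \<odot>\<^bsub>DF\<^esub> \<eta>) \<oplus>\<^bsub>DF\<^esub> \<eta> = \<zero>\<^bsub>DF\<^esub>"
    proof (rule eqI[OF cl(1)[OF c \<eta>] cl(3)])
      fix S :: "('k,'s) module" and x assume S: "algebra K S" and x: "x \<in> carrier (ob F S)"
      interpret S: algebra K S by (rule S)
      show "(((\<ominus>\<^bsub>K\<^esub> \<one>\<^bsub>K\<^esub>) \<odot>\<^bsub>DF\<^esub> \<eta>) \<oplus>\<^bsub>DF\<^esub> \<eta>) S x = \<zero>\<^bsub>DF\<^esub> S x"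
        using dual_space_app_closed[OF \<eta> S x]
        by (simp add: dual_space_app[OF S x] S.smult_l_minus S.M.l_neg)
    qed
    then show "\<exists>\<theta>\<in>carrier DF. \<theta> \<oplus>\<^bsub>DF\<^esub> \<eta> = \<zero>\<^bsub>DF\<^esub>" using c by blast
    show "\<zero>\<^bsub>DF\<^esub> \<oplus>\<^bsub>DF\<^esub> \<eta> = \<eta>"
    proof (rule eqI[OF cl(1)[OF cl(3) \<eta>] \<eta>])
      fix S :: "('k,'s) module" and x assume S: "algebra K S" and x: "x \<in> carrier (ob F S)"
      interpret S: algebra K S by (rule S)
      show "(\<zero>\<^bsub>DF\<^esub> \<oplus>\<^bsub>DF\<^esub> \<eta>) S x = \<eta> S x"
        using dual_space_app_closed[OF \<eta> S x] by (simp add: dual_space_app[OF S x])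
    qed
    fix \<theta> assume \<theta>: "\<theta> \<in> carrier DF"
    show "\<eta> \<oplus>\<^bsub>DF\<^esub> \<theta> \<in> carrier DF" by (rule cl(1)[OF \<eta> \<theta>])
    show "\<eta> \<oplus>\<^bsub>DF\<^esub> \<theta> = \<theta> \<oplus>\<^bsub>DF\<^esub> \<eta>"
    proof (rule eqI[OF cl(1)[OF \<eta> \<theta>] cl(1)[OF \<theta> \<eta>]])
      fix S :: "('k,'s) module" and x assume S: "algebra K S" and x: "x \<in> carrier (ob F S)"
      interpret S: algebra K S by (rule S)
      show "(\<eta> \<oplus>\<^bsub>DF\<^esub> \<theta>) S x = (\<theta> \<oplus>\<^bsub>DF\<^esub> \<eta>) S x"
        using dual_space_app_closed[OF \<eta> S x] dual_space_app_closed[OF \<theta> S x]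
        by (simp add: dual_space_app[OF S x] S.a_comm)
    qed
    fix \<zeta> assume \<zeta>: "\<zeta> \<in> carrier DF"
    show "\<eta> \<oplus>\<^bsub>DF\<^esub> \<theta> \<oplus>\<^bsub>DF\<^esub> \<zeta> = \<eta> \<oplus>\<^bsub>DF\<^esub> (\<theta> \<oplus>\<^bsub>DF\<^esub> \<zeta>)"
    proof (rule eqI[OF cl(1)[OF cl(1)[OF \<eta> \<theta>] \<zeta>] cl(1)[OF \<eta> cl(1)[OF \<theta> \<zeta>]]])
      fix S :: "('k,'s) module" and x assume S: "algebra K S" and x: "x \<in> carrier (ob F S)"
      interpret S: algebra K S by (rule S)
      show "(\<eta> \<oplus>\<^bsub>DF\<^esub> \<theta> \<oplus>\<^bsub>DF\<^esub> \<zeta>) S x = (\<eta> \<oplus>\<^bsub>DF\<^esub> (\<theta> \<oplus>\<^bsub>DF\<^esub> \<zeta>)) S x"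
        using dual_space_app_closed[OF \<eta> S x] dual_space_app_closed[OF \<theta> S x] dual_space_app_closed[OF \<zeta> S x]
        by (simp add: dual_space_app[OF S x] S.a_assoc)
    qed
  qed (rule cl(3))
  show ?thesis
  proof (rule moduleI[OF K ab])
    fix c \<eta> assume c: "c \<in> carrier K" and \<eta>: "\<eta> \<in> carrier DF"
    show "c \<odot>\<^bsub>DF\<^esub> \<eta> \<in> carrier DF" by (rule cl(2)[OF c \<eta>])
    {
      fix d assume d: "d \<in> carrier K"
      show "(c \<oplus>\<^bsub>K\<^esub> d) \<odot>\<^bsub>DF\<^esub> \<eta> = c \<odot>\<^bsub>DF\<^esub> \<eta> \<oplus>\<^bsub>DF\<^esub> d \<odot>\<^bsub>DF\<^esub> \<eta>"
      proof (rule eqI[OF cl(2)[OF K.a_closed[OF c d] \<eta>] cl(1)[OF cl(2)[OF c \<eta>] cl(2)[OF d \<eta>]]])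
        fix S :: "('k,'s) module" and x assume S: "algebra K S" and x: "x \<in> carrier (ob F S)"
        interpret S: algebra K S by (rule S)
        show "((c \<oplus>\<^bsub>K\<^esub> d) \<odot>\<^bsub>DF\<^esub> \<eta>) S x = (c \<odot>\<^bsub>DF\<^esub> \<eta> \<oplus>\<^bsub>DF\<^esub> d \<odot>\<^bsub>DF\<^esub> \<eta>) S x"
          using dual_space_app_closed[OF \<eta> S x] c d by (simp add: dual_space_app[OF S x] S.smult_l_distr)
      qed
      show "(c \<otimes>\<^bsub>K\<^esub> d) \<odot>\<^bsub>DF\<^esub> \<eta> = c \<odot>\<^bsub>DF\<^esub> (d \<odot>\<^bsub>DF\<^esub> \<eta>)"
      proof (rule eqI[OF cl(2)[OF K.m_closed[OF c d] \<eta>] cl(2)[OF c cl(2)[OF d \<eta>]]])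
        fix S :: "('k,'s) module" and x assume S: "algebra K S" and x: "x \<in> carrier (ob F S)"
        interpret S: algebra K S by (rule S)
        show "((c \<otimes>\<^bsub>K\<^esub> d) \<odot>\<^bsub>DF\<^esub> \<eta>) S x = (c \<odot>\<^bsub>DF\<^esub> (d \<odot>\<^bsub>DF\<^esub> \<eta>)) S x"
          using dual_space_app_closed[OF \<eta> S x] c d by (simp add: dual_space_app[OF S x] S.smult_assoc1)
      qed
    }
    fix \<theta> assume \<theta>: "\<theta> \<in> carrier DF"
    show "c \<odot>\<^bsub>DF\<^esub> (\<eta> \<oplus>\<^bsub>DF\<^esub> \<theta>) = c \<odot>\<^bsub>DF\<^esub> \<eta> \<oplus>\<^bsub>DF\<^esub> c \<odot>\<^bsub>DF\<^esub> \<theta>"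
    proof (rule eqI[OF cl(2)[OF c cl(1)[OF \<eta> \<theta>]] cl(1)[OF cl(2)[OF c \<eta>] cl(2)[OF c \<theta>]]])
      fix S :: "('k,'s) module" and x assume S: "algebra K S" and x: "x \<in> carrier (ob F S)"
      interpret S: algebra K S by (rule S)
      show "(c \<odot>\<^bsub>DF\<^esub> (\<eta> \<oplus>\<^bsub>DF\<^esub> \<theta>)) S x = (c \<odot>\<^bsub>DF\<^esub> \<eta> \<oplus>\<^bsub>DF\<^esub> c \<odot>\<^bsub>DF\<^esub> \<theta>) S x"
        using dual_space_app_closed[OF \<eta> S x] dual_space_app_closed[OF \<theta> S x] c
        by (simp add: dual_space_app[OF S x] S.smult_r_distr)
    qed
  next
    fix \<eta> assume \<eta>: "\<eta> \<in> carrier DF"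
    show "\<one>\<^bsub>K\<^esub> \<odot>\<^bsub>DF\<^esub> \<eta> = \<eta>"
    proof (rule eqI[OF cl(2)[OF K.one_closed \<eta>] \<eta>])
      fix S :: "('k,'s) module" and x assume S: "algebra K S" and x: "x \<in> carrier (ob F S)"
      interpret S: algebra K S by (rule S)
      show "(\<one>\<^bsub>K\<^esub> \<odot>\<^bsub>DF\<^esub> \<eta>) S x = \<eta> S x"
        using dual_space_app_closed[OF \<eta> S x] by (simp add: dual_space_app[OF S x])
    qed
  qed
qed

end

subsection \<open>Module schemes\<close>

lemma dual_functor_simps:
  "ob (dual_functor K M) S = hom_module K M S" "ar (dual_functor K M) S T \<phi> = push M \<phi>"
  by (simp_all add: dual_functor_def)

lemma push_app: "x \<in> carrier M \<Longrightarrow> push M \<phi> w x = \<phi> (w x)"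
  by simp

lemma push_linear:
  assumes M: "module K M" and S: "algebra K S" and T: "algebra K T" and \<phi>: "\<phi> \<in> alg_hom K S T"
  shows "linear_map S (hom_module K M S)
    ((hom_module K M T)\<lparr>smult := (\<lambda>s. smult (hom_module K M T) (\<phi> s))\<rparr>) (push M \<phi>)"
proof -
  interpret MT: module T "hom_module K M T" by (rule module_hom_module[OF M T])
  interpret MS: module S "hom_module K M S" by (rule module_hom_module[OF M S])
  note p = push_closed[OF M \<phi>]
  have ap: "w x \<in> carrier S" if "w \<in> carrier (hom_module K M S)" "x \<in> carrier M" for w x
    by (rule linear_mapD(1)[OF hom_module_linear[OF that(1)] that(2)])
  show ?thesis
  proof (rule linear_mapI; (simp only: smult_update_simps)?)
    fix v w assume v: "v \<in> carrier (hom_module K M S)"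
    show "push M \<phi> v \<in> carrier (hom_module K M T)" by (rule p[OF v])
    show "push M \<phi> (v \<oplus>\<^bsub>hom_module K M S\<^esub> w) = push M \<phi> v \<oplus>\<^bsub>hom_module K M T\<^esub> push M \<phi> w"
      if w: "w \<in> carrier (hom_module K M S)"
      by (rule hom_module_eqI[OF p[OF MS.M.a_closed[OF v w]] MT.M.a_closed[OF p[OF v] p[OF w]]])
        (simp add: hom_module_app ap v w alg_homD(6)[OF \<phi>])
    show "push M \<phi> (s \<odot>\<^bsub>hom_module K M S\<^esub> v) = \<phi> s \<odot>\<^bsub>hom_module K M T\<^esub> push M \<phi> v"
      if s: "s \<in> carrier S" for s
      by (rule hom_module_eqI[OF p[OF MS.smult_closed[OF s v]] MT.smult_closed[OF alg_homD(5)[OF \<phi> s] p[OF v]]])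
        (simp add: hom_module_app ap v s alg_homD(3)[OF \<phi>])
  qed
qed

lemma module_functor_dual: "module K M \<Longrightarrow> module_functor K (dual_functor K M)"
  unfolding module_functor_def dual_functor_simps
  by (intro conjI allI impI module_hom_module push_linear)

lemma sub_simps:
  "ob (sub F B) S = (ob F S)\<lparr>carrier := B S\<rparr>" "ar (sub F B) = ar F"
  by (simp_all add: sub_def)

lemma module_functor_sub:
  fixes F :: "('k,'s,'m) kfunctor"
  assumes F: "module_functor K F" and B: "subfunctor K F B"
  shows "module_functor K (sub F B)"
  unfolding module_functor_def sub_simps
proof (intro conjI allI impI)
  fix S :: "('k,'s) module" assume S: "algebra K S"
  have BS: "submodule (B S) S (ob F S)" using B S by (simp add: subfunctor_def)
  show "module S ((ob F S)\<lparr>carrier := B S\<rparr>)"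
    by (rule submodule.submodule_is_module[OF BS module_functorD(1)[OF F S]])
  fix T \<phi> assume T: "algebra K T" and \<phi>: "\<phi> \<in> alg_hom K S T"
  have sub: "B S \<subseteq> carrier (ob F S)"
    by (rule module.submoduleE(1)[OF module_functorD(1)[OF F S] BS])
  have im: "ar F S T \<phi> ` B S \<subseteq> B T" using B S T \<phi> by (simp add: subfunctor_def)
  note L = linear_mapD[OF module_functorD(2)[OF F S T \<phi>]]
  show "linear_map S ((ob F S)\<lparr>carrier := B S\<rparr>)
     ((ob F T)\<lparr>carrier := B T, smult := (\<lambda>s. smult ((ob F T)\<lparr>carrier := B T\<rparr>) (\<phi> s))\<rparr>) (ar F S T \<phi>)"
    using sub im L by (intro linear_mapI) (auto simp: subset_iff)
qed

lemma submodule_of_submodule: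
  assumes M: "module R M" and C: "submodule C R M" and B: "submodule B R M" and BC: "B \<subseteq> C"
  shows "submodule B R (M\<lparr>carrier := C\<rparr>)"
proof -
  interpret M: module R M by (rule M)
  interpret C: module R "M\<lparr>carrier := C\<rparr>" by (rule submodule.submodule_is_module[OF C M])
  note E = M.submoduleE[OF B]
  have "\<ominus>\<^bsub>M\<lparr>carrier := C\<rparr>\<^esub> a \<in> B" if "a \<in> B" for a
  proof -
    have "(\<ominus>\<^bsub>R\<^esub> \<one>\<^bsub>R\<^esub>) \<odot>\<^bsub>M\<lparr>carrier := C\<rparr>\<^esub> a = \<ominus>\<^bsub>M\<lparr>carrier := C\<rparr>\<^esub> a"
      using that BC C.smult_l_minus[of "\<one>\<^bsub>R\<^esub>" a] C.smult_one[of a] by auto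
    moreover have "(\<ominus>\<^bsub>R\<^esub> \<one>\<^bsub>R\<^esub>) \<odot>\<^bsub>M\<^esub> a \<in> B" using that by (intro E(4)) auto
    ultimately show ?thesis by simp
  qed
  then show ?thesis
    using BC E submodule_zero[OF B] by (intro C.submoduleI) auto
qed

lemma coset_carrier_update: "B +>\<^bsub>M\<lparr>carrier := C\<rparr>\<^esub> x = B +>\<^bsub>M\<^esub> x"
  by (simp add: a_r_coset_def r_coset_def)

lemma quot_simps:
  "ob (quot F B) S = quot_module (ob F S) (B S)"
  "ar (quot F B) S T \<phi> X = (\<Union>x\<in>X. B T +>\<^bsub>ob F T\<^esub> ar F S T \<phi> x)"
  by (simp_all add: quot_def)

context
  fixes K :: "('k,'x) ring_scheme" and F :: "('k,'s,'m) kfunctor" and B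
  assumes F: "module_functor K F" and B: "subfunctor K F B"
begin

lemma subfunctor_submodule: "algebra K S \<Longrightarrow> submodule (B S) S (ob F S)"
  using B by (simp add: subfunctor_def)

text \<open>The transition map of a quotient is defined as a union over representatives; it is a
  single coset because the transition map of \<open>F\<close> carries \<open>B S\<close> into
  \<open>B T\<close>.\<close>

lemma quot_ar_coset:
  assumes S: "algebra K S" and T: "algebra K T" and \<phi>: "\<phi> \<in> alg_hom K S T" and x: "x \<in> carrier (ob F S)"
  shows "ar (quot F B) S T \<phi> (B S +>\<^bsub>ob F S\<^esub> x) = B T +>\<^bsub>ob F T\<^esub> ar F S T \<phi> x"
proof -
  note FS = module_functorD(1)[OF F S] and FT = module_functorD(1)[OF F T]
  interpret FS: module S "ob F S" by (rule FS)
  interpret FT: module T "ob F T" by (rule FT)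
  note BS = subfunctor_submodule[OF S] and BT = subfunctor_submodule[OF T]
  let ?FT = "(ob F T)\<lparr>smult := (\<lambda>s. smult (ob F T) (\<phi> s))\<rparr>"
  have FT': "module S ?FT"
    by (rule module_smult_update[OF algebraD(2)[OF S] FT alg_homD(1)[OF \<phi>]])
  note L = module_functorD(2)[OF F S T \<phi>]
  have im: "ar F S T \<phi> ` B S \<subseteq> B T" using B S T \<phi> by (simp add: subfunctor_def)
  have "B T +>\<^bsub>ob F T\<^esub> ar F S T \<phi> y = B T +>\<^bsub>ob F T\<^esub> ar F S T \<phi> x" if y: "y \<in> B S +>\<^bsub>ob F S\<^esub> x" for y
  proof -
    have yF: "y \<in> carrier (ob F S)" "y \<ominus>\<^bsub>ob F S\<^esub> x \<in> B S"
      using coset_eqD[OF FS BS y x] FS.coset_eq_iff[OF BS _ x, of y] by blast+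
    have cl: "ar F S T \<phi> y \<in> carrier (ob F T)" "ar F S T \<phi> x \<in> carrier (ob F T)"
      using module_functor_ar_closed[OF F S T \<phi>] yF x by blast+
    have "ar F S T \<phi> (y \<ominus>\<^bsub>ob F S\<^esub> x) = ar F S T \<phi> y \<ominus>\<^bsub>?FT\<^esub> ar F S T \<phi> x"
      by (rule linear_map_minus[OF FS FT' L yF(1) x])
    also have "\<dots> = ar F S T \<phi> y \<ominus>\<^bsub>ob F T\<^esub> ar F S T \<phi> x"
      by (simp add: a_minus_def a_inv_def m_inv_def)
    finally have "ar F S T \<phi> y \<ominus>\<^bsub>ob F T\<^esub> ar F S T \<phi> x \<in> B T" using im yF(2) by (metis image_subset_iff)
    then show ?thesis using FT.coset_eq_iff[OF BT cl] by blast
  qed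
  then show ?thesis using coset_self[OF FS BS x] unfolding quot_simps by blast
qed

lemma module_functor_quot: "module_functor K (quot F B)"
  unfolding module_functor_def
proof (intro conjI allI impI)
  fix S :: "('k,'s) module" assume S: "algebra K S"
  note FS = module_functorD(1)[OF F S] and BS = subfunctor_submodule[OF S]
  interpret FS: module S "ob F S" by (rule FS)
  show "module S (ob (quot F B) S)" unfolding quot_simps by (rule module_quot[OF FS BS])
  fix T \<phi> assume T: "algebra K T" and \<phi>: "\<phi> \<in> alg_hom K S T"
  note FT = module_functorD(1)[OF F T] and BT = subfunctor_submodule[OF T]
  note L = linear_mapD[OF module_functorD(2)[OF F S T \<phi>], simplified]
  note ar = quot_ar_coset[OF S T \<phi>]
  have ex: "\<exists>x\<in>carrier (ob F S). X = B S +>\<^bsub>ob F S\<^esub> x" if "X \<in> carrier (ob (quot F B) S)" for X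
    using that unfolding quot_simps quot_carrier_iff .
  show "linear_map S (ob (quot F B) S)
    ((ob (quot F B) T)\<lparr>smult := (\<lambda>s. smult (ob (quot F B) T) (\<phi> s))\<rparr>) (ar (quot F B) S T \<phi>)"
  proof (rule linear_mapI; (simp only: smult_update_simps)?)
    fix X Y assume X: "X \<in> carrier (ob (quot F B) S)"
    then obtain x where x: "x \<in> carrier (ob F S)" "X = B S +>\<^bsub>ob F S\<^esub> x" using ex by blast
    show "ar (quot F B) S T \<phi> X \<in> carrier (ob (quot F B) T)"
      unfolding x(2) ar[OF x(1)] unfolding quot_simps by (rule coset_closed[OF FT BT L(1)[OF x(1)]])
    show "ar (quot F B) S T \<phi> (s \<odot>\<^bsub>ob (quot F B) S\<^esub> X) = \<phi> s \<odot>\<^bsub>ob (quot F B) T\<^esub> ar (quot F B) S T \<phi> X"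
      if s: "s \<in> carrier S" for s
      unfolding x(2) quot_simps(1) quot_smult[OF FS BS s x(1)] ar[OF x(1)] ar[OF FS.smult_closed[OF s x(1)]]
        quot_smult[OF FT BT alg_homD(5)[OF \<phi> s] L(1)[OF x(1)]] L(3)[OF s x(1)] ..
    show "ar (quot F B) S T \<phi> (X \<oplus>\<^bsub>ob (quot F B) S\<^esub> Y) = ar (quot F B) S T \<phi> X \<oplus>\<^bsub>ob (quot F B) T\<^esub> ar (quot F B) S T \<phi> Y"
      if Y: "Y \<in> carrier (ob (quot F B) S)"
    proof -
      obtain y where y: "y \<in> carrier (ob F S)" "Y = B S +>\<^bsub>ob F S\<^esub> y" using ex[OF Y] by blast
      show ?thesis
        unfolding x(2) y(2) quot_simps(1) quot_add[OF FS BS x(1) y(1)] ar[OF x(1)] ar[OF y(1)] ar[OF FS.M.a_closed[OF x(1) y(1)]]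
          quot_add[OF FT BT L(1)[OF x(1)] L(1)[OF y(1)]] L(2)[OF x(1) y(1)] ..
    qed
  qed
qed

end

subsection \<open>Symmetric powers of functors\<close>

lemma tuples_map:
  assumes "xs \<in> tuples n M" "\<And>x. x \<in> carrier M \<Longrightarrow> f x \<in> carrier N"
  shows "map f xs \<in> tuples n N"
  using assms by (auto simp: tuples_def subset_iff)

context
  fixes K :: "('k,'x) ring_scheme" and F :: "('k,'s,'m) kfunctor"
  assumes F: "module_functor K F"
begin

context
  fixes S T :: "('k,'s) module" and \<phi>
  assumes S: "algebra K S" and T: "algebra K T" and \<phi>: "\<phi> \<in> alg_hom K S T"
begin

abbreviation (input) "PT n \<equiv> (sym_power T n (ob F T))\<lparr>smult := (\<lambda>s. smult (sym_power T n (ob F T)) (\<phi> s))\<rparr>"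

lemma module_PT: "module S (PT n)"
  by (rule module_smult_update[OF algebraD(2)[OF S] module_sym_power[OF module_functorD(1)[OF F T]] alg_homD(1)[OF \<phi>]])

text \<open>The defining sum is the universal property over \<open>S\<close> of the symmetric power,
  applied to the \<open>S\<close>-module obtained from the symmetric power over \<open>T\<close> by
  restricting scalars along \<open>\<phi>\<close>. Independence from the representative and
  linearity then follow from the general lifting lemmas.\<close>

lemma sym_functor_ar: "ar (sym_functor n F) S T \<phi>
    = quot_lift (lin_ext S (PT n) (\<lambda>xs. sym_product T n (ob F T) (map (ar F S T \<phi>) xs)))"
  by (simp add: fun_eq_iff sym_functor_def quot_lift_def lin_ext_def Let_def finsum_smult_update)

lemma sym_functor_ar_multilinear:
  "sym_multilinear S n (ob F S) (PT n) (\<lambda>xs. sym_product T n (ob F T) (map (ar F S T \<phi>) xs))"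
proof -
  note L = linear_mapD[OF module_functorD(2)[OF F S T \<phi>], simplified]
  have tm: "map (ar F S T \<phi>) xs \<in> tuples n (ob F T)" if "xs \<in> tuples n (ob F S)" for xs
    using tuples_map[OF that L(1)] .
  have tin: "x \<in> carrier (ob F S)" if "xs @ x # ys \<in> tuples n (ob F S)" for xs x ys
    using that by (auto simp: tuples_def)
  show ?thesis
    unfolding sym_multilinear_def
  proof (intro conjI ballI allI impI; (simp only: smult_update_simps map_append list.map)?)
    fix xs assume "xs \<in> tuples n (ob F S)"
    then show "sym_product T n (ob F T) (map (ar F S T \<phi>) xs) \<in> carrier (sym_power T n (ob F T))"
      by (rule sym_multilinearD(1)[OF sym_product_multilinear[OF module_functorD(1)[OF F T]] tm])
  next
    fix xs x y ys assume a: "xs @ x # ys \<in> tuples n (ob F S)" "y \<in> carrier (ob F S)"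
    note t = tm[OF a(1), simplified map_append list.map]
    show "sym_product T n (ob F T) (map (ar F S T \<phi>) xs @ ar F S T \<phi> (x \<oplus>\<^bsub>ob F S\<^esub> y) # map (ar F S T \<phi>) ys)
      = sym_product T n (ob F T) (map (ar F S T \<phi>) xs @ ar F S T \<phi> x # map (ar F S T \<phi>) ys)
       \<oplus>\<^bsub>sym_power T n (ob F T)\<^esub> sym_product T n (ob F T) (map (ar F S T \<phi>) xs @ ar F S T \<phi> y # map (ar F S T \<phi>) ys)"
      unfolding L(2)[OF tin[OF a(1)] a(2)]
      by (rule sym_multilinearD(2)[OF sym_product_multilinear[OF module_functorD(1)[OF F T]] t L(1)[OF a(2)]])
  next
    fix xs x ys r assume a: "xs @ x # ys \<in> tuples n (ob F S)" "r \<in> carrier S"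
    note t = tm[OF a(1), simplified map_append list.map]
    show "sym_product T n (ob F T) (map (ar F S T \<phi>) xs @ ar F S T \<phi> (r \<odot>\<^bsub>ob F S\<^esub> x) # map (ar F S T \<phi>) ys)
      = \<phi> r \<odot>\<^bsub>sym_power T n (ob F T)\<^esub> sym_product T n (ob F T) (map (ar F S T \<phi>) xs @ ar F S T \<phi> x # map (ar F S T \<phi>) ys)"
      unfolding L(3)[OF a(2) tin[OF a(1)]]
      by (rule sym_multilinearD(3)[OF sym_product_multilinear[OF module_functorD(1)[OF F T]] t alg_homD(5)[OF \<phi> a(2)]])
  next
    fix xs x y ys assume a: "xs @ x # y # ys \<in> tuples n (ob F S)"
    note t = tm[OF a, simplified map_append list.map]
    show "sym_product T n (ob F T) (map (ar F S T \<phi>) xs @ ar F S T \<phi> x # ar F S T \<phi> y # map (ar F S T \<phi>) ys)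
      = sym_product T n (ob F T) (map (ar F S T \<phi>) xs @ ar F S T \<phi> y # ar F S T \<phi> x # map (ar F S T \<phi>) ys)"
      by (rule sym_multilinearD(4)[OF sym_product_multilinear[OF module_functorD(1)[OF F T]] t])
  qed
qed

lemma sym_functor_ar_product:
  "xs \<in> tuples n (ob F S) \<Longrightarrow> ar (sym_functor n F) S T \<phi> (sym_product S n (ob F S) xs)
    = sym_product T n (ob F T) (map (ar F S T \<phi>) xs)"
  unfolding sym_functor_ar
  by (rule sym_lift_product[OF module_functorD(1)[OF F S] module_PT sym_functor_ar_multilinear])

lemma sym_functor_ar_linear:
  "linear_map S (sym_power S n (ob F S)) (PT n) (ar (sym_functor n F) S T \<phi>)"
  unfolding sym_functor_ar
  by (rule sym_lift_linear[OF module_functorD(1)[OF F S] module_PT sym_functor_ar_multilinear])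

end

lemma sym_functor_ob: "ob (sym_functor n F) S = sym_power S n (ob F S)"
  by (simp add: sym_functor_def)

lemma module_functor_sym: "module_functor K (sym_functor n F)"
  unfolding module_functor_def sym_functor_ob
  by (intro conjI allI impI module_sym_power module_functorD(1)[OF F] sym_functor_ar_linear)

end

section \<open>Linear algebra over a field inside the universe\<close>

definition scalar_algebra :: "'k ring \<Rightarrow> ('k,'k) module" where
  "scalar_algebra K = \<lparr>carrier = carrier K, mult = mult K, one = one K, zero = zero K, add = add K,
     smult = mult K\<rparr>"

lemma scalar_algebra_simps:
  "carrier (scalar_algebra K) = carrier K"
  "x \<oplus>\<^bsub>scalar_algebra K\<^esub> y = x \<oplus>\<^bsub>K\<^esub> y"
  "x \<otimes>\<^bsub>scalar_algebra K\<^esub> y = x \<otimes>\<^bsub>K\<^esub> y"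
  "\<zero>\<^bsub>scalar_algebra K\<^esub> = \<zero>\<^bsub>K\<^esub>"
  "\<one>\<^bsub>scalar_algebra K\<^esub> = \<one>\<^bsub>K\<^esub>"
  "r \<odot>\<^bsub>scalar_algebra K\<^esub> x = r \<otimes>\<^bsub>K\<^esub> x"
  by (simp_all add: scalar_algebra_def)

lemma algebra_scalar_algebra:
  assumes "cring K" shows "algebra K (scalar_algebra K)"
proof -
  interpret K: cring K by fact
  have ab: "abelian_group (scalar_algebra K)"
    by (rule abelian_groupI)
      (auto simp: scalar_algebra_simps K.a_ac intro!: bexI[of _ "\<ominus>\<^bsub>K\<^esub> _"] K.l_neg)
  have cm: "Group.comm_monoid (scalar_algebra K)"
    by (rule comm_monoidI) (auto simp: scalar_algebra_simps K.m_ac)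
  have cr: "cring (scalar_algebra K)"
    by (rule cringI[OF ab cm]) (auto simp: scalar_algebra_simps K.l_distr)
  show ?thesis
    by (rule algebraI[OF assms cr]) (auto simp: scalar_algebra_simps K.l_distr K.r_distr K.m_assoc)
qed

text \<open>On the image of \<open>j\<close> the map is forced, and a retraction of \<open>N\<close>
  onto this image extends it to \<open>N\<close>. Since \<open>P\<close> may be any algebra
  \<open>S\<close>, this describes which \<open>S\<close>-valued functionals on \<open>M\<close>
  come from \<open>N\<close>.\<close>

lemma factor_through:
  fixes K :: "'k ring"
  assumes "field K" and M: "module K M" and N: "module K N" and P: "module K P"
    and j: "linear_map K M N j" and w: "linear_map K M P w"
    and ker: "\<And>a. a \<in> carrier M \<Longrightarrow> j a = \<zero>\<^bsub>N\<^esub> \<Longrightarrow> w a = \<zero>\<^bsub>P\<^esub>"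
  obtains v where "linear_map K N P v" "\<And>a. a \<in> carrier M \<Longrightarrow> w a = v (j a)"
proof -
  interpret K: field K by fact
  interpret M: module K M by fact
  interpret N: module K N by fact
  interpret P: module K P by fact
  note J = linear_mapD[OF j] and W = linear_mapD[OF w]
  have V: "submodule (j ` carrier M) K N"
  proof (rule N.submoduleI)
    show "\<zero>\<^bsub>N\<^esub> \<in> j ` carrier M" using linear_map_zero[OF M N j] by (metis M.M.zero_closed imageI)
    show "\<ominus>\<^bsub>N\<^esub> x \<in> j ` carrier M" if "x \<in> j ` carrier M" for x
      using that linear_map_neg[OF M N j] by (metis (no_types, lifting) M.M.a_inv_closed image_iff)
    show "x \<oplus>\<^bsub>N\<^esub> y \<in> j ` carrier M" if "x \<in> j ` carrier M" "y \<in> j ` carrier M" for x y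
      using that J(2) by (metis (no_types, lifting) M.M.a_closed image_iff)
    show "r \<odot>\<^bsub>N\<^esub> x \<in> j ` carrier M" if "r \<in> carrier K" "x \<in> j ` carrier M" for r x
      using that J(3) by (metis (no_types, lifting) M.smult_closed image_iff)
  qed (use J(1) in blast)
  have well: "w a = w b" if a: "a \<in> carrier M" and b: "b \<in> carrier M" and ab: "j a = j b" for a b
  proof -
    have "j (a \<ominus>\<^bsub>M\<^esub> b) = \<zero>\<^bsub>N\<^esub>"
      unfolding linear_map_minus[OF M N j a b] ab using J(1)[OF b] by (simp add: a_minus_def N.M.r_neg)
    then have "w a \<ominus>\<^bsub>P\<^esub> w b = \<zero>\<^bsub>P\<^esub>"
      using ker[of "a \<ominus>\<^bsub>M\<^esub> b"] a b linear_map_minus[OF M P w a b] by simp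
    then have "\<ominus>\<^bsub>P\<^esub> (\<ominus>\<^bsub>P\<^esub> w b) = w a"
      using W(1)[OF a] W(1)[OF b] by (intro P.M.minus_equality) (auto simp: a_minus_def)
    then show ?thesis using W(1)[OF b] by simp
  qed
  obtain \<pi> where \<pi>: "linear_map K N N \<pi>" "\<And>x. x \<in> carrier N \<Longrightarrow> \<pi> x \<in> j ` carrier M"
      "\<And>x. x \<in> j ` carrier M \<Longrightarrow> \<pi> x = x"
    by (rule K.linear_retraction[OF N V]) blast
  note PI = linear_mapD[OF \<pi>(1)]
  define s where "s = inv_into (carrier M) j"
  have s: "s (\<pi> x) \<in> carrier M" "j (s (\<pi> x)) = \<pi> x" if "x \<in> carrier N" for x
    using \<pi>(2)[OF that] unfolding s_def by (auto intro: inv_into_into f_inv_into_f)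
  show ?thesis
  proof (rule that[of "\<lambda>x. w (s (\<pi> x))"])
    show "linear_map K N P (\<lambda>x. w (s (\<pi> x)))"
    proof (rule linear_mapI)
      fix x assume x: "x \<in> carrier N"
      show "w (s (\<pi> x)) \<in> carrier P" by (rule W(1)[OF s(1)[OF x]])
      show "w (s (\<pi> (x \<oplus>\<^bsub>N\<^esub> y))) = w (s (\<pi> x)) \<oplus>\<^bsub>P\<^esub> w (s (\<pi> y))" if y: "y \<in> carrier N" for y
        unfolding W(2)[OF s(1)[OF x] s(1)[OF y], symmetric]
        by (rule well[OF s(1)[OF N.M.a_closed[OF x y]] M.M.a_closed[OF s(1)[OF x] s(1)[OF y]]])
          (rule trans[OF s(2)[OF N.M.a_closed[OF x y]]],
            simp only: J(2)[OF s(1)[OF x] s(1)[OF y]] s(2)[OF x] s(2)[OF y] PI(2)[OF x y])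
      show "w (s (\<pi> (r \<odot>\<^bsub>N\<^esub> x))) = r \<odot>\<^bsub>P\<^esub> w (s (\<pi> x))" if r: "r \<in> carrier K" for r
        unfolding W(3)[OF r s(1)[OF x], symmetric]
        by (rule well[OF s(1)[OF N.smult_closed[OF r x]] M.smult_closed[OF r s(1)[OF x]]])
          (rule trans[OF s(2)[OF N.smult_closed[OF r x]]],
            simp only: J(3)[OF r s(1)[OF x]] s(2)[OF x] PI(3)[OF r x])
    qed
    fix a assume a: "a \<in> carrier M"
    show "w a = w (s (\<pi> (j a)))"
      by (rule well[OF a s(1)[OF J(1)[OF a]]]) (rule trans[OF s(2)[OF J(1)[OF a]] \<pi>(3)[OF imageI[OF a]], symmetric])
  qed
qed

context char_zero_field
begin

abbreviation Kc :: "('k,'s) module" where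
  "Kc \<equiv> transport (scalar_algebra K) kemb"

lemma scalar_inj: "inj_on kemb (carrier (scalar_algebra K))"
  using kemb by (simp add: scalar_algebra_simps)

lemma scalar: "algebra K (scalar_algebra K)"
  by (rule algebra_scalar_algebra[OF is_cring])

lemma Kc_algebra: "algebra K Kc"
  by (rule transport_algebra[OF scalar scalar_inj])

text \<open>The difference of the identity and a retraction onto \<open>V\<close> vanishes on
  \<open>V\<close> but not at \<open>x\<close>, and some coordinate of its value at \<open>x\<close>
  is nonzero. Values in \<open>Kc\<close>, the copy of \<open>K\<close> in the universe, make the
  form a point of the module scheme dual to \<open>M\<close>.\<close>

lemma separation:
  assumes M: "module K M" and V: "submodule V K M" and x: "x \<in> carrier M" "x \<notin> V"
  obtains w where "linear_map K M Kc w" "\<And>v. v \<in> V \<Longrightarrow> w v = \<zero>\<^bsub>Kc\<^esub>" "w x \<noteq> \<zero>\<^bsub>Kc\<^esub>"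
proof -
  interpret M: module K M by fact
  interpret S: algebra K "scalar_algebra K" by (rule scalar)
  obtain \<pi> where \<pi>: "linear_map K M M \<pi>" "\<And>x. x \<in> carrier M \<Longrightarrow> \<pi> x \<in> V" "\<And>x. x \<in> V \<Longrightarrow> \<pi> x = x"
    by (rule linear_retraction[OF M V]) blast
  obtain B c where B: "B \<subseteq> carrier M" "linear_map K M (free_module K B) c"
    "\<And>x. x \<in> carrier M \<Longrightarrow> lin_ext K M (\<lambda>b. b) (c x) = x"
    by (rule coordinates[OF M M.independent_empty]) blast
  interpret F: module K "free_module K B" by (rule module_free_module)
  have VM: "V \<subseteq> carrier M" by (rule M.submoduleE(1)[OF V])
  let ?d = "\<lambda>x. x \<ominus>\<^bsub>M\<^esub> \<pi> x"
  have d: "linear_map K M M ?d"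
  proof -
    have "linear_map K M M (\<lambda>x. x \<oplus>\<^bsub>M\<^esub> ((\<ominus> \<one>) \<odot>\<^bsub>M\<^esub> \<pi> x))"
      by (rule linear_map_add[OF M linear_map_ident linear_map_smult[OF M \<pi>(1)]]) simp
    then show ?thesis
      by (rule linear_map_cong[OF _ M])
        (use linear_mapD(1)[OF \<pi>(1)] in \<open>simp add: M.smult_l_minus a_minus_def\<close>)
  qed
  have dx: "?d x \<in> carrier M" by (rule linear_mapD(1)[OF d x(1)])
  have "?d x \<noteq> \<zero>\<^bsub>M\<^esub>"
  proof
    assume "?d x = \<zero>\<^bsub>M\<^esub>"
    then have "x \<ominus>\<^bsub>M\<^esub> \<pi> x \<in> V" using submodule_zero[OF V] by simp
    then have "(x \<ominus>\<^bsub>M\<^esub> \<pi> x) \<oplus>\<^bsub>M\<^esub> \<pi> x \<in> V" using \<pi>(2)[OF x(1)] M.submoduleE(5)[OF V] by blast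
    moreover have "(x \<ominus>\<^bsub>M\<^esub> \<pi> x) \<oplus>\<^bsub>M\<^esub> \<pi> x = x"
      using x(1) linear_mapD(1)[OF \<pi>(1) x(1)] by (simp add: a_minus_def M.M.a_assoc M.M.l_neg)
    ultimately show False using x(2) by simp
  qed
  then have "c (?d x) \<noteq> (\<lambda>_. \<zero>)"
    using B(3)[OF dx] by (auto simp: lin_ext_def)
  then obtain b where b: "c (?d x) b \<noteq> \<zero>" by auto
  have cR: "c y b \<in> carrier K" if "y \<in> carrier M" for y
    by (rule free_module_apply[OF linear_mapD(1)[OF B(2) that]])
  have lin: "linear_map K M (scalar_algebra K) (\<lambda>y. c y b)"
    by (rule linear_mapI)
      (simp_all add: scalar_algebra_simps cR linear_mapD(2)[OF B(2)] linear_mapD(3)[OF B(2)])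
  have L: "linear_map K M Kc (\<lambda>y. kemb (c (?d y) b))"
    by (rule linear_map_comp[OF linear_map_comp[OF d lin] transport_linear[OF scalar scalar_inj]])
  have z: "\<zero>\<^bsub>Kc\<^esub> = kemb \<zero>"
    by (simp add: transport_simps[OF scalar scalar_inj] scalar_algebra_simps)
  show ?thesis
  proof (rule that[OF L])
    fix v assume v: "v \<in> V"
    have "?d v = \<zero>\<^bsub>M\<^esub>" using \<pi>(3)[OF v] v VM by (auto simp: a_minus_def M.M.r_neg)
    moreover have "c \<zero>\<^bsub>M\<^esub> = (\<lambda>_. \<zero>)"
      using linear_map_zero[OF M F.module_axioms B(2)] by simp
    ultimately show "kemb (c (?d v) b) = \<zero>\<^bsub>Kc\<^esub>" by (simp add: z)
  next
    show "kemb (c (?d x) b) \<noteq> \<zero>\<^bsub>Kc\<^esub>"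
      unfolding z using b inj_onD[OF kemb _ cR[OF dx] zero_closed] by blast
  qed
qed

text \<open>The case of one argument in \<open>multi_yoneda\<close>: tuples have length one, and a
  weighted sum of evaluations is evaluation at one combination of vectors. The elements of
  \<open>M\<close> may have any type as long as \<open>enc\<close> embeds the carrier;
  \<open>NN_enc\<close> relies on this.\<close>

lemma yoneda:
  fixes M :: "('k,'m,'y) module_scheme" and \<psi> :: "('k,'s) module \<Rightarrow> ('m \<Rightarrow> 's) \<Rightarrow> 's"
  assumes M: "module K M" and enc: "inj_on (enc :: 'm \<Rightarrow> 's) (carrier M)"
    and cl: "\<And>S w. algebra K S \<Longrightarrow> w \<in> carrier (hom_module K M S) \<Longrightarrow> \<psi> S w \<in> carrier S"
    and hom: "\<And>S w c. algebra K S \<Longrightarrow> w \<in> carrier (hom_module K M S) \<Longrightarrow> c \<in> carrier K \<Longrightarrow>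
      \<psi> S (\<lambda>x\<in>carrier M. c \<odot>\<^bsub>S\<^esub> w x) = c \<odot>\<^bsub>S\<^esub> \<psi> S w"
    and nat: "\<And>S T \<phi> w. algebra K S \<Longrightarrow> algebra K T \<Longrightarrow> \<phi> \<in> alg_hom K S T \<Longrightarrow>
      w \<in> carrier (hom_module K M S) \<Longrightarrow> \<psi> T (push M \<phi> w) = \<phi> (\<psi> S w)"
  obtains y where "y \<in> carrier M"
    "\<And>S w. algebra K S \<Longrightarrow> w \<in> carrier (hom_module K M S) \<Longrightarrow> \<psi> S w = w y"
proof -
  interpret M: module K M by (rule M)
  have one: "ws = [hd ws]" "hd ws \<in> carrier (hom_module K M S)"
    if "length ws = 1" "set ws \<subseteq> carrier (hom_module K M S)" for ws and S :: "('k,'s) module"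
    using that by (cases ws; auto)+
  obtain X :: "(nat \<times> 's) multiset set" and q tt where X: "finite X"
    "\<And>x. x \<in> X \<Longrightarrow> q x \<in> carrier K" "\<And>x. x \<in> X \<Longrightarrow> tt x \<in> tuples 1 M"
    "\<And>S ws. algebra K S \<Longrightarrow> length ws = 1 \<Longrightarrow> set ws \<subseteq> carrier (hom_module K M S) \<Longrightarrow>
      \<psi> S (hd ws) = finsum S (\<lambda>x. q x \<odot>\<^bsub>S\<^esub> eval_prod S ws (tt x)) X"
  proof (rule multi_yoneda[where \<Theta> = "\<lambda>S ws. \<psi> S (hd ws)" and n = 1, OF M enc])
    fix S :: "('k,'s) module" and ws assume a: "algebra K S" "length ws = 1" "set ws \<subseteq> carrier (hom_module K M S)"
    show "\<psi> S (hd ws) \<in> carrier S" by (rule cl[OF a(1) one(2)[OF a(2,3)]])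
    show "\<psi> S (hd (ws[i := (\<lambda>x\<in>carrier M. c \<odot>\<^bsub>S\<^esub> (ws ! i) x)])) = c \<odot>\<^bsub>S\<^esub> \<psi> S (hd ws)"
      if "i < 1" "c \<in> carrier K" for i c
      using hom[OF a(1) one(2)[OF a(2,3)] that(2)] that(1) a(2) by (cases ws) auto
    show "\<psi> T (hd (map (push M \<phi>) ws)) = \<phi> (\<psi> S (hd ws))" if "algebra K T" "\<phi> \<in> alg_hom K S T" for T \<phi>
      using nat[OF a(1) that one(2)[OF a(2,3)]] a(2) by (cases ws) auto
  qed blast
  have tM: "hd (tt x) \<in> carrier M" "tt x = [hd (tt x)]" if "x \<in> X" for x
    using X(3)[OF that] by (cases "tt x"; auto simp: tuples_def)+
  have qt: "(\<lambda>x. q x \<odot>\<^bsub>M\<^esub> hd (tt x)) \<in> X \<rightarrow> carrier M" using tM X(2) by blast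
  show ?thesis
  proof (rule that[of "finsum M (\<lambda>x. q x \<odot>\<^bsub>M\<^esub> hd (tt x)) X"])
    show "finsum M (\<lambda>x. q x \<odot>\<^bsub>M\<^esub> hd (tt x)) X \<in> carrier M" by (rule M.finsum_closed[OF qt])
    fix S :: "('k,'s) module" and w assume S: "algebra K S" and w: "w \<in> carrier (hom_module K M S)"
    interpret S: algebra K S by (rule S)
    note W = hom_module_linear[OF w]
    have "\<psi> S w = finsum S (\<lambda>x. q x \<odot>\<^bsub>S\<^esub> eval_prod S [w] (tt x)) X"
      using X(4)[OF S, of "[w]"] w by simp
    also have "\<dots> = finsum S (\<lambda>x. w (q x \<odot>\<^bsub>M\<^esub> hd (tt x))) X"
    proof (rule S.finsum_cong'[OF refl])
      show "(\<lambda>x. w (q x \<odot>\<^bsub>M\<^esub> hd (tt x))) \<in> X \<rightarrow> carrier S" using qt linear_mapD(1)[OF W] by blast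
      fix x assume x: "x \<in> X"
      have "eval_prod S [w] (tt x) = w (hd (tt x))"
        by (subst tM(2)[OF x]) (simp add: eval_prod_simps linear_mapD(1)[OF W tM(1)[OF x]])
      then show "q x \<odot>\<^bsub>S\<^esub> eval_prod S [w] (tt x) = w (q x \<odot>\<^bsub>M\<^esub> hd (tt x))"
        by (simp add: linear_mapD(3)[OF W X(2)[OF x] tM(1)[OF x]])
    qed
    also have "\<dots> = w (finsum M (\<lambda>x. q x \<odot>\<^bsub>M\<^esub> hd (tt x)) X)"
      by (rule linear_map_finsum[OF M S.module W qt, symmetric])
    finally show "\<psi> S w = w (finsum M (\<lambda>x. q x \<odot>\<^bsub>M\<^esub> hd (tt x)) X)" .
  qed
qed

end

section \<open>The filtration dual to the powers of the augmentation ideal\<close>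

locale bialgebra_universe = cocomm_bialgebra K A for K :: "'k ring" and A :: "('k,'a) bialgebra" +
  fixes emb :: "'a \<Rightarrow> 's"
  assumes emb: "inj emb"
    and char0: "\<forall>k::nat. k > 0 \<longrightarrow> add_pow K k \<one>\<^bsub>K\<^esub> \<noteq> \<zero>\<^bsub>K\<^esub>"
begin

text \<open>The scalars enter the universe through the multiples of the unit of \<open>A\<close>;
  these are distinct because the counit sends \<open>c\<close> times the unit back to
  \<open>c\<close>.\<close>

sublocale Kz: char_zero_field K "\<lambda>c. emb (c \<odot>\<^bsub>A\<^esub> \<one>\<^bsub>A\<^esub>)"
proof unfold_locales
  have e: "\<epsilon> (c \<odot>\<^bsub>A\<^esub> \<one>\<^bsub>A\<^esub>) = c" if "c \<in> carrier K" for c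
    using that by (simp add: counit_smult counit_one)
  show "inj_on (\<lambda>c. emb (c \<odot>\<^bsub>A\<^esub> \<one>\<^bsub>A\<^esub>)) (carrier K)"
  proof (rule inj_onI)
    fix c d assume cd: "c \<in> carrier K" "d \<in> carrier K" "emb (c \<odot>\<^bsub>A\<^esub> \<one>\<^bsub>A\<^esub>) = emb (d \<odot>\<^bsub>A\<^esub> \<one>\<^bsub>A\<^esub>)"
    have "\<epsilon> (c \<odot>\<^bsub>A\<^esub> \<one>\<^bsub>A\<^esub>) = \<epsilon> (d \<odot>\<^bsub>A\<^esub> \<one>\<^bsub>A\<^esub>)" by (simp only: injD[OF emb cd(3)])
    then show "c = d" by (simp only: e[OF cd(1)] e[OF cd(2)])
  qed
qed (use char0 in blast)

text \<open>For \<open>n = 0\<close> the only product is the unit \<open>\<epsilon>\<close>, whereas \<open>\<I>\<^sup>*\<^sup>0 = \<A>\<^sup>*\<close> is the annihilator of \<open>0\<close>.\<close>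

definition G :: "nat \<Rightarrow> 'a set" where
  "G n = (if n = 0 then {\<zero>\<^bsub>A\<^esub>} else
     {a \<in> carrier A. \<forall>(S :: ('k,'s) module) ws. algebra K S \<longrightarrow> length ws = n \<longrightarrow>
        set ws \<subseteq> aug_ideal K A S \<longrightarrow> conv_prod K A S ws a = \<zero>\<^bsub>S\<^esub>})"

lemma GD:
  assumes "a \<in> G n" "n > 0" "algebra K S" "length ws = n" "set ws \<subseteq> aug_ideal K A S"
  shows "conv_prod K A (S :: ('k,'s) module) ws a = \<zero>\<^bsub>S\<^esub>"
  using assms by (simp add: G_def)

lemma GI:
  assumes "a \<in> carrier A" "n > 0"
    "\<And>(S :: ('k,'s) module) ws. algebra K S \<Longrightarrow> length ws = n \<Longrightarrow> set ws \<subseteq> aug_ideal K A S \<Longrightarrow>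
      conv_prod K A S ws a = \<zero>\<^bsub>S\<^esub>"
  shows "a \<in> G n"
  using assms by (simp add: G_def)

lemma aug_H: "algebra K S \<Longrightarrow> set ws \<subseteq> aug_ideal K A S \<Longrightarrow> set ws \<subseteq> carrier (H S)"
  using aug_ideal_subset by blast

lemma G_subset: "G n \<subseteq> carrier A"
  by (auto simp: G_def)

lemma G_submodule: "submodule (G n) K A"
proof (cases "n = 0")
  case True
  then show ?thesis by (intro A.submoduleI) (auto simp: G_def)
next
  case False
  have lin: "linear_map K A S (conv_prod K A S ws)"
    if "algebra K S" "set ws \<subseteq> aug_ideal K A S" for S :: "('k,'s) module" and ws
    by (rule hom_module_linear[OF conv_prod_closed[OF that(1) aug_H[OF that]]])
  show ?thesis
  proof (rule A.submoduleI)
    show "\<zero>\<^bsub>A\<^esub> \<in> G n"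
      using False linear_map_zero[OF A_module algebraD(1) lin] by (intro GI) auto
    fix a assume a: "a \<in> G n"
    then have aA: "a \<in> carrier A" using G_subset by blast
    have z: "conv_prod K A S ws a = \<zero>\<^bsub>S\<^esub>"
      if "algebra K S" "length ws = n" "set ws \<subseteq> aug_ideal K A S" for S :: "('k,'s) module" and ws
      using GD[OF a _ that] False by simp
    show "\<ominus>\<^bsub>A\<^esub> a \<in> G n"
    proof (rule GI)
      fix S :: "('k,'s) module" and ws assume s: "algebra K S" "length ws = n" "set ws \<subseteq> aug_ideal K A S"
      interpret S: algebra K S by (rule s(1))
      show "conv_prod K A S ws (\<ominus>\<^bsub>A\<^esub> a) = \<zero>\<^bsub>S\<^esub>"
        by (simp only: linear_map_neg[OF A_module S.module lin[OF s(1,3)] aA] z[OF s] S.minus_zero)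
    qed (use aA False in auto)
    show "r \<odot>\<^bsub>A\<^esub> a \<in> G n" if r: "r \<in> carrier K" for r
    proof (rule GI)
      fix S :: "('k,'s) module" and ws assume s: "algebra K S" "length ws = n" "set ws \<subseteq> aug_ideal K A S"
      interpret S: algebra K S by (rule s(1))
      show "conv_prod K A S ws (r \<odot>\<^bsub>A\<^esub> a) = \<zero>\<^bsub>S\<^esub>"
        by (simp only: linear_mapD(3)[OF lin[OF s(1,3)] r aA] z[OF s] S.smult_r_null[OF r])
    qed (use aA r False in auto)
    show "a \<oplus>\<^bsub>A\<^esub> b \<in> G n" if b: "b \<in> G n" for b
    proof (rule GI)
      have bA: "b \<in> carrier A" using b G_subset by blast
      then show "a \<oplus>\<^bsub>A\<^esub> b \<in> carrier A" using aA by simp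
      fix S :: "('k,'s) module" and ws assume s: "algebra K S" "length ws = n" "set ws \<subseteq> aug_ideal K A S"
      interpret S: algebra K S by (rule s(1))
      have zb: "conv_prod K A S ws b = \<zero>\<^bsub>S\<^esub>" using GD[OF b _ s] False by simp
      show "conv_prod K A S ws (a \<oplus>\<^bsub>A\<^esub> b) = \<zero>\<^bsub>S\<^esub>"
        by (simp only: linear_mapD(2)[OF lin[OF s(1,3)] aA bA] z[OF s] zb S.l_zero S.zero_closed)
    qed (use False in auto)
  qed (rule G_subset)
qed

lemma one_in_G: "n > 0 \<Longrightarrow> \<one>\<^bsub>A\<^esub> \<in> G n"
  by (rule GI) (auto simp: conv_prod_vanish[of _ "[]", unfolded A_prod_simps])

text \<open>A product of \<open>n + 1\<close> factors is also a product of \<open>n\<close> factors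
  from the augmentation ideal: two of them are merged into one. For \<open>n = 0\<close> there is
  nothing to merge, but \<open>G 0\<close> is zero.\<close>

lemma G_mono: "G n \<subseteq> G (Suc n)"
proof (cases "n = 0")
  case True
  then show ?thesis using submodule_zero[OF G_submodule[of 1]] by (simp add: G_def[of 0])
next
  case False
  show ?thesis
  proof
    fix a assume a: "a \<in> G n"
    show "a \<in> G (Suc n)"
    proof (rule GI)
      fix S :: "('k,'s) module" and ws assume s: "algebra K S" "length ws = Suc n" "set ws \<subseteq> aug_ideal K A S"
      obtain u v ws' where ws: "ws = u # v # ws'"
        using s(2) False by (cases ws; cases "tl ws") auto
      have mem: "u \<in> aug_ideal K A S" "v \<in> aug_ideal K A S" "set ws' \<subseteq> aug_ideal K A S"
        using s(3) ws by auto
      have H: "u \<in> carrier (H S)" "v \<in> carrier (H S)" "conv_prod K A S ws' \<in> carrier (H S)"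
        using mem aug_ideal_subset[OF s(1)] conv_prod_closed[OF s(1) aug_H[OF s(1) mem(3)]] by auto
      have "conv_prod K A S ws = conv_prod K A S (conv K A S u v # ws')"
        by (simp add: ws conv_prod_Cons[OF s(1)] conv_assoc[OF s(1)] H)
      moreover have "conv_prod K A S (conv K A S u v # ws') a = \<zero>\<^bsub>S\<^esub>"
        by (rule GD[OF a _ s(1)]) (use False s(2) ws mem aug_ideal_conv[OF s(1) mem(1) H(2)] in auto)
      ultimately show "conv_prod K A S ws a = \<zero>\<^bsub>S\<^esub>" by simp
    qed (use a G_subset in auto)
  qed
qed

text \<open>The primitive elements. \<open>G 2\<close> is the sum of \<open>P\<close> and the
  multiples of the unit, so the cotangent functor, which consists of functionals on
  \<open>G 2\<close> vanishing at the unit, is dual to \<open>P\<close>.\<close>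

definition P :: "'a set" where
  "P = {p \<in> G 2. \<epsilon> p = \<zero>\<^bsub>K\<^esub>}"

lemma P_subset: "P \<subseteq> carrier A"
  using G_subset by (auto simp: P_def)

lemma P_submodule: "submodule P K A"
proof -
  note E = A.submoduleE[OF G_submodule[of 2]]
  have GA: "a \<in> carrier A" if "a \<in> G 2" for a using that E(1) by blast
  have e0: "\<epsilon> \<zero>\<^bsub>A\<^esub> = \<zero>\<^bsub>K\<^esub>"
    using counit_smult[of "\<zero>\<^bsub>K\<^esub>" "\<zero>\<^bsub>A\<^esub>"] counit_closed[of "\<zero>\<^bsub>A\<^esub>"] by simp
  have sm: "r \<odot>\<^bsub>A\<^esub> a \<in> P" if "r \<in> carrier K" "a \<in> P" for r a
    using that E(4) GA by (auto simp: P_def counit_smult)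
  show ?thesis
  proof (rule A.submoduleI[OF P_subset _ _ _ sm])
    show "\<zero>\<^bsub>A\<^esub> \<in> P" using submodule_zero[OF G_submodule] e0 by (simp add: P_def)
    show "a \<oplus>\<^bsub>A\<^esub> b \<in> P" if "a \<in> P" "b \<in> P" for a b
      using that E(5) GA by (auto simp: P_def counit_add)
    show "\<ominus>\<^bsub>A\<^esub> a \<in> P" if "a \<in> P" for a
      using sm[of "\<ominus>\<^bsub>K\<^esub> \<one>\<^bsub>K\<^esub>" a] that P_subset A.smult_l_minus[of "\<one>\<^bsub>K\<^esub>" a] by auto
  qed
qed

lemma P_prim:
  assumes S: "algebra K (S :: ('k,'s) module)" and p: "p \<in> P"
  shows "prim S p"
proof -
  have "conv K A S v w p = \<zero>\<^bsub>S\<^esub>" if v: "v \<in> aug_ideal K A S" and w: "w \<in> aug_ideal K A S" for v w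
  proof -
    have "w \<in> carrier (H S)" using w aug_ideal_subset[OF S] by blast
    then have "conv_prod K A S [v, w] = conv K A S v w"
      by (simp add: conv_prod_Cons[OF S] conv_prod_Nil[OF S] conv_comm[OF S, of w] conv_unit_closed[OF S] conv_unit_left[OF S])
    then show ?thesis using GD[of p 2 S "[v, w]"] p S v w by (simp add: P_def)
  qed
  then show ?thesis using p P_subset by (auto simp: prim_def P_def)
qed

text \<open>The index of the filtration exceeds the number of primitive factors by one:
  \<open>n + 1\<close> functionals cannot all be absorbed by \<open>n\<close> primitive
  elements.\<close>

lemma A_prod_in_G:
  assumes "set ps \<subseteq> P" shows "A_prod ps \<in> G (Suc (length ps))"
proof (rule GI)
  show "A_prod ps \<in> carrier A" using assms P_subset by (intro A_prod_closed) auto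
  fix S :: "('k,'s) module" and ws assume s: "algebra K S" "length ws = Suc (length ps)" "set ws \<subseteq> aug_ideal K A S"
  show "conv_prod K A S ws (A_prod ps) = \<zero>\<^bsub>S\<^esub>"
    by (rule conv_prod_vanish[OF s(1) _ s(3)]) (use assms s P_prim[OF s(1)] in auto)
qed simp

subsection \<open>Annihilators\<close>

text \<open>The annihilator of \<open>V\<close>. For a subspace \<open>V\<close> it is the module
  subscheme dual to the quotient of \<open>A\<close> by \<open>V\<close>.\<close>

definition Kill :: "'a set \<Rightarrow> ('k,'s) module \<Rightarrow> ('a \<Rightarrow> 's) set" where
  "Kill V S = {w \<in> carrier (H S). \<forall>a\<in>V. w a = \<zero>\<^bsub>S\<^esub>}"

lemma Kill_submodule:
  assumes V: "V \<subseteq> carrier A" and S: "algebra K S"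
  shows "submodule (Kill V S) S (H S)"
proof -
  interpret S: algebra K S by (rule S)
  interpret HS: module S "H S" by (rule module_hom_module[OF A_module S])
  have VA: "a \<in> carrier A" if "a \<in> V" for a using V that by blast
  have sm: "r \<odot>\<^bsub>H S\<^esub> w \<in> Kill V S" if "r \<in> carrier S" "w \<in> Kill V S" for r w
    using that by (simp add: Kill_def hom_module_app VA)
  show ?thesis
  proof (rule HS.submoduleI[OF _ _ _ _ sm])
    show "\<zero>\<^bsub>H S\<^esub> \<in> Kill V S" by (simp add: Kill_def hom_module_app VA)
    show "v \<oplus>\<^bsub>H S\<^esub> w \<in> Kill V S" if "v \<in> Kill V S" "w \<in> Kill V S" for v w
      using that by (simp add: Kill_def hom_module_app VA)
    show "\<ominus>\<^bsub>H S\<^esub> w \<in> Kill V S" if "w \<in> Kill V S" for w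
      using sm[of "\<ominus>\<^bsub>S\<^esub> \<one>\<^bsub>S\<^esub>" w] that HS.smult_l_minus[of "\<one>\<^bsub>S\<^esub>" w] by (auto simp: Kill_def)
  qed (auto simp: Kill_def)
qed

lemma Kill_subfunctor:
  assumes V: "V \<subseteq> carrier A" shows "subfunctor K (dual_functor K A) (Kill V)"
  unfolding subfunctor_def dual_functor_simps
proof (intro conjI allI impI image_subsetI)
  fix S T :: "('k,'s) module" and \<phi> w
  assume S: "algebra K S" and T: "algebra K T" and \<phi>: "\<phi> \<in> alg_hom K S T" and w: "w \<in> Kill V S"
  have "\<phi> \<zero>\<^bsub>S\<^esub> = \<zero>\<^bsub>T\<^esub>"
    by (rule linear_map_zero[OF algebraD(1)[OF S] algebraD(1)[OF T] alg_homD(2)[OF \<phi>]])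
  then show "push A \<phi> w \<in> Kill V T"
    using w V push_closed[OF A_module \<phi>, of w] by (auto simp: Kill_def)
qed (rule Kill_submodule[OF V])

lemma hom_minus_app:
  assumes "module K M" "algebra K (S :: ('k,'s) module)" "v \<in> carrier (hom_module K M S)" "w \<in> carrier (hom_module K M S)" "a \<in> carrier M"
  shows "(v \<ominus>\<^bsub>hom_module K M S\<^esub> w) a = v a \<ominus>\<^bsub>S\<^esub> w a"
proof -
  interpret S: algebra K S by (rule assms(2))
  interpret HS: module S "hom_module K M S" by (rule module_hom_module[OF assms(1,2)])
  have wa: "w a \<in> carrier S" by (rule linear_mapD(1)[OF hom_module_linear[OF assms(4)] assms(5)])
  have "\<ominus>\<^bsub>hom_module K M S\<^esub> w = (\<ominus>\<^bsub>S\<^esub> \<one>\<^bsub>S\<^esub>) \<odot>\<^bsub>hom_module K M S\<^esub> w"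
    using assms(4) HS.smult_l_minus[of "\<one>\<^bsub>S\<^esub>" w] by simp
  then have "(\<ominus>\<^bsub>hom_module K M S\<^esub> w) a = \<ominus>\<^bsub>S\<^esub> (w a)"
    using assms(5) wa by (simp add: hom_module_app S.l_minus)
  then show ?thesis using assms(5) by (simp add: a_minus_def hom_module_app)
qed

text \<open>Dividing by the annihilator of \<open>V\<close> amounts to restricting functionals to
  \<open>V\<close>. Through this, equations between classes become equations between values on
  \<open>G 2\<close> or on \<open>G (n + 1)\<close>.\<close>

lemma Kill_coset_eq:
  assumes V: "V \<subseteq> carrier A" and S: "algebra K S" and v: "v \<in> carrier (H S)" and w: "w \<in> carrier (H S)"
  shows "Kill V S +>\<^bsub>H S\<^esub> v = Kill V S +>\<^bsub>H S\<^esub> w \<longleftrightarrow> (\<forall>a\<in>V. v a = w a)"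
proof -
  interpret S: algebra K S by (rule S)
  interpret HS: module S "H S" by (rule module_hom_module[OF A_module S])
  have "v a \<ominus>\<^bsub>S\<^esub> w a = \<zero>\<^bsub>S\<^esub> \<longleftrightarrow> v a = w a" if "a \<in> V" for a
  proof -
    have c: "v a \<in> carrier S" "w a \<in> carrier S" using that V H_app_closed[OF S] v w by auto
    show ?thesis
    proof
      assume "v a \<ominus>\<^bsub>S\<^esub> w a = \<zero>\<^bsub>S\<^esub>"
      then have "\<ominus>\<^bsub>S\<^esub> (\<ominus>\<^bsub>S\<^esub> w a) = v a" using c by (intro S.minus_equality) (auto simp: a_minus_def)
      then show "v a = w a" using c by simp
    qed (use c in \<open>simp add: a_minus_def S.r_neg\<close>)
  qed
  moreover have "v \<ominus>\<^bsub>H S\<^esub> w \<in> Kill V S \<longleftrightarrow> (\<forall>a\<in>V. v a \<ominus>\<^bsub>S\<^esub> w a = \<zero>\<^bsub>S\<^esub>)"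
  proof -
    have "(v \<ominus>\<^bsub>H S\<^esub> w) a = v a \<ominus>\<^bsub>S\<^esub> w a" if "a \<in> V" for a
      by (rule hom_minus_app[OF A_module S v w]) (use V that in blast)
    then show ?thesis using HS.M.minus_closed[OF v w] by (simp add: Kill_def)
  qed
  ultimately show ?thesis
    unfolding HS.coset_eq_iff[OF Kill_submodule[OF V S] v w] by simp
qed

end

section \<open>Module subschemes of the dual of \<open>A\<close> and the powers of the augmentation
  ideal\<close>

lemma list_all2_replicate_right:
  "list_all2 R xs (replicate n y) \<longleftrightarrow> length xs = n \<and> (\<forall>x\<in>set xs. R x y)"
  by (induction n arbitrary: xs) (auto simp: list_all2_Cons2 length_Suc_conv)

context bialgebra_universe
begin

text \<open>The annihilator of \<open>V\<close> is dual to the quotient of \<open>A\<close> by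
  \<open>V\<close>. The candidate \<open>N\<close> must have elements of type \<open>'a\<close>, so
  the complement \<open>W\<close> of \<open>V\<close> in \<open>A\<close> takes the place of the
  quotient, and functionals on it are extended by composition with the projection
  \<open>d\<close>.\<close>

lemma Kill_module_subscheme:
  assumes V: "submodule V K A"
  shows "module_subscheme K A (Kill V)"
proof -
  have VA: "V \<subseteq> carrier A" by (rule A.submoduleE(1)[OF V])
  obtain \<pi> where \<pi>: "linear_map K A A \<pi>" "\<And>x. x \<in> carrier A \<Longrightarrow> \<pi> x \<in> V" "\<And>x. x \<in> V \<Longrightarrow> \<pi> x = x"
    by (rule K.linear_retraction[OF A_module V]) blast
  note PI = linear_mapD[OF \<pi>(1)]
  define d where "d x = x \<oplus>\<^bsub>A\<^esub> ((\<ominus>\<^bsub>K\<^esub> \<one>\<^bsub>K\<^esub>) \<odot>\<^bsub>A\<^esub> \<pi> x)" for x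
  have d: "linear_map K A A d"
    unfolding d_def by (rule linear_map_add[OF A_module linear_map_ident linear_map_smult[OF A_module \<pi>(1)]]) simp
  have d_eq: "d x = x \<ominus>\<^bsub>A\<^esub> \<pi> x" if "x \<in> carrier A" for x
    using that PI(1) by (simp add: d_def A.smult_l_minus a_minus_def)
  define W where "W = {x \<in> carrier A. \<pi> x = \<zero>\<^bsub>A\<^esub>}"
  have W: "submodule W K A" unfolding W_def by (rule kernel_submodule[OF A_module A_module \<pi>(1)])
  have WA: "W \<subseteq> carrier A" by (auto simp: W_def)
  have dW: "d x \<in> W" if x: "x \<in> carrier A" for x
  proof -
    have "\<pi> (d x) = \<pi> x \<ominus>\<^bsub>A\<^esub> \<pi> (\<pi> x)"
      unfolding d_eq[OF x] by (rule linear_map_minus[OF A_module A_module \<pi>(1) x PI(1)[OF x]])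
    also have "\<dots> = \<zero>\<^bsub>A\<^esub>"
      using \<pi>(3)[OF \<pi>(2)[OF x]] PI(1)[OF x] by (simp add: a_minus_def A.M.r_neg)
    finally show ?thesis using linear_mapD(1)[OF d x] by (simp add: W_def)
  qed
  have dWid: "d x = x" if "x \<in> W" for x using that d_eq[of x] by (simp add: W_def a_minus_def)
  have dV: "d x = \<zero>\<^bsub>A\<^esub>" if "x \<in> V" for x
    using that VA d_eq[of x] \<pi>(3)[OF that] by (auto simp: a_minus_def A.M.r_neg)
  \<comment> \<open>A fresh record: \<open>A\<close> with a smaller carrier would still have the
    bialgebra fields, and hence another type than the definition of \<open>module_subscheme\<close>
    asks for.\<close>
  define N :: "('k,'a) module" where "N = \<lparr>carrier = W, mult = undefined, one = undefined,
    zero = \<zero>\<^bsub>A\<^esub>, add = add A, smult = smult A\<rparr>"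
  have Ns: "carrier N = W" "\<zero>\<^bsub>N\<^esub> = \<zero>\<^bsub>A\<^esub>" "x \<oplus>\<^bsub>N\<^esub> y = x \<oplus>\<^bsub>A\<^esub> y" "c \<odot>\<^bsub>N\<^esub> x = c \<odot>\<^bsub>A\<^esub> x" for x y c
    by (simp_all add: N_def)
  have N: "module K N"
  proof -
    interpret W: module K "A\<lparr>carrier := W\<rparr>" by (rule submodule.submodule_is_module[OF W A_module])
    have "abelian_group N"
    proof (rule abelian_groupI)
      fix x assume "x \<in> carrier N"
      then show "\<exists>y\<in>carrier N. y \<oplus>\<^bsub>N\<^esub> x = \<zero>\<^bsub>N\<^esub>"
        using W.M.l_neg[of x] W.M.a_inv_closed[of x] by (auto simp: Ns)
    qed (use W.M.a_closed W.M.zero_closed W.M.a_assoc W.M.a_comm W.M.l_zero in \<open>auto simp: Ns\<close>)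
    then show ?thesis
      using W.smult_closed W.smult_l_distr W.smult_r_distr W.smult_assoc1 W.smult_one
      by (intro moduleI A.R.is_cring) (simp_all add: Ns)
  qed
  have dN: "linear_map K A N d"
    using dW linear_mapD[OF d] by (intro linear_mapI) (simp_all add: Ns)
  have inN: "linear_map K N A (\<lambda>x. x)"
    using WA by (intro linear_mapI) (auto simp: Ns)
  let ?g = "\<lambda>(S :: ('k,'s) module) f. (\<lambda>a\<in>carrier A. f (d a))"
  note F = module_functor_dual[OF N]
  note G = module_functor_sub[OF module_functor_dual[OF A_module] Kill_subfunctor[OF VA]]
  have f0: "f \<zero>\<^bsub>A\<^esub> = \<zero>\<^bsub>S\<^esub>" if "algebra K S" "f \<in> carrier (hom_module K N S)" for S :: "('k,'s) module" and f
    using linear_map_zero[OF N algebraD(1)[OF that(1)] hom_module_linear[OF that(2)]] by (simp add: Ns)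
  have gK: "?g S f \<in> Kill V S" if S: "algebra K S" and f: "f \<in> carrier (hom_module K N S)" for S :: "('k,'s) module" and f
    using hom_module_restrict[OF A_module linear_map_comp[OF dN hom_module_linear[OF f]]] VA dV f0[OF S f]
    by (auto simp: Kill_def)
  have gl: "linear_map S (hom_module K N S) ((H S)\<lparr>carrier := Kill V S\<rparr>) (?g S)" if S: "algebra K S" for S :: "('k,'s) module"
    by (rule linear_mapI) (use gK[OF S] dW in \<open>auto simp: hom_module_simps(3,4) Ns fun_eq_iff\<close>)
  have \<eta>: "mk_hom K (dual_functor K N) ?g \<in> functor_hom K (dual_functor K N) (sub (dual_functor K A) (Kill V))"
  proof (rule mk_hom_functor_hom[OF F]; unfold dual_functor_simps sub_simps)
    fix S :: "('k,'s) module" assume S: "algebra K S"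
    show "linear_map S (hom_module K N S) ((H S)\<lparr>carrier := Kill V S\<rparr>) (?g S)" by (rule gl[OF S])
    fix T \<phi> f assume "algebra K T" "\<phi> \<in> alg_hom K S T" "f \<in> carrier (hom_module K N S)"
    show "?g T (push N \<phi> f) = push A \<phi> (?g S f)"
      using dW by (auto simp: fun_eq_iff Ns)
  qed
  have "functor_iso K (dual_functor K N) (sub (dual_functor K A) (Kill V)) (mk_hom K (dual_functor K N) ?g)"
  proof (rule functor_iso_bij[OF F G \<eta>]; unfold dual_functor_simps sub_simps)
    fix S :: "('k,'s) module" assume S: "algebra K S"
    have app: "mk_hom K (dual_functor K N) ?g S f = ?g S f" if "f \<in> carrier (hom_module K N S)" for f
      by (rule mk_hom_app[OF S]) (simp add: dual_functor_simps that)
    have "bij_betw (?g S) (carrier (hom_module K N S)) (Kill V S)"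
    proof (rule bij_betwI[where g = "\<lambda>w. (\<lambda>x\<in>carrier N. w x)"])
      show "?g S \<in> carrier (hom_module K N S) \<rightarrow> Kill V S" using gK[OF S] by blast
      show "(\<lambda>w. \<lambda>x\<in>carrier N. w x) \<in> Kill V S \<rightarrow> carrier (hom_module K N S)"
        using hom_module_restrict[OF N linear_map_comp[OF inN hom_module_linear]] by (auto simp: Kill_def)
      show "(\<lambda>x\<in>carrier N. ?g S f x) = f" if f: "f \<in> carrier (hom_module K N S)" for f
        using f WA dWid unfolding hom_module_simps
        by (auto simp: fun_eq_iff Ns extensional_def)
      show "?g S (\<lambda>x\<in>carrier N. w x) = w" if w: "w \<in> Kill V S" for w
      proof -
        have wH: "w \<in> carrier (H S)" and wV: "\<And>a. a \<in> V \<Longrightarrow> w a = \<zero>\<^bsub>S\<^esub>" using w by (auto simp: Kill_def)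
        interpret S: algebra K S by (rule S)
        have "w (d a) = w a" if a: "a \<in> carrier A" for a
          unfolding d_eq[OF a] using linear_map_minus[OF A_module S.module hom_module_linear[OF wH] a PI(1)[OF a]]
            wV[OF \<pi>(2)[OF a]] H_app_closed[OF S wH a] by (simp add: a_minus_def)
        then show ?thesis using wH dW by (auto simp: fun_eq_iff Ns hom_module_simps extensional_def)
      qed
    qed
    then show "bij_betw (mk_hom K (dual_functor K N) ?g S) (carrier (hom_module K N S))
        (carrier ((H S)\<lparr>carrier := Kill V S\<rparr>))"
      by (simp only: bij_betw_cong[OF app] partial_object.simps) simp
  qed
  then show ?thesis
    unfolding module_subscheme_def using N Kill_subfunctor[OF VA] by blast
qed

text \<open>By Yoneda a module subscheme \<open>\<N>\<^sup>* \<subseteq> \<A>\<^sup>*\<close> is composition with a linear map \<open>j : A \<rightarrow> N\<close>. If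
  it contains the products of \<open>n\<close> elements of \<open>\<I>\<^sup>*\<close>, then \<open>ker j \<subseteq> G n\<close>.\<close>

lemma subscheme_contains_Kill:
  fixes S :: "('k,'s) module"
  assumes B: "module_subscheme K A B" and n: "n > 0"
    and im: "\<And>T :: ('k,'s) module. algebra K T \<Longrightarrow> mult_image K A (replicate n (aug_ideal K A)) T \<subseteq> B T"
    and S: "algebra K S"
  shows "Kill (G n) S \<subseteq> B S"
proof -
  obtain N :: "('k,'a) module" and \<eta> where N: "module K N"
    and iso: "functor_iso K (dual_functor K N) (sub (dual_functor K A) B) \<eta>"
    using B unfolding module_subscheme_def by blast
  then obtain \<theta> where \<eta>: "\<eta> \<in> functor_hom K (dual_functor K N) (sub (dual_functor K A) B)"
    and \<theta>: "\<theta> \<in> functor_hom K (sub (dual_functor K A) B) (dual_functor K N)"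
    and inv: "\<And>(S :: ('k,'s) module) y. algebra K S \<Longrightarrow> y \<in> carrier (ob (sub (dual_functor K A) B) S) \<Longrightarrow> \<eta> S (\<theta> S y) = y"
    unfolding functor_iso_def by blast
  have BH: "B T \<subseteq> carrier (H T)" if "algebra K T" for T :: "('k,'s) module"
    using module.submoduleE(1)[OF module_hom_module[OF A_module that]] B that
    by (simp add: module_subscheme_def subfunctor_def dual_functor_simps)
  note L = functor_homD(2)[OF \<eta>, unfolded dual_functor_simps sub_simps]
  have eB: "\<eta> T w \<in> B T" if "algebra K T" "w \<in> carrier (hom_module K N T)" for T :: "('k,'s) module" and w
    using linear_mapD(1)[OF L[OF that(1)] that(2)] by simp
  have eH: "\<eta> T w \<in> carrier (H T)" if "algebra K T" "w \<in> carrier (hom_module K N T)" for T :: "('k,'s) module" and w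
    using eB[OF that] BH[OF that(1)] by blast
  \<comment> \<open>For fixed \<open>a\<close> the value of \<open>\<eta> T w\<close> at
    \<open>a\<close> is natural in \<open>T\<close> and homogeneous in \<open>w\<close>, so it is
    evaluation of \<open>w\<close> at a vector \<open>y\<close> of \<open>N\<close>. These vectors
    define \<open>j\<close>.\<close>
  have "\<exists>y\<in>carrier N. \<forall>(T :: ('k,'s) module) w. algebra K T \<longrightarrow> w \<in> carrier (hom_module K N T) \<longrightarrow> \<eta> T w a = w y"
    if a: "a \<in> carrier A" for a
  proof -
    obtain y where "y \<in> carrier N"
      "\<And>(T :: ('k,'s) module) w. algebra K T \<Longrightarrow> w \<in> carrier (hom_module K N T) \<Longrightarrow> \<eta> T w a = w y"
    proof (rule Kz.yoneda[where \<psi> = "\<lambda>T w. \<eta> T w a", OF N inj_on_subset[OF emb subset_UNIV]])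
      fix T :: "('k,'s) module" and w assume T: "algebra K T" and w: "w \<in> carrier (hom_module K N T)"
      interpret T: algebra K T by (rule T)
      show "\<eta> T w a \<in> carrier T" by (rule H_app_closed[OF T eH[OF T w] a])
      show "\<eta> T (\<lambda>x\<in>carrier N. c \<odot>\<^bsub>T\<^esub> w x) a = c \<odot>\<^bsub>T\<^esub> \<eta> T w a" if c: "c \<in> carrier K" for c
      proof -
        have wc: "w x \<in> carrier T" if "x \<in> carrier N" for x
          by (rule linear_mapD(1)[OF hom_module_linear[OF w] that])
        have "(\<lambda>x\<in>carrier N. c \<odot>\<^bsub>T\<^esub> w x) = (c \<odot>\<^bsub>T\<^esub> \<one>\<^bsub>T\<^esub>) \<odot>\<^bsub>hom_module K N T\<^esub> w"
          using wc c by (auto simp: hom_module_simps T.smult_assoc2 fun_eq_iff)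
        then have "\<eta> T (\<lambda>x\<in>carrier N. c \<odot>\<^bsub>T\<^esub> w x) = (c \<odot>\<^bsub>T\<^esub> \<one>\<^bsub>T\<^esub>) \<odot>\<^bsub>H T\<^esub> \<eta> T w"
          using linear_mapD(3)[OF L[OF T] _ w, of "c \<odot>\<^bsub>T\<^esub> \<one>\<^bsub>T\<^esub>"] c by simp
        then show ?thesis using a c H_app_closed[OF T eH[OF T w] a] by (simp add: hom_module_app T.smult_assoc2)
      qed
      fix T' \<phi> assume T': "algebra K T'" and \<phi>: "\<phi> \<in> alg_hom K T T'"
      show "\<eta> T' (push N \<phi> w) a = \<phi> (\<eta> T w a)"
        using functor_homD(4)[OF \<eta> T T' \<phi>, unfolded dual_functor_simps sub_simps, OF w] a by simp
    qed blast
    then show ?thesis by blast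
  qed
  then obtain j where j: "\<And>a. a \<in> carrier A \<Longrightarrow> j a \<in> carrier N"
    "\<And>a (T :: ('k,'s) module) w. a \<in> carrier A \<Longrightarrow> algebra K T \<Longrightarrow> w \<in> carrier (hom_module K N T) \<Longrightarrow> \<eta> T w a = w (j a)"
    by metis
  interpret N: module K N by (rule N)
  \<comment> \<open>Functionals with values in \<open>Kz.Kc\<close> separate the points of
    \<open>N\<close>. Linearity of \<open>j\<close> can be checked after applying them, where it
    follows from linearity of the functionals \<open>\<eta> Kz.Kc w\<close>.\<close>
  have sep: "x = y" if xy: "x \<in> carrier N" "y \<in> carrier N"
    "\<And>w. w \<in> carrier (hom_module K N Kz.Kc) \<Longrightarrow> w x = w y" for x y
  proof (rule ccontr)
    assume "x \<noteq> y"
    then have ne: "x \<ominus>\<^bsub>N\<^esub> y \<notin> {\<zero>\<^bsub>N\<^esub>}"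
      using xy(1,2) N.M.minus_equality[of x "\<ominus>\<^bsub>N\<^esub> y"] by (auto simp: a_minus_def)
    have "submodule {\<zero>\<^bsub>N\<^esub>} K N" by (rule N.submoduleI) auto
    from Kz.separation[OF N this N.M.minus_closed[OF xy(1,2)] ne]
    obtain w where w: "linear_map K N Kz.Kc w" "w (x \<ominus>\<^bsub>N\<^esub> y) \<noteq> \<zero>\<^bsub>Kz.Kc\<^esub>" by blast
    interpret C: algebra K Kz.Kc by (rule Kz.Kc_algebra)
    have "w x = w y" using xy(3)[OF hom_module_restrict[OF N w(1)]] xy(1,2) by simp
    then show False
      using w(2) linear_map_minus[OF N C.module w(1) xy(1,2)] linear_mapD(1)[OF w(1) xy(2)]
      by (simp add: a_minus_def C.M.r_neg)
  qed
  have jl: "linear_map K A N j"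
  proof (rule linear_mapI)
    fix a assume a: "a \<in> carrier A"
    show "j a \<in> carrier N" by (rule j(1)[OF a])
    note C = Kz.Kc_algebra
    show "j (a \<oplus>\<^bsub>A\<^esub> b) = j a \<oplus>\<^bsub>N\<^esub> j b" if b: "b \<in> carrier A" for b
    proof (rule sep[OF j(1)[OF A.M.a_closed[OF a b]] N.M.a_closed[OF j(1)[OF a] j(1)[OF b]]])
      fix w assume w: "w \<in> carrier (hom_module K N Kz.Kc)"
      show "w (j (a \<oplus>\<^bsub>A\<^esub> b)) = w (j a \<oplus>\<^bsub>N\<^esub> j b)"
        by (simp only: linear_mapD(2)[OF hom_module_linear[OF w] j(1)[OF a] j(1)[OF b]]
            j(2)[OF A.M.a_closed[OF a b] C w, symmetric] j(2)[OF a C w, symmetric] j(2)[OF b C w, symmetric]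
            linear_mapD(2)[OF hom_module_linear[OF eH[OF C w]] a b])
    qed
    show "j (r \<odot>\<^bsub>A\<^esub> a) = r \<odot>\<^bsub>N\<^esub> j a" if r: "r \<in> carrier K" for r
    proof (rule sep[OF j(1)[OF A.smult_closed[OF r a]] N.smult_closed[OF r j(1)[OF a]]])
      fix w assume w: "w \<in> carrier (hom_module K N Kz.Kc)"
      show "w (j (r \<odot>\<^bsub>A\<^esub> a)) = w (r \<odot>\<^bsub>N\<^esub> j a)"
        by (simp only: linear_mapD(3)[OF hom_module_linear[OF w] r j(1)[OF a]]
            j(2)[OF A.smult_closed[OF r a] C w, symmetric] j(2)[OF a C w, symmetric]
            linear_mapD(3)[OF hom_module_linear[OF eH[OF C w]] r a])
    qed
  qed
  have ker: "a \<in> G n" if a: "a \<in> carrier A" "j a = \<zero>\<^bsub>N\<^esub>" for a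
  proof (rule GI[OF a(1) n])
    fix T :: "('k,'s) module" and ws assume T: "algebra K T" and ws: "length ws = n" "set ws \<subseteq> aug_ideal K A T"
    interpret HT: module T "H T" by (rule module_hom_module[OF A_module T])
    have "conv_prod K A T ws \<in> mult_image K A (replicate n (aug_ideal K A)) T"
      unfolding mult_image_def
      by (rule subsetD[OF HT.module_span_subset]) (use ws in \<open>auto simp: list_all2_replicate_right\<close>)
    then have b: "conv_prod K A T ws \<in> B T" using im[OF T] by blast
    let ?w = "\<theta> T (conv_prod K A T ws)"
    have w: "?w \<in> carrier (hom_module K N T)"
      using linear_mapD(1)[OF functor_homD(2)[OF \<theta> T, unfolded dual_functor_simps sub_simps], of "conv_prod K A T ws"] b by simp
    have "conv_prod K A T ws a = \<eta> T ?w a" using inv[OF T, of "conv_prod K A T ws"] b by (simp add: sub_simps)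
    also have "\<dots> = ?w \<zero>\<^bsub>N\<^esub>" using j(2)[OF a(1) T w] a(2) by simp
    also have "\<dots> = \<zero>\<^bsub>T\<^esub>" by (rule linear_map_zero[OF N algebraD(1)[OF T] hom_module_linear[OF w]])
    finally show "conv_prod K A T ws a = \<zero>\<^bsub>T\<^esub>" .
  qed
  show ?thesis
  proof
    fix w assume w: "w \<in> Kill (G n) S"
    then have wH: "w \<in> carrier (H S)" and w0: "\<And>a. a \<in> G n \<Longrightarrow> w a = \<zero>\<^bsub>S\<^esub>" by (auto simp: Kill_def)
    \<comment> \<open>A functional vanishing on \<open>G n\<close> vanishes on the kernel of
      \<open>j\<close>, so it factors through \<open>j\<close> and is a value of
      \<open>\<eta> S\<close>.\<close>
    from factor_through[OF field A_module N algebraD(1)[OF S] jl hom_module_linear[OF wH] w0[OF ker]]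
    obtain v where v: "linear_map K N S v" "\<And>a. a \<in> carrier A \<Longrightarrow> w a = v (j a)" by blast
    have vN: "(\<lambda>x\<in>carrier N. v x) \<in> carrier (hom_module K N S)" by (rule hom_module_restrict[OF N v(1)])
    have "w = \<eta> S (\<lambda>x\<in>carrier N. v x)"
      by (rule hom_module_eqI[OF wH eH[OF S vN]]) (simp add: j(2)[OF _ S vN] j(1) v(2))
    then show "w \<in> B S" using eB[OF S vN] by simp
  qed
qed

text \<open>\<open>Kill (G n)\<close> is one of the module subschemes over which the intersection is
  taken, and by \<open>subscheme_contains_Kill\<close> it lies in all of them. In degree zero both
  sides are the whole convolution algebra.\<close>

lemma aug_power_eq:
  fixes S :: "('k,'s) module"
  assumes S: "algebra K S" shows "aug_power K A n S = Kill (G n) S"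
proof (cases "n = 0")
  case True
  have "w \<zero>\<^bsub>A\<^esub> = \<zero>\<^bsub>S\<^esub>" if "w \<in> carrier (H S)" for w
    by (rule linear_map_zero[OF A_module algebraD(1)[OF S] hom_module_linear[OF that]])
  then show ?thesis using True by (auto simp: aug_power_def Kill_def G_def)
next
  case False
  then have n: "n > 0" by simp
  have mi: "mult_image K A (replicate n (aug_ideal K A)) T \<subseteq> Kill (G n) T" if T: "algebra K T" for T :: "('k,'s) module"
    unfolding mult_image_def
  proof (rule module.module_span_least[OF module_hom_module[OF A_module T] Kill_submodule[OF G_subset T]], rule subsetI)
    fix x assume "x \<in> {conv_prod K A T ws | ws. list_all2 (\<lambda>w J. w \<in> J T) ws (replicate n (aug_ideal K A))}"
    then obtain ws where x: "x = conv_prod K A T ws" and ws: "length ws = n" "set ws \<subseteq> aug_ideal K A T"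
      by (auto simp: list_all2_replicate_right)
    show "x \<in> Kill (G n) T"
      unfolding x using conv_prod_closed[OF T aug_H[OF T ws(2)]] GD[OF _ n T ws] by (simp add: Kill_def)
  qed
  have "Kill (G n) S \<subseteq> X" if "X \<in> {B S | B. module_subscheme K A B \<and>
      (\<forall>T. algebra K T \<longrightarrow> mult_image K A (replicate n (aug_ideal K A)) T \<subseteq> B T)}" for X
    using that subscheme_contains_Kill[OF _ n _ S] by blast
  then have "Kill (G n) S \<subseteq> ideal_product K A (replicate n (aug_ideal K A)) S"
    unfolding ideal_product_def by blast
  moreover have "ideal_product K A (replicate n (aug_ideal K A)) S \<subseteq> Kill (G n) S"
    unfolding ideal_product_def using Kill_module_subscheme[OF G_submodule[of n]] mi by blast
  ultimately show ?thesis using False by (simp add: aug_power_def)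
qed

subsection \<open>Products with an element of the closure of the square\<close>

lemma independent_one: "independent K A {\<one>\<^bsub>A\<^esub>}"
  unfolding independent_def
proof (intro conjI ballI impI)
  fix f assume f: "f \<in> carrier (free_module K {\<one>\<^bsub>A\<^esub>})" "lin_ext K A (\<lambda>b. b) f = \<zero>\<^bsub>A\<^esub>"
  have fK: "f i \<in> carrier K" for i by (rule A.R.free_module_apply[OF f(1)])
  have "lin_ext K A (\<lambda>b. b) f = finsum A (\<lambda>i. f i \<odot>\<^bsub>A\<^esub> i) {\<one>\<^bsub>A\<^esub>}"
    by (rule A.lin_ext_superset[OF f(1) _ A.free_support_subset[OF f(1)]]) auto
  then have "f \<one>\<^bsub>A\<^esub> \<odot>\<^bsub>A\<^esub> \<one>\<^bsub>A\<^esub> = \<zero>\<^bsub>A\<^esub>" using f(2) fK by simp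
  then have "\<epsilon> (f \<one>\<^bsub>A\<^esub> \<odot>\<^bsub>A\<^esub> \<one>\<^bsub>A\<^esub>) = \<epsilon> (\<zero>\<^bsub>K\<^esub> \<odot>\<^bsub>A\<^esub> \<one>\<^bsub>A\<^esub>)" by simp
  then have "f \<one>\<^bsub>A\<^esub> = \<zero>\<^bsub>K\<^esub>" using fK by (simp only: counit_smult counit_one Ar.one_closed A.R.zero_closed A.R.r_one)
  moreover have "f i = \<zero>\<^bsub>K\<^esub>" if "i \<noteq> \<one>\<^bsub>A\<^esub>" for i using A.free_support_subset[OF f(1)] that by auto
  ultimately show "f = (\<lambda>_. \<zero>\<^bsub>K\<^esub>)" by (metis ext)
qed simp

text \<open>With a basis of \<open>A\<close> containing the unit, \<open>\<Delta> a\<close> is a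
  finite sum of tensors \<open>sl b a \<otimes> b\<close> over basis vectors \<open>b\<close>. The
  coordinate functionals \<open>\<beta> S b\<close> for \<open>b\<close> other than the unit vanish
  at the unit, so they lie in the augmentation ideal; the term of the unit itself drops out because
  \<open>w\<close> vanishes there. The finite set \<open>D\<close> depends on \<open>a\<close>
  alone, not on \<open>S\<close>, \<open>V\<close> or \<open>w\<close>.\<close>

lemma coproduct_slices:
  obtains B and \<beta> :: "('k,'s) module \<Rightarrow> 'a \<Rightarrow> 'a \<Rightarrow> 's" and sl :: "'a \<Rightarrow> 'a \<Rightarrow> 'a" where
    "B \<subseteq> carrier A"
    "\<And>S b. algebra K S \<Longrightarrow> b \<in> B \<Longrightarrow> \<beta> S b \<in> aug_ideal K A S"
    "\<And>a b. a \<in> carrier A \<Longrightarrow> b \<in> B \<Longrightarrow> sl b a \<in> carrier A"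
    "\<And>S V a b. algebra K S \<Longrightarrow> V \<in> carrier (H S) \<Longrightarrow> a \<in> carrier A \<Longrightarrow> b \<in> B \<Longrightarrow>
      conv K A S V (\<beta> S b) a = V (sl b a)"
    "\<And>a. a \<in> carrier A \<Longrightarrow> \<exists>D. finite D \<and> D \<subseteq> B \<and>
      (\<forall>(S :: ('k,'s) module) V w. algebra K S \<longrightarrow> V \<in> carrier (H S) \<longrightarrow> w \<in> aug_ideal K A S \<longrightarrow>
        conv K A S V w a = finsum S (\<lambda>b. w b \<otimes>\<^bsub>S\<^esub> V (sl b a)) D)"
proof -
  note MA = A_module A_module
  obtain B c where B: "{\<one>\<^bsub>A\<^esub>} \<subseteq> B" "B \<subseteq> carrier A" "linear_map K A (free_module K B) c"
    "\<And>x. x \<in> carrier A \<Longrightarrow> lin_ext K A (\<lambda>b. b) (c x) = x"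
    "\<And>f. f \<in> carrier (free_module K B) \<Longrightarrow> c (lin_ext K A (\<lambda>b. b) f) = f"
    using K.coordinates[OF A_module independent_one] by metis
  have c: "c y \<in> carrier (free_module K B)" if "y \<in> carrier A" for y by (rule linear_mapD(1)[OF B(3) that])
  have cK: "c y b \<in> carrier K" if "y \<in> carrier A" for y b by (rule A.R.free_module_apply[OF c[OF that]])
  have c_add: "c (y \<oplus>\<^bsub>A\<^esub> z) b = c y b \<oplus>\<^bsub>K\<^esub> c z b" if "y \<in> carrier A" "z \<in> carrier A" for y z b
    using linear_mapD(2)[OF B(3) that] by simp
  have c_smult: "c (r \<odot>\<^bsub>A\<^esub> y) b = r \<otimes>\<^bsub>K\<^esub> c y b" if "r \<in> carrier K" "y \<in> carrier A" for r y b
    using linear_mapD(3)[OF B(3) that] by simp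
  have c_one: "c \<one>\<^bsub>A\<^esub> = free_gen K \<one>\<^bsub>A\<^esub>"
    using B(5)[of "free_gen K \<one>\<^bsub>A\<^esub>"] B(1) A.R.free_gen_closed[of "\<one>\<^bsub>A\<^esub>" B] A.lin_ext_gen[of "\<lambda>b. b" "\<one>\<^bsub>A\<^esub>"] by simp
  define \<beta> where "\<beta> S b = (\<lambda>y\<in>carrier A. c y b \<odot>\<^bsub>S\<^esub> \<one>\<^bsub>S\<^esub>)" for S :: "('k,'s) module" and b
  define sl where "sl b a = tensor_lift K A (\<lambda>x y. c y b \<odot>\<^bsub>A\<^esub> x) (\<Delta> a)" for b a
  have bl: "bilinear K A A A (\<lambda>x y. c y b \<odot>\<^bsub>A\<^esub> x)" for b
    by (intro bilinearI linear_mapI)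
      (simp_all add: cK c_add c_smult A.smult_r_distr A.smult_l_distr A.smult_assoc1[symmetric] A.R.m_comm)
  have \<beta>H: "\<beta> S b \<in> carrier (H S)" if S: "algebra K S" for S :: "('k,'s) module" and b
  proof -
    interpret S: algebra K S by (rule S)
    show ?thesis unfolding \<beta>_def
      by (rule hom_module_restrict[OF A_module], rule linear_mapI)
        (simp_all add: cK c_add c_smult S.smult_l_distr S.smult_assoc1)
  qed
  have conv_\<beta>: "conv K A S V (\<beta> S b) a = V (sl b a)"
    if S: "algebra K S" and V: "V \<in> carrier (H S)" and a: "a \<in> carrier A" for S :: "('k,'s) module" and V a b
  proof -
    interpret S: algebra K S by (rule S)
    have "V (sl b a) = tensor_lift K S (\<lambda>x y. V (c y b \<odot>\<^bsub>A\<^esub> x)) (\<Delta> a)"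
      unfolding sl_def by (rule linear_tensor_lift[OF MA A_module S.module bl hom_module_linear[OF V] comult_closed[OF a]])
    also have "\<dots> = conv K A S V (\<beta> S b) a"
      unfolding conv_app[OF S a]
    proof (rule tensor_lift_cong[OF MA S.module conv_bilinear[OF S V \<beta>H[OF S]] _ comult_closed[OF a]])
      fix x y assume xy: "x \<in> carrier A" "y \<in> carrier A"
      have Vx: "V x \<in> carrier S" by (rule H_app_closed[OF S V xy(1)])
      have "V x \<otimes>\<^bsub>S\<^esub> (c y b \<odot>\<^bsub>S\<^esub> \<one>\<^bsub>S\<^esub>) = (c y b \<odot>\<^bsub>S\<^esub> \<one>\<^bsub>S\<^esub>) \<otimes>\<^bsub>S\<^esub> V x"
        using Vx cK[OF xy(2)] by (intro S.m_comm) auto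
      also have "\<dots> = c y b \<odot>\<^bsub>S\<^esub> V x" using Vx cK[OF xy(2)] by (simp add: S.smult_assoc2)
      finally show "V (c y b \<odot>\<^bsub>A\<^esub> x) = V x \<otimes>\<^bsub>S\<^esub> \<beta> S b y"
        using xy by (simp add: \<beta>_def linear_mapD(3)[OF hom_module_linear[OF V] cK[OF xy(2)] xy(1)])
    qed
    finally show ?thesis by simp
  qed
  show ?thesis
  proof (rule that[of "B - {\<one>\<^bsub>A\<^esub>}" \<beta> sl])
    show "B - {\<one>\<^bsub>A\<^esub>} \<subseteq> carrier A" using B(2) by blast
    show "\<beta> S b \<in> aug_ideal K A S" if S: "algebra K S" and b: "b \<in> B - {\<one>\<^bsub>A\<^esub>}" for S :: "('k,'s) module" and b
    proof -
      interpret S: algebra K S by (rule S)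
      have "c \<one>\<^bsub>A\<^esub> b = \<zero>\<^bsub>K\<^esub>" using b by (auto simp: c_one free_gen_def)
      then show ?thesis using \<beta>H[OF S, of b] by (simp add: aug_ideal_iff[OF S] \<beta>_def)
    qed
    show "sl b a \<in> carrier A" if "a \<in> carrier A" for a b
      unfolding sl_def by (rule linear_mapD(1)[OF tensor_lift_linear[OF MA A_module bl] comult_closed[OF that]])
    show "conv K A S V (\<beta> S b) a = V (sl b a)"
      if "algebra K S" "V \<in> carrier (H S)" "a \<in> carrier A" for S :: "('k,'s) module" and V a b
      by (rule conv_\<beta>[OF that])
    fix a assume a: "a \<in> carrier A"
    obtain f where f: "f \<in> carrier (free_module K (carrier A \<times> carrier A))"
      "\<Delta> a = tensor_kernel K A A +>\<^bsub>free_module K (carrier A \<times> carrier A)\<^esub> f"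
      by (rule tensor_carrierE[OF MA comult_closed[OF a]])
    let ?I = "{i. f i \<noteq> \<zero>\<^bsub>K\<^esub>}"
    have I: "finite ?I" "?I \<subseteq> carrier A \<times> carrier A"
      using A.free_support_finite[OF f(1)] A.free_support_subset[OF f(1)] by auto
    \<comment> \<open>All coordinates, except that of the unit, that occur in the second components
      of one representative of \<open>\<Delta> a\<close>.\<close>
    let ?D = "(\<Union>i\<in>?I. {b. c (snd i) b \<noteq> \<zero>\<^bsub>K\<^esub>}) - {\<one>\<^bsub>A\<^esub>}"
    have sI: "snd i \<in> carrier A" if "i \<in> ?I" for i using I(2) that by auto
    have D: "finite ?D" "?D \<subseteq> B - {\<one>\<^bsub>A\<^esub>}"
    proof -
      show "finite ?D"
        using I(1) A.free_support_finite[OF c[OF sI]] by (intro finite_Diff finite_UN_I) auto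
      show "?D \<subseteq> B - {\<one>\<^bsub>A\<^esub>}" using A.free_support_subset[OF c[OF sI]] by blast
    qed
    have "conv K A S V w a = finsum S (\<lambda>b. w b \<otimes>\<^bsub>S\<^esub> V (sl b a)) ?D"
      if S: "algebra K S" and V: "V \<in> carrier (H S)" and w: "w \<in> aug_ideal K A S" for S :: "('k,'s) module" and V w
    proof -
      interpret S: algebra K S by (rule S)
      interpret HS: module S "H S" by (rule module_hom_module[OF A_module S])
      have wH: "w \<in> carrier (H S)" and w1: "w \<one>\<^bsub>A\<^esub> = \<zero>\<^bsub>S\<^esub>" using w by (auto simp: aug_ideal_iff[OF S])
      have DA: "b \<in> carrier A" if "b \<in> ?D" for b using D(2) B(2) that by blast
      have wS: "w b \<in> carrier S" if "b \<in> carrier A" for b by (rule H_app_closed[OF S wH that])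
      let ?w = "finsum (H S) (\<lambda>b. w b \<odot>\<^bsub>H S\<^esub> \<beta> S b) ?D"
      have tcl: "(\<lambda>b. w b \<odot>\<^bsub>H S\<^esub> \<beta> S b) \<in> ?D \<rightarrow> carrier (H S)"
        using wS[OF DA] \<beta>H[OF S] by (intro funcsetI HS.smult_closed) auto
      have wDH: "?w \<in> carrier (H S)" by (rule HS.M.finsum_closed[OF tcl])
      \<comment> \<open>\<open>regular_module S\<close> and \<open>S\<close> have the same addition,
        hence the same finite sums.\<close>
      have addm: "finsum (regular_module S) = finsum S" by (simp add: finsum_def finprod_def regular_module_def fun_eq_iff)
      \<comment> \<open>On the second components of the representative, \<open>w\<close> coincides
        with a finite combination of the functionals \<open>\<beta> S b\<close>. The value of
        \<open>conv\<close> at \<open>a\<close> only involves these components, so \<open>w\<close>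
        may be replaced by the combination.\<close>
      have w_eq: "w y = ?w y" if i: "i \<in> ?I" and y: "y = snd i" for i y
      proof -
        have yA: "y \<in> carrier A" using sI[OF i] y by simp
        let ?E = "{b. c y b \<noteq> \<zero>\<^bsub>K\<^esub>}"
        have E: "finite ?E" "?E \<subseteq> carrier A" "?E - {\<one>\<^bsub>A\<^esub>} \<subseteq> ?D"
          using A.free_support_finite[OF c[OF yA]] A.free_support_subset[OF c[OF yA]] B(2) i y by auto
        have EA: "b \<in> carrier A" if "c y b \<noteq> \<zero>\<^bsub>K\<^esub>" for b using E(2) that by blast
        have "w y = w (finsum A (\<lambda>b. c y b \<odot>\<^bsub>A\<^esub> b) ?E)" using B(4)[OF yA] by (simp add: lin_ext_def)
        also have "\<dots> = finsum S (\<lambda>b. w (c y b \<odot>\<^bsub>A\<^esub> b)) ?E"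
          using cK[OF yA] EA by (intro linear_map_finsum[OF A_module S.module hom_module_linear[OF wH]]) auto
        also have "\<dots> = finsum S (\<lambda>b. w b \<otimes>\<^bsub>S\<^esub> \<beta> S b y) ?E"
        proof (rule S.finsum_cong'[OF refl])
          show "(\<lambda>b. w b \<otimes>\<^bsub>S\<^esub> \<beta> S b y) \<in> ?E \<rightarrow> carrier S"
            using wS EA H_app_closed[OF S \<beta>H[OF S] yA] by auto
          fix b assume "b \<in> ?E"
          then have bA: "b \<in> carrier A" using EA by simp
          have "w b \<otimes>\<^bsub>S\<^esub> (c y b \<odot>\<^bsub>S\<^esub> \<one>\<^bsub>S\<^esub>) = (c y b \<odot>\<^bsub>S\<^esub> \<one>\<^bsub>S\<^esub>) \<otimes>\<^bsub>S\<^esub> w b"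
            using wS[OF bA] cK[OF yA] by (intro S.m_comm) auto
          also have "\<dots> = c y b \<odot>\<^bsub>S\<^esub> w b" using wS[OF bA] cK[OF yA] by (simp add: S.smult_assoc2)
          finally show "w (c y b \<odot>\<^bsub>A\<^esub> b) = w b \<otimes>\<^bsub>S\<^esub> \<beta> S b y"
            using yA by (simp add: \<beta>_def linear_mapD(3)[OF hom_module_linear[OF wH] cK[OF yA] bA])
        qed
        also have "\<dots> = finsum S (\<lambda>b. w b \<otimes>\<^bsub>S\<^esub> \<beta> S b y) (?E - {\<one>\<^bsub>A\<^esub>})"
          using E(1) wS EA H_app_closed[OF S \<beta>H[OF S] yA] w1
          by (intro finsum_mono_neutral[OF S.M.abelian_monoid_axioms, symmetric]) auto
        also have "\<dots> = finsum S (\<lambda>b. w b \<otimes>\<^bsub>S\<^esub> \<beta> S b y) ?D"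
        proof (rule finsum_mono_neutral[OF S.M.abelian_monoid_axioms D(1) E(3)])
          show "(\<lambda>b. w b \<otimes>\<^bsub>S\<^esub> \<beta> S b y) \<in> ?D \<rightarrow> carrier S"
            using wS[OF DA] H_app_closed[OF S \<beta>H[OF S] yA] by auto
          fix b assume b: "b \<in> ?D - (?E - {\<one>\<^bsub>A\<^esub>})"
          then have "c y b = \<zero>\<^bsub>K\<^esub>" by auto
          then show "w b \<otimes>\<^bsub>S\<^esub> \<beta> S b y = \<zero>\<^bsub>S\<^esub>" using b wS[OF DA, of b] yA by (simp add: \<beta>_def)
        qed
        also have "\<dots> = finsum S (\<lambda>b. (w b \<odot>\<^bsub>H S\<^esub> \<beta> S b) y) ?D"
          using yA by (simp add: hom_module_app)
        also have "\<dots> = ?w y"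
          using linear_map_finsum[OF HS.module_axioms module_regular[OF S] evaluation_linear[OF S yA] tcl]
          by (simp add: addm)
        finally show ?thesis .
      qed
      have "conv K A S V w a = lin_ext K S (\<lambda>i. V (fst i) \<otimes>\<^bsub>S\<^esub> w (snd i)) f"
        unfolding conv_app[OF S a] f(2) by (rule tensor_lift_coset[OF MA S.module conv_bilinear[OF S V wH] f(1)])
      also have "\<dots> = lin_ext K S (\<lambda>i. V (fst i) \<otimes>\<^bsub>S\<^esub> ?w (snd i)) f"
        unfolding lin_ext_def
      proof (rule S.finsum_cong'[OF refl])
        show "(\<lambda>i. f i \<odot>\<^bsub>S\<^esub> (V (fst i) \<otimes>\<^bsub>S\<^esub> ?w (snd i))) \<in> ?I \<rightarrow> carrier S"
        proof
          fix i assume i: "i \<in> ?I"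
          then have "fst i \<in> carrier A" "snd i \<in> carrier A" using I(2) by auto
          then show "f i \<odot>\<^bsub>S\<^esub> (V (fst i) \<otimes>\<^bsub>S\<^esub> ?w (snd i)) \<in> carrier S"
            using A.R.free_module_apply[OF f(1)] H_app_closed[OF S V] H_app_closed[OF S wDH] by simp
        qed
      qed (simp only: w_eq[OF _ refl])
      also have "\<dots> = conv K A S V ?w a"
        unfolding conv_app[OF S a] f(2) by (rule tensor_lift_coset[OF MA S.module conv_bilinear[OF S V wDH] f(1), symmetric])
      also have "\<dots> = finsum S (\<lambda>b. conv K A S V (w b \<odot>\<^bsub>H S\<^esub> \<beta> S b) a) ?D"
      proof -
        have "linear_map S (H S) (regular_module S) (\<lambda>u. conv K A S V u a)"
          by (rule linear_mapI)
            (simp_all add: regular_module_simps a hom_module_app conv_add_right[OF S] conv_smult_right[OF S] V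
              H_app_closed[OF S conv_closed[OF S]])
        from linear_map_finsum[OF HS.module_axioms module_regular[OF S] this tcl]
        show ?thesis by (simp add: addm)
      qed
      also have "\<dots> = finsum S (\<lambda>b. w b \<otimes>\<^bsub>S\<^esub> V (sl b a)) ?D"
      proof (rule S.finsum_cong'[OF refl])
        have e: "conv K A S V (w b \<odot>\<^bsub>H S\<^esub> \<beta> S b) a = w b \<otimes>\<^bsub>S\<^esub> V (sl b a)" if "b \<in> ?D" for b
          using wS[OF DA[OF that]] by (simp add: conv_smult_right[OF S] V \<beta>H[OF S] hom_module_app a conv_\<beta>[OF S V a])
        then show "conv K A S V (w b \<odot>\<^bsub>H S\<^esub> \<beta> S b) a = w b \<otimes>\<^bsub>S\<^esub> V (sl b a)" if "b \<in> ?D" for b using that .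
        show "(\<lambda>b. w b \<otimes>\<^bsub>S\<^esub> V (sl b a)) \<in> ?D \<rightarrow> carrier S"
        proof
          fix b assume b: "b \<in> ?D"
          have "conv K A S V (w b \<odot>\<^bsub>H S\<^esub> \<beta> S b) a \<in> carrier S"
            by (rule H_app_closed[OF S conv_closed[OF S V HS.smult_closed[OF wS[OF DA[OF b]] \<beta>H[OF S]]] a])
          then show "w b \<otimes>\<^bsub>S\<^esub> V (sl b a) \<in> carrier S" by (simp only: e[OF b])
        qed
      qed
      finally show ?thesis .
    qed
    then show "\<exists>D. finite D \<and> D \<subseteq> B - {\<one>\<^bsub>A\<^esub>} \<and>
      (\<forall>(S :: ('k,'s) module) V w. algebra K S \<longrightarrow> V \<in> carrier (H S) \<longrightarrow> w \<in> aug_ideal K A S \<longrightarrow>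
        conv K A S V w a = finsum S (\<lambda>b. w b \<otimes>\<^bsub>S\<^esub> V (sl b a)) D)"
      using D by blast
  qed
qed

text \<open>\<open>Kill (G 2)\<close> is the closure of the square of \<open>\<I>\<^sup>*\<close>, so its elements are not finite sums of
  products. Expanding the other factors in coordinate functionals, which take values in \<open>K\<close>,
  reduces the claim to the definition of \<open>G 2\<close>.\<close>

lemma conv_Kill:
  fixes S :: "('k,'s) module"
  assumes S: "algebra K S" and u: "u \<in> Kill (G 2) S"
    and "set ws \<subseteq> aug_ideal K A S" "a \<in> G (length ws + 2)"
  shows "conv K A S u (conv_prod K A S ws) a = \<zero>\<^bsub>S\<^esub>"
proof -
  interpret S: algebra K S by (rule S)
  obtain B and \<beta> :: "('k,'s) module \<Rightarrow> 'a \<Rightarrow> 'a \<Rightarrow> 's" and sl :: "'a \<Rightarrow> 'a \<Rightarrow> 'a" where sl: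
    "B \<subseteq> carrier A"
    "\<And>S b. algebra K S \<Longrightarrow> b \<in> B \<Longrightarrow> \<beta> S b \<in> aug_ideal K A S"
    "\<And>a b. a \<in> carrier A \<Longrightarrow> b \<in> B \<Longrightarrow> sl b a \<in> carrier A"
    "\<And>S V a b. algebra K S \<Longrightarrow> V \<in> carrier (H S) \<Longrightarrow> a \<in> carrier A \<Longrightarrow> b \<in> B \<Longrightarrow>
      conv K A S V (\<beta> S b) a = V (sl b a)"
    "\<And>a. a \<in> carrier A \<Longrightarrow> \<exists>D. finite D \<and> D \<subseteq> B \<and>
      (\<forall>(S :: ('k,'s) module) V w. algebra K S \<longrightarrow> V \<in> carrier (H S) \<longrightarrow> w \<in> aug_ideal K A S \<longrightarrow>
        conv K A S V w a = finsum S (\<lambda>b. w b \<otimes>\<^bsub>S\<^esub> V (sl b a)) D)"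
    by (rule coproduct_slices) blast
  \<comment> \<open>A slice lowers the filtration by one step: evaluating a product at it means
    multiplying by one more element \<open>\<beta> T b\<close> of the augmentation ideal and
    evaluating at \<open>a\<close>.\<close>
  have slG: "sl b a \<in> G m" if a: "a \<in> G (Suc m)" and b: "b \<in> B" and m: "m > 0" for a b m
  proof (rule GI[OF _ m])
    have aA: "a \<in> carrier A" using a G_subset by blast
    show "sl b a \<in> carrier A" by (rule sl(3)[OF aA b])
    fix T :: "('k,'s) module" and vs assume T: "algebra K T" and vs: "length vs = m" "set vs \<subseteq> aug_ideal K A T"
    note C = conv_prod_closed[OF T aug_H[OF T vs(2)]]
    have \<beta>: "\<beta> T b \<in> carrier (H T)" using sl(2)[OF T b] aug_ideal_subset[OF T] by blast
    have "conv_prod K A T vs (sl b a) = conv_prod K A T (\<beta> T b # vs) a"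
      by (simp only: sl(4)[OF T C aA b, symmetric] conv_prod_Cons[OF T] conv_comm[OF T C \<beta>])
    also have "\<dots> = \<zero>\<^bsub>T\<^esub>" by (rule GD[OF a _ T]) (use vs sl(2)[OF T b] in auto)
    finally show "conv_prod K A T vs (sl b a) = \<zero>\<^bsub>T\<^esub>" .
  qed
  have uH: "u \<in> carrier (H S)" using u by (simp add: Kill_def)
  show ?thesis using assms(3,4)
  proof (induction ws arbitrary: a)
    case Nil
    then show ?case using u uH
      by (simp add: conv_prod_Nil[OF S] conv_comm[OF S uH conv_unit_closed[OF S]] conv_unit_left[OF S] Kill_def numeral_2_eq_2)
  next
    case (Cons w ws)
    have aA: "a \<in> carrier A" using Cons.prems(2) G_subset by blast
    have w: "w \<in> aug_ideal K A S" "set ws \<subseteq> aug_ideal K A S" using Cons.prems(1) by auto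
    have wH: "w \<in> carrier (H S)" using w(1) aug_ideal_subset[OF S] by blast
    note C = conv_prod_closed[OF S aug_H[OF S w(2)]]
    note V = conv_closed[OF S uH C]
    obtain D where D: "finite D" "D \<subseteq> B"
      "conv K A S (conv K A S u (conv_prod K A S ws)) w a
        = finsum S (\<lambda>b. w b \<otimes>\<^bsub>S\<^esub> conv K A S u (conv_prod K A S ws) (sl b a)) D"
      using sl(5)[OF aA] S V w(1) by blast
    \<comment> \<open>The factor \<open>w\<close> is moved to the end and expanded; what remains is
      a shorter product, evaluated at slices of \<open>a\<close>.\<close>
    have "conv K A S u (conv_prod K A S (w # ws)) a = conv K A S (conv K A S u (conv_prod K A S ws)) w a"
      by (simp only: conv_prod_Cons[OF S] conv_comm[OF S wH C] conv_assoc[OF S uH C wH])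
    also have "\<dots> = finsum S (\<lambda>b. \<zero>\<^bsub>S\<^esub>) D"
      unfolding D(3)
    proof (rule S.finsum_cong'[OF refl])
      fix b assume b: "b \<in> D"
      have "conv K A S u (conv_prod K A S ws) (sl b a) = \<zero>\<^bsub>S\<^esub>"
        by (rule Cons.IH[OF w(2) slG]) (use Cons.prems(2) b D(2) in auto)
      then show "w b \<otimes>\<^bsub>S\<^esub> conv K A S u (conv_prod K A S ws) (sl b a) = \<zero>\<^bsub>S\<^esub>"
        using H_app_closed[OF S wH, of b] b D(2) sl(1) by auto
    qed simp
    finally show ?case by simp
  qed
qed

end

lemma linear_map_id_update:
  assumes "linear_map T P Q g" "\<And>s. s \<in> carrier S \<Longrightarrow> \<phi> s \<in> carrier T"
  shows "linear_map S (P\<lparr>smult := (\<lambda>s. smult P (\<phi> s))\<rparr>) (Q\<lparr>smult := (\<lambda>s. smult Q (\<phi> s))\<rparr>) g"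
  using linear_mapD[OF assms(1)] assms(2) by (intro linear_mapI) simp_all

text \<open>Adjacent transpositions suffice: by \<open>bubble\<close> an entry can be carried across
  a whole segment, and the entries of \<open>ys\<close> are brought into the order of
  \<open>xs\<close> one after the other, behind a prefix \<open>us\<close> that is already in
  place.\<close>

lemma sym_multilinear_mset:
  assumes b: "sym_multilinear R n M P b" and "xs \<in> tuples n M" "mset xs = mset ys"
  shows "b xs = b ys"
proof -
  have bubble: "b (us @ zs @ v # ws) = b (us @ v # zs @ ws)" if "us @ zs @ v # ws \<in> tuples n M" for us zs v ws
    using that
  proof (induction zs arbitrary: ws rule: rev_induct)
    case (snoc z zs)
    have "us @ zs @ v # z # ws \<in> tuples n M" using snoc.prems by (auto simp: tuples_def)
    moreover have "b ((us @ zs) @ z # v # ws) = b ((us @ zs) @ v # z # ws)"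
      by (rule sym_multilinearD(4)[OF b]) (use snoc.prems in simp)
    ultimately show ?case using snoc.IH[of "z # ws"] by simp
  qed simp
  have "b (us @ xs) = b (us @ ys)" if "us @ xs \<in> tuples n M" "mset xs = mset ys" for us xs ys
    using that
  proof (induction xs arbitrary: us ys)
    case (Cons x xs)
    then have "x \<in> set ys" by (metis list.set_intros(1) mset_eq_setD)
    then obtain y1 y2 where ys: "ys = y1 @ x # y2" by (meson split_list)
    then have m: "mset xs = mset (y1 @ y2)" using Cons.prems(2) by simp
    have t: "us @ y1 @ x # y2 \<in> tuples n M"
      using Cons.prems mset_eq_setD[OF Cons.prems(2)] mset_eq_length[OF Cons.prems(2)] ys
      by (auto simp: tuples_def)
    have "b ((us @ [x]) @ xs) = b ((us @ [x]) @ y1 @ y2)"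
      by (rule Cons.IH[OF _ m]) (use Cons.prems in simp)
    also have "\<dots> = b (us @ y1 @ x # y2)" using bubble[OF t] by simp
    finally show ?case by (simp add: ys)
  qed simp
  from this[of "[]" xs ys] assms(2,3) show ?thesis by simp
qed

context bialgebra_universe
begin

subsection \<open>Quotients of annihilators\<close>

context
  fixes C B :: "('k,'s) module \<Rightarrow> ('a \<Rightarrow> 's) set" and V W :: "'a set"
  assumes C: "\<And>S. algebra K S \<Longrightarrow> C S = Kill V S" and B: "\<And>S. algebra K S \<Longrightarrow> B S = Kill W S"
    and VW: "V \<subseteq> W" and WA: "W \<subseteq> carrier A"
begin

abbreviation (input) "FC \<equiv> sub (dual_functor K A) C"

text \<open>Serves the cotangent functor, where \<open>V\<close> is the unit alone and
  \<open>W\<close> is \<open>G 2\<close>, and the graded pieces, where they are \<open>G n\<close>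
  and \<open>G (n + 1)\<close>. \<open>C\<close> and \<open>B\<close> are identified with
  annihilators at algebras, the only place where \<open>aug_power_eq\<close> speaks of them.\<close>

lemma kq_subfunctor: "subfunctor K (dual_functor K A) C" "subfunctor K FC B"
proof -
  note k = Kill_subfunctor[OF subset_trans[OF VW WA]] Kill_subfunctor[OF WA]
  show 1: "subfunctor K (dual_functor K A) C"
    using k(1) unfolding subfunctor_def by (simp add: C)
  show "subfunctor K FC B"
    unfolding subfunctor_def sub_simps dual_functor_simps
  proof (intro conjI allI impI)
    fix S :: "('k,'s) module" assume S: "algebra K S"
    show "submodule (B S) S ((H S)\<lparr>carrier := C S\<rparr>)"
      unfolding B[OF S] C[OF S]
      by (rule submodule_of_submodule[OF module_hom_module[OF A_module S] Kill_submodule[OF subset_trans[OF VW WA] S]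
            Kill_submodule[OF WA S]]) (use VW in \<open>auto simp: Kill_def\<close>)
    fix T \<phi> assume "algebra K T" "\<phi> \<in> alg_hom K S T"
    then show "push A \<phi> ` B S \<subseteq> B T"
      using k(2) S unfolding subfunctor_def dual_functor_simps by (simp add: B)
  qed
qed

lemma kq_FC: "module_functor K FC"
  by (rule module_functor_sub[OF module_functor_dual[OF A_module] kq_subfunctor(1)])

lemma kq_module_functor: "module_functor K (quot FC B)"
  by (rule module_functor_quot[OF kq_FC kq_subfunctor(2)])

context
  fixes S :: "('k,'s) module"
  assumes S: "algebra K S"
begin

lemma kq_carrier: "X \<in> carrier (ob (quot FC B) S) \<longleftrightarrow> (\<exists>w\<in>Kill V S. X = B S +>\<^bsub>H S\<^esub> w)"
  unfolding quot_simps quot_carrier_iff by (simp add: sub_simps dual_functor_simps coset_carrier_update C[OF S])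

lemma kq_add:
  assumes "v \<in> Kill V S" "w \<in> Kill V S"
  shows "(B S +>\<^bsub>H S\<^esub> v) \<oplus>\<^bsub>ob (quot FC B) S\<^esub> (B S +>\<^bsub>H S\<^esub> w) = B S +>\<^bsub>H S\<^esub> (v \<oplus>\<^bsub>H S\<^esub> w)"
  using quot_add[OF module_functorD(1)[OF kq_FC S] subfunctor_submodule[OF kq_FC kq_subfunctor(2) S], of v w] assms
  by (simp add: quot_simps sub_simps dual_functor_simps coset_carrier_update C[OF S])

lemma kq_smult:
  assumes "s \<in> carrier S" "w \<in> Kill V S"
  shows "s \<odot>\<^bsub>ob (quot FC B) S\<^esub> (B S +>\<^bsub>H S\<^esub> w) = B S +>\<^bsub>H S\<^esub> (s \<odot>\<^bsub>H S\<^esub> w)"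
  using quot_smult[OF module_functorD(1)[OF kq_FC S] subfunctor_submodule[OF kq_FC kq_subfunctor(2) S], of s w] assms
  by (simp add: quot_simps sub_simps dual_functor_simps coset_carrier_update C[OF S])

lemma kq_ar:
  assumes "algebra K T" "\<phi> \<in> alg_hom K S T" "w \<in> Kill V S"
  shows "ar (quot FC B) S T \<phi> (B S +>\<^bsub>H S\<^esub> w) = B T +>\<^bsub>H T\<^esub> push A \<phi> w"
  using quot_ar_coset[OF kq_FC kq_subfunctor(2) S assms(1,2), of w] assms(3)
  by (simp add: sub_simps dual_functor_simps coset_carrier_update C[OF S])

lemma kq_eq:
  assumes "v \<in> carrier (H S)" "w \<in> carrier (H S)"
  shows "B S +>\<^bsub>H S\<^esub> v = B S +>\<^bsub>H S\<^esub> w \<longleftrightarrow> (\<forall>a\<in>W. v a = w a)"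
  unfolding B[OF S] by (rule Kill_coset_eq[OF WA S assms])

end
end

subsection \<open>The cotangent functor\<close>

lemma aug_ideal_Kill: "algebra K S \<Longrightarrow> aug_ideal K A S = Kill {\<one>\<^bsub>A\<^esub>} S"
  by (auto simp: aug_ideal_iff Kill_def)

abbreviation cot :: "('k,'s,('a \<Rightarrow> 's) set) kfunctor" where "cot \<equiv> cotangent K A"

abbreviation \<kappa> :: "('k,'s) module \<Rightarrow> ('a \<Rightarrow> 's) \<Rightarrow> ('a \<Rightarrow> 's) set" where
  "\<kappa> S w \<equiv> aug_power K A 2 S +>\<^bsub>H S\<^esub> w"

lemma one_G2: "{\<one>\<^bsub>A\<^esub>} \<subseteq> G 2"
  using one_in_G[of 2] by simp

lemmas cot_facts = aug_ideal_Kill aug_power_eq one_G2 G_subset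

lemma cot_module_functor: "module_functor K cot"
  unfolding cotangent_def by (rule kq_module_functor[OF cot_facts])

lemma cot_carrier:
  "algebra K S \<Longrightarrow> X \<in> carrier (ob cot S) \<longleftrightarrow> (\<exists>w\<in>aug_ideal K A S. X = \<kappa> S w)"
  unfolding cotangent_def by (subst kq_carrier[OF cot_facts]) (simp_all add: aug_ideal_Kill)

lemma cot_add:
  "algebra K S \<Longrightarrow> v \<in> aug_ideal K A S \<Longrightarrow> w \<in> aug_ideal K A S \<Longrightarrow>
    \<kappa> S v \<oplus>\<^bsub>ob cot S\<^esub> \<kappa> S w = \<kappa> S (v \<oplus>\<^bsub>H S\<^esub> w)"
  unfolding cotangent_def by (rule kq_add[OF cot_facts]) (simp_all add: aug_ideal_Kill)

lemma cot_smult: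
  "algebra K S \<Longrightarrow> s \<in> carrier S \<Longrightarrow> w \<in> aug_ideal K A S \<Longrightarrow>
    s \<odot>\<^bsub>ob cot S\<^esub> \<kappa> S w = \<kappa> S (s \<odot>\<^bsub>H S\<^esub> w)"
  unfolding cotangent_def by (rule kq_smult[OF cot_facts]) (simp_all add: aug_ideal_Kill)

lemma cot_ar:
  "algebra K S \<Longrightarrow> algebra K T \<Longrightarrow> \<phi> \<in> alg_hom K S T \<Longrightarrow> w \<in> aug_ideal K A S \<Longrightarrow>
    ar cot S T \<phi> (\<kappa> S w) = \<kappa> T (push A \<phi> w)"
  unfolding cotangent_def by (rule kq_ar[OF cot_facts]) (simp_all add: aug_ideal_Kill)

lemma cot_eq:
  "algebra K S \<Longrightarrow> v \<in> aug_ideal K A S \<Longrightarrow> w \<in> aug_ideal K A S \<Longrightarrow>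
    \<kappa> S v = \<kappa> S w \<longleftrightarrow> (\<forall>a\<in>G 2. v a = w a)"
  by (rule kq_eq[OF cot_facts]) (auto simp: aug_ideal_iff)

lemma cot_tuples:
  assumes S: "algebra K S" and "xs \<in> tuples n (ob cot S)"
  obtains ws where "xs = map (\<kappa> S) ws" "length ws = n" "set ws \<subseteq> aug_ideal K A S"
proof -
  have "\<exists>ws. xs = map (\<kappa> S) ws \<and> set ws \<subseteq> aug_ideal K A S" if "set xs \<subseteq> carrier (ob cot S)"
    using that
  proof (induction xs)
    case (Cons x xs)
    then obtain ws w where "xs = map (\<kappa> S) ws" "set ws \<subseteq> aug_ideal K A S" "w \<in> aug_ideal K A S" "x = \<kappa> S w"
      using cot_carrier[OF S] by auto
    then show ?case by (intro exI[of _ "w # ws"]) simp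
  qed simp
  then show ?thesis using assms(2) that by (auto simp: tuples_def)
qed

lemma cot_tuplesI:
  "algebra K S \<Longrightarrow> length ws = n \<Longrightarrow> set ws \<subseteq> aug_ideal K A S \<Longrightarrow> map (\<kappa> S) ws \<in> tuples n (ob cot S)"
  using cot_carrier by (fastforce simp: tuples_def)

lemma aug_ideal_push:
  assumes S: "algebra K S" and T: "algebra K T" and \<phi>: "\<phi> \<in> alg_hom K S T" and w: "w \<in> aug_ideal K A S"
  shows "push A \<phi> w \<in> aug_ideal K A T"
  using w push_closed[OF A_module \<phi>] linear_map_zero[OF algebraD(1)[OF S] algebraD(1)[OF T] alg_homD(2)[OF \<phi>]]
  by (auto simp: aug_ideal_iff[OF S] aug_ideal_iff[OF T])

lemma aug_ideal_add:
  fixes S :: "('k,'s) module"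
  assumes "algebra K S" "v \<in> aug_ideal K A S" "w \<in> aug_ideal K A S" shows "v \<oplus>\<^bsub>H S\<^esub> w \<in> aug_ideal K A S"
proof -
  interpret HS: module S "H S" by (rule module_hom_module[OF A_module assms(1)])
  show ?thesis
    using HS.submoduleE(5)[OF Kill_submodule[OF _ assms(1), of "{\<one>\<^bsub>A\<^esub>}"]] assms by (simp add: aug_ideal_Kill)
qed

lemma aug_ideal_smult:
  fixes S :: "('k,'s) module"
  assumes "algebra K S" "s \<in> carrier S" "w \<in> aug_ideal K A S" shows "s \<odot>\<^bsub>H S\<^esub> w \<in> aug_ideal K A S"
proof -
  interpret HS: module S "H S" by (rule module_hom_module[OF A_module assms(1)])
  show ?thesis
    using HS.submoduleE(4)[OF Kill_submodule[OF _ assms(1), of "{\<one>\<^bsub>A\<^esub>}"]] assms by (simp add: aug_ideal_Kill)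
qed

text \<open>Factors are exchanged one at a time. The difference of two representatives of a class
  lies in \<open>Kill (G 2)\<close>, and by \<open>conv_Kill\<close> its product with the other
  \<open>n - 1\<close> factors vanishes on \<open>G (n + 1)\<close>. The prefix \<open>us\<close>
  holds the factors already exchanged.\<close>

lemma conv_prod_cot_cong:
  fixes S :: "('k,'s) module"
  assumes S: "algebra K S" and a: "a \<in> G (Suc n)"
    and "set ws \<subseteq> aug_ideal K A S" "set vs \<subseteq> aug_ideal K A S" "length ws = n" "map (\<kappa> S) ws = map (\<kappa> S) vs"
  shows "conv_prod K A S ws a = conv_prod K A S vs a"
proof -
  interpret S: algebra K S by (rule S)
  interpret HS: module S "H S" by (rule module_hom_module[OF A_module S])
  have aA: "a \<in> carrier A" using a G_subset by blast
  have "conv_prod K A S (us @ ws) a = conv_prod K A S (us @ vs) a"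
    if "set us \<subseteq> aug_ideal K A S" "set ws \<subseteq> aug_ideal K A S" "set vs \<subseteq> aug_ideal K A S"
      "length us + length ws = n" "map (\<kappa> S) ws = map (\<kappa> S) vs" for us ws vs
    using that
  proof (induction ws arbitrary: us vs)
    case (Cons w ws)
    then obtain v vs' where vs: "vs = v # vs'" by (cases vs) auto
    have mem: "w \<in> aug_ideal K A S" "v \<in> aug_ideal K A S" "set us \<subseteq> carrier (H S)" "set ws \<subseteq> carrier (H S)"
      "w \<in> carrier (H S)" "v \<in> carrier (H S)"
      using Cons.prems vs aug_ideal_subset[OF S] by auto
    let ?C = "conv_prod K A S (us @ ws)"
    have C: "?C \<in> carrier (H S)" using mem by (intro conv_prod_closed[OF S]) auto
    have eq: "\<forall>a\<in>G 2. w a = v a" using Cons.prems(5) vs cot_eq[OF S mem(1,2)] by simp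
    have d: "w \<ominus>\<^bsub>H S\<^esub> v \<in> Kill (G 2) S"
      unfolding HS.coset_eq_iff[OF Kill_submodule[OF G_subset S] mem(5,6), symmetric]
        Kill_coset_eq[OF G_subset S mem(5,6)] by (rule eq)
    have "conv K A S (w \<ominus>\<^bsub>H S\<^esub> v) ?C a = \<zero>\<^bsub>S\<^esub>"
      by (rule conv_Kill[OF S d]) (use Cons.prems a in auto)
    moreover have "conv K A S (w \<ominus>\<^bsub>H S\<^esub> v) ?C = conv K A S w ?C \<ominus>\<^bsub>H S\<^esub> conv K A S v ?C"
    proof -
      have "linear_map S (H S) (H S) (\<lambda>u. conv K A S u ?C)"
        by (rule linear_mapI) (simp_all add: C conv_closed[OF S] conv_add_left[OF S] conv_smult_left[OF S])
      from linear_map_minus[OF HS.module_axioms HS.module_axioms this mem(5,6)] show ?thesis .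
    qed
    ultimately have 0: "conv K A S w ?C a \<ominus>\<^bsub>S\<^esub> conv K A S v ?C a = \<zero>\<^bsub>S\<^esub>"
      by (simp add: hom_minus_app[OF A_module S] conv_closed[OF S] C mem aA)
    have cl: "conv K A S w ?C a \<in> carrier S" "conv K A S v ?C a \<in> carrier S"
      by (rule H_app_closed[OF S conv_closed[OF S _ C] aA], rule mem)+
    have "\<ominus>\<^bsub>S\<^esub> (\<ominus>\<^bsub>S\<^esub> conv K A S v ?C a) = conv K A S w ?C a"
      using 0 cl by (intro S.minus_equality) (auto simp: a_minus_def)
    then have "conv_prod K A S (us @ w # ws) a = conv_prod K A S (us @ v # ws) a"
      using cl by (simp add: conv_prod_insert[OF S] mem)
    also have "\<dots> = conv_prod K A S ((us @ [v]) @ vs') a"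
      using Cons.IH[of "us @ [v]" vs'] Cons.prems vs by simp
    finally show ?case by (simp add: vs)
  qed simp
  from this[of "[]" ws vs] assms show ?thesis by simp
qed

subsection \<open>Linear forms on the symmetric power\<close>

abbreviation SF :: "nat \<Rightarrow> ('k,'s,(('a \<Rightarrow> 's) set list \<Rightarrow> 's) set) kfunctor" where
  "SF n \<equiv> sym_functor n cot"

abbreviation "NN n \<equiv> dual_space K (SF n)"

abbreviation sp :: "nat \<Rightarrow> ('k,'s) module \<Rightarrow> ('a \<Rightarrow> 's) list \<Rightarrow> (('a \<Rightarrow> 's) set list \<Rightarrow> 's) set" where
  "sp n S ws \<equiv> sym_product S n (ob cot S) (map (\<kappa> S) ws)"

lemma K_cring: "cring K"
  by (rule A.R.is_cring)

lemma SF_functor: "module_functor K (SF n)"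
  by (rule module_functor_sym[OF cot_module_functor])

lemma NN_module: "module K (NN n)"
  by (rule module_dual_space[OF SF_functor K_cring])

lemma sp_closed:
  "algebra K S \<Longrightarrow> length ws = n \<Longrightarrow> set ws \<subseteq> aug_ideal K A S \<Longrightarrow> sp n S ws \<in> carrier (ob (SF n) S)"
  unfolding sym_functor_ob[OF cot_module_functor]
  by (rule sym_multilinearD(1)[OF sym_product_multilinear[OF module_functorD(1)[OF cot_module_functor]] cot_tuplesI])

text \<open>A form is linear over each algebra, and the symmetric power is spanned by products of
  classes, each of which lifts to functionals in the augmentation ideal.\<close>

lemma NN_eqI:
  assumes \<eta>: "\<eta> \<in> carrier (NN n)" and \<theta>: "\<theta> \<in> carrier (NN n)"
    and eq: "\<And>S ws. algebra K S \<Longrightarrow> length ws = n \<Longrightarrow> set ws \<subseteq> aug_ideal K A S \<Longrightarrow> \<eta> S (sp n S ws) = \<theta> S (sp n S ws)"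
  shows "\<eta> = \<theta>"
proof (rule functor_hom_eqI[OF \<eta>[unfolded dual_space_simps] \<theta>[unfolded dual_space_simps]])
  fix S :: "('k,'s) module" and X assume S: "algebra K S" and X: "X \<in> carrier (ob (SF n) S)"
  note M = module_functorD(1)[OF cot_module_functor S]
  note L = dual_space_linear[OF SF_functor K_cring \<eta> S] dual_space_linear[OF SF_functor K_cring \<theta> S]
  show "\<eta> S X = \<theta> S X"
  proof (rule sym_linear_unique[OF M module_regular[OF S] L[unfolded sym_functor_ob[OF cot_module_functor]]
        X[unfolded sym_functor_ob[OF cot_module_functor]]])
    fix xs assume "xs \<in> tuples n (ob cot S)"
    then obtain ws where ws: "xs = map (\<kappa> S) ws" "length ws = n" "set ws \<subseteq> aug_ideal K A S"
      by (rule cot_tuples[OF S])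
    show "\<eta> S (sym_product S n (ob cot S) xs) = \<theta> S (sym_product S n (ob cot S) xs)"
      unfolding ws(1) by (rule eq[OF S ws(2,3)])
  qed
qed

section \<open>The form attached to an element of the filtration\<close>

definition rep :: "('k,'s) module \<Rightarrow> ('a \<Rightarrow> 's) set \<Rightarrow> 'a \<Rightarrow> 's" where
  "rep S X = (SOME w. w \<in> aug_ideal K A S \<and> X = \<kappa> S w)"

lemma rep:
  assumes "algebra K S" "w \<in> aug_ideal K A S"
  shows "rep S (\<kappa> S w) \<in> aug_ideal K A S" "\<kappa> S (rep S (\<kappa> S w)) = \<kappa> S w"
  using someI[of "\<lambda>v. v \<in> aug_ideal K A S \<and> \<kappa> S w = \<kappa> S v" w] assms(2) unfolding rep_def by auto

text \<open>The product is taken of chosen representatives; by \<open>form_eq\<close> the choice is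
  immaterial when \<open>a\<close> is in \<open>G (n + 1)\<close> and there are \<open>n\<close>
  factors.\<close>

definition form :: "'a \<Rightarrow> ('k,'s) module \<Rightarrow> ('a \<Rightarrow> 's) set list \<Rightarrow> 's" where
  "form a S xs = conv_prod K A S (map (rep S) xs) a"

lemma form_eq:
  assumes S: "algebra K S" and a: "a \<in> G (Suc n)" and ws: "length ws = n" "set ws \<subseteq> aug_ideal K A S"
  shows "form a S (map (\<kappa> S) ws) = conv_prod K A S ws a"
  unfolding form_def
  by (rule conv_prod_cot_cong[OF S a]) (use rep[OF S] ws in \<open>auto simp: subset_iff\<close>)

lemma form_multilinear:
  assumes S: "algebra K S" and a: "a \<in> G (Suc n)"
  shows "sym_multilinear S n (ob cot S) (regular_module S) (form a S)"
proof -
  interpret S: algebra K S by (rule S)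
  interpret HS: module S "H S" by (rule module_hom_module[OF A_module S])
  have aA: "a \<in> carrier A" using a G_subset by blast
  \<comment> \<open>A tuple of classes with a marked entry lifts to a list of functionals split at
    the same place. By \<open>app\<close> the marked factor then moves to the front, where
    \<open>conv\<close> is linear.\<close>
  have split: "\<exists>us w vs. xs = map (\<kappa> S) us \<and> x = \<kappa> S w \<and> ys = map (\<kappa> S) vs \<and> set us \<subseteq> aug_ideal K A S
      \<and> w \<in> aug_ideal K A S \<and> set vs \<subseteq> aug_ideal K A S \<and> length us + length vs + 1 = n"
    if "xs @ x # ys \<in> tuples n (ob cot S)" for xs x ys
  proof -
    obtain ws where ws: "xs @ x # ys = map (\<kappa> S) ws" "length ws = n" "set ws \<subseteq> aug_ideal K A S"
      by (rule cot_tuples[OF S \<open>xs @ x # ys \<in> tuples n (ob cot S)\<close>])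
    from ws(1)[symmetric] obtain us vs' where 1: "ws = us @ vs'" "xs = map (\<kappa> S) us" "x # ys = map (\<kappa> S) vs'"
      by (auto simp: map_eq_append_conv)
    then obtain w vs where 2: "vs' = w # vs" "x = \<kappa> S w" "ys = map (\<kappa> S) vs" by (cases vs') auto
    show ?thesis using 1 2 ws by auto
  qed
  note cH = subset_trans[OF _ aug_ideal_subset[OF S]] subsetD[OF aug_ideal_subset[OF S]]
  have app: "form a S (map (\<kappa> S) us @ \<kappa> S w # map (\<kappa> S) vs) = conv K A S w (conv_prod K A S (us @ vs)) a"
    if "set us \<subseteq> aug_ideal K A S" "w \<in> aug_ideal K A S" "set vs \<subseteq> aug_ideal K A S" "length us + length vs + 1 = n" for us w vs
    using form_eq[OF S a, of "us @ w # vs"] that by (simp add: conv_prod_insert[OF S] cH)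
  have Ccl: "conv_prod K A S (us @ vs) \<in> carrier (H S)" if "set us \<subseteq> aug_ideal K A S" "set vs \<subseteq> aug_ideal K A S" for us vs
    using that cH by (intro conv_prod_closed[OF S]) auto
  show ?thesis
    unfolding sym_multilinear_def regular_module_simps
  proof (intro conjI ballI allI impI)
    fix xs assume "xs \<in> tuples n (ob cot S)"
    then obtain ws where ws: "xs = map (\<kappa> S) ws" "length ws = n" "set ws \<subseteq> aug_ideal K A S"
      by (rule cot_tuples[OF S])
    show "form a S xs \<in> carrier S"
      unfolding ws(1) form_eq[OF S a ws(2,3)]
      by (rule H_app_closed[OF S conv_prod_closed[OF S aug_H[OF S ws(3)]] aA])
  next
    fix xs x y ys assume t: "xs @ x # ys \<in> tuples n (ob cot S)" and y: "y \<in> carrier (ob cot S)"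
    from split[OF t] obtain us w vs where w: "xs = map (\<kappa> S) us" "x = \<kappa> S w" "ys = map (\<kappa> S) vs"
      "set us \<subseteq> aug_ideal K A S" "w \<in> aug_ideal K A S" "set vs \<subseteq> aug_ideal K A S" "length us + length vs + 1 = n" by blast
    obtain v where v: "y = \<kappa> S v" "v \<in> aug_ideal K A S" using y cot_carrier[OF S] by blast
    show "form a S (xs @ (x \<oplus>\<^bsub>ob cot S\<^esub> y) # ys) = form a S (xs @ x # ys) \<oplus>\<^bsub>S\<^esub> form a S (xs @ y # ys)"
      unfolding w(1-3) v(1) cot_add[OF S w(5) v(2)] app[OF w(4-7)] app[OF w(4) v(2) w(6,7)]
        app[OF w(4) aug_ideal_add[OF S w(5) v(2)] w(6,7)]
      by (simp add: conv_add_left[OF S] cH(2)[OF w(5)] cH(2)[OF v(2)] Ccl w hom_module_app aA)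
  next
    fix xs x ys r assume t: "xs @ x # ys \<in> tuples n (ob cot S)" and r: "r \<in> carrier S"
    from split[OF t] obtain us w vs where w: "xs = map (\<kappa> S) us" "x = \<kappa> S w" "ys = map (\<kappa> S) vs"
      "set us \<subseteq> aug_ideal K A S" "w \<in> aug_ideal K A S" "set vs \<subseteq> aug_ideal K A S" "length us + length vs + 1 = n" by blast
    show "form a S (xs @ (r \<odot>\<^bsub>ob cot S\<^esub> x) # ys) = r \<otimes>\<^bsub>S\<^esub> form a S (xs @ x # ys)"
      unfolding w(1-3) cot_smult[OF S r w(5)] app[OF w(4-7)] app[OF w(4) aug_ideal_smult[OF S r w(5)] w(6,7)]
      by (simp add: conv_smult_left[OF S r] cH(2)[OF w(5)] Ccl w hom_module_app aA)
  next
    fix xs x y ys assume t: "xs @ x # y # ys \<in> tuples n (ob cot S)"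
    from split[OF t] obtain us w vs' where w: "xs = map (\<kappa> S) us" "x = \<kappa> S w" "y # ys = map (\<kappa> S) vs'"
      "set us \<subseteq> aug_ideal K A S" "w \<in> aug_ideal K A S" "set vs' \<subseteq> aug_ideal K A S" "length us + length vs' + 1 = n"
      by (elim exE conjE) (rule that)
    from w(3) obtain v vs where v: "vs' = v # vs" "y = \<kappa> S v" "ys = map (\<kappa> S) vs" by (cases vs') auto
    have m: "v \<in> aug_ideal K A S" "set vs \<subseteq> aug_ideal K A S" using w(6) v(1) by auto
    have 1: "form a S (map (\<kappa> S) (us @ w # v # vs)) = conv_prod K A S (us @ w # v # vs) a"
      by (rule form_eq[OF S a]) (use w v(1) m in auto)
    have 2: "form a S (map (\<kappa> S) (us @ v # w # vs)) = conv_prod K A S (us @ v # w # vs) a"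
      by (rule form_eq[OF S a]) (use w v(1) m in auto)
    have "conv_prod K A S (us @ w # v # vs) = conv_prod K A S (us @ v # w # vs)"
      using conv_prod_insert[OF S, of us "v # vs" w] conv_prod_insert[OF S, of us vs v]
        conv_prod_insert[OF S, of us "w # vs" v] conv_prod_insert[OF S, of us vs w]
      by (simp add: cH w m conv_lcomm[OF S, of w v] Ccl)
    then show "form a S (xs @ x # y # ys) = form a S (xs @ y # x # ys)"
      using 1 2 by (simp add: w(1,2) v(2,3))
  qed
qed

text \<open>The pairing of \<open>G (n + 1)\<close> with the n-th symmetric power of the cotangent
  functor: products are evaluated at \<open>a\<close>. It identifies \<open>G (n + 1)\<close> modulo
  \<open>G n\<close> with the space \<open>NN n\<close> of all forms, by \<open>\<Xi>_kernel\<close>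
  and \<open>\<Xi>_onto\<close>.\<close>

definition \<Xi> :: "nat \<Rightarrow> 'a \<Rightarrow> ('k,'s) module \<Rightarrow> (('a \<Rightarrow> 's) set list \<Rightarrow> 's) set \<Rightarrow> 's" where
  "\<Xi> n a = mk_hom K (SF n) (\<lambda>S. quot_lift (lin_ext S (regular_module S) (form a S)))"

lemma \<Xi>_sp:
  assumes S: "algebra K S" and a: "a \<in> G (Suc n)" and ws: "length ws = n" "set ws \<subseteq> aug_ideal K A S"
  shows "\<Xi> n a S (sp n S ws) = conv_prod K A S ws a"
  unfolding \<Xi>_def mk_hom_app[OF S sp_closed[OF S ws]]
    sym_lift_product[OF module_functorD(1)[OF cot_module_functor S] module_regular[OF S] form_multilinear[OF S a] cot_tuplesI[OF S ws]]
  by (rule form_eq[OF S a ws])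

lemma \<Xi>_closed:
  assumes a: "a \<in> G (Suc n)" shows "\<Xi> n a \<in> carrier (NN n)"
  unfolding dual_space_simps \<Xi>_def
proof (rule mk_hom_functor_hom[OF SF_functor]; unfold base_functor_simps sym_functor_ob[OF cot_module_functor])
  let ?g = "\<lambda>S :: ('k,'s) module. quot_lift (lin_ext S (regular_module S) (form a S))"
  fix S :: "('k,'s) module" assume S: "algebra K S"
  note MS = module_functorD(1)[OF cot_module_functor S]
  note gS = sym_lift_linear[OF MS module_regular[OF S] form_multilinear[OF S a]]
  show "linear_map S (sym_power S n (ob cot S)) (regular_module S) (?g S)" by (rule gS)
  fix T \<phi> X assume T: "algebra K T" and \<phi>: "\<phi> \<in> alg_hom K S T" and X: "X \<in> carrier (sym_power S n (ob cot S))"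
  note MT = module_functorD(1)[OF cot_module_functor T]
  note gT = sym_lift_linear[OF MT module_regular[OF T] form_multilinear[OF T a]]
  \<comment> \<open>Both composites are maps to \<open>T\<close> that are semilinear over
    \<open>\<phi>\<close>. Restricting scalars makes them linear over \<open>S\<close>, so that
    comparing them on products is enough.\<close>
  let ?R = "(regular_module T)\<lparr>smult := (\<lambda>s. smult (regular_module T) (\<phi> s))\<rparr>"
  have R: "module S ?R"
    by (rule module_smult_update[OF algebraD(2)[OF S] module_regular[OF T] alg_homD(1)[OF \<phi>]])
  have 1: "linear_map S (sym_power S n (ob cot S)) ?R (\<lambda>X. ?g T (ar (SF n) S T \<phi> X))"
    by (rule linear_map_comp[OF sym_functor_ar_linear[OF cot_module_functor S T \<phi>] linear_map_id_update[OF gT alg_homD(5)[OF \<phi>]]])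
  have "linear_map S (regular_module S) ?R \<phi>"
    by (rule linear_mapI) (simp_all add: regular_module_simps alg_homD[OF \<phi>])
  from linear_map_comp[OF gS this]
  have 2: "linear_map S (sym_power S n (ob cot S)) ?R (\<lambda>X. \<phi> (?g S X))" .
  show "?g T (ar (SF n) S T \<phi> X) = \<phi> (?g S X)"
  proof (rule sym_linear_unique[OF MS R 1 2 X])
    fix xs assume xs: "xs \<in> tuples n (ob cot S)"
    then obtain ws where ws: "xs = map (\<kappa> S) ws" "length ws = n" "set ws \<subseteq> aug_ideal K A S"
      by (rule cot_tuples[OF S])
    have aA: "a \<in> carrier A" using a G_subset by blast
    have pw: "length (map (push A \<phi>) ws) = n" "set (map (push A \<phi>) ws) \<subseteq> aug_ideal K A T"
      using ws aug_ideal_push[OF S T \<phi>] by auto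
    have "map (ar cot S T \<phi>) xs = map (\<kappa> T) (map (push A \<phi>) ws)"
      unfolding ws(1) using ws(3) cot_ar[OF S T \<phi>] by auto
    then have "?g T (ar (SF n) S T \<phi> (sym_product S n (ob cot S) xs)) = ?g T (sp n T (map (push A \<phi>) ws))"
      by (simp only: sym_functor_ar_product[OF cot_module_functor S T \<phi> xs])
    also have "\<dots> = conv_prod K A T (map (push A \<phi>) ws) a"
      by (simp only: sym_lift_product[OF MT module_regular[OF T] form_multilinear[OF T a] cot_tuplesI[OF T pw]]
          form_eq[OF T a pw])
    also have "\<dots> = \<phi> (conv_prod K A S ws a)"
      using conv_prod_push[OF S T \<phi> aug_H[OF S ws(3)]] aA by (metis push_app)
    also have "conv_prod K A S ws a = ?g S (sym_product S n (ob cot S) xs)"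
      unfolding ws(1)
      by (simp only: sym_lift_product[OF MS module_regular[OF S] form_multilinear[OF S a] cot_tuplesI[OF S ws(2,3)]]
          form_eq[OF S a ws(2,3)])
    finally show "?g T (ar (SF n) S T \<phi> (sym_product S n (ob cot S) xs)) = \<phi> (?g S (sym_product S n (ob cot S) xs))" .
  qed
qed

lemma G_module: "module K (A\<lparr>carrier := G n\<rparr>)"
  by (rule submodule.submodule_is_module[OF G_submodule A_module])

lemma \<Xi>_linear: "linear_map K (A\<lparr>carrier := G (Suc n)\<rparr>) (NN n) (\<Xi> n)"
proof -
  interpret N: module K "NN n" by (rule NN_module)
  note E = A.submoduleE[OF G_submodule[of "Suc n"]]
  have lin: "linear_map K A S (conv_prod K A S ws)"
    if "algebra K S" "set ws \<subseteq> aug_ideal K A S" for S :: "('k,'s) module" and ws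
    by (rule hom_module_linear[OF conv_prod_closed[OF that(1) aug_H[OF that]]])
  note app = dual_space_app[OF SF_functor K_cring]
  have GA: "a \<in> carrier A" if "a \<in> G (Suc n)" for a using that G_subset by blast
  have 1: "\<Xi> n (a \<oplus>\<^bsub>A\<^esub> b) = \<Xi> n a \<oplus>\<^bsub>NN n\<^esub> \<Xi> n b" if a: "a \<in> G (Suc n)" and b: "b \<in> G (Suc n)" for a b
  proof (rule NN_eqI[OF \<Xi>_closed[OF E(5)[OF a b]] N.M.a_closed[OF \<Xi>_closed[OF a] \<Xi>_closed[OF b]]])
    fix S :: "('k,'s) module" and ws assume s: "algebra K S" "length ws = n" "set ws \<subseteq> aug_ideal K A S"
    show "\<Xi> n (a \<oplus>\<^bsub>A\<^esub> b) S (sp n S ws) = (\<Xi> n a \<oplus>\<^bsub>NN n\<^esub> \<Xi> n b) S (sp n S ws)"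
      by (simp only: app(2)[OF s(1) sp_closed[OF s]] \<Xi>_sp[OF s(1) _ s(2,3)] a b E(5)
          linear_mapD(2)[OF lin[OF s(1,3)] GA[OF a] GA[OF b]])
  qed
  have 2: "\<Xi> n (r \<odot>\<^bsub>A\<^esub> a) = r \<odot>\<^bsub>NN n\<^esub> \<Xi> n a" if r: "r \<in> carrier K" and a: "a \<in> G (Suc n)" for r a
  proof (rule NN_eqI[OF \<Xi>_closed[OF E(4)[OF r a]] N.smult_closed[OF r \<Xi>_closed[OF a]]])
    fix S :: "('k,'s) module" and ws assume s: "algebra K S" "length ws = n" "set ws \<subseteq> aug_ideal K A S"
    show "\<Xi> n (r \<odot>\<^bsub>A\<^esub> a) S (sp n S ws) = (r \<odot>\<^bsub>NN n\<^esub> \<Xi> n a) S (sp n S ws)"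
      by (simp only: app(3)[OF s(1) sp_closed[OF s]] \<Xi>_sp[OF s(1) _ s(2,3)] a E(4) r
          linear_mapD(3)[OF lin[OF s(1,3)] r GA[OF a]])
  qed
  show ?thesis by (rule linear_mapI) (simp_all add: \<Xi>_closed 1 2)
qed

text \<open>A functional and its augmentation part have the same value at an element with zero
  counit, and the augmentation part vanishes on \<open>G 1\<close>; since functionals separate
  points, the element is zero. This settles degree zero, where the only product is the convolution
  unit.\<close>

lemma counit_G1:
  assumes a: "a \<in> G 1" and e: "\<epsilon> a = \<zero>\<^bsub>K\<^esub>" shows "a = \<zero>\<^bsub>A\<^esub>"
proof (rule ccontr)
  assume ne: "a \<noteq> \<zero>\<^bsub>A\<^esub>"
  have aA: "a \<in> carrier A" using a G_subset by blast
  have "submodule {\<zero>\<^bsub>A\<^esub>} K A" by (rule A.submoduleI) auto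
  from Kz.separation[OF A_module this aA] ne
  obtain w where w: "linear_map K A Kz.Kc w" "w a \<noteq> \<zero>\<^bsub>Kz.Kc\<^esub>" by blast
  note S = Kz.Kc_algebra
  interpret S: algebra K Kz.Kc by (rule S)
  let ?w = "\<lambda>x\<in>carrier A. w x"
  have wH: "?w \<in> carrier (H Kz.Kc)" by (rule hom_module_restrict[OF A_module w(1)])
  let ?v = "aug_part Kz.Kc ?w"
  have v: "?v \<in> aug_ideal K A Kz.Kc" by (rule aug_part_aug_ideal[OF S wH])
  have vH: "?v \<in> carrier (H Kz.Kc)" using v aug_ideal_subset[OF S] by blast
  have "conv_prod K A Kz.Kc [?v] a = \<zero>\<^bsub>Kz.Kc\<^esub>" by (rule GD[OF a _ S]) (use v in auto)
  then have "?v a = \<zero>\<^bsub>Kz.Kc\<^esub>"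
    by (simp only: conv_prod_Cons[OF S] conv_prod_Nil[OF S] conv_comm[OF S vH conv_unit_closed[OF S]] conv_unit_left[OF S vH])
  moreover have "conv_unit A Kz.Kc a = \<zero>\<^bsub>Kz.Kc\<^esub>"
    using aA by (simp only: conv_unit_app[OF S aA] e S.smult_l_null S.one_closed)
  ultimately have "?w a = \<zero>\<^bsub>Kz.Kc\<^esub>"
    using aug_part_app[OF S wH aA] H_app_closed[OF S wH aA] H_app_closed[OF S wH Ar.one_closed]
    by (simp only: S.r_null a_minus_def S.minus_zero S.r_zero)
  then show False using w(2) aA by simp
qed

lemma \<Xi>_kernel:
  assumes a: "a \<in> G (Suc n)"
  shows "\<Xi> n a = \<zero>\<^bsub>NN n\<^esub> \<longleftrightarrow> a \<in> G n"
proof -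
  interpret N: module K "NN n" by (rule NN_module)
  have aA: "a \<in> carrier A" using a G_subset by blast
  note app = dual_space_app[OF SF_functor K_cring]
  have z: "\<Xi> n a = \<zero>\<^bsub>NN n\<^esub> \<longleftrightarrow> (\<forall>(S :: ('k,'s) module) ws. algebra K S \<longrightarrow> length ws = n \<longrightarrow>
      set ws \<subseteq> aug_ideal K A S \<longrightarrow> conv_prod K A S ws a = \<zero>\<^bsub>S\<^esub>)" (is "?L = ?R")
  proof
    assume L: ?L
    show ?R
    proof (intro allI impI)
      fix S :: "('k,'s) module" and ws assume s: "algebra K S" "length ws = n" "set ws \<subseteq> aug_ideal K A S"
      show "conv_prod K A S ws a = \<zero>\<^bsub>S\<^esub>"
        by (simp only: \<Xi>_sp[OF s(1) a s(2,3), symmetric] L app(1)[OF s(1) sp_closed[OF s]])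
    qed
  next
    assume R: ?R
    show ?L
    proof (rule NN_eqI[OF \<Xi>_closed[OF a] N.M.zero_closed])
      fix S :: "('k,'s) module" and ws assume s: "algebra K S" "length ws = n" "set ws \<subseteq> aug_ideal K A S"
      have "conv_prod K A S ws a = \<zero>\<^bsub>S\<^esub>" using R s by blast
      then show "\<Xi> n a S (sp n S ws) = \<zero>\<^bsub>NN n\<^esub> S (sp n S ws)"
        by (simp only: \<Xi>_sp[OF s(1) a s(2,3)] app(1)[OF s(1) sp_closed[OF s]])
    qed
  qed
  show ?thesis
  proof (cases "n = 0")
    case False
    then show ?thesis using z aA by (simp add: G_def)
  next
    \<comment> \<open>The product of no factors is the convolution unit, so the form of
      \<open>a\<close> is zero only if the counit of \<open>a\<close> is. As \<open>a\<close> lies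
      in \<open>G 1\<close>, it is then zero, in accordance with the value of
      \<open>G 0\<close>.\<close>
    case True
    note S = Kz.Kc_algebra
    interpret S: algebra K Kz.Kc by (rule S)
    have "a = \<zero>\<^bsub>A\<^esub>" if "\<Xi> n a = \<zero>\<^bsub>NN n\<^esub>"
    proof -
      have "conv_unit A Kz.Kc a = \<zero>\<^bsub>Kz.Kc\<^esub>"
        using z that S True conv_prod_Nil[OF S] by (metis empty_subsetI list.set(1) list.size(3))
      then have "\<epsilon> a \<odot>\<^bsub>Kz.Kc\<^esub> \<one>\<^bsub>Kz.Kc\<^esub> = \<zero>\<^bsub>Kz.Kc\<^esub>" by (simp only: conv_unit_app[OF S aA])
      moreover have "\<epsilon> a \<odot>\<^bsub>Kz.Kc\<^esub> \<one>\<^bsub>Kz.Kc\<^esub> = emb (\<epsilon> a \<odot>\<^bsub>A\<^esub> \<one>\<^bsub>A\<^esub>)"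
        using counit_closed[OF aA] transport_simps(4)[OF Kz.scalar Kz.scalar_inj, of "\<one>\<^bsub>K\<^esub>" "\<epsilon> a"]
          transport_simps(5)[OF Kz.scalar Kz.scalar_inj]
        by (simp add: scalar_algebra_simps)
      moreover have "\<zero>\<^bsub>Kz.Kc\<^esub> = emb (\<zero>\<^bsub>K\<^esub> \<odot>\<^bsub>A\<^esub> \<one>\<^bsub>A\<^esub>)"
        by (simp only: transport_simps(6)[OF Kz.scalar Kz.scalar_inj] scalar_algebra_simps)
      ultimately have "emb (\<epsilon> a \<odot>\<^bsub>A\<^esub> \<one>\<^bsub>A\<^esub>) = emb (\<zero>\<^bsub>K\<^esub> \<odot>\<^bsub>A\<^esub> \<one>\<^bsub>A\<^esub>)" by simp
      then have "\<epsilon> a = \<zero>\<^bsub>K\<^esub>"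
        by (rule inj_onD[OF Kz.kemb]) (simp_all add: counit_closed aA)
      then show ?thesis using counit_G1[of a] a True by simp
    qed
    moreover have "\<Xi> n \<zero>\<^bsub>A\<^esub> = \<zero>\<^bsub>NN n\<^esub>"
      using linear_map_zero[OF G_module NN_module \<Xi>_linear[of n]] by simp
    ultimately show ?thesis using True by (auto simp: G_def)
  qed
qed

end

lemma finsum_lsum_swap:
  assumes S: "algebra K S" and q: "\<And>x. x \<in> X \<Longrightarrow> q x \<in> carrier K"
    and f: "\<And>x v. x \<in> X \<Longrightarrow> v \<in> set L \<Longrightarrow> f x v \<in> carrier S"
  shows "finsum S (\<lambda>x. q x \<odot>\<^bsub>S\<^esub> lsum S (map (f x) L)) X = lsum S (map (\<lambda>v. finsum S (\<lambda>x. q x \<odot>\<^bsub>S\<^esub> f x v) X) L)"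
proof -
  interpret S: algebra K S by fact
  show ?thesis using f
  proof (induction L)
    case Nil
    have "finsum S (\<lambda>x. q x \<odot>\<^bsub>S\<^esub> \<zero>\<^bsub>S\<^esub>) X = finsum S (\<lambda>x. \<zero>\<^bsub>S\<^esub>) X"
      by (rule S.finsum_cong'[OF refl]) (simp_all add: q)
    then show ?case by (simp add: lsum_simps)
  next
    case (Cons v L)
    have l: "lsum S (map (f x) L) \<in> carrier S" if "x \<in> X" for x
      by (rule S.lsum_closed) (use Cons.prems that in auto)
    have "finsum S (\<lambda>x. q x \<odot>\<^bsub>S\<^esub> lsum S (map (f x) (v # L))) X
      = finsum S (\<lambda>x. (q x \<odot>\<^bsub>S\<^esub> f x v) \<oplus>\<^bsub>S\<^esub> (q x \<odot>\<^bsub>S\<^esub> lsum S (map (f x) L))) X"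
      by (rule S.finsum_cong'[OF refl]) (use Cons.prems q l in \<open>auto simp: lsum_simps S.smult_r_distr\<close>)
    also have "\<dots> = finsum S (\<lambda>x. q x \<odot>\<^bsub>S\<^esub> f x v) X \<oplus>\<^bsub>S\<^esub> finsum S (\<lambda>x. q x \<odot>\<^bsub>S\<^esub> lsum S (map (f x) L)) X"
      by (rule S.finsum_addf) (use Cons.prems q l in auto)
    finally show ?case using Cons by (simp add: lsum_simps)
  qed
qed

lemma lsum_const:
  assumes S: "algebra K S" and z: "z \<in> carrier S"
  shows "lsum S (map (\<lambda>_. z) L) = add_pow K (length L) \<one>\<^bsub>K\<^esub> \<odot>\<^bsub>S\<^esub> z"
proof -
  interpret S: algebra K S by fact
  show ?thesis
  proof (induction L)
    case Nil
    then show ?case using z by (simp add: lsum_simps)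
  next
    case (Cons v L)
    have "add_pow K (length L) \<one>\<^bsub>K\<^esub> \<in> carrier K" by (rule S.R.add.nat_pow_closed) simp
    then show ?case using Cons z by (simp add: lsum_simps S.smult_l_distr S.M.a_comm)
  qed
qed

context bialgebra_universe
begin

subsection \<open>Every linear form comes from the filtration\<close>

lemma sp_smult:
  assumes S: "algebra K S" and ws: "length ws = n" "set ws \<subseteq> aug_ideal K A S" and i: "i < n" and s: "s \<in> carrier S"
  shows "sp n S (ws[i := s \<odot>\<^bsub>H S\<^esub> (ws ! i)]) = s \<odot>\<^bsub>ob (SF n) S\<^esub> sp n S ws"
proof -
  have wi: "ws ! i \<in> aug_ideal K A S" using ws i by (auto simp: subset_iff)
  have e: "map (\<kappa> S) ws = map (\<kappa> S) (take i ws) @ \<kappa> S (ws ! i) # map (\<kappa> S) (drop (Suc i) ws)"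
    using id_take_nth_drop[of i ws] i ws(1) by (metis list.map(2) map_append)
  have "map (\<kappa> S) (ws[i := s \<odot>\<^bsub>H S\<^esub> (ws ! i)])
      = map (\<kappa> S) (take i ws) @ (s \<odot>\<^bsub>ob cot S\<^esub> \<kappa> S (ws ! i)) # map (\<kappa> S) (drop (Suc i) ws)"
    using i ws(1) by (simp add: upd_conv_take_nth_drop cot_smult[OF S s wi])
  moreover have "map (\<kappa> S) (take i ws) @ \<kappa> S (ws ! i) # map (\<kappa> S) (drop (Suc i) ws) \<in> tuples n (ob cot S)"
    using cot_tuplesI[OF S ws] by (simp only: e[symmetric])
  ultimately show ?thesis
    using sym_multilinearD(3)[OF sym_product_multilinear[OF module_functorD(1)[OF cot_module_functor S]] _ s]
    by (simp only: e sym_functor_ob[OF cot_module_functor])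
qed

lemma NN_permute:
  assumes \<eta>: "\<eta> \<in> carrier (NN n)" and S: "algebra K S" and ws: "length ws = n" "set ws \<subseteq> aug_ideal K A S"
    and m: "mset vs = mset ws"
  shows "\<eta> S (sp n S vs) = \<eta> S (sp n S ws)"
proof -
  have "mset (map (\<kappa> S) ws) = mset (map (\<kappa> S) vs)" using m by simp
  from sym_multilinear_mset[OF sym_product_multilinear[OF module_functorD(1)[OF cot_module_functor S]] cot_tuplesI[OF S ws] this]
  show ?thesis by simp
qed

text \<open>The form is first applied to functionals extended from \<open>P\<close>, so that
  \<open>Kz.multi_yoneda\<close> yields vectors of \<open>P\<close>. This loses nothing, because a
  class in the cotangent functor is determined by its values on \<open>G 2\<close>. Symmetry of the
  form makes all n! terms of the permanent equal.\<close>

lemma \<Xi>_onto: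
  assumes \<eta>: "\<eta> \<in> carrier (NN n)"
  shows "\<exists>a\<in>G (Suc n). \<Xi> n a = \<eta>"
proof -
  let ?P = "A\<lparr>carrier := P\<rparr>"
  have PM: "module K ?P" by (rule submodule.submodule_is_module[OF P_submodule A_module])
  have PA: "p \<in> carrier A" if "p \<in> P" for p using that P_subset by blast
  obtain \<pi> where \<pi>: "linear_map K A A \<pi>" "\<And>x. x \<in> carrier A \<Longrightarrow> \<pi> x \<in> P" "\<And>x. x \<in> P \<Longrightarrow> \<pi> x = x"
    by (rule K.linear_retraction[OF A_module P_submodule]) blast
  \<comment> \<open>The projection of \<open>A\<close> that removes the component along the unit; it
    carries \<open>G 2\<close> to \<open>P\<close> and fixes \<open>P\<close>.\<close>
  define \<delta> where "\<delta> a = a \<oplus>\<^bsub>A\<^esub> ((\<ominus>\<^bsub>K\<^esub> \<one>\<^bsub>K\<^esub>) \<odot>\<^bsub>A\<^esub> (\<epsilon> a \<odot>\<^bsub>A\<^esub> \<one>\<^bsub>A\<^esub>))" for a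
  have el: "linear_map K A A (\<lambda>a. \<epsilon> a \<odot>\<^bsub>A\<^esub> \<one>\<^bsub>A\<^esub>)"
    by (rule linear_mapI)
      (simp_all add: counit_closed counit_add counit_smult A.smult_l_distr A.smult_assoc1)
  have \<delta>: "linear_map K A A \<delta>"
    unfolding \<delta>_def by (rule linear_map_add[OF A_module linear_map_ident linear_map_smult[OF A_module el]]) simp
  have \<delta>A: "\<delta> a \<in> carrier A" if "a \<in> carrier A" for a by (rule linear_mapD(1)[OF \<delta> that])
  have \<delta>1: "\<delta> \<one>\<^bsub>A\<^esub> = \<zero>\<^bsub>A\<^esub>"
    by (simp add: \<delta>_def counit_one A.smult_l_minus A.M.r_neg)
  have \<delta>P: "\<delta> p = p" if "p \<in> P" for p using that PA by (simp add: \<delta>_def P_def)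
  have \<delta>G2: "\<delta> a \<in> P" if a: "a \<in> G 2" for a
  proof -
    have aA: "a \<in> carrier A" using a G_subset by blast
    note E = A.submoduleE[OF G_submodule[of 2]]
    have "\<delta> a \<in> G 2"
      unfolding \<delta>_def using a one_in_G[of 2] counit_closed[OF aA] by (intro E(4,5)) auto
    moreover have "\<epsilon> (\<delta> a) = \<zero>\<^bsub>K\<^esub>"
      unfolding \<delta>_def using aA counit_closed[OF aA]
      by (simp add: counit_add counit_smult counit_one A.R.l_minus A.R.r_neg)
    ultimately show ?thesis by (simp add: P_def)
  qed
  \<comment> \<open>A projection of \<open>A\<close> onto \<open>P\<close> that kills the unit.
    Killing the unit puts extended functionals into the augmentation ideal; agreement with
    \<open>\<delta>\<close> on \<open>G 2\<close> preserves classes.\<close>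
  define \<rho> where "\<rho> a = \<pi> (\<delta> a)" for a
  have \<rho>: "linear_map K A ?P \<rho>"
  proof -
    have "linear_map K A A \<rho>" unfolding \<rho>_def by (rule linear_map_comp[OF \<delta> \<pi>(1)])
    then show ?thesis using \<pi>(2)[OF \<delta>A] linear_mapD by (auto simp: linear_map_def \<rho>_def)
  qed
  have \<rho>P: "\<rho> a \<in> P" if "a \<in> carrier A" for a unfolding \<rho>_def by (rule \<pi>(2)[OF \<delta>A[OF that]])
  have \<rho>1: "\<rho> \<one>\<^bsub>A\<^esub> = \<zero>\<^bsub>A\<^esub>"
    unfolding \<rho>_def \<delta>1 by (rule linear_map_zero[OF A_module A_module \<pi>(1)])
  have \<rho>id: "\<rho> a = \<delta> a" if "a \<in> G 2" for a unfolding \<rho>_def by (rule \<pi>(3)[OF \<delta>G2[OF that]])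
  define ext where "ext w = (\<lambda>a\<in>carrier A. w (\<rho> a))" for w :: "'a \<Rightarrow> 's"
  have extI: "ext w \<in> aug_ideal K A S" if S: "algebra K S" and w: "w \<in> carrier (hom_module K ?P S)" for S :: "('k,'s) module" and w
    using hom_module_restrict[OF A_module linear_map_comp[OF \<rho> hom_module_linear[OF w]]]
      linear_map_zero[OF PM algebraD(1)[OF S] hom_module_linear[OF w]] \<rho>1
    by (simp add: aug_ideal_iff[OF S] ext_def)
  have extS: "set (map ext ws) \<subseteq> aug_ideal K A S" if "algebra K S" "set ws \<subseteq> carrier (hom_module K ?P S)"
    for S :: "('k,'s) module" and ws using extI[OF that(1)] that(2) by auto
  let ?\<Theta> = "\<lambda>S ws. \<eta> S (sp n S (map ext ws))"
  obtain X :: "(nat \<times> 's) multiset set" and q tt where X: "finite X"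
    "\<And>x. x \<in> X \<Longrightarrow> q x \<in> carrier K" "\<And>x. x \<in> X \<Longrightarrow> tt x \<in> tuples n ?P"
    "\<And>S ws. algebra K S \<Longrightarrow> length ws = n \<Longrightarrow> set ws \<subseteq> carrier (hom_module K ?P S) \<Longrightarrow>
      ?\<Theta> S ws = finsum S (\<lambda>x. q x \<odot>\<^bsub>S\<^esub> eval_prod S ws (tt x)) X"
  proof (rule Kz.multi_yoneda[where \<Theta> = ?\<Theta> and n = n, OF PM inj_on_subset[OF emb subset_UNIV]])
    fix S :: "('k,'s) module" and ws assume S: "algebra K S" and ws: "length ws = n" "set ws \<subseteq> carrier (hom_module K ?P S)"
    interpret S: algebra K S by (rule S)
    note e = extS[OF S ws(2)]
    have len: "length (map ext ws) = n" using ws(1) by simp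
    show "\<eta> S (sp n S (map ext ws)) \<in> carrier S"
      by (rule dual_space_app_closed[OF SF_functor K_cring \<eta> S sp_closed[OF S len e]])
    show "\<eta> S (sp n S (map ext (ws[i := (\<lambda>x\<in>carrier ?P. c \<odot>\<^bsub>S\<^esub> (ws ! i) x)]))) = c \<odot>\<^bsub>S\<^esub> \<eta> S (sp n S (map ext ws))"
      if i: "i < n" and c: "c \<in> carrier K" for i c
    proof -
      let ?s = "c \<odot>\<^bsub>S\<^esub> \<one>\<^bsub>S\<^esub>"
      have s: "?s \<in> carrier S" using c by simp
      have wi: "ws ! i \<in> carrier (hom_module K ?P S)" using ws i by (auto simp: subset_iff)
      have "ext (\<lambda>x\<in>carrier ?P. c \<odot>\<^bsub>S\<^esub> (ws ! i) x) = ?s \<odot>\<^bsub>H S\<^esub> ext (ws ! i)"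
        using \<rho>P linear_mapD(1)[OF hom_module_linear[OF wi]] c
        by (auto simp: ext_def hom_module_simps(4) fun_eq_iff S.smult_assoc2)
      then have "map ext (ws[i := (\<lambda>x\<in>carrier ?P. c \<odot>\<^bsub>S\<^esub> (ws ! i) x)])
        = (map ext ws)[i := ?s \<odot>\<^bsub>H S\<^esub> (map ext ws ! i)]"
        using i ws(1) by (simp add: map_update)
      then have "\<eta> S (sp n S (map ext (ws[i := (\<lambda>x\<in>carrier ?P. c \<odot>\<^bsub>S\<^esub> (ws ! i) x)])))
        = ?s \<otimes>\<^bsub>S\<^esub> \<eta> S (sp n S (map ext ws))"
        using linear_mapD(3)[OF dual_space_linear[OF SF_functor K_cring \<eta> S] s sp_closed[OF S len e]]
        by (simp only: sp_smult[OF S len e i s] regular_module_simps)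
      also have "\<dots> = c \<odot>\<^bsub>S\<^esub> \<eta> S (sp n S (map ext ws))"
        using c dual_space_app_closed[OF SF_functor K_cring \<eta> S sp_closed[OF S len e]] by (simp add: S.smult_assoc2)
      finally show ?thesis .
    qed
    show "\<eta> T (sp n T (map ext (map (push ?P \<phi>) ws))) = \<phi> (\<eta> S (sp n S (map ext ws)))"
      if T: "algebra K T" and \<phi>: "\<phi> \<in> alg_hom K S T" for T \<phi>
    proof -
      have "ext (push ?P \<phi> w) = push A \<phi> (ext w)" for w
        using \<rho>P by (auto simp: ext_def fun_eq_iff)
      then have "map (\<kappa> T) (map ext (map (push ?P \<phi>) ws)) = map (ar cot S T \<phi>) (map (\<kappa> S) (map ext ws))"
        using e cot_ar[OF S T \<phi>] by auto
      then have "sp n T (map ext (map (push ?P \<phi>) ws)) = ar (SF n) S T \<phi> (sp n S (map ext ws))"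
        by (simp only: sym_functor_ar_product[OF cot_module_functor S T \<phi> cot_tuplesI[OF S len e]])
      then show ?thesis
        by (simp only: dual_space_natural[OF SF_functor K_cring \<eta> S T \<phi> sp_closed[OF S len e]])
    qed
  qed blast
  have tP: "set (tt x) \<subseteq> P" "length (tt x) = n" if "x \<in> X" for x
    using X(3)[OF that] by (auto simp: tuples_def)
  \<comment> \<open>Restricting a functional of the augmentation ideal to \<open>P\<close> and
    extending it again along \<open>\<rho>\<close> does not change it on \<open>G 2\<close>, where
    \<open>a\<close> and \<open>\<rho> a\<close> differ by a multiple of the unit. Hence the formula
    found for functionals on \<open>P\<close> holds for all factors.\<close>
  have \<eta>_eq: "\<eta> S (sp n S ws) = finsum S (\<lambda>x. q x \<odot>\<^bsub>S\<^esub> eval_prod S ws (tt x)) X"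
    if S: "algebra K S" and ws: "length ws = n" "set ws \<subseteq> aug_ideal K A S" for S :: "('k,'s) module" and ws
  proof -
    interpret S: algebra K S by (rule S)
    let ?r = "\<lambda>w. restrict w (carrier ?P)"
    have wH: "w \<in> carrier (H S)" if "w \<in> set ws" for w using that ws(2) aug_ideal_subset[OF S] by blast
    have incl: "linear_map K ?P A (\<lambda>x. x)" using PA by (intro linear_mapI) auto
    have r: "?r w \<in> carrier (hom_module K ?P S)" if "w \<in> set ws" for w
      using hom_module_restrict[OF PM linear_map_comp[OF incl hom_module_linear[OF wH[OF that]]]] .
    have rs: "length (map ?r ws) = n" "set (map ?r ws) \<subseteq> carrier (hom_module K ?P S)" using r ws(1) by auto
    have "\<kappa> S (ext (?r w)) = \<kappa> S w" if w: "w \<in> set ws" for w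
    proof -
      have wI: "w \<in> aug_ideal K A S" using w ws(2) by blast
      note L = hom_module_linear[OF wH[OF w]]
      have w1: "w \<one>\<^bsub>A\<^esub> = \<zero>\<^bsub>S\<^esub>" using wI by (simp add: aug_ideal_iff[OF S])
      have "ext (?r w) a = w a" if a: "a \<in> G 2" for a
      proof -
        have aA: "a \<in> carrier A" using a G_subset by blast
        have ea: "\<epsilon> a \<in> carrier K" by (rule counit_closed[OF aA])
        have "ext (?r w) a = w (\<delta> a)" using aA \<rho>P[OF aA] by (simp add: ext_def \<rho>id[OF a])
        also have "\<dots> = w a \<oplus>\<^bsub>S\<^esub> ((\<ominus>\<^bsub>K\<^esub> \<one>\<^bsub>K\<^esub>) \<odot>\<^bsub>S\<^esub> (\<epsilon> a \<odot>\<^bsub>S\<^esub> w \<one>\<^bsub>A\<^esub>))"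
          unfolding \<delta>_def using aA ea by (simp add: linear_mapD(2)[OF L] linear_mapD(3)[OF L])
        also have "\<dots> = w a" using ea H_app_closed[OF S wH[OF w] aA] by (simp add: w1)
        finally show ?thesis .
      qed
      then show ?thesis using cot_eq[OF S extI[OF S r[OF w]] wI] by blast
    qed
    then have k: "map (\<kappa> S) (map ext (map ?r ws)) = map (\<kappa> S) ws" by auto
    have "\<eta> S (sp n S ws) = ?\<Theta> S (map ?r ws)" by (simp only: k)
    also have "\<dots> = finsum S (\<lambda>x. q x \<odot>\<^bsub>S\<^esub> eval_prod S (map ?r ws) (tt x)) X" by (rule X(4)[OF S rs])
    also have "\<dots> = finsum S (\<lambda>x. q x \<odot>\<^bsub>S\<^esub> eval_prod S ws (tt x)) X"
    proof (rule S.finsum_cong'[OF refl])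
      show "(\<lambda>x. q x \<odot>\<^bsub>S\<^esub> eval_prod S ws (tt x)) \<in> X \<rightarrow> carrier S"
      proof
        fix x assume x: "x \<in> X"
        have "set (tt x) \<subseteq> carrier A" using tP(1)[OF x] P_subset by blast
        from eval_prod_closed[OF S aug_H[OF S ws(2)] this] X(2)[OF x]
        show "q x \<odot>\<^bsub>S\<^esub> eval_prod S ws (tt x) \<in> carrier S" by simp
      qed
      fix x assume x: "x \<in> X"
      have "map2 (\<lambda>w p. w p) (map ?r ws) (tt x) = map2 (\<lambda>w p. w p) ws (tt x)"
        using tP[OF x] ws(1) by (intro nth_equalityI) (auto simp: subset_iff)
      then show "q x \<odot>\<^bsub>S\<^esub> eval_prod S (map ?r ws) (tt x) = q x \<odot>\<^bsub>S\<^esub> eval_prod S ws (tt x)"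
        by (simp add: eval_prod_def)
    qed
    finally show ?thesis .
  qed
  \<comment> \<open>The inverse of n!, the number of terms of the permanent.\<close>
  define c where "c = inv\<^bsub>K\<^esub> (add_pow K (fact n :: nat) \<one>\<^bsub>K\<^esub>)"
  have fK: "add_pow K (fact n :: nat) \<one>\<^bsub>K\<^esub> \<in> carrier K" by (rule A.R.add.nat_pow_closed) simp
  have "add_pow K (fact n :: nat) \<one>\<^bsub>K\<^esub> \<noteq> \<zero>\<^bsub>K\<^esub>" using char0 by simp
  then have c: "c \<in> carrier K" "c \<otimes>\<^bsub>K\<^esub> add_pow K (fact n :: nat) \<one>\<^bsub>K\<^esub> = \<one>\<^bsub>K\<^esub>"
    using fK by (auto simp: c_def K.field_Units)
  have AP: "A_prod (tt x) \<in> G (Suc n)" if "x \<in> X" for x using A_prod_in_G[OF tP(1)[OF that]] tP(2)[OF that] by simp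
  note E = A.submoduleE[OF G_submodule[of "Suc n"]]
  let ?b = "finsum A (\<lambda>x. q x \<odot>\<^bsub>A\<^esub> A_prod (tt x)) X"
  have bG: "?b \<in> G (Suc n)"
    by (rule submodule_finsum[OF A_module G_submodule]) (use X(2) AP E(4) in auto)
  have aG: "c \<odot>\<^bsub>A\<^esub> ?b \<in> G (Suc n)" by (rule E(4)[OF c(1) bG])
  have GA: "a \<in> carrier A" if "a \<in> G (Suc n)" for a using that G_subset by blast
  have "\<Xi> n (c \<odot>\<^bsub>A\<^esub> ?b) = \<eta>"
  proof (rule NN_eqI[OF \<Xi>_closed[OF aG] \<eta>])
    fix S :: "('k,'s) module" and ws assume S: "algebra K S" and ws: "length ws = n" "set ws \<subseteq> aug_ideal K A S"
    interpret S: algebra K S by (rule S)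
    let ?w = "conv_prod K A S ws"
    note wH = conv_prod_closed[OF S aug_H[OF S ws(2)]]
    note L = hom_module_linear[OF wH]
    let ?z = "\<eta> S (sp n S ws)"
    have z: "?z \<in> carrier S" by (rule dual_space_app_closed[OF SF_functor K_cring \<eta> S sp_closed[OF S ws]])
    have arr: "length vs = n" "set vs \<subseteq> aug_ideal K A S" "mset vs = mset ws" if "vs \<in> set (arrangements n ws)" for vs
      using arrangements_mset[OF ws(1) that] ws by (metis mset_eq_length, metis mset_eq_setD, blast)
    have ev: "eval_prod S vs (tt x) \<in> carrier S" if "x \<in> X" "vs \<in> set (arrangements n ws)" for x vs
      using tP(1)[OF that(1)] P_subset by (intro eval_prod_closed[OF S aug_H[OF S arr(2)[OF that(2)]]]) blast
    have "?w ?b = finsum S (\<lambda>x. ?w (q x \<odot>\<^bsub>A\<^esub> A_prod (tt x))) X"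
      by (rule linear_map_finsum[OF A_module S.module L]) (use X(2) AP GA in auto)
    also have "\<dots> = finsum S (\<lambda>x. q x \<odot>\<^bsub>S\<^esub> lsum S (map (\<lambda>vs. eval_prod S vs (tt x)) (arrangements n ws))) X"
    proof (rule S.finsum_cong'[OF refl])
      show "(\<lambda>x. q x \<odot>\<^bsub>S\<^esub> lsum S (map (\<lambda>vs. eval_prod S vs (tt x)) (arrangements n ws))) \<in> X \<rightarrow> carrier S"
        using X(2) ev by (intro funcsetI S.smult_closed S.lsum_closed) auto
      fix x assume x: "x \<in> X"
      have "?w (A_prod (tt x)) = lsum S (map (\<lambda>vs. eval_prod S vs (tt x)) (arrangements n ws))"
        by (rule conv_prod_permanent[OF S tP(2)[OF x] ws]) (use tP(1)[OF x] P_prim[OF S] in blast)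
      then show "?w (q x \<odot>\<^bsub>A\<^esub> A_prod (tt x)) = q x \<odot>\<^bsub>S\<^esub> lsum S (map (\<lambda>vs. eval_prod S vs (tt x)) (arrangements n ws))"
        by (simp only: linear_mapD(3)[OF L X(2)[OF x] GA[OF AP[OF x]]])
    qed
    also have "\<dots> = lsum S (map (\<lambda>vs. finsum S (\<lambda>x. q x \<odot>\<^bsub>S\<^esub> eval_prod S vs (tt x)) X) (arrangements n ws))"
      by (rule finsum_lsum_swap[OF S X(2) ev])
    \<comment> \<open>The inner sum is the value of \<open>\<eta>\<close> on the permuted product,
      which by symmetry does not depend on the permutation.\<close>
    also have "\<dots> = lsum S (map (\<lambda>_. ?z) (arrangements n ws))"
    proof (intro arg_cong[where f = "lsum S"] map_cong[OF refl])
      fix vs assume vs: "vs \<in> set (arrangements n ws)"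
      show "finsum S (\<lambda>x. q x \<odot>\<^bsub>S\<^esub> eval_prod S vs (tt x)) X = ?z"
        by (simp only: \<eta>_eq[OF S arr(1,2)[OF vs], symmetric] NN_permute[OF \<eta> S ws arr(3)[OF vs]])
    qed
    also have "\<dots> = add_pow K (fact n :: nat) \<one>\<^bsub>K\<^esub> \<odot>\<^bsub>S\<^esub> ?z"
      by (simp only: lsum_const[OF S z] length_arrangements[OF ws(1)])
    finally have "?w (c \<odot>\<^bsub>A\<^esub> ?b) = (c \<otimes>\<^bsub>K\<^esub> add_pow K (fact n :: nat) \<one>\<^bsub>K\<^esub>) \<odot>\<^bsub>S\<^esub> ?z"
      using linear_mapD(3)[OF L c(1) GA[OF bG]] z c(1) fK by (simp only: S.smult_assoc1)
    also have "\<dots> = ?z" using c(2) z by simp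
    finally show "\<Xi> n (c \<odot>\<^bsub>A\<^esub> ?b) S (sp n S ws) = ?z" by (simp only: \<Xi>_sp[OF S aG ws])
  qed
  then show ?thesis using aG by blast
qed

subsection \<open>The natural morphism\<close>

text \<open>\<open>\<Xi>\<close> is meaningful on \<open>G (n + 1)\<close> only, while points of the
  graded piece are represented by functionals on all of \<open>A\<close>. A retraction extends them;
  its choice disappears in the quotient, where only values on \<open>G (n + 1)\<close>
  count.\<close>

definition ret :: "nat \<Rightarrow> 'a \<Rightarrow> 'a" where
  "ret n = (SOME \<pi>. linear_map K A A \<pi> \<and> (\<forall>x\<in>carrier A. \<pi> x \<in> G (Suc n)) \<and> (\<forall>x\<in>G (Suc n). \<pi> x = x))"

lemma ret:
  shows "linear_map K A (A\<lparr>carrier := G (Suc n)\<rparr>) (ret n)" and "x \<in> G (Suc n) \<Longrightarrow> ret n x = x"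
proof -
  have "\<exists>\<pi>. linear_map K A A \<pi> \<and> (\<forall>x\<in>carrier A. \<pi> x \<in> G (Suc n)) \<and> (\<forall>x\<in>G (Suc n). \<pi> x = x)"
    by (rule K.linear_retraction[OF A_module G_submodule[of "Suc n"]]) blast
  from someI_ex[OF this] have r: "linear_map K A A (ret n)" "\<forall>x\<in>carrier A. ret n x \<in> G (Suc n)" "\<forall>x\<in>G (Suc n). ret n x = x"
    unfolding ret_def by blast+
  show "linear_map K A (A\<lparr>carrier := G (Suc n)\<rparr>) (ret n)"
    using linear_mapD[OF r(1)] r(2) by (intro linear_mapI) auto
  show "x \<in> G (Suc n) \<Longrightarrow> ret n x = x" using r(3) by blast
qed

definition lift :: "nat \<Rightarrow> ((('k,'s) module \<Rightarrow> (('a \<Rightarrow> 's) set list \<Rightarrow> 's) set \<Rightarrow> 's) \<Rightarrow> 's) \<Rightarrow> 'a \<Rightarrow> 's" where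
  "lift n f = (\<lambda>a\<in>carrier A. f (\<Xi> n (ret n a)))"

abbreviation \<gamma> :: "nat \<Rightarrow> ('k,'s) module \<Rightarrow> ('a \<Rightarrow> 's) \<Rightarrow> ('a \<Rightarrow> 's) set" where
  "\<gamma> n S w \<equiv> aug_power K A (Suc n) S +>\<^bsub>H S\<^esub> w"

lemma lift_app: "a \<in> G (Suc n) \<Longrightarrow> lift n f a = f (\<Xi> n a)"
  using G_subset by (auto simp: lift_def ret(2))

lemma ret_closed: "a \<in> carrier A \<Longrightarrow> ret n a \<in> G (Suc n)"
  using linear_mapD(1)[OF ret(1)] by simp

lemma lift_Kill:
  assumes S: "algebra K S" and f: "f \<in> carrier (hom_module K (NN n) S)"
  shows "lift n f \<in> Kill (G n) S"
proof -
  have "lift n f \<in> carrier (H S)"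
    unfolding lift_def
    by (rule hom_module_restrict[OF A_module linear_map_comp[OF linear_map_comp[OF ret(1) \<Xi>_linear] hom_module_linear[OF f]]])
  moreover have "lift n f a = \<zero>\<^bsub>S\<^esub>" if a: "a \<in> G n" for a
  proof -
    have a': "a \<in> G (Suc n)" using a G_mono by blast
    have "\<Xi> n a = \<zero>\<^bsub>NN n\<^esub>" using \<Xi>_kernel[OF a'] a by blast
    then show ?thesis
      using lift_app[OF a'] linear_map_zero[OF NN_module algebraD(1)[OF S] hom_module_linear[OF f]] by simp
  qed
  ultimately show ?thesis by (simp add: Kill_def)
qed

abbreviation gp :: "nat \<Rightarrow> ('k,'s,('a \<Rightarrow> 's) set) kfunctor" where "gp n \<equiv> graded_piece K A n"

lemmas gp_facts = aug_power_eq aug_power_eq G_mono G_subset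

lemma gp_module_functor: "module_functor K (gp n)"
  unfolding graded_piece_def by (rule kq_module_functor[OF gp_facts])

lemma gp_carrier: "algebra K S \<Longrightarrow> X \<in> carrier (ob (gp n) S) \<longleftrightarrow> (\<exists>w\<in>Kill (G n) S. X = \<gamma> n S w)"
  unfolding graded_piece_def by (rule kq_carrier[OF gp_facts])

lemma gp_add: "algebra K S \<Longrightarrow> v \<in> Kill (G n) S \<Longrightarrow> w \<in> Kill (G n) S \<Longrightarrow>
    \<gamma> n S v \<oplus>\<^bsub>ob (gp n) S\<^esub> \<gamma> n S w = \<gamma> n S (v \<oplus>\<^bsub>H S\<^esub> w)"
  unfolding graded_piece_def by (rule kq_add[OF gp_facts])

lemma gp_smult: "algebra K S \<Longrightarrow> s \<in> carrier S \<Longrightarrow> w \<in> Kill (G n) S \<Longrightarrow>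
    s \<odot>\<^bsub>ob (gp n) S\<^esub> \<gamma> n S w = \<gamma> n S (s \<odot>\<^bsub>H S\<^esub> w)"
  unfolding graded_piece_def by (rule kq_smult[OF gp_facts])

lemma gp_ar: "algebra K S \<Longrightarrow> algebra K T \<Longrightarrow> \<phi> \<in> alg_hom K S T \<Longrightarrow> w \<in> Kill (G n) S \<Longrightarrow>
    ar (gp n) S T \<phi> (\<gamma> n S w) = \<gamma> n T (push A \<phi> w)"
  unfolding graded_piece_def by (rule kq_ar[OF gp_facts])

lemma gp_eq: "algebra K S \<Longrightarrow> v \<in> carrier (H S) \<Longrightarrow> w \<in> carrier (H S) \<Longrightarrow>
    \<gamma> n S v = \<gamma> n S w \<longleftrightarrow> (\<forall>a\<in>G (Suc n). v a = w a)"
  by (rule kq_eq[OF gp_facts])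

lemma Kill_H: "w \<in> Kill V S \<Longrightarrow> w \<in> carrier (H S)"
  by (simp add: Kill_def)

abbreviation CL :: "nat \<Rightarrow> ('k,'s,(('k,'s) module \<Rightarrow> (('a \<Rightarrow> 's) set list \<Rightarrow> 's) set \<Rightarrow> 's) \<Rightarrow> 's) kfunctor" where
  "CL n \<equiv> closure_scheme K (SF n)"

lemma CL_simps: "ob (CL n) S = hom_module K (NN n) S" "ar (CL n) S T \<phi> = push (NN n) \<phi>"
  by (simp_all add: closure_scheme_def dual_functor_simps)

lemma CL_module_functor: "module_functor K (CL n)"
  unfolding closure_scheme_def by (rule module_functor_dual[OF NN_module])

text \<open>The transpose of \<open>\<Xi>\<close>: a functional on \<open>NN n\<close> is pulled
  back to \<open>G (n + 1)\<close>, where it kills \<open>G n\<close>, and extended to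
  \<open>A\<close>.\<close>

definition mm :: "nat \<Rightarrow> ('k,'s) module \<Rightarrow> ((('k,'s) module \<Rightarrow> (('a \<Rightarrow> 's) set list \<Rightarrow> 's) set \<Rightarrow> 's) \<Rightarrow> 's) \<Rightarrow> ('a \<Rightarrow> 's) set" where
  "mm n = mk_hom K (CL n) (\<lambda>S f. \<gamma> n S (lift n f))"

lemma mm_app: "algebra K S \<Longrightarrow> f \<in> carrier (hom_module K (NN n) S) \<Longrightarrow> mm n S f = \<gamma> n S (lift n f)"
  unfolding mm_def by (rule mk_hom_app) (simp_all add: CL_simps)

lemma mm_functor_hom: "mm n \<in> functor_hom K (CL n) (gp n)"
  unfolding mm_def
proof (rule mk_hom_functor_hom[OF CL_module_functor]; unfold CL_simps)
  fix S :: "('k,'s) module" assume S: "algebra K S"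
  interpret S: algebra K S by (rule S)
  interpret HS: module S "H S" by (rule module_hom_module[OF A_module S])
  interpret NS: module S "hom_module K (NN n) S" by (rule module_hom_module[OF NN_module S])
  note lH = Kill_H[OF lift_Kill[OF S]]
  note \<Xi>N = \<Xi>_closed
  show "linear_map S (hom_module K (NN n) S) (ob (gp n) S) (\<lambda>f. \<gamma> n S (lift n f))"
  proof (rule linear_mapI)
    fix f assume f: "f \<in> carrier (hom_module K (NN n) S)"
    show "\<gamma> n S (lift n f) \<in> carrier (ob (gp n) S)" using gp_carrier[OF S] lift_Kill[OF S f] by blast
    show "\<gamma> n S (lift n (f \<oplus>\<^bsub>hom_module K (NN n) S\<^esub> g)) = \<gamma> n S (lift n f) \<oplus>\<^bsub>ob (gp n) S\<^esub> \<gamma> n S (lift n g)"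
      if g: "g \<in> carrier (hom_module K (NN n) S)" for g
      unfolding gp_add[OF S lift_Kill[OF S f] lift_Kill[OF S g]]
        gp_eq[OF S lH[OF NS.M.a_closed[OF f g]] HS.M.a_closed[OF lH[OF f] lH[OF g]]]
      using G_subset by (auto simp: lift_app hom_module_app \<Xi>_closed subset_iff)
    show "\<gamma> n S (lift n (s \<odot>\<^bsub>hom_module K (NN n) S\<^esub> f)) = s \<odot>\<^bsub>ob (gp n) S\<^esub> \<gamma> n S (lift n f)" if s: "s \<in> carrier S" for s
      unfolding gp_smult[OF S s lift_Kill[OF S f]]
        gp_eq[OF S lH[OF NS.smult_closed[OF s f]] HS.smult_closed[OF s lH[OF f]]]
      using G_subset by (auto simp: lift_app hom_module_app \<Xi>_closed subset_iff)
  qed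
  fix T \<phi> f assume T: "algebra K T" and \<phi>: "\<phi> \<in> alg_hom K S T" and f: "f \<in> carrier (hom_module K (NN n) S)"
  have "lift n (push (NN n) \<phi> f) = push A \<phi> (lift n f)"
    using \<Xi>_closed[OF ret_closed] by (auto simp: lift_def fun_eq_iff)
  then show "\<gamma> n T (lift n (push (NN n) \<phi> f)) = ar (gp n) S T \<phi> (\<gamma> n S (lift n f))"
    by (simp only: gp_ar[OF S T \<phi> lift_Kill[OF S f]])
qed

text \<open>Injective because every form is some \<open>\<Xi> n a\<close>; surjective because a
  functional that vanishes on the kernel \<open>G n\<close> of \<open>\<Xi> n\<close> factors
  through it.\<close>

lemma mm_bij:
  assumes S: "algebra K S"
  shows "bij_betw (mm n S) (carrier (ob (CL n) S)) (carrier (ob (gp n) S))"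
  unfolding CL_simps bij_betw_def
proof
  note lH = Kill_H[OF lift_Kill[OF S]]
  show "inj_on (mm n S) (carrier (hom_module K (NN n) S))"
  proof (rule inj_onI)
    fix f g assume f: "f \<in> carrier (hom_module K (NN n) S)" and g: "g \<in> carrier (hom_module K (NN n) S)"
      and eq: "mm n S f = mm n S g"
    have *: "\<forall>a\<in>G (Suc n). lift n f a = lift n g a"
      using eq by (simp only: mm_app[OF S f] mm_app[OF S g] gp_eq[OF S lH[OF f] lH[OF g]])
    show "f = g"
    proof (rule hom_module_eqI[OF f g])
      fix \<eta> assume "\<eta> \<in> carrier (NN n)"
      then obtain a where "a \<in> G (Suc n)" "\<Xi> n a = \<eta>" using \<Xi>_onto by blast
      then show "f \<eta> = g \<eta>" using * lift_app by metis
    qed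
  qed
  show "mm n S ` carrier (hom_module K (NN n) S) = carrier (ob (gp n) S)"
  proof
    show "mm n S ` carrier (hom_module K (NN n) S) \<subseteq> carrier (ob (gp n) S)"
    proof (rule image_subsetI)
      fix f assume f: "f \<in> carrier (hom_module K (NN n) S)"
      show "mm n S f \<in> carrier (ob (gp n) S)"
        unfolding mm_app[OF S f] gp_carrier[OF S] using lift_Kill[OF S f] by blast
    qed
    show "carrier (ob (gp n) S) \<subseteq> mm n S ` carrier (hom_module K (NN n) S)"
    proof
      fix X assume "X \<in> carrier (ob (gp n) S)"
      then obtain w where w: "w \<in> Kill (G n) S" "X = \<gamma> n S w" using gp_carrier[OF S] by blast
      note l = linear_mapD[OF hom_module_linear[OF Kill_H[OF w(1)]]]
      have wl: "linear_map K (A\<lparr>carrier := G (Suc n)\<rparr>) S w"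
      proof (intro linear_mapI, goal_cases)
          case (1 x)
          then show ?case using l(1) G_subset[of "Suc n"] by auto
        next
          case (2 x y)
          then have "x \<in> carrier A" "y \<in> carrier A" using G_subset[of "Suc n"] by auto
          then show ?case by (simp add: l(2))
        next
          case (3 c x)
          then have "x \<in> carrier A" using G_subset[of "Suc n"] by auto
          then show ?case using 3(1) by (simp add: l(3))
      qed
      obtain v where v: "linear_map K (NN n) S v"
        "\<And>a. a \<in> carrier (A\<lparr>carrier := G (Suc n)\<rparr>) \<Longrightarrow> w a = v (\<Xi> n a)"
      proof (rule factor_through[OF field G_module NN_module algebraD(1)[OF S] \<Xi>_linear wl])
        show "w a = \<zero>\<^bsub>S\<^esub>" if "a \<in> carrier (A\<lparr>carrier := G (Suc n)\<rparr>)" "\<Xi> n a = \<zero>\<^bsub>NN n\<^esub>" for a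
          using that \<Xi>_kernel[of a n] w(1) by (simp add: Kill_def)
      qed blast
      let ?f = "\<lambda>\<eta>\<in>carrier (NN n). v \<eta>"
      have f: "?f \<in> carrier (hom_module K (NN n) S)" by (rule hom_module_restrict[OF NN_module v(1)])
      have "\<forall>a\<in>G (Suc n). lift n ?f a = w a"
        using v(2) by (simp add: lift_app \<Xi>_closed)
      then have "mm n S ?f = X"
        unfolding mm_app[OF S f] w(2) gp_eq[OF S lH[OF f] Kill_H[OF w(1)]] .
      then show "X \<in> mm n S ` carrier (hom_module K (NN n) S)" using f by blast
    qed
  qed
qed

section \<open>Characterisation of the natural morphism by its values on products\<close>

lemma closure_map_closed:
  assumes S: "algebra K S" and x: "x \<in> carrier (ob (SF n) S)"
  shows "closure_map K (SF n) S x \<in> carrier (hom_module K (NN n) S)"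
  unfolding closure_map_def
  by (rule hom_module_restrict[OF NN_module], rule linear_mapI)
    (simp_all only: dual_space_app_closed[OF SF_functor K_cring _ S x] dual_space_app[OF SF_functor K_cring S x])

lemma mm_natural: "natural_morphism K A n (mm n)"
  unfolding natural_morphism_def
proof (intro conjI allI impI mm_functor_hom)
  fix S :: "('k,'s) module" and ws assume S: "algebra K S" and ws: "length ws = n" "set ws \<subseteq> aug_ideal K A S"
  let ?f = "closure_map K (SF n) S (sp n S ws)"
  have f: "?f \<in> carrier (hom_module K (NN n) S)" by (rule closure_map_closed[OF S sp_closed[OF S ws]])
  have "\<forall>a\<in>G (Suc n). lift n ?f a = conv_prod K A S ws a"
    by (simp add: lift_app closure_map_def \<Xi>_closed \<Xi>_sp[OF S _ ws])
  then show "mm n S ?f = \<gamma> n S (conv_prod K A S ws)"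
    unfolding mm_app[OF S f]
      gp_eq[OF S Kill_H[OF lift_Kill[OF S f]] conv_prod_closed[OF S aug_H[OF S ws(2)]]] .
qed

text \<open>Reads off from a point of the graded piece its value at \<open>a\<close>. A morphism
  into the graded piece thus becomes a family of scalar functions, to which \<open>Kz.yoneda\<close>
  applies.\<close>

lemma some_coset_app:
  assumes S: "algebra K S" and w: "w \<in> carrier (H S)" and a: "a \<in> G (Suc n)"
  shows "(SOME v. v \<in> \<gamma> n S w) a = w a"
proof -
  note M = module_hom_module[OF A_module S] and N = Kill_submodule[OF G_subset[of "Suc n"] S]
  note c = coset_some[OF M N w, folded aug_power_eq[OF S]]
  show ?thesis using c(2) gp_eq[OF S c(1) w] a by blast
qed

text \<open>\<open>Kz.yoneda\<close> requires the carrier of \<open>NN n\<close> inside the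
  universe, but its elements are families of functions indexed by algebras. Since
  \<open>\<Xi>\<close> is onto, a form can be coded by a chosen element of \<open>A\<close> that
  induces it.\<close>

lemma NN_enc:
  obtains enc :: "(('k,'s) module \<Rightarrow> (('a \<Rightarrow> 's) set list \<Rightarrow> 's) set \<Rightarrow> 's) \<Rightarrow> 's" where "inj_on enc (carrier (NN n))"
proof -
  have "inj_on (\<lambda>\<eta>. emb (inv_into (G (Suc n)) (\<Xi> n) \<eta>)) (carrier (NN n))"
  proof (rule inj_onI)
    fix \<eta> \<theta> assume \<eta>: "\<eta> \<in> carrier (NN n)" and \<theta>: "\<theta> \<in> carrier (NN n)"
      and eq: "emb (inv_into (G (Suc n)) (\<Xi> n) \<eta>) = emb (inv_into (G (Suc n)) (\<Xi> n) \<theta>)"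
    have im: "\<eta> \<in> \<Xi> n ` G (Suc n)" "\<theta> \<in> \<Xi> n ` G (Suc n)" using \<Xi>_onto[OF \<eta>] \<Xi>_onto[OF \<theta>] by blast+
    show "\<eta> = \<theta>" by (rule inv_into_injective[OF injD[OF emb eq] im])
  qed
  then show ?thesis by (rule that)
qed

text \<open>The defining condition concerns only points coming from the symmetric power, whereas the
  closure can have more. For fixed \<open>a\<close> in \<open>G (n + 1)\<close>, naturality and
  linearity force the value of \<open>m\<close> at \<open>a\<close> to be evaluation at one form
  \<open>y\<close>; the points coming from products then suffice to identify \<open>y\<close> with
  \<open>\<Xi> n a\<close>.\<close>

lemma natural_morphism_unique:
  assumes m: "natural_morphism K A n m"
  shows "m = mm n"
proof -
  have mh: "m \<in> functor_hom K (CL n) (gp n)"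
    and mc: "\<And>(S :: ('k,'s) module) ws. algebra K S \<Longrightarrow> length ws = n \<Longrightarrow> set ws \<subseteq> aug_ideal K A S \<Longrightarrow>
      m S (closure_map K (SF n) S (sp n S ws)) = \<gamma> n S (conv_prod K A S ws)"
    using m unfolding natural_morphism_def by blast+
  have ex: "\<exists>w\<in>Kill (G n) S. m S f = \<gamma> n S w" if S: "algebra K S" and f: "f \<in> carrier (hom_module K (NN n) S)" for S :: "('k,'s) module" and f
    using linear_mapD(1)[OF functor_homD(2)[OF mh S, unfolded CL_simps] f] gp_carrier[OF S] by blast
  obtain enc :: "(('k,'s) module \<Rightarrow> (('a \<Rightarrow> 's) set list \<Rightarrow> 's) set \<Rightarrow> 's) \<Rightarrow> 's" where enc: "inj_on enc (carrier (NN n))"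
    by (rule NN_enc)
  have val: "(SOME v. v \<in> m S f) a = f (\<Xi> n a)"
    if S: "algebra K S" and f: "f \<in> carrier (hom_module K (NN n) S)" and a: "a \<in> G (Suc n)" for S :: "('k,'s) module" and f a
  proof -
    have aA: "a \<in> carrier A" using a G_subset by blast
    obtain y where y: "y \<in> carrier (NN n)"
      "\<And>(S :: ('k,'s) module) f. algebra K S \<Longrightarrow> f \<in> carrier (hom_module K (NN n) S) \<Longrightarrow> (SOME v. v \<in> m S f) a = f y"
    proof (rule Kz.yoneda[where \<psi> = "\<lambda>S f. (SOME v. v \<in> m S f) a", OF NN_module enc])
      fix S :: "('k,'s) module" and f assume S: "algebra K S" and f: "f \<in> carrier (hom_module K (NN n) S)"
      interpret S: algebra K S by (rule S)
      interpret HS: module S "H S" by (rule module_hom_module[OF A_module S])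
      obtain w where w: "w \<in> Kill (G n) S" "m S f = \<gamma> n S w" using ex[OF S f] by blast
      have wH: "w \<in> carrier (H S)" by (rule Kill_H[OF w(1)])
      have wa: "w a \<in> carrier S" by (rule H_app_closed[OF S wH aA])
      have v: "(SOME v. v \<in> m S f) a = w a" unfolding w(2) by (rule some_coset_app[OF S wH a])
      show "(SOME v. v \<in> m S f) a \<in> carrier S" unfolding v by (rule wa)
      show "(SOME v. v \<in> m S (\<lambda>x\<in>carrier (NN n). c \<odot>\<^bsub>S\<^esub> f x)) a = c \<odot>\<^bsub>S\<^esub> (SOME v. v \<in> m S f) a" if c: "c \<in> carrier K" for c
      proof -
        let ?s = "c \<odot>\<^bsub>S\<^esub> \<one>\<^bsub>S\<^esub>"
        have s: "?s \<in> carrier S" using c by simp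
        have "(\<lambda>x\<in>carrier (NN n). c \<odot>\<^bsub>S\<^esub> f x) = ?s \<odot>\<^bsub>hom_module K (NN n) S\<^esub> f"
          unfolding hom_module_simps(4)
        proof (rule restrict_ext)
          fix x assume x: "x \<in> carrier (NN n)"
          have "f x \<in> carrier S" by (rule linear_mapD(1)[OF hom_module_linear[OF f] x])
          then show "c \<odot>\<^bsub>S\<^esub> f x = ?s \<otimes>\<^bsub>S\<^esub> f x" using c by (simp add: S.smult_assoc2)
        qed
        then have "m S (\<lambda>x\<in>carrier (NN n). c \<odot>\<^bsub>S\<^esub> f x) = \<gamma> n S (?s \<odot>\<^bsub>H S\<^esub> w)"
          using linear_mapD(3)[OF functor_homD(2)[OF mh S, unfolded CL_simps] s f] gp_smult[OF S s w(1)] by (simp only: w(2))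
        then have "(SOME v. v \<in> m S (\<lambda>x\<in>carrier (NN n). c \<odot>\<^bsub>S\<^esub> f x)) a = (?s \<odot>\<^bsub>H S\<^esub> w) a"
          using some_coset_app[OF S HS.smult_closed[OF s wH] a] by (simp only:)
        also have "\<dots> = c \<odot>\<^bsub>S\<^esub> w a" using aA c wa by (simp add: hom_module_app S.smult_assoc2)
        finally show ?thesis unfolding v .
      qed
      fix T \<phi> assume T: "algebra K T" and \<phi>: "\<phi> \<in> alg_hom K S T"
      have "m T (push (NN n) \<phi> f) = \<gamma> n T (push A \<phi> w)"
        using functor_homD(4)[OF mh S T \<phi>, unfolded CL_simps, OF f] by (simp only: w(2) gp_ar[OF S T \<phi> w(1)])
      then have "(SOME v. v \<in> m T (push (NN n) \<phi> f)) a = push A \<phi> w a"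
        using some_coset_app[OF T push_closed[OF A_module \<phi> wH] a] by (simp only:)
      then show "(SOME v. v \<in> m T (push (NN n) \<phi> f)) a = \<phi> ((SOME v. v \<in> m S f) a)"
        unfolding v using aA by simp
    qed blast
    have "y = \<Xi> n a"
    proof (rule NN_eqI[OF y(1) \<Xi>_closed[OF a]])
      fix S :: "('k,'s) module" and ws assume s: "algebra K S" "length ws = n" "set ws \<subseteq> aug_ideal K A S"
      let ?f = "closure_map K (SF n) S (sp n S ws)"
      have "y S (sp n S ws) = ?f y" using y(1) by (simp add: closure_map_def)
      also have "\<dots> = (SOME v. v \<in> m S ?f) a"
        by (rule y(2)[OF s(1) closure_map_closed[OF s(1) sp_closed[OF s]], symmetric])
      also have "\<dots> = conv_prod K A S ws a"
        unfolding mc[OF s] by (rule some_coset_app[OF s(1) conv_prod_closed[OF s(1) aug_H[OF s(1,3)]] a])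
      finally show "y S (sp n S ws) = \<Xi> n a S (sp n S ws)" by (simp only: \<Xi>_sp[OF s(1) a s(2,3)])
    qed
    then show ?thesis using y(2)[OF S f] by simp
  qed
  show ?thesis
  proof (rule functor_hom_eqI[OF mh mm_functor_hom])
    fix S :: "('k,'s) module" and f assume S: "algebra K S" and "f \<in> carrier (ob (CL n) S)"
    then have f: "f \<in> carrier (hom_module K (NN n) S)" by (simp add: CL_simps)
    obtain w where w: "w \<in> Kill (G n) S" "m S f = \<gamma> n S w" using ex[OF S f] by blast
    have "w a = lift n f a" if a: "a \<in> G (Suc n)" for a
    proof -
      have "w a = (SOME v. v \<in> m S f) a" unfolding w(2) by (rule some_coset_app[OF S Kill_H[OF w(1)] a, symmetric])
      then show ?thesis by (simp only: val[OF S f a] lift_app[OF a])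
    qed
    then show "m S f = mm n S f"
      unfolding w(2) mm_app[OF S f] gp_eq[OF S Kill_H[OF w(1)] Kill_H[OF lift_Kill[OF S f]]] by blast
  qed
qed

end

theorem theorem9p11:
  fixes K :: "'k ring" and A :: "('k,'a) bialgebra" and n :: nat
  assumes universe: "\<exists>f :: 'a \<Rightarrow> 's. inj f"
    and "field K"
    and char_zero: "\<forall>k::nat. k > 0 \<longrightarrow> add_pow K k \<one>\<^bsub>K\<^esub> \<noteq> \<zero>\<^bsub>K\<^esub>"
    and "cocommutative_bialgebra K A"
    and "infinitesimal_formal_monoid TYPE('s) K A"
  shows "(\<exists>!m :: ('k,'s) module \<Rightarrow> _. natural_morphism K A n m) \<and>
         (\<forall>m :: ('k,'s) module \<Rightarrow> _. natural_morphism K A n m \<longrightarrow>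
            functor_iso K (closure_scheme K (sym_functor n (cotangent K A))) (graded_piece K A n) m)"
proof -
  obtain emb :: "'a \<Rightarrow> 's" where "inj emb" using universe by blast
  then interpret bialgebra_universe K A emb
    using assms by (simp add: bialgebra_universe_def cocomm_bialgebra_def bialgebra_universe_axioms_def)
  have "functor_iso K (CL n) (gp n) (mm n)"
    by (rule functor_iso_bij[OF CL_module_functor gp_module_functor mm_functor_hom mm_bij])
  then show ?thesis using mm_natural natural_morphism_unique by blast
qed

end
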